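(* Let $(K,k_K,\Gamma_K)$ and $(L,k_L,\Gamma_L)$ be two valued fields, viewed as structures in the three-sorted language $\mathscr{L}_{\mathrm{3s}}$, which are Henselian and of equicharacteristic $0$. Then $(K,k_K,\Gamma_K)\equiv(L,k_L,\Gamma_L)$ as $\mathscr{L}_{\mathrm{3s}}$-structures if and only if both $k_K\equiv k_L$ as fields (in the language $\{+,-,\cdot,0,1\}$) and $\Gamma_K\equiv\Gamma_L$ as ordered groups (in the language $\mathscr{L}_{\mathrm{gp}}=\{+,-,<,0,\infty\}$).
   Context: A valued field is a field $K$ with a group homomorphism $v:K^\times\to\Gamma$ to an ordered abelian group $\Gamma$ with $v(a+b)\ge\min\{v(a),v(b)\}$, extended by $v(0)=\infty$, where $\infty>\gamma$ for all $\gamma\in\Gamma$. Its valuation ring is $\mathcal{O}=\{a: v(a)\ge 0\}$, its maximal ideal is $\mathfrak{m}=\{a: v(a)>0\}$, its residue field is $k_K=\mathcal{O}/\mathfrak{m}$, its value group is $\Gamma_K=v(K^\times)$. Equicharacteristic $0$ means that $K$ and $k_K$ both have characteristic $0$. The valued field is Henselian if: for each $P\in\mathcal{O}[X]$ and $\bar a\in k_K$ with $\mathrm{res}(P)(\bar a)=0$ and $\mathrm{res}(P')(\bar a)\ne 0$ there exists $b\in\mathcal{O}$ such that $P(b)=0$ and $\mathrm{res}(b)=\bar a$. The language $\mathscr{L}_{\mathrm{3s}}$ has three sorts: a valued field sort $K$ with symbols $+,-,\cdot,0,1$; a residue field sort $k$ with its own copy of $+,-,\cdot,0,1$; a value group sort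 $\Gamma\cup\{\infty\}$ with symbols $+,-,<,0,\infty$; together with function symbols $v:K\to\Gamma\cup\{\infty\}$ and $\mathrm{res}:K\to k$. A valued field is viewed as an $\mathscr{L}_{\mathrm{3s}}$-structure $(K,k_K,\Gamma_K)$ by interpreting $v$ as the valuation and $\mathrm{res}$ as the residue map $\mathcal{O}\to k_K$ extended by $0$ on $K\setminus\mathcal{O}$; on the value group sort, $\gamma+\infty=\infty$ and $-\infty=\infty$. For two structures $M,N$ in the same language, $M\equiv N$ means that they satisfy the same first-order sentences. *)

theory Defs
  imports "HOL-Algebra.UnivPoly" "HOL-Algebra.QuotRing"
begin

section \<open>Many-sorted first-order logic with equality\<close>

text \<open>
  A language assigns to its function symbols the argument sorts and the value sort, and to its
  relation symbols the argument sorts; a symbol that is mapped to \<open>None\<close> is not in the language.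
\<close>

record ('s, 'f, 'r) language =
  fun_arity :: "'f \<Rightarrow> ('s list \<times> 's) option"
  rel_arity :: "'r \<Rightarrow> 's list option"

datatype ('s, 'f) fo_term =
    Var 's nat
  | App 'f "('s, 'f) fo_term list"

datatype ('s, 'f, 'r) fo_formula =
    Eq "('s, 'f) fo_term" "('s, 'f) fo_term"
  | Rel 'r "('s, 'f) fo_term list"
  | Neg "('s, 'f, 'r) fo_formula"
  | Conj "('s, 'f, 'r) fo_formula" "('s, 'f, 'r) fo_formula"
  | Exists 's nat "('s, 'f, 'r) fo_formula"

inductive has_sort :: "('s, 'f, 'r) language \<Rightarrow> ('s, 'f) fo_term \<Rightarrow> 's \<Rightarrow> bool"
  for \<L> :: "('s, 'f, 'r) language" where
  has_sort_Var: "has_sort \<L> (Var s n) s"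
| has_sort_App: "\<lbrakk>fun_arity \<L> f = Some (ss, s); list_all2 (has_sort \<L>) ts ss\<rbrakk>
    \<Longrightarrow> has_sort \<L> (App f ts) s"

primrec is_formula :: "('s, 'f, 'r) language \<Rightarrow> ('s, 'f, 'r) fo_formula \<Rightarrow> bool" where
  "is_formula \<L> (Eq t u) \<longleftrightarrow> (\<exists>s. has_sort \<L> t s \<and> has_sort \<L> u s)"
| "is_formula \<L> (Rel r ts) \<longleftrightarrow>
    (\<exists>ss. rel_arity \<L> r = Some ss \<and> list_all2 (has_sort \<L>) ts ss)"
| "is_formula \<L> (Neg \<phi>) \<longleftrightarrow> is_formula \<L> \<phi>"
| "is_formula \<L> (Conj \<phi> \<psi>) \<longleftrightarrow> is_formula \<L> \<phi> \<and> is_formula \<L> \<psi>"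
| "is_formula \<L> (Exists s n \<phi>) \<longleftrightarrow> is_formula \<L> \<phi>"

primrec term_vars :: "('s, 'f) fo_term \<Rightarrow> ('s \<times> nat) set" where
  "term_vars (Var s n) = {(s, n)}"
| "term_vars (App f ts) = \<Union> (set (map term_vars ts))"

primrec free_vars :: "('s, 'f, 'r) fo_formula \<Rightarrow> ('s \<times> nat) set" where
  "free_vars (Eq t u) = term_vars t \<union> term_vars u"
| "free_vars (Rel r ts) = (\<Union>t\<in>set ts. term_vars t)"
| "free_vars (Neg \<phi>) = free_vars \<phi>"
| "free_vars (Conj \<phi> \<psi>) = free_vars \<phi> \<union> free_vars \<psi>"
| "free_vars (Exists s n \<phi>) = free_vars \<phi> - {(s, n)}"

definition is_sentence :: "('s, 'f, 'r) language \<Rightarrow> ('s, 'f, 'r) fo_formula \<Rightarrow> bool" where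
  "is_sentence \<L> \<phi> \<longleftrightarrow> is_formula \<L> \<phi> \<and> free_vars \<phi> = {}"

text \<open>
  The universes of all sorts live in one type \<open>'u\<close>. Values of the interpretations on lists that do
  not have the argument sorts of the symbol are never used by well-sorted formulas.
\<close>

record ('s, 'f, 'r, 'u) fo_structure =
  universe :: "'s \<Rightarrow> 'u set"
  fun_interp :: "'f \<Rightarrow> 'u list \<Rightarrow> 'u"
  rel_interp :: "'r \<Rightarrow> 'u list \<Rightarrow> bool"

primrec term_val :: "('s, 'f, 'r, 'u) fo_structure \<Rightarrow> ('s \<times> nat \<Rightarrow> 'u) \<Rightarrow> ('s, 'f) fo_term \<Rightarrow> 'u" where
  "term_val M e (Var s n) = e (s, n)"
| "term_val M e (App f ts) = fun_interp M f (map (term_val M e) ts)"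

primrec satisfies ::
  "('s, 'f, 'r, 'u) fo_structure \<Rightarrow> ('s \<times> nat \<Rightarrow> 'u) \<Rightarrow> ('s, 'f, 'r) fo_formula \<Rightarrow> bool" where
  "satisfies M e (Eq t u) \<longleftrightarrow> term_val M e t = term_val M e u"
| "satisfies M e (Rel r ts) \<longleftrightarrow> rel_interp M r (map (term_val M e) ts)"
| "satisfies M e (Neg \<phi>) \<longleftrightarrow> \<not> satisfies M e \<phi>"
| "satisfies M e (Conj \<phi> \<psi>) \<longleftrightarrow> satisfies M e \<phi> \<and> satisfies M e \<psi>"
| "satisfies M e (Exists s n \<phi>) \<longleftrightarrow> (\<exists>x\<in>universe M s. satisfies M (e((s, n) := x)) \<phi>)"

definition models :: "('s, 'f, 'r, 'u) fo_structure \<Rightarrow> ('s, 'f, 'r) fo_formula \<Rightarrow> bool" where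
  "models M \<phi> \<longleftrightarrow> (\<forall>e. (\<forall>s n. e (s, n) \<in> universe M s) \<longrightarrow> satisfies M e \<phi>)"

definition elementarily_equivalent ::
  "('s, 'f, 'r) language \<Rightarrow> ('s, 'f, 'r, 'u) fo_structure \<Rightarrow> ('s, 'f, 'r, 'w) fo_structure \<Rightarrow> bool" where
  "elementarily_equivalent \<L> M N \<longleftrightarrow>
    (\<forall>\<phi>. is_sentence \<L> \<phi> \<longrightarrow> (models M \<phi> \<longleftrightarrow> models N \<phi>))"


section \<open>An ordered abelian group with a point at infinity\<close>

datatype 'g with_inf = Fin 'g | Inf

instantiation with_inf :: (linordered_ab_group_add) "{zero, plus, uminus, linorder}"
begin

definition "0 = Fin 0"

fun plus_with_inf :: "'a with_inf \<Rightarrow> 'a with_inf \<Rightarrow> 'a with_inf" where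
  "Fin a + Fin b = Fin (a + b)"
| "Fin a + Inf = Inf"
| "Inf + y = Inf"

fun uminus_with_inf :: "'a with_inf \<Rightarrow> 'a with_inf" where
  "- Fin a = Fin (- a)"
| "- Inf = Inf"

fun less_eq_with_inf :: "'a with_inf \<Rightarrow> 'a with_inf \<Rightarrow> bool" where
  "Fin a \<le> Fin b \<longleftrightarrow> a \<le> b"
| "Inf \<le> Fin b \<longleftrightarrow> False"
| "x \<le> Inf \<longleftrightarrow> True"

definition less_with_inf :: "'a with_inf \<Rightarrow> 'a with_inf \<Rightarrow> bool" where
  "less_with_inf x y \<longleftrightarrow> x \<le> y \<and> \<not> y \<le> x"

instance
proof
  fix x y z :: "'a with_inf"
  show "x < y \<longleftrightarrow> x \<le> y \<and> \<not> y \<le> x"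
    by (rule less_with_inf_def)
  show "x \<le> x"
    by (cases x) auto
  show "x \<le> y \<Longrightarrow> y \<le> z \<Longrightarrow> x \<le> z"
    by (cases x; cases y; cases z) auto
  show "x \<le> y \<Longrightarrow> y \<le> x \<Longrightarrow> x = y"
    by (cases x; cases y) auto
  show "x \<le> y \<or> y \<le> x"
    by (cases x; cases y) auto
qed

end


section \<open>Valued fields\<close>

text \<open>
  The valuation need not be surjective onto the type \<open>'g\<close>; its values off the carrier are irrelevant.
\<close>

locale valued_field = field K for K (structure) +
  fixes v :: "'a \<Rightarrow> 'g::linordered_ab_group_add with_inf"
  assumes val_eq_Inf_iff: "a \<in> carrier K \<Longrightarrow> v a = Inf \<longleftrightarrow> a = \<zero>"
    and val_mult: "\<lbrakk>a \<in> carrier K - {\<zero>}; b \<in> carrier K - {\<zero>}\<rbrakk> \<Longrightarrow> v (a \<otimes> b) = v a + v b"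
    and val_add: "\<lbrakk>a \<in> carrier K; b \<in> carrier K\<rbrakk> \<Longrightarrow> min (v a) (v b) \<le> v (a \<oplus> b)"

definition valuation_ring ::
  "('a, 'm) ring_scheme \<Rightarrow> ('a \<Rightarrow> 'g::linordered_ab_group_add with_inf) \<Rightarrow> ('a, 'm) ring_scheme" where
  "valuation_ring K v = K\<lparr>carrier := {a \<in> carrier K. 0 \<le> v a}\<rparr>"

definition valuation_ideal ::
  "('a, 'm) ring_scheme \<Rightarrow> ('a \<Rightarrow> 'g::linordered_ab_group_add with_inf) \<Rightarrow> 'a set" where
  "valuation_ideal K v = {a \<in> carrier K. 0 < v a}"

definition residue_field ::
  "('a, 'm) ring_scheme \<Rightarrow> ('a \<Rightarrow> 'g::linordered_ab_group_add with_inf) \<Rightarrow> 'a set ring" where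
  "residue_field K v = valuation_ring K v Quot valuation_ideal K v"

definition residue_map ::
  "('a, 'm) ring_scheme \<Rightarrow> ('a \<Rightarrow> 'g::linordered_ab_group_add with_inf) \<Rightarrow> 'a \<Rightarrow> 'a set" where
  "residue_map K v a =
    (if a \<in> carrier (valuation_ring K v)
     then valuation_ideal K v +>\<^bsub>valuation_ring K v\<^esub> a
     else \<zero>\<^bsub>residue_field K v\<^esub>)"

definition value_group ::
  "('a, 'm) ring_scheme \<Rightarrow> ('a \<Rightarrow> 'g::linordered_ab_group_add with_inf) \<Rightarrow> 'g with_inf set" where
  "value_group K v = v ` (carrier K - {\<zero>\<^bsub>K\<^esub>})"

definition char_zero :: "('a, 'm) ring_scheme \<Rightarrow> bool" where
  "char_zero R \<longleftrightarrow> (\<forall>n::nat. n > 0 \<longrightarrow> [n] \<cdot>\<^bsub>R\<^esub> \<one>\<^bsub>R\<^esub> \<noteq> \<zero>\<^bsub>R\<^esub>)"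

definition equichar_zero ::
  "('a, 'm) ring_scheme \<Rightarrow> ('a \<Rightarrow> 'g::linordered_ab_group_add with_inf) \<Rightarrow> bool" where
  "equichar_zero K v \<longleftrightarrow> char_zero K \<and> char_zero (residue_field K v)"

text \<open>Elements of \<^term>\<open>carrier (UP R)\<close> are coefficient functions \<^typ>\<open>nat \<Rightarrow> 'a\<close>.\<close>

definition UP_deriv :: "('a, 'm) ring_scheme \<Rightarrow> (nat \<Rightarrow> 'a) \<Rightarrow> nat \<Rightarrow> 'a" where
  "UP_deriv R P = (\<lambda>n. [Suc n] \<cdot>\<^bsub>R\<^esub> P (Suc n))"

definition UP_eval :: "('a, 'm) ring_scheme \<Rightarrow> (nat \<Rightarrow> 'a) \<Rightarrow> 'a \<Rightarrow> 'a" where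
  "UP_eval R P x = eval R R (\<lambda>c. c) x P"

definition henselian ::
  "('a, 'm) ring_scheme \<Rightarrow> ('a \<Rightarrow> 'g::linordered_ab_group_add with_inf) \<Rightarrow> bool" where
  "henselian K v \<longleftrightarrow>
    (\<forall>P \<in> carrier (UP (valuation_ring K v)). \<forall>\<alpha> \<in> carrier (residue_field K v).
      UP_eval (residue_field K v) (residue_map K v \<circ> P) \<alpha> = \<zero>\<^bsub>residue_field K v\<^esub> \<and>
      UP_eval (residue_field K v) (residue_map K v \<circ> UP_deriv (valuation_ring K v) P) \<alpha>
        \<noteq> \<zero>\<^bsub>residue_field K v\<^esub> \<longrightarrow>
      (\<exists>b \<in> carrier (valuation_ring K v).
        UP_eval (valuation_ring K v) P b = \<zero>\<^bsub>valuation_ring K v\<^esub> \<and> residue_map K v b = \<alpha>))"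


section \<open>The languages and the structures\<close>

text \<open>The symbol \<open>-\<close> is the unary minus, for fields and for groups. One-sorted languages have sort \<^typ>\<open>unit\<close>.\<close>

datatype ring_sym = RPlus | RMinus | RTimes | RZero | ROne

datatype gp_sym = GPlus | GMinus | GZero | GInf

datatype gp_rel = GLess

primrec ring_sym_arity :: "ring_sym \<Rightarrow> nat" where
  "ring_sym_arity RPlus = 2"
| "ring_sym_arity RMinus = 1"
| "ring_sym_arity RTimes = 2"
| "ring_sym_arity RZero = 0"
| "ring_sym_arity ROne = 0"

primrec gp_sym_arity :: "gp_sym \<Rightarrow> nat" where
  "gp_sym_arity GPlus = 2"
| "gp_sym_arity GMinus = 1"
| "gp_sym_arity GZero = 0"
| "gp_sym_arity GInf = 0"

primrec ring_op :: "('a, 'm) ring_scheme \<Rightarrow> ring_sym \<Rightarrow> 'a list \<Rightarrow> 'a" where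
  "ring_op R RPlus = (\<lambda>xs. xs ! 0 \<oplus>\<^bsub>R\<^esub> xs ! 1)"
| "ring_op R RMinus = (\<lambda>xs. \<ominus>\<^bsub>R\<^esub> (xs ! 0))"
| "ring_op R RTimes = (\<lambda>xs. xs ! 0 \<otimes>\<^bsub>R\<^esub> xs ! 1)"
| "ring_op R RZero = (\<lambda>xs. \<zero>\<^bsub>R\<^esub>)"
| "ring_op R ROne = (\<lambda>xs. \<one>\<^bsub>R\<^esub>)"

primrec gp_op :: "gp_sym \<Rightarrow> 'g::linordered_ab_group_add with_inf list \<Rightarrow> 'g with_inf" where
  "gp_op GPlus = (\<lambda>xs. xs ! 0 + xs ! 1)"
| "gp_op GMinus = (\<lambda>xs. - (xs ! 0))"
| "gp_op GZero = (\<lambda>xs. 0)"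
| "gp_op GInf = (\<lambda>xs. Inf)"

primrec gp_less :: "gp_rel \<Rightarrow> 'g::linordered_ab_group_add with_inf list \<Rightarrow> bool" where
  "gp_less GLess = (\<lambda>xs. xs ! 0 < xs ! 1)"

definition L_ring :: "(unit, ring_sym, unit) language" where
  "L_ring = \<lparr>fun_arity = (\<lambda>f. Some (replicate (ring_sym_arity f) (), ())),
             rel_arity = (\<lambda>_. None)\<rparr>"

definition ring_structure :: "('a, 'm) ring_scheme \<Rightarrow> (unit, ring_sym, unit, 'a) fo_structure" where
  "ring_structure R = \<lparr>universe = (\<lambda>_. carrier R), fun_interp = ring_op R,
                       rel_interp = (\<lambda>_ _. False)\<rparr>"

definition L_gp :: "(unit, gp_sym, gp_rel) language" where
  "L_gp = \<lparr>fun_arity = (\<lambda>f. Some (replicate (gp_sym_arity f) (), ())),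
           rel_arity = (\<lambda>_. Some [(), ()])\<rparr>"

text \<open>For a subgroup \<open>G\<close> of \<open>'g\<close>, given as a subset of \<^typ>\<open>'g with_inf\<close>: the structure on \<open>G \<union> {\<infinity>}\<close>.\<close>

definition gp_structure ::
  "'g::linordered_ab_group_add with_inf set \<Rightarrow> (unit, gp_sym, gp_rel, 'g with_inf) fo_structure" where
  "gp_structure G = \<lparr>universe = (\<lambda>_. insert Inf G), fun_interp = gp_op, rel_interp = gp_less\<rparr>"

datatype sort3 = SField | SResidue | SGroup

datatype sym3 = KSym ring_sym | RSym ring_sym | GSym gp_sym | ValSym | ResSym

primrec sym3_arity :: "sym3 \<Rightarrow> sort3 list \<times> sort3" where
  "sym3_arity (KSym f) = (replicate (ring_sym_arity f) SField, SField)"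
| "sym3_arity (RSym f) = (replicate (ring_sym_arity f) SResidue, SResidue)"
| "sym3_arity (GSym f) = (replicate (gp_sym_arity f) SGroup, SGroup)"
| "sym3_arity ValSym = ([SField], SGroup)"
| "sym3_arity ResSym = ([SField], SResidue)"

definition L_3s :: "(sort3, sym3, gp_rel) language" where
  "L_3s = \<lparr>fun_arity = Some \<circ> sym3_arity, rel_arity = (\<lambda>_. Some [SGroup, SGroup])\<rparr>"

datatype ('a, 'k, 'g) elem3 =
  KElem (the_K: 'a) | RElem (the_R: 'k) | GElem (the_G: "'g with_inf")

primrec universe3 ::
  "('a, 'm) ring_scheme \<Rightarrow> ('a \<Rightarrow> 'g::linordered_ab_group_add with_inf) \<Rightarrow> sort3
    \<Rightarrow> ('a, 'a set, 'g) elem3 set" where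
  "universe3 K v SField = KElem ` carrier K"
| "universe3 K v SResidue = RElem ` carrier (residue_field K v)"
| "universe3 K v SGroup = GElem ` insert Inf (value_group K v)"

primrec fun_interp3 ::
  "('a, 'm) ring_scheme \<Rightarrow> ('a \<Rightarrow> 'g::linordered_ab_group_add with_inf) \<Rightarrow> sym3
    \<Rightarrow> ('a, 'a set, 'g) elem3 list \<Rightarrow> ('a, 'a set, 'g) elem3" where
  "fun_interp3 K v (KSym f) = (\<lambda>xs. KElem (ring_op K f (map the_K xs)))"
| "fun_interp3 K v (RSym f) = (\<lambda>xs. RElem (ring_op (residue_field K v) f (map the_R xs)))"
| "fun_interp3 K v (GSym f) = (\<lambda>xs. GElem (gp_op f (map the_G xs)))"
| "fun_interp3 K v ValSym = (\<lambda>xs. GElem (v (the_K (xs ! 0))))"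
| "fun_interp3 K v ResSym = (\<lambda>xs. RElem (residue_map K v (the_K (xs ! 0))))"

definition vf_structure ::
  "('a, 'm) ring_scheme \<Rightarrow> ('a \<Rightarrow> 'g::linordered_ab_group_add with_inf)
    \<Rightarrow> (sort3, sym3, gp_rel, ('a, 'a set, 'g) elem3) fo_structure" where
  "vf_structure K v = \<lparr>universe = universe3 K v, fun_interp = fun_interp3 K v,
                       rel_interp = (\<lambda>r xs. gp_less r (map the_G xs))\<rparr>"

end

theory Submission
  imports Defs "HOL-Computational_Algebra.Polynomial" "HOL-Library.Function_Algebras"
    "HOL-Library.Product_Plus" "HOL-Library.Countable_Set"
begin

text \<open>
  If residue fields and value groups are elementarily equivalent, pass to ultrapowers of \<open>K\<close> and
  \<open>L\<close> over a free ultrafilter on the natural numbers. These are countably saturated, so they carry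
  angular components, and they are compared by a back-and-forth argument. Its positions are subfields
  generated by countably many elements, together with an isomorphism between them that preserves the
  valuation and the angular component and that induces partial elementary maps of the residue fields and
  of the value groups. Given a further element, close the domain and this element under roots from Hensel's lemma
  and angular components, extend the two elementary maps to the countably many new residues and values,
  and take a maximal extension of the isomorphism that is compatible with these maps. It is defined
  on all of the new domain: a missing residue is lifted by Hensel's lemma, a missing value is adjoined after
  correcting a root of it by an \<open>n\<close>-th root of a \<open>1\<close>-unit, which exists in residue
  characteristic \<open>0\<close>, and an immediate extension is generated by a pseudo-limit, for which a partner exists
  by saturation. Conversely, residue field and value group are sorts of the three-sorted structure.
\<close>

section \<open>Valuations with support\<close>

text \<open>Each element of one common ring stands for a pair of field elements, the two fields
  being its quotients by the supports of \<open>v1\<close> and \<open>v2\<close>. A partial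
  isomorphism is then a subring on which the two valuations behave alike, and adjoining an element
  means adding the values of polynomials at it; no type of subfields is ever needed.

  The residues and values of the new domain are mapped before its elements are. This fixes a set
  \<open>C\<close> of admissible pairs in advance, and the field isomorphism becomes a maximal
  subring of \<open>C\<close>. As the domain is Henselian, whatever would be missing from such a
  subring can be found inside the domain. Residue characteristic 0 enters through derivatives: that
  of a monic polynomial of degree \<open>n\<close> has the unit \<open>n\<close> as leading
  coefficient, and this is what starts Newton's method in both fields.

  An angular component pins down an element of given value up to a 1-unit; without it, an
  \<open>n\<close>-th power could not be matched with an element of the subring in both fields at
  once. Back and forth needs countable saturation only, so no cardinal assumption enters.\<close>

hide_const (open) up_ring.coeff up_ring.monom Coset.order

section \<open>Arithmetic of values, including infinity\<close>

instance with_inf :: (linordered_ab_group_add) ordered_comm_monoid_add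
proof
  fix a b c :: "'a with_inf"
  show "a + b + c = a + (b + c)"
    by (cases a; cases b; cases c) (auto simp: add.assoc)
  show "a + b = b + a"
    by (cases a; cases b) (auto simp: add.commute)
  show "0 + a = a"
    by (cases a) (auto simp: zero_with_inf_def)
  show "a \<le> b \<Longrightarrow> c + a \<le> c + b"
    by (cases a; cases b; cases c) auto
qed

lemma Fin_less_Fin [simp]: "Fin a < Fin b \<longleftrightarrow> a < b"
  by (auto simp: less_le_not_le)

lemma less_Inf_iff [simp]: "x < Inf \<longleftrightarrow> x \<noteq> Inf"
  by (cases x) (auto simp: less_le_not_le)

lemma not_Inf_less [simp]: "\<not> Inf < x"
  by (cases x) (auto simp: less_le_not_le)

lemma Inf_le_iff [simp]: "Inf \<le> x \<longleftrightarrow> x = Inf"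
  by (cases x) auto

lemma zero_neq_Inf [simp]: "0 \<noteq> Inf" "Inf \<noteq> 0"
  by (auto simp: zero_with_inf_def)

lemma Fin_eq_0_iff [simp]: "Fin a = 0 \<longleftrightarrow> a = 0"
  by (auto simp: zero_with_inf_def)

lemma add_eq_Inf_iff [simp]: "x + y = Inf \<longleftrightarrow> x = Inf \<or> y = Inf"
  by (cases x; cases y) auto

lemma Inf_add [simp]: "x + Inf = Inf"
  by (cases x) auto

lemma fin_add_less_cancel: "a \<noteq> Inf \<Longrightarrow> a + x < a + y \<longleftrightarrow> x < y"
  by (cases a; cases x; cases y) (auto simp: less_le_not_le)

lemma fin_add_le_cancel: "a \<noteq> Inf \<Longrightarrow> a + x \<le> a + y \<longleftrightarrow> x \<le> y"
  by (cases a; cases x; cases y) auto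

lemma fin_add_eq_cancel: "a \<noteq> Inf \<Longrightarrow> a + x = a + y \<longleftrightarrow> x = y"
  by (cases a; cases x; cases y) auto

lemma fin_add_cancel_0: "a \<noteq> Inf \<Longrightarrow> a + x = a \<longleftrightarrow> x = 0"
  using fin_add_eq_cancel[of a x 0] by simp

lemma add_less_add_le: "\<lbrakk>a < c; b \<le> d; b \<noteq> Inf\<rbrakk> \<Longrightarrow> a + b < c + d" for a b c d :: "'g::linordered_ab_group_add with_inf"
  by (cases a; cases b; cases c; cases d) (auto intro: add_less_le_mono)

lemma add_eq_0_imp_neg: "x + y = 0 \<Longrightarrow> y = - x" for x :: "'g::linordered_ab_group_add with_inf"
  by (cases x; cases y) (auto simp: add_eq_0_iff)

section \<open>Subrings and polynomials over them\<close>

definition subring_of :: "'a::comm_ring_1 set \<Rightarrow> bool" where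
  "subring_of R \<longleftrightarrow> 1 \<in> R \<and> (\<forall>x\<in>R. \<forall>y\<in>R. x - y \<in> R \<and> x * y \<in> R)"

lemma
  assumes "subring_of R"
  shows subring_1: "1 \<in> R"
    and subring_diff: "\<And>x y. \<lbrakk>x \<in> R; y \<in> R\<rbrakk> \<Longrightarrow> x - y \<in> R"
    and subring_mult: "\<And>x y. \<lbrakk>x \<in> R; y \<in> R\<rbrakk> \<Longrightarrow> x * y \<in> R"
    and subring_0: "0 \<in> R"
    and subring_uminus: "\<And>x. x \<in> R \<Longrightarrow> - x \<in> R"
    and subring_add: "\<And>x y. \<lbrakk>x \<in> R; y \<in> R\<rbrakk> \<Longrightarrow> x + y \<in> R"
proof -
  show 1: "1 \<in> R" and d: "\<And>x y. \<lbrakk>x \<in> R; y \<in> R\<rbrakk> \<Longrightarrow> x - y \<in> R"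
    and "\<And>x y. \<lbrakk>x \<in> R; y \<in> R\<rbrakk> \<Longrightarrow> x * y \<in> R"
    using assms by (auto simp: subring_of_def)
  show z: "0 \<in> R" using d[OF 1 1] by simp
  show m: "- x \<in> R" if "x \<in> R" for x using d[OF z that] by simp
  show "x + y \<in> R" if "x \<in> R" "y \<in> R" for x y using d[OF that(1) m[OF that(2)]] by simp
qed

lemma subring_of_nat: "subring_of R \<Longrightarrow> of_nat n \<in> R"
  by (induction n) (auto intro: subring_0 subring_1 subring_add)

lemma subring_power: "subring_of R \<Longrightarrow> x \<in> R \<Longrightarrow> x ^ n \<in> R"
  by (induction n) (auto intro: subring_1 subring_mult)

lemma subring_sum: "subring_of R \<Longrightarrow> (\<And>i. i \<in> I \<Longrightarrow> f i \<in> R) \<Longrightarrow> sum f I \<in> R"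
  by (induction I rule: infinite_finite_induct) (auto intro: subring_0 subring_add)

definition coeffs_in :: "'a::comm_ring_1 set \<Rightarrow> 'a poly set" where
  "coeffs_in R = {p. \<forall>i. coeff p i \<in> R}"

lemma coeffs_inD: "p \<in> coeffs_in R \<Longrightarrow> coeff p i \<in> R"
  by (simp add: coeffs_in_def)

lemma poly_in_subring:
  assumes "subring_of R" "p \<in> coeffs_in R" "x \<in> R"
  shows "poly p x \<in> R"
  unfolding poly_altdef using assms
  by (auto intro!: subring_sum subring_mult subring_power coeffs_inD)

lemma
  assumes "subring_of R"
  shows coeffs_in_add: "\<lbrakk>p \<in> coeffs_in R; q \<in> coeffs_in R\<rbrakk> \<Longrightarrow> p + q \<in> coeffs_in R"
    and coeffs_in_diff: "\<lbrakk>p \<in> coeffs_in R; q \<in> coeffs_in R\<rbrakk> \<Longrightarrow> p - q \<in> coeffs_in R"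
    and coeffs_in_mult: "\<lbrakk>p \<in> coeffs_in R; q \<in> coeffs_in R\<rbrakk> \<Longrightarrow> p * q \<in> coeffs_in R"
    and coeffs_in_smult: "\<lbrakk>c \<in> R; q \<in> coeffs_in R\<rbrakk> \<Longrightarrow> smult c q \<in> coeffs_in R"
    and coeffs_in_monom: "c \<in> R \<Longrightarrow> monom c n \<in> coeffs_in R"
    and coeffs_in_const: "c \<in> R \<Longrightarrow> [:c:] \<in> coeffs_in R"
    and coeffs_in_0: "0 \<in> coeffs_in R"
  using assms unfolding coeffs_in_def
  by (auto intro!: subring_add[OF assms] subring_diff[OF assms] subring_sum[OF assms]
      subring_mult[OF assms] subring_0 simp: coeff_mult coeff_pCons coeff_monom split: nat.split)

lemma monic_division:
  fixes f p :: "'a::comm_ring_1 poly"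
  assumes R: "subring_of R" and p: "lead_coeff p = 1" "p \<in> coeffs_in R" and "f \<in> coeffs_in R"
  shows "\<exists>q r. q \<in> coeffs_in R \<and> r \<in> coeffs_in R \<and> f = q * p + r \<and> (degree r < degree p \<or> r = 0)"
  using assms(4)
proof (induction "degree f" arbitrary: f rule: less_induct)
  case less
  show ?case
  proof (cases "degree f < degree p \<or> f = 0")
    case True
    then show ?thesis using less.prems R by (intro exI[of _ 0] exI[of _ f]) (auto intro: coeffs_in_0)
  next
    case False
    define k where "k = degree f - degree p"
    define m where "m = monom (lead_coeff f) k"
    define g where "g = f - m * p"
    have m: "m \<in> coeffs_in R"
      using less.prems R by (auto simp: m_def intro: coeffs_in_monom coeffs_inD)
    have g: "g \<in> coeffs_in R"
      unfolding g_def by (intro coeffs_in_diff coeffs_in_mult m less.prems R p)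
    have dmp: "degree (m * p) \<le> degree f"
      using degree_mult_le[of m p] degree_monom_le[of "lead_coeff f" k] False
      unfolding m_def k_def by linarith
    have cmp: "coeff (m * p) (degree f) = lead_coeff f"
      using False p by (simp add: m_def coeff_monom_mult k_def)
    have "degree g < degree f \<or> g = 0"
    proof (cases "degree f = 0")
      case True
      then have "degree g = 0" using dmp degree_diff_le[of f 0 "m*p"] by (simp add: g_def)
      moreover have "coeff g 0 = 0" using cmp True by (simp add: g_def)
      ultimately show ?thesis by (metis leading_coeff_0_iff)
    next
      case False
      have "degree g \<le> degree f" unfolding g_def using dmp by (simp add: degree_diff_le)
      moreover have "coeff g (degree f) = 0" using cmp by (simp add: g_def)
      ultimately show ?thesis by (metis leading_coeff_0_iff le_neq_implies_less)
    qed
    then obtain q r where qr: "q \<in> coeffs_in R" "r \<in> coeffs_in R" "g = q * p + r"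
        "degree r < degree p \<or> r = 0"
    proof
      assume "degree g < degree f"
      from less.hyps[OF this g] that show thesis by blast
    next
      assume "g = 0"
      then show thesis using that[of 0 0] coeffs_in_0[OF R] by simp
    qed
    have "f = (m + q) * p + r" using qr(3) by (simp add: g_def algebra_simps)
    with qr m R show ?thesis by (blast intro: coeffs_in_add)
  qed
qed

section \<open>Divided derivatives and Taylor expansion\<close>

definition hasse :: "nat \<Rightarrow> 'a::comm_ring_1 poly \<Rightarrow> 'a poly" where
  "hasse j p = (\<Sum>i\<le>degree p. monom (of_nat ((i + j) choose j) * coeff p (i + j)) i)"

text \<open>These are the coefficients of the \<open>j\<close>-th derivative divided by the
  factorial of \<open>j\<close>. The binomial coefficients avoid the division, so the Taylor formula
  below holds over every commutative ring.\<close>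

lemma coeff_hasse: "coeff (hasse j p) i = of_nat ((i + j) choose j) * coeff p (i + j)"
proof -
  have "coeff (hasse j p) i =
      (\<Sum>k\<le>degree p. if k = i then of_nat ((i + j) choose j) * coeff p (i + j) else 0)"
    unfolding hasse_def coeff_sum coeff_monom by (rule sum.cong) auto
  also have "\<dots> = (if i \<le> degree p then of_nat ((i + j) choose j) * coeff p (i + j) else 0)"
    by simp
  finally show ?thesis by (auto simp: coeff_eq_0)
qed

lemma hasse_0: "hasse 0 p = p"
  by (rule poly_eqI) (simp add: coeff_hasse)

lemma degree_hasse_le: "degree (hasse j p) \<le> degree p - j"
proof (rule degree_le, intro allI impI)
  fix i assume "degree p - j < i"
  then have "degree p < i + j" by linarith
  then show "coeff (hasse j p) i = 0" by (simp add: coeff_hasse coeff_eq_0)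
qed

lemma coeffs_in_hasse: "subring_of R \<Longrightarrow> p \<in> coeffs_in R \<Longrightarrow> hasse j p \<in> coeffs_in R"
  by (simp add: coeffs_in_def coeff_hasse subring_mult subring_of_nat)

text \<open>When \<open>Suc i\<close> is a unit, this turns estimates for the Taylor terms of the
  derivative into estimates for those of \<open>p\<close>, one degree higher.\<close>

lemma hasse_hasse_1: "hasse i (hasse 1 p) = smult (of_nat (Suc i)) (hasse (Suc i) p)"
proof (rule poly_eqI)
  fix k
  have "((k + i) choose i) * (k + i + 1) = Suc i * ((k + Suc i) choose Suc i)"
    using Suc_times_binomial_eq[of "k + i" i] by (simp add: mult.commute)
  then have "of_nat (((k + i) choose i) * (k + i + 1)) * coeff p (k + Suc i) =
      of_nat (Suc i * ((k + Suc i) choose Suc i)) * coeff p (k + Suc i)"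
    by metis
  then show "coeff (hasse i (hasse 1 p)) k = coeff (smult (of_nat (Suc i)) (hasse (Suc i) p)) k"
    by (simp only: coeff_hasse coeff_smult of_nat_mult) (simp add: mult.assoc ac_simps)
qed

lemma hasse_const [simp]: "hasse (Suc j) [:c:] = 0"
  by (rule poly_eqI) (simp add: coeff_hasse)

lemma hasse_Suc_pCons: "hasse (Suc j) (pCons c p) = hasse j p + pCons 0 (hasse (Suc j) p)"
proof (rule poly_eqI)
  fix i
  have "Suc (i + j) choose Suc j = (i + j choose j) + (i + j choose Suc j)" by simp
  then show "coeff (hasse (Suc j) (pCons c p)) i = coeff (hasse j p + pCons 0 (hasse (Suc j) p)) i"
    by (cases i) (simp_all add: coeff_hasse distrib_right)
qed

lemma coeff_pcompose_hasse:
  "coeff (pcompose p [:e, a:]) j = poly (hasse j p) e * a ^ j"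
proof (induction p arbitrary: j)
  case 0
  have "hasse j (0 :: 'a poly) = 0" by (rule poly_eqI) (simp add: coeff_hasse)
  then show ?case by simp
next
  case (pCons c p)
  show ?case
  proof (cases j)
    case 0
    then show ?thesis using pCons.IH[of 0] by (simp add: pcompose_pCons hasse_0 coeff_pCons)
  next
    case (Suc i)
    then show ?thesis using pCons.IH[of i] pCons.IH[of "Suc i"]
      by (simp add: pcompose_pCons hasse_Suc_pCons algebra_simps)
  qed
qed

lemma poly_taylor:
  "poly p (e + h) = (\<Sum>j\<le>degree p. poly (hasse j p) e * h ^ j)"
proof -
  have "poly p (e + h) = poly (pcompose p [:e, 1:]) h" by (simp add: poly_pcompose)
  also have "\<dots> = (\<Sum>j\<le>degree p. coeff (pcompose p [:e, 1:]) j * h ^ j)"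
  proof -
    have "degree (pcompose p [:e, 1:]) \<le> degree p"
      using degree_pcompose_le[of p "[:e,1:]"] by simp
    then show ?thesis
      unfolding poly_altdef by (intro sum.mono_neutral_left) (auto simp: coeff_eq_0)
  qed
  finally show ?thesis by (simp add: coeff_pcompose_hasse)
qed

lemma poly_taylor_diff:
  "poly p x - poly p e = (\<Sum>j=1..degree p. poly (hasse j p) e * (x - e) ^ j)"
proof -
  have "poly p x = (\<Sum>j\<le>degree p. poly (hasse j p) e * (x - e) ^ j)"
    using poly_taylor[of p e "x - e"] by simp
  also have "\<dots> = (\<Sum>j\<in>insert 0 {1..degree p}. poly (hasse j p) e * (x - e) ^ j)"
    by (rule sum.cong) auto
  finally show ?thesis by (simp add: hasse_0)
qed

text \<open>A valuation on a ring with support \<open>{x. v x = Inf}\<close>. Since the inverse exists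
  modulo the support, this is a valued field given by representatives, and \<open>eqv\<close> below is equality in
  that field. Working on representatives allows two fields to live on the same ring.\<close>

locale supp_val =
  fixes v :: "'a::comm_ring_1 \<Rightarrow> 'g::linordered_ab_group_add with_inf"
  assumes val_0 [simp]: "v 0 = Inf" and val_1 [simp]: "v 1 = 0"
    and val_mult: "v (x * y) = v x + v y"
    and val_add: "min (v x) (v y) \<le> v (x + y)"
    and val_inverse: "v x \<noteq> Inf \<Longrightarrow> \<exists>y. v (x * y - 1) = Inf"
begin

lemma val_minus [simp]: "v (- x) = v x"
proof -
  have "v (- 1) + v (- 1) = 0" using val_mult[of "- 1" "- 1"] by simp
  then have "v (- 1) = 0" by (cases "v (- 1)") (auto simp: zero_with_inf_def)
  then show ?thesis using val_mult[of "- 1" x] by simp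
qed

lemma val_diff_commute: "v (x - y) = v (y - x)"
  using val_minus[of "x - y"] by simp

lemma le_val_add: "c \<le> v x \<Longrightarrow> c \<le> v y \<Longrightarrow> c \<le> v (x + y)"
  using val_add[of x y] by (meson min.boundedI order.trans)

lemma less_val_add: "c < v x \<Longrightarrow> c < v y \<Longrightarrow> c < v (x + y)"
  using val_add[of x y] by (meson min_less_iff_conj less_le_trans)

lemma le_val_diff: "c \<le> v x \<Longrightarrow> c \<le> v y \<Longrightarrow> c \<le> v (x - y)"
  using le_val_add[of c x "- y"] by simp

lemma less_val_diff: "c < v x \<Longrightarrow> c < v y \<Longrightarrow> c < v (x - y)"
  using less_val_add[of c x "- y"] by simp

lemma less_val_trans: "c < v (x - y) \<Longrightarrow> c < v (y - z) \<Longrightarrow> c < v (x - z)"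
  using less_val_add[of c "x - y" "y - z"] by simp

lemma le_val_trans: "c \<le> v (x - y) \<Longrightarrow> c \<le> v (y - z) \<Longrightarrow> c \<le> v (x - z)"
  using le_val_add[of c "x - y" "y - z"] by simp

lemma le_val_sum: "(\<And>i. i \<in> I \<Longrightarrow> c \<le> v (f i)) \<Longrightarrow> c \<le> v (sum f I)"
  by (induction I rule: infinite_finite_induct) (auto intro: le_val_add)

lemma less_val_sum: "(\<And>i. i \<in> I \<Longrightarrow> c < v (f i)) \<Longrightarrow> c \<noteq> Inf \<Longrightarrow> c < v (sum f I)"
  by (induction I rule: infinite_finite_induct) (auto intro: less_val_add)

lemma val_add_eq: "v x < v y \<Longrightarrow> v (x + y) = v x"
proof (rule antisym)
  assume l: "v x < v y"
  show "v x \<le> v (x + y)" using l by (intro le_val_add) auto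
  show "v (x + y) \<le> v x"
  proof (rule ccontr)
    assume "\<not> v (x + y) \<le> v x"
    then have "v x < v ((x + y) - y)" using l by (intro less_val_diff) auto
    then show False by simp
  qed
qed

lemma val_eq_of_close: "v x < v (y - x) \<Longrightarrow> v y = v x"
  using val_add_eq[of x "y - x"] by simp

lemma val_eq_of_close': "v x < v (x - y) \<Longrightarrow> v y = v x"
  using val_eq_of_close[of x y] by (simp add: val_diff_commute)

lemma val_power_ge_0: "0 \<le> v x \<Longrightarrow> 0 \<le> v (x ^ n)"
  by (induction n) (auto simp: val_mult add_nonneg_nonneg)

lemma val_power_eq_Inf_iff: "v (x ^ n) = Inf \<longleftrightarrow> n > 0 \<and> v x = Inf"
  by (induction n) (auto simp: val_mult)

lemma val_power_mono: "v a \<le> v x \<Longrightarrow> v (a ^ n) \<le> v (x ^ n)"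
  by (induction n) (auto simp: val_mult add_mono)

lemma val_power_cong: "v a = v x \<Longrightarrow> v (a ^ n) = v (x ^ n)"
  by (induction n) (auto simp: val_mult)

lemma val_of_nat_ge_0: "0 \<le> v (of_nat n)"
  by (induction n) (auto intro!: le_val_add)

section \<open>Equality modulo the support\<close>

definition eqv :: "'a \<Rightarrow> 'a \<Rightarrow> bool" where
  "eqv x y \<longleftrightarrow> v (x - y) = Inf"

lemma eqv_refl [simp, intro]: "eqv x x"
  by (simp add: eqv_def)

lemma eqv_sym: "eqv x y \<Longrightarrow> eqv y x"
  by (simp add: eqv_def val_diff_commute)

lemma eqv_trans [trans]: "eqv x y \<Longrightarrow> eqv y z \<Longrightarrow> eqv x z"
  using le_val_trans[of Inf x y z] by (simp add: eqv_def)

lemma eqv_val: "eqv x y \<Longrightarrow> v x = v y"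
proof (cases "v x = Inf")
  case True
  assume "eqv x y"
  then show ?thesis using True le_val_diff[of Inf x "x - y"] by (simp add: eqv_def)
next
  case False
  assume "eqv x y"
  then show ?thesis using False val_eq_of_close'[of x y] by (simp add: eqv_def)
qed

lemma eqv_0_iff: "eqv x 0 \<longleftrightarrow> v x = Inf"
  by (simp add: eqv_def)

lemma eqv_add: "eqv x x' \<Longrightarrow> eqv y y' \<Longrightarrow> eqv (x + y) (x' + y')"
  using le_val_add[of Inf "x - x'" "y - y'"] by (simp add: eqv_def algebra_simps)

lemma eqv_minus: "eqv x x' \<Longrightarrow> eqv (- x) (- x')"
  by (simp add: eqv_def val_diff_commute)

lemma eqv_diff: "eqv x x' \<Longrightarrow> eqv y y' \<Longrightarrow> eqv (x - y) (x' - y')"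
  using eqv_add[of x x' "- y" "- y'"] eqv_minus[of y y'] by simp

lemma eqv_mult: "eqv x x' \<Longrightarrow> eqv y y' \<Longrightarrow> eqv (x * y) (x' * y')"
proof -
  assume a: "eqv x x'" "eqv y y'"
  have "x * y - x' * y' = (x - x') * y + x' * (y - y')" by (simp add: algebra_simps)
  moreover have "Inf \<le> v ((x - x') * y + x' * (y - y'))"
    using a by (intro le_val_add) (auto simp: eqv_def val_mult)
  ultimately show ?thesis by (simp add: eqv_def)
qed

lemma eqv_power: "eqv x y \<Longrightarrow> eqv (x ^ n) (y ^ n)"
  by (induction n) (auto intro: eqv_mult)

lemma eqv_sum: "(\<And>i. i \<in> I \<Longrightarrow> eqv (f i) (g i)) \<Longrightarrow> eqv (sum f I) (sum g I)"
  by (induction I rule: infinite_finite_induct) (auto intro: eqv_add)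

lemma eqv_poly: "eqv x y \<Longrightarrow> eqv (poly p x) (poly p y)"
  unfolding poly_altdef by (intro eqv_sum eqv_mult eqv_power eqv_refl)

lemma poly_altdef_le: "degree p \<le> n \<Longrightarrow> poly p x = (\<Sum>i\<le>n. coeff p i * x ^ i)"
  for p :: "'a poly"
  unfolding poly_altdef by (intro sum.mono_neutral_left) (auto simp: coeff_eq_0)

lemma eqv_poly_coeffs: "(\<And>i. eqv (coeff p i) (coeff q i)) \<Longrightarrow> eqv (poly p x) (poly q x)"
  unfolding poly_altdef_le[of p "max (degree p) (degree q)", simplified]
    poly_altdef_le[of q "max (degree p) (degree q)", simplified]
  by (intro eqv_sum eqv_mult) auto

definition iv :: "'a \<Rightarrow> 'a" where
  "iv x = (SOME y. eqv (x * y) 1)"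

lemma eqv_iv: "v x \<noteq> Inf \<Longrightarrow> eqv (x * iv x) 1"
  unfolding iv_def by (rule someI_ex) (simp add: eqv_def val_inverse)

lemma val_inv_add: "eqv (x * y) 1 \<Longrightarrow> v x + v y = 0"
  using eqv_val[of "x * y" 1] by (simp add: val_mult)

lemma val_iv: "v x \<noteq> Inf \<Longrightarrow> v (iv x) = - v x"
  by (rule add_eq_0_imp_neg[OF val_inv_add[OF eqv_iv]])

lemma val_iv_fin: "v x \<noteq> Inf \<Longrightarrow> v (iv x) \<noteq> Inf"
  using val_inv_add[OF eqv_iv[of x]] by auto

lemma eqv_mult_cancel: "v a \<noteq> Inf \<Longrightarrow> eqv (a * x) (a * y) \<longleftrightarrow> eqv x y"
  by (simp add: eqv_def right_diff_distrib[symmetric] val_mult)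

text \<open>Equality of residues is written \<open>0 < v (x - x')\<close>, since the residue field
  of \<open>v\<close> is not formed here. Integrality is asked of the two factors that survive in
  \<open>x * (y - y') + (x - x') * y'\<close>.\<close>

lemma res_mult:
  "\<lbrakk>0 \<le> v x; 0 \<le> v y'; 0 < v (x - x'); 0 < v (y - y')\<rbrakk> \<Longrightarrow> 0 < v (x * y - x' * y')"
proof -
  assume a: "0 \<le> v x" "0 \<le> v y'" "0 < v (x - x')" "0 < v (y - y')"
  have "x * y - x' * y' = x * (y - y') + (x - x') * y'" by (simp add: algebra_simps)
  moreover have "0 < v (x * (y - y') + (x - x') * y')"
    using a by (intro less_val_add) (auto simp: val_mult add_nonneg_pos add_pos_nonneg)
  ultimately show ?thesis by simp
qed

lemma val_poly_ge_0: "\<lbrakk>\<And>i. 0 \<le> v (coeff p i); 0 \<le> v x\<rbrakk> \<Longrightarrow> 0 \<le> v (poly p x)"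
  unfolding poly_altdef by (intro le_val_sum) (auto simp: val_mult val_power_ge_0 add_nonneg_nonneg)

lemma res_ge_0: "0 \<le> v x \<Longrightarrow> 0 < v (x - y) \<Longrightarrow> 0 \<le> v y"
  using le_val_diff[of 0 x "x - y"] by auto

lemma res_power:
  assumes "0 \<le> v x" "0 < v (x - y)"
  shows "0 < v (x ^ n - y ^ n)"
proof (induction n)
  case (Suc n)
  then show ?case
    using res_mult[of x "y ^ n" y "x ^ n"] assms res_ge_0[of x y] val_power_ge_0[of y n] by simp
qed simp

lemma res_poly: "\<lbrakk>\<And>i. 0 \<le> v (coeff p i); 0 \<le> v x; 0 < v (x - y)\<rbrakk> \<Longrightarrow> 0 < v (poly p x - poly p y)"
  unfolding poly_altdef sum_subtractf[symmetric] right_diff_distrib[symmetric]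
  by (intro less_val_sum) (auto simp: val_mult res_power add_nonneg_pos)

lemma val_eq_0_of_res: "v x = 0 \<Longrightarrow> 0 < v (x - y) \<Longrightarrow> v y = 0"
  using val_eq_of_close'[of x y] by simp

text \<open>Hensel's lemma at the residue \<open>0\<close>; a root modulo the support suffices. Other residues
  are reached by translation.\<close>

definition hensel_on :: "'a set \<Rightarrow> bool" where
  "hensel_on E \<longleftrightarrow> (\<forall>p\<in>coeffs_in E. (\<forall>i. 0 \<le> v (coeff p i)) \<and> 0 < v (coeff p 0) \<and> v (coeff p 1) = 0
     \<longrightarrow> (\<exists>b\<in>E. 0 < v b \<and> v (poly p b) = Inf))"

definition inv_closed :: "'a set \<Rightarrow> bool" where
  "inv_closed E \<longleftrightarrow> (\<forall>x\<in>E. v x \<noteq> Inf \<longrightarrow> (\<exists>y\<in>E. eqv (x * y) 1))"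

text \<open>Substitute \<open>x + a * t\<close> into \<open>p\<close> and divide by the linear
  coefficient \<open>poly (hasse 1 p) x * a\<close>. The assumptions make the result integral in
  \<open>t\<close>, with a unit as linear and an element of the maximal ideal as constant
  coefficient, so Hensel's lemma at the residue 0 gives \<open>t\<close>.\<close>

lemma newton_root:
  assumes E: "subring_of E" "inv_closed E" "hensel_on E"
    and p: "p \<in> coeffs_in E" "x \<in> E" "a \<in> E"
    and fin: "v (poly (hasse 1 p) x * a) \<noteq> Inf"
    and c: "v (poly (hasse 1 p) x * a) < v (poly p x)"
    and ge: "\<And>j. j \<ge> 2 \<Longrightarrow> v (poly (hasse 1 p) x * a) \<le> v (poly (hasse j p) x * a ^ j)"
  shows "\<exists>y\<in>E. v (poly p y) = Inf \<and> v a < v (y - x)"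
proof -
  let ?d = "poly (hasse 1 p) x * a"
  have dE: "?d \<in> E" using E p by (intro subring_mult poly_in_subring coeffs_in_hasse) auto
  then obtain b where b: "b \<in> E" "eqv (?d * b) 1" using E(2) fin by (auto simp: inv_closed_def)
  have vb: "v ?d + v b = 0" using val_inv_add[OF b(2)] .
  then have vbf: "v b \<noteq> Inf" by auto
  define q where "q = smult b (pcompose p [:x, a:])"
  have cq: "coeff q j = b * (poly (hasse j p) x * a ^ j)" for j
    by (simp add: q_def coeff_pcompose_hasse)
  have "q \<in> coeffs_in E"
    unfolding coeffs_in_def using E p b
    by (auto simp: cq intro!: subring_mult poly_in_subring coeffs_in_hasse subring_power)
  moreover have "0 < v (coeff q 0)"
    using c vb vbf fin_add_less_cancel[of "v b" "v ?d" "v (poly p x)"]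
    by (simp add: cq hasse_0 val_mult add.commute add.left_commute)
  moreover have c1: "v (coeff q 1) = 0"
    using vb by (simp add: cq val_mult add.commute add.left_commute)
  moreover have "0 \<le> v (coeff q j)" for j
  proof -
    consider "j = 0" | "j = 1" | "j \<ge> 2" by linarith
    then show ?thesis
    proof cases
      case 3
      then have "v b + v ?d \<le> v b + v (poly (hasse j p) x * a ^ j)"
        using ge[OF 3] vbf by (simp add: fin_add_le_cancel)
      then show ?thesis using vb by (simp add: cq val_mult[of b] add.commute)
    qed (use c1 \<open>0 < v (coeff q 0)\<close> in auto)
  qed
  ultimately obtain t where t: "t \<in> E" "0 < v t" "v (poly q t) = Inf"
    using E(3) unfolding hensel_on_def by meson
  have "poly q t = b * poly p (x + a * t)" by (simp add: q_def poly_pcompose mult.commute)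
  then have "v (poly p (x + a * t)) = Inf" using t(3) vbf by (simp add: val_mult)
  moreover have "v a < v ((x + a * t) - x)"
  proof -
    have "v a \<noteq> Inf" using fin by (auto simp: val_mult)
    then show ?thesis using t(2) fin_add_less_cancel[of "v a" 0 "v t"] by (simp add: val_mult)
  qed
  moreover have "x + a * t \<in> E" using E p t by (intro subring_add subring_mult)
  ultimately show ?thesis by blast
qed

text \<open>Taylor expansion at \<open>x\<close> factors \<open>poly p y - poly p z\<close> as
  \<open>y - z\<close> times a sum with first term \<open>poly (hasse 1 p) x\<close>. The other
  terms have larger value because \<open>y\<close> and \<open>z\<close> are closer to
  \<open>x\<close> than \<open>a\<close> allows for, so the second factor is not zero in the
  field.\<close>

lemma newton_unique:
  assumes fin: "v (poly (hasse 1 p) x * a) \<noteq> Inf"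
    and ge: "\<And>j. j \<ge> 2 \<Longrightarrow> v (poly (hasse 1 p) x * a) \<le> v (poly (hasse j p) x * a ^ j)"
    and y: "v (poly p y) = Inf" "v a < v (y - x)" and z: "v (poly p z) = Inf" "v a < v (z - x)"
  shows "eqv y z"
proof -
  define h k where "h = y - x" and "k = z - x"
  \<comment> \<open>The cofactor of \<open>h - k\<close> in \<open>h ^ j - k ^ j\<close>.\<close>
  define g where "g j = (\<Sum>i<j. k ^ (j - Suc i) * h ^ i)" for j
  let ?d = "poly (hasse 1 p) x"
  let ?s = "\<Sum>j=1..degree p. poly (hasse j p) x * g j"
  have va: "v a \<noteq> Inf" "v ?d \<noteq> Inf" using fin by (auto simp: val_mult)
  have hk: "h ^ j - k ^ j = (h - k) * g j" for j
    unfolding g_def by (rule power_diff_sumr2)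
  have "poly p y - poly p z = (poly p y - poly p x) - (poly p z - poly p x)" by simp
  also have "\<dots> = (\<Sum>j=1..degree p. poly (hasse j p) x * (h ^ j - k ^ j))"
    unfolding poly_taylor_diff h_def k_def by (simp add: sum_subtractf right_diff_distrib)
  also have "\<dots> = (h - k) * ?s"
    unfolding hk sum_distrib_left by (simp add: ac_simps)
  finally have eq: "poly p y - poly p z = (h - k) * ?s" .
  have big: "v ?d < v (poly (hasse j p) x * g j)" if j: "j \<ge> 2" for j
  proof -
    have "v (a ^ j) < v (a * g j)"
    proof -
      \<comment> \<open>Every term of \<open>g j\<close> is a monomial of degree
        \<open>j - 1\<close> in \<open>h\<close> and \<open>k\<close>, each of which has larger
        value than \<open>a\<close>; the degree is positive since \<open>j \<ge> 2\<close>.\<close>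
      have "v (a ^ (j - 1)) < v (g j)" unfolding g_def
      proof (rule less_val_sum)
        fix i assume i: "i \<in> {..<j}"
        have m: "v (a ^ (j - Suc i)) \<le> v (k ^ (j - Suc i))" "v (a ^ i) \<le> v (h ^ i)"
          using y z by (auto intro!: val_power_mono simp: h_def k_def)
        have *: "v (a ^ n) < v (u ^ n)" if u: "v a < v u" "n > 0" for u n
        proof -
          obtain m where "n = Suc m" using u(2) gr0_implies_Suc by blast
          then show ?thesis
            using u(1) va val_power_mono[of a u m] add_less_add_le[of "v a" "v u" "v (a ^ m)" "v (u ^ m)"]
            by (simp add: val_mult val_power_eq_Inf_iff)
        qed
        have "v (a ^ (j - Suc i)) + v (a ^ i) < v (k ^ (j - Suc i)) + v (h ^ i)"
        proof (cases "i = 0")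
          case True
          then show ?thesis using *[of k "j - Suc i"] z j by (auto simp: k_def)
        next
          case False
          then have "v (a ^ i) < v (h ^ i)" using *[of h i] y by (auto simp: h_def)
          then show ?thesis using m va add_less_add_le[of "v (a^i)" "v (h^i)" "v (a ^ (j - Suc i))" "v (k ^ (j - Suc i))"]
            by (auto simp: add.commute val_power_eq_Inf_iff)
        qed
        moreover have "v (a ^ (j - Suc i)) + v (a ^ i) = v (a ^ (j - 1))"
        proof -
          have "j - Suc i + i = j - 1" using i by auto
          then show ?thesis
            using power_add[of a "j - Suc i" i] val_mult[of "a ^ (j - Suc i)" "a ^ i"] by simp
        qed
        ultimately show "v (a ^ (j - 1)) < v (k ^ (j - Suc i) * h ^ i)" by (simp add: val_mult)
      qed (use va in \<open>simp add: val_power_eq_Inf_iff\<close>)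
      then have "v a + v (a ^ (j - 1)) < v (a * g j)" using va by (simp add: val_mult fin_add_less_cancel)
      moreover have "v a + v (a ^ (j - 1)) = v (a ^ j)"
        using j power_Suc[of a "j - 1"] val_mult[of a "a ^ (j - 1)"] by simp
      ultimately show ?thesis by simp
    qed
    show ?thesis
    proof (cases "v (poly (hasse j p) x) = Inf")
      case True
      then show ?thesis using va by (simp add: val_mult)
    next
      case False
      have "v a + v ?d \<le> v (poly (hasse j p) x) + v (a ^ j)"
        using ge[OF j] by (simp add: val_mult add.commute)
      also have "\<dots> < v (poly (hasse j p) x) + v (a * g j)"
        using \<open>v (a ^ j) < v (a * g j)\<close> False by (simp add: fin_add_less_cancel)
      finally have "v a + v ?d < v a + (v (poly (hasse j p) x) + v (g j))"
        by (simp add: val_mult ac_simps)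
      then show ?thesis using va by (simp add: fin_add_less_cancel val_mult)
    qed
  qed
  have dp: "degree p \<ge> 1"
  proof (rule ccontr)
    assume "\<not> 1 \<le> degree p"
    then have "hasse 1 p = 0" by (intro poly_eqI) (simp add: coeff_hasse coeff_eq_0)
    then show False using va by simp
  qed
  have "?s = poly (hasse 1 p) x * g 1 + (\<Sum>j=2..degree p. poly (hasse j p) x * g j)"
    using sum.atLeast_Suc_atMost[OF dp, of "\<lambda>j. poly (hasse j p) x * g j"] by (simp add: numeral_2_eq_2)
  moreover have "v ?d < v (\<Sum>j=2..degree p. poly (hasse j p) x * g j)"
    using big va by (intro less_val_sum) auto
  moreover have "g 1 = 1" by (simp add: g_def)
  ultimately have "v ?s = v ?d" using val_add_eq by simp
  moreover have "Inf \<le> v (poly p y - poly p z)" using y z by (intro le_val_diff) auto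
  ultimately have "v (h - k) = Inf" using va by (simp add: eq val_mult)
  then show ?thesis by (simp add: eqv_def h_def k_def)
qed

end

locale hens_val = supp_val +
  assumes hensel: "hensel_on UNIV" and residue_char_0: "n > 0 \<Longrightarrow> v (of_nat n) = 0"
begin

text \<open>Newton's method for \<open>X^n - u\<close> at 1 with scale 1: the derivative there is
  \<open>n\<close>, a unit in residue characteristic 0, and \<open>1 - u\<close> lies in the maximal
  ideal.\<close>

lemma nth_root:
  assumes E: "subring_of E" "inv_closed E" "hensel_on E" and u: "u \<in> E" "0 < v (u - 1)" and n: "n > 0"
  shows "\<exists>w\<in>E. eqv (w ^ n) u \<and> 0 < v (w - 1)"
proof -
  define p where "p = monom 1 n + [:- u:]"
  have p: "p \<in> coeffs_in E" unfolding p_def using E u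
    by (intro coeffs_in_add coeffs_in_monom coeffs_in_const subring_1 subring_uminus)
  have h: "poly (hasse (Suc j) p) 1 = of_nat (n choose Suc j)" for j
  proof -
    have "hasse (Suc j) p = monom (of_nat (n choose Suc j)) (n - Suc j)"
    proof (rule poly_eqI)
      fix i
      show "coeff (hasse (Suc j) p) i = coeff (monom (of_nat (n choose Suc j)) (n - Suc j)) i"
        using n by (cases "n < Suc j")
          (auto simp: coeff_hasse p_def coeff_pCons coeff_monom binomial_eq_0 simp del: binomial_Suc_Suc)
    qed
    then show ?thesis by (simp add: poly_monom)
  qed
  have h1: "poly (hasse 1 p) 1 = of_nat n" using h[of 0] by simp
  have "\<exists>y\<in>E. v (poly p y) = Inf \<and> v 1 < v (y - 1)"
  proof (rule newton_root[OF E p])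
    show "1 \<in> E" "1 \<in> E" using E subring_1 by auto
    show "v (poly (hasse 1 p) 1 * 1) \<noteq> Inf" using h1 residue_char_0[OF n] by simp
    show "v (poly (hasse 1 p) 1 * 1) < v (poly p 1)"
      using u residue_char_0[OF n] unfolding h1 by (simp add: p_def poly_monom val_diff_commute)
    fix j :: nat assume "2 \<le> j"
    then obtain k where "j = Suc k" by (cases j) auto
    then show "v (poly (hasse 1 p) 1 * 1) \<le> v (poly (hasse j p) 1 * 1 ^ j)"
      using h[of k] h1 residue_char_0[OF n] val_of_nat_ge_0 by simp
  qed
  then show ?thesis by (auto simp: p_def poly_monom eqv_def)
qed

end

section \<open>Angular components and the correspondence of residues and values\<close>

text \<open>Only the residue of \<open>ac x\<close> carries meaning. Hence all axioms but the first
  are congruences modulo the maximal ideal: \<open>ac\<close> is multiplicative, extends the residue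
  map on units and depends on leading parts only.\<close>

locale ac_val = hens_val +
  fixes ac :: "'a \<Rightarrow> 'a"
  assumes val_ac: "v x \<noteq> Inf \<Longrightarrow> v (ac x) = 0"
    and ac_mult: "v x \<noteq> Inf \<Longrightarrow> v y \<noteq> Inf \<Longrightarrow> 0 < v (ac (x * y) - ac x * ac y)"
    and ac_unit: "v x = 0 \<Longrightarrow> 0 < v (ac x - x)"
    and ac_close: "v x \<noteq> Inf \<Longrightarrow> v x < v (y - x) \<Longrightarrow> 0 < v (ac y - ac x)"
begin

lemma ac_eqv: "v x \<noteq> Inf \<Longrightarrow> eqv x y \<Longrightarrow> 0 < v (ac y - ac x)"
  by (rule ac_close) (auto simp: eqv_def val_diff_commute)

lemma res_mult_1: "0 < v (a - 1) \<Longrightarrow> 0 < v (b - 1) \<Longrightarrow> 0 < v (a * b - 1)"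
  using res_mult[of a 1 1 b] res_ge_0[of 1 a] by (simp add: val_diff_commute)

lemma ac_mult_1: "\<lbrakk>v x \<noteq> Inf; v y \<noteq> Inf; 0 < v (ac x - 1); 0 < v (ac y - 1)\<rbrakk> \<Longrightarrow> 0 < v (ac (x * y) - 1)"
  using less_val_trans[OF ac_mult res_mult_1] by blast

lemma ac_1: "0 < v (ac 1 - 1)"
  using ac_unit[of 1] by simp

lemma ac_power_1: "\<lbrakk>v x \<noteq> Inf; 0 < v (ac x - 1)\<rbrakk> \<Longrightarrow> 0 < v (ac (x ^ n) - 1)"
  by (induction n) (auto simp: ac_1 ac_mult_1 val_power_eq_Inf_iff)

lemma ac_inverse:
  assumes "v x \<noteq> Inf" "eqv (x * y) 1"
  shows "0 < v (ac x * ac y - 1)"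
proof -
  have y: "v y \<noteq> Inf" using val_inv_add[OF assms(2)] by auto
  have "v (x * y) = 0" using eqv_val[OF assms(2)] by simp
  then have "0 < v (ac (x * y) - x * y)" by (rule ac_unit)
  moreover have "0 < v (x * y - 1)" using assms(2) by (simp add: eqv_def)
  ultimately have "0 < v (ac (x * y) - 1)" by (rule less_val_trans)
  moreover have "0 < v (ac x * ac y - ac (x * y))"
    using ac_mult[OF assms(1) y] by (simp add: val_diff_commute)
  ultimately show ?thesis using less_val_trans by blast
qed

text \<open>Divide \<open>z\<close> by its own angular component, which is a unit.\<close>

lemma make_ac_1:
  assumes E: "subring_of E" "inv_closed E" "z \<in> E" "ac z \<in> E" "v z \<noteq> Inf"
  shows "\<exists>x\<in>E. v x = v z \<and> 0 < v (ac x - 1)"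
proof -
  have a: "v (ac z) = 0" using val_ac E by auto
  then obtain y where y: "y \<in> E" "eqv (ac z * y) 1"
    using E(2,4) by (auto simp: inv_closed_def)
  have vy: "v y = 0" using val_inv_add[OF y(2)] a by simp
  have "0 < v (ac (z * y) - ac z * ac y)" using E vy by (intro ac_mult) auto
  moreover have "0 < v (ac z * ac y - ac z * y)"
    using ac_unit[OF vy] a by (simp add: right_diff_distrib[symmetric] val_mult)
  moreover have "0 < v (ac z * y - 1)" using y by (simp add: eqv_def)
  ultimately have "0 < v (ac (z * y) - 1)" using less_val_trans by blast
  moreover have "v (z * y) = v z" using vy by (simp add: val_mult)
  ultimately show ?thesis using y E subring_mult by blast
qed

text \<open>The quotient \<open>u\<close> of \<open>e\<close> by \<open>x ^ n\<close> has value 0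
  and angular component 1, so it is a 1-unit and has an \<open>n\<close>-th root. Without the
  condition on angular components it would be an arbitrary unit, which need not have one.\<close>

lemma adjust_nth_root:
  assumes E: "subring_of E" "inv_closed E" "hensel_on E" "x \<in> E" "e \<in> E" and n: "n > 0"
    and x: "v x \<noteq> Inf" "0 < v (ac x - 1)" and e: "v (x ^ n) = v e" "0 < v (ac e - 1)"
  shows "\<exists>y\<in>E. eqv (y ^ n) e \<and> v y = v x \<and> 0 < v (ac y - 1)"
proof -
  have xn: "v (x ^ n) \<noteq> Inf" "x ^ n \<in> E" using x E by (auto simp: val_power_eq_Inf_iff subring_power)
  then obtain b where b: "b \<in> E" "eqv (x ^ n * b) 1" using E(2) by (auto simp: inv_closed_def)
  define u where "u = e * b"
  have bf: "v b \<noteq> Inf" using val_inv_add[OF b(2)] by auto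
  have vu: "v u = 0" using val_inv_add[OF b(2)] e by (simp add: u_def val_mult)
  have acb: "0 < v (ac b - 1)"
  proof -
    have "0 < v (ac (x ^ n) * ac b - 1)" using ac_inverse[OF xn(1) b(2)] .
    moreover have "0 < v (ac (x ^ n) * ac b - 1 * ac b)"
      unfolding left_diff_distrib[symmetric]
      using ac_power_1[OF x, of n] val_ac[OF bf] by (simp add: val_mult)
    ultimately show ?thesis using less_val_trans[of 0 "1 * ac b" "ac (x ^ n) * ac b" 1]
      by (simp add: val_diff_commute)
  qed
  have "0 < v (ac u - 1)" unfolding u_def using e xn bf acb by (intro ac_mult_1) auto
  then have "0 < v (u - 1)" using less_val_trans[of 0 u "ac u" 1] ac_unit[OF vu]
    by (simp add: val_diff_commute)
  moreover have "u \<in> E" using E b by (simp add: u_def subring_mult)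
  ultimately obtain w where w: "w \<in> E" "eqv (w ^ n) u" "0 < v (w - 1)"
    using nth_root[OF E(1-3) _ _ n, of u] by blast
  have vw: "v w = 0" using val_eq_0_of_res[of 1 w] w(3) by (simp add: val_diff_commute)
  have "eqv ((x * w) ^ n) (x ^ n * u)"
    unfolding power_mult_distrib using w(2) by (intro eqv_mult) auto
  also have "eqv (x ^ n * u) e"
    using eqv_mult[OF b(2) eqv_refl[of e]] by (simp add: u_def ac_simps)
  finally have "eqv ((x * w) ^ n) e" .
  moreover have "0 < v (ac w - 1)" using less_val_trans[OF ac_unit[OF vw] w(3)] .
  then have "0 < v (ac (x * w) - 1)" using x vw by (intro ac_mult_1) auto
  moreover have "v (x * w) = v x" using vw by (simp add: val_mult)
  ultimately show ?thesis using E w subring_mult by blast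
qed

end

text \<open>A partial isomorphism between the fields of \<open>v1\<close> and \<open>v2\<close> is a subring: each element
  represents a pair of corresponding elements. The assumption \<open>combine\<close> says that all pairs are
  represented.\<close>

locale two_val =
  V1: ac_val v1 ac + V2: ac_val v2 ac
  for v1 :: "'a::comm_ring_1 \<Rightarrow> 'g::linordered_ab_group_add with_inf"
    and v2 :: "'a \<Rightarrow> 'h::linordered_ab_group_add with_inf" and ac +
  assumes combine: "\<exists>z. V1.eqv z a \<and> V2.eqv z b"
    and saturated2: "(\<And>m::nat. \<exists>z. \<forall>i\<le>m. v2 (z - e i) = v2 (g i)) \<Longrightarrow> \<exists>z. \<forall>i. v2 (z - e i) = v2 (g i)"

text \<open>\<open>E\<close> is a Henselian subfield of the first field. The residues of \<open>A\<close> and the values of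
  \<open>D\<close> are graphs of partial homomorphisms from the residues and values of \<open>E\<close> to those of the second
  field; \<open>C\<close> below consists of the pairs whose values and angular components match these graphs.\<close>

locale corr = two_val +
  fixes E A D :: "'a set"
  assumes E_subring: "subring_of E" and E_inv: "V1.inv_closed E" and E_hensel: "V1.hensel_on E"
    and E_eqv: "x \<in> E \<Longrightarrow> V1.eqv x y \<Longrightarrow> y \<in> E"
    and E_ac: "x \<in> E \<Longrightarrow> v1 x \<noteq> Inf \<Longrightarrow> ac x \<in> E"
    and A_int: "a \<in> A \<Longrightarrow> 0 \<le> v1 a" "a \<in> A \<Longrightarrow> 0 \<le> v2 a"
    and A_ex: "x \<in> E \<Longrightarrow> 0 \<le> v1 x \<Longrightarrow> \<exists>a\<in>A. 0 < v1 (x - a)"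
    and A_0: "a \<in> A \<Longrightarrow> 0 < v1 a \<longleftrightarrow> 0 < v2 a"
    and A_1: "a \<in> A \<Longrightarrow> 0 < v1 (a - 1) \<longleftrightarrow> 0 < v2 (a - 1)"
    and A_add: "\<lbrakk>a \<in> A; b \<in> A; c \<in> A\<rbrakk> \<Longrightarrow> 0 < v1 (a + b - c) \<longleftrightarrow> 0 < v2 (a + b - c)"
    and A_mult: "\<lbrakk>a \<in> A; b \<in> A; c \<in> A\<rbrakk> \<Longrightarrow> 0 < v1 (a * b - c) \<longleftrightarrow> 0 < v2 (a * b - c)"
    and D_ex: "x \<in> E \<Longrightarrow> \<exists>d\<in>D. v1 d = v1 x"
    and D_less: "\<lbrakk>a \<in> D; b \<in> D\<rbrakk> \<Longrightarrow> v1 a < v1 b \<longleftrightarrow> v2 a < v2 b"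
    and D_Inf: "a \<in> D \<Longrightarrow> v1 a = Inf \<longleftrightarrow> v2 a = Inf"
    and D_0: "a \<in> D \<Longrightarrow> v1 a = 0 \<longleftrightarrow> v2 a = 0"
    and D_mult: "\<lbrakk>a \<in> D; b \<in> D; c \<in> D\<rbrakk> \<Longrightarrow> v1 (a * b) = v1 c \<longleftrightarrow> v2 (a * b) = v2 c"
    and D_countable: "countable D"
begin

section \<open>Elements whose residues and values are matched\<close>

definition "rA z \<longleftrightarrow> z \<in> E \<and> (\<exists>a\<in>A. 0 < v1 (z - a) \<and> 0 < v2 (z - a))"
definition "rD z \<longleftrightarrow> z \<in> E \<and> (\<exists>d\<in>D. v1 z = v1 d \<and> v2 z = v2 d)"
definition "C = {z. rD z \<and> (v1 z \<noteq> Inf \<longrightarrow> rA (ac z))}"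

lemma rA_E: "rA z \<Longrightarrow> z \<in> E" and rD_E: "rD z \<Longrightarrow> z \<in> E"
  by (auto simp: rA_def rD_def)

lemma rA_int: "rA z \<Longrightarrow> 0 \<le> v1 z \<and> 0 \<le> v2 z"
  using A_int V1.res_ge_0 V2.res_ge_0 V1.val_diff_commute V2.val_diff_commute
  unfolding rA_def by metis

lemma rA_res: "\<lbrakk>rA z; w \<in> E; 0 < v1 (z - w); 0 < v2 (z - w)\<rbrakk> \<Longrightarrow> rA w"
  using V1.less_val_trans V2.less_val_trans V1.val_diff_commute V2.val_diff_commute
  unfolding rA_def by metis

lemma rA_pos_iff: "rA z \<Longrightarrow> 0 < v1 z \<longleftrightarrow> 0 < v2 z"
proof -
  assume "rA z"
  then obtain a where a: "a \<in> A" "0 < v1 (z - a)" "0 < v2 (z - a)" by (auto simp: rA_def)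
  have "0 < v1 z \<longleftrightarrow> 0 < v1 a"
    using a V1.less_val_add[of 0 a "z - a"] V1.less_val_diff[of 0 z "z - a"] by auto
  moreover have "0 < v2 z \<longleftrightarrow> 0 < v2 a"
    using a V2.less_val_add[of 0 a "z - a"] V2.less_val_diff[of 0 z "z - a"] by auto
  ultimately show ?thesis using A_0 a by blast
qed

lemma rA_val_0_iff: "rA z \<Longrightarrow> v1 z = 0 \<longleftrightarrow> v2 z = 0"
  using rA_pos_iff[of z] rA_int[of z] by (metis less_le order_less_irrefl)

lemma rA_0: "rA 0"
proof -
  obtain a where "a \<in> A" "0 < v1 (0 - a)" using A_ex[of 0] E_subring subring_0 by auto
  then show ?thesis using A_0 E_subring subring_0 by (auto simp: rA_def)
qed

lemma rA_1: "rA 1"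
proof -
  obtain a where "a \<in> A" "0 < v1 (1 - a)" using A_ex[of 1] E_subring subring_1 by auto
  then show ?thesis using A_1[of a] E_subring subring_1 V1.val_diff_commute V2.val_diff_commute
    unfolding rA_def by metis
qed

text \<open>\<open>A_ex\<close> gives a representative of the sum that is correct in the first
  field; \<open>A_add\<close> carries its relation to the summands over, so it is correct in the
  second field too. The closure properties below follow this pattern.\<close>

lemma rA_add: "rA x \<Longrightarrow> rA y \<Longrightarrow> rA (x + y)"
proof -
  assume xy: "rA x" "rA y"
  then obtain a b where a: "a \<in> A" "0 < v1 (x - a)" "0 < v2 (x - a)"
    and b: "b \<in> A" "0 < v1 (y - b)" "0 < v2 (y - b)" by (auto simp: rA_def)
  have s: "x + y \<in> E" using xy E_subring by (auto intro: subring_add rA_E)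
  moreover have "0 \<le> v1 (x + y)" using xy rA_int by (auto intro: V1.le_val_add)
  ultimately obtain c where c: "c \<in> A" "0 < v1 (x + y - c)" using A_ex by blast
  have 1: "0 < v1 (x + y - (a + b))" "0 < v2 (x + y - (a + b))"
    using V1.less_val_add[OF a(2) b(2)] V2.less_val_add[OF a(3) b(3)] by (auto simp: algebra_simps)
  then have "0 < v1 (a + b - c)"
    using c V1.less_val_trans[of 0 "a + b" "x + y" c] V1.val_diff_commute by metis
  then have "0 < v2 (a + b - c)" using A_add a b c by blast
  with 1(2) have "0 < v2 (x + y - c)" using V2.less_val_trans by blast
  then show ?thesis using s c by (auto simp: rA_def)
qed

lemma rA_mult: "rA x \<Longrightarrow> rA y \<Longrightarrow> rA (x * y)"
proof -
  assume xy: "rA x" "rA y"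
  then obtain a b where a: "a \<in> A" "0 < v1 (x - a)" "0 < v2 (x - a)"
    and b: "b \<in> A" "0 < v1 (y - b)" "0 < v2 (y - b)" by (auto simp: rA_def)
  have s: "x * y \<in> E" using xy E_subring by (auto intro: subring_mult rA_E)
  moreover have "0 \<le> v1 (x * y)" using xy rA_int by (auto simp: V1.val_mult add_nonneg_nonneg)
  ultimately obtain c where c: "c \<in> A" "0 < v1 (x * y - c)" using A_ex by blast
  have 1: "0 < v1 (x * y - a * b)" "0 < v2 (x * y - a * b)"
    using V1.res_mult[of x b a y] V2.res_mult[of x b a y] a b rA_int xy A_int by auto
  then have "0 < v1 (a * b - c)"
    using c V1.less_val_trans[of 0 "a * b" "x * y" c] V1.val_diff_commute by metis
  then have "0 < v2 (a * b - c)" using A_mult a b c by blast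
  with 1(2) have "0 < v2 (x * y - c)" using V2.less_val_trans by blast
  then show ?thesis using s c by (auto simp: rA_def)
qed

text \<open>The assumptions on \<open>A\<close> do not mention negation, so \<open>- x\<close> is
  characterized by giving 0 when added to \<open>x\<close>.\<close>

lemma rA_uminus: "rA x \<Longrightarrow> rA (- x)"
proof -
  assume x: "rA x"
  then obtain a where a: "a \<in> A" "0 < v1 (x - a)" "0 < v2 (x - a)" by (auto simp: rA_def)
  have s: "- x \<in> E" using x E_subring by (auto intro: subring_uminus rA_E)
  moreover have "0 \<le> v1 (- x)" using x rA_int by auto
  ultimately obtain b where b: "b \<in> A" "0 < v1 (- x - b)" using A_ex by blast
  obtain c where c: "c \<in> A" "0 < v1 c" "0 < v2 c" using rA_0 by (auto simp: rA_def)
  have "a + b - c = - (x - a) - (- x - b) - c" by simp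
  then have "0 < v1 (a + b - c)" using a b c
    by (metis V1.less_val_diff V1.val_minus)
  then have "0 < v2 (a + b - c)" using A_add a b c by blast
  moreover have "- x - b = - (x - a) - (a + b - c) - c" by simp
  ultimately have "0 < v2 (- x - b)" using a c by (metis V2.less_val_diff V2.val_minus)
  then show ?thesis using s b by (auto simp: rA_def)
qed

lemma rA_diff: "rA x \<Longrightarrow> rA y \<Longrightarrow> rA (x - y)"
  using rA_add[of x "- y"] rA_uminus by simp

lemma rA_poly: "(\<And>i. rA (coeff p i)) \<Longrightarrow> rA x \<Longrightarrow> rA (poly p x)"
proof (induction p)
  case (pCons c p)
  have "rA c" using pCons.prems(1)[of 0] by simp
  moreover have "rA (coeff p i)" for i using pCons.prems(1)[of "Suc i"] by simp
  ultimately show ?case using pCons by (auto intro: rA_add rA_mult)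
qed (simp add: rA_0)

lemma rD_less: "rD z \<Longrightarrow> rD w \<Longrightarrow> v1 z < v1 w \<longleftrightarrow> v2 z < v2 w"
  using D_less unfolding rD_def by metis

lemma rD_le: "rD z \<Longrightarrow> rD w \<Longrightarrow> v1 z \<le> v1 w \<longleftrightarrow> v2 z \<le> v2 w"
  using rD_less[of w z] by (simp add: not_less[symmetric])

lemma rD_eq: "rD z \<Longrightarrow> rD w \<Longrightarrow> v1 z = v1 w \<longleftrightarrow> v2 z = v2 w"
  using rD_le[of w z] rD_le[of z w] by (simp add: order.eq_iff)

lemma rD_Inf: "rD z \<Longrightarrow> v1 z = Inf \<longleftrightarrow> v2 z = Inf"
  using D_Inf unfolding rD_def by metis

lemma rD_val_0: "rD z \<Longrightarrow> v1 z = 0 \<longleftrightarrow> v2 z = 0"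
  using D_0 unfolding rD_def by metis

lemma rD_mult: "rD x \<Longrightarrow> rD y \<Longrightarrow> rD (x * y)"
proof -
  assume xy: "rD x" "rD y"
  then obtain a b where a: "a \<in> D" "v1 x = v1 a" "v2 x = v2 a"
    and b: "b \<in> D" "v1 y = v1 b" "v2 y = v2 b" by (auto simp: rD_def)
  have s: "x * y \<in> E" using xy E_subring by (auto intro: subring_mult rD_E)
  then obtain c where c: "c \<in> D" "v1 c = v1 (x * y)" using D_ex by blast
  then have "v2 (a * b) = v2 c" using D_mult[of a b c] a b by (simp add: V1.val_mult)
  then have "v1 (x * y) = v1 c" "v2 (x * y) = v2 c" using a b c by (simp_all add: V2.val_mult)
  then show ?thesis using s c unfolding rD_def by metis
qed

lemma rD_unit: "z \<in> E \<Longrightarrow> v1 z = 0 \<Longrightarrow> v2 z = 0 \<Longrightarrow> rD z"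
  using D_ex[of z] D_0 unfolding rD_def by metis

lemma CD: "z \<in> C \<Longrightarrow> rD z" and CE: "z \<in> C \<Longrightarrow> z \<in> E" and CA: "z \<in> C \<Longrightarrow> v1 z \<noteq> Inf \<Longrightarrow> rA (ac z)"
  by (auto simp: C_def rD_E)

lemma CI: "rD z \<Longrightarrow> (v1 z \<noteq> Inf \<Longrightarrow> rA (ac z)) \<Longrightarrow> z \<in> C"
  by (auto simp: C_def)

lemma C_InfI: "v1 z = Inf \<Longrightarrow> v2 z = Inf \<Longrightarrow> z \<in> C"
proof -
  assume z: "v1 z = Inf" "v2 z = Inf"
  have "z \<in> E" using E_eqv[of 0 z] z E_subring subring_0 by (auto simp: V1.eqv_def)
  then obtain d where d: "d \<in> D" "v1 d = v1 z" using D_ex by blast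
  then have "v2 d = v2 z" using D_Inf[of d] z by simp
  then have "rD z" using d \<open>z \<in> E\<close> unfolding rD_def by metis
  then show ?thesis using z by (simp add: C_def)
qed

lemma C_mult: "z \<in> C \<Longrightarrow> w \<in> C \<Longrightarrow> z * w \<in> C"
proof (rule CI)
  assume zw: "z \<in> C" "w \<in> C"
  then show "rD (z * w)" by (intro rD_mult CD)
  assume "v1 (z * w) \<noteq> Inf"
  then have f: "v1 z \<noteq> Inf" "v1 w \<noteq> Inf" "v1 (z * w) \<noteq> Inf" by (auto simp: V1.val_mult)
  then have f2: "v2 z \<noteq> Inf" "v2 w \<noteq> Inf" using zw CD rD_Inf by auto
  have "rA (ac z * ac w)" using zw f by (intro rA_mult CA)
  moreover have "ac (z * w) \<in> E" using E_ac[OF subring_mult[OF E_subring CE CE]] zw f by blast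
  moreover have "0 < v1 (ac z * ac w - ac (z * w))" "0 < v2 (ac z * ac w - ac (z * w))"
    using V1.ac_mult f V2.ac_mult f2 V1.val_diff_commute V2.val_diff_commute by metis+
  ultimately show "rA (ac (z * w))" by (rule rA_res)
qed

lemma C_unitI: "rA z \<Longrightarrow> v1 z = 0 \<Longrightarrow> z \<in> C"
proof (rule CI)
  assume z: "rA z" "v1 z = 0"
  then have v2: "v2 z = 0" using rA_val_0_iff by blast
  then show "rD z" using rD_unit z rA_E by blast
  show "rA (ac z)"
    using rA_res[OF z(1)] V1.ac_unit[OF z(2)] V2.ac_unit[OF v2] E_ac[OF rA_E[OF z(1)]] z
    by (auto simp: V1.val_diff_commute V2.val_diff_commute)
qed

lemma C_1: "1 \<in> C"
  by (rule C_unitI) (auto simp: rA_1)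

lemma C_power: "z \<in> C \<Longrightarrow> z ^ n \<in> C"
  by (induction n) (auto intro: C_1 C_mult)

lemma C_val_1_pos: "z \<in> C \<Longrightarrow> 0 < v1 z \<longleftrightarrow> 0 < v2 z"
  using rD_less[of 1 z] CD C_1 by simp

text \<open>An integral member of \<open>C\<close> is either a unit, whose residue is that of its
  angular component, or has residue 0.\<close>

lemma C_rA: "z \<in> C \<Longrightarrow> 0 \<le> v1 z \<Longrightarrow> rA z"
proof (cases "v1 z = 0")
  case True
  assume z: "z \<in> C"
  then have v2: "v2 z = 0" using True rD_val_0 CD by blast
  have "rA (ac z)" using CA z True by auto
  then show "rA z"
    using rA_res[of "ac z" z] V1.ac_unit[OF True] V2.ac_unit[OF v2] CE[OF z] by auto
next
  case False
  assume z: "z \<in> C" "0 \<le> v1 z"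
  then have "0 < v1 z" using False by auto
  moreover have "0 < v2 z" using calculation C_val_1_pos z by blast
  ultimately show "rA z" using rA_res[OF rA_0, of z] CE[OF z(1)] by auto
qed

text \<open>Value and angular component depend only on the leading part of an element. Later a
  polynomial value is shown to be in \<open>C\<close> by exhibiting a part of it in \<open>C\<close>
  that dominates in both fields.\<close>

lemma C_close: "\<lbrakk>z \<in> C; v1 z \<noteq> Inf; w \<in> E; v1 z < v1 (w - z); v2 z < v2 (w - z)\<rbrakk> \<Longrightarrow> w \<in> C"
proof (rule CI)
  assume z: "z \<in> C" "v1 z \<noteq> Inf" "w \<in> E" and c: "v1 z < v1 (w - z)" "v2 z < v2 (w - z)"
  have e: "v1 w = v1 z" "v2 w = v2 z" using V1.val_eq_of_close[OF c(1)] V2.val_eq_of_close[OF c(2)] by auto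
  then show "rD w" using z CD[OF z(1)] by (auto simp: rD_def)
  have "rA (ac z)" using CA z by auto
  moreover have "ac w \<in> E" using E_ac z e by auto
  moreover have "0 < v1 (ac z - ac w)" "0 < v2 (ac z - ac w)"
    using V1.ac_close[OF z(2) c(1)] V2.ac_close[OF _ c(2)] rD_Inf[OF CD[OF z(1)]] z
    by (auto simp: V1.val_diff_commute V2.val_diff_commute)
  ultimately show "rA (ac w)" by (rule rA_res)
qed

lemma C_eqv: "\<lbrakk>z \<in> C; V1.eqv z w; V2.eqv z w\<rbrakk> \<Longrightarrow> w \<in> C"
proof (cases "v1 z = Inf")
  case True
  assume a: "z \<in> C" "V1.eqv z w" "V2.eqv z w"
  then have "v2 z = Inf" using True rD_Inf CD by blast
  then show "w \<in> C" using True a V1.eqv_val V2.eqv_val by (intro C_InfI) metis+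
next
  case False
  assume a: "z \<in> C" "V1.eqv z w" "V2.eqv z w"
  then have "v2 z \<noteq> Inf" using False rD_Inf CD by blast
  moreover have "w \<in> E" using E_eqv[OF CE] a by blast
  moreover have "v1 (w - z) = Inf" "v2 (w - z) = Inf"
    using a V1.val_diff_commute[of w z] V2.val_diff_commute[of w z]
    by (auto simp: V1.eqv_def V2.eqv_def)
  ultimately show "w \<in> C" using False a(1) by (intro C_close[of z w]) simp_all
qed

text \<open>Representatives for the value and the angular component of \<open>y\<close> are found in
  the first field. \<open>D_mult\<close> and \<open>A_mult\<close> carry the relation that
  \<open>z * y\<close> is 1 to the second field, where cancelling \<open>z\<close> shows that they
  are right.\<close>

lemma C_inverse:
  assumes z: "z \<in> C" "v1 z \<noteq> Inf" and y: "V1.eqv (z * y) 1" "V2.eqv (z * y) 1"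
  shows "y \<in> C"
proof (rule CI)
  have z2: "v2 z \<noteq> Inf" using z rD_Inf CD by blast
  obtain y' where y': "y' \<in> E" "V1.eqv (z * y') 1" using E_inv z CE by (auto simp: V1.inv_closed_def)
  have "V1.eqv (z * y') (z * y)" using y y' V1.eqv_sym V1.eqv_trans by blast
  then have yE: "y \<in> E" using E_eqv y' z by (simp add: V1.eqv_mult_cancel)
  have vz: "v1 z + v1 y = 0" "v2 z + v2 y = 0" using y V1.val_inv_add V2.val_inv_add by auto
  have yf: "v1 y \<noteq> Inf" "v2 y \<noteq> Inf" using vz by auto
  show "rD y"
  proof -
    obtain c where c: "c \<in> D" "v1 z = v1 c" "v2 z = v2 c" using CD[OF z(1)] by (auto simp: rD_def)
    obtain d where d: "d \<in> D" "v1 d = v1 y" using D_ex yE by blast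
    obtain f where f: "f \<in> D" "v1 f = 0" "v2 f = 0" using CD[OF C_1] by (auto simp: rD_def)
    have "v2 (c * d) = v2 f" using D_mult[of c d f] c d f vz by (simp add: V1.val_mult)
    then have "v2 z + v2 d = v2 z + v2 y" using c f vz by (simp add: V2.val_mult)
    then have "v2 d = v2 y" using z2 by (simp add: fin_add_eq_cancel)
    then show ?thesis using d yE unfolding rD_def by metis
  qed
  have ay: "ac y \<in> E" "v1 (ac y) = 0" "v2 (ac y) = 0"
    using E_ac yE yf V1.val_ac V2.val_ac by auto
  obtain b where b: "b \<in> A" "0 < v1 (ac y - b)" using A_ex[OF ay(1)] ay(2) by auto
  obtain a where a: "a \<in> A" "0 < v1 (ac z - a)" "0 < v2 (ac z - a)" using CA z by (auto simp: rA_def)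
  obtain c where c: "c \<in> A" "0 < v1 (1 - c)" "0 < v2 (1 - c)" using rA_1 by (auto simp: rA_def)
  have az: "v1 (ac z) = 0" "v2 (ac z) = 0" using z z2 V1.val_ac V2.val_ac by auto
  have i: "0 < v1 (ac z * ac y - 1)" "0 < v2 (ac z * ac y - 1)"
    using V1.ac_inverse V2.ac_inverse z z2 y by auto
  have "0 < v1 (ac z * ac y - a * b)" using V1.res_mult[of "ac z" b a "ac y"] az A_int a b by auto
  then have "0 < v1 (a * b - ac z * ac y)" by (simp add: V1.val_diff_commute)
  then have "0 < v1 (a * b - c)" using V1.less_val_trans i c by blast
  then have "0 < v2 (a * b - c)" using A_mult a b c by blast
  then have "0 < v2 (a * b - 1)" using c V2.less_val_trans[of 0 "a * b" c 1] V2.val_diff_commute by metis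
  moreover have "0 < v2 (ac z * b - a * b)" using a A_int(2)[OF b(1)]
    by (simp add: left_diff_distrib[symmetric] V2.val_mult add_pos_nonneg)
  ultimately have "0 < v2 (ac z * b - 1)" using V2.less_val_trans by blast
  then have "0 < v2 (ac z * ac y - ac z * b)"
    using i V2.less_val_trans[of 0 "ac z * ac y" 1 "ac z * b"] V2.val_diff_commute by metis
  then have "0 < v2 (ac y - b)" using az by (simp add: right_diff_distrib[symmetric] V2.val_mult)
  then show "rA (ac y)" using ay b by (auto simp: rA_def)
qed

lemma maximal_subring:
  assumes "subring_of R0" "R0 \<subseteq> C"
  shows "\<exists>R. subring_of R \<and> R0 \<subseteq> R \<and> R \<subseteq> C \<and> (\<forall>S. subring_of S \<and> R \<subseteq> S \<and> S \<subseteq> C \<longrightarrow> S = R)"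
proof -
  let ?X = "{R. subring_of R \<and> R0 \<subseteq> R \<and> R \<subseteq> C}"
  have "\<exists>M\<in>?X. \<forall>X\<in>?X. M \<subseteq> X \<longrightarrow> X = M"
  proof (rule subset_Zorn_nonempty)
    show "?X \<noteq> {}" using assms by blast
    fix \<C> assume ne: "\<C> \<noteq> {}" and ch: "subset.chain ?X \<C>"
    have sub: "\<And>R. R \<in> \<C> \<Longrightarrow> R \<in> ?X" using ch by (auto simp: subset.chain_def)
    have "subring_of (\<Union>\<C>)"
      unfolding subring_of_def
    proof (intro conjI ballI)
      show "1 \<in> \<Union>\<C>" using ne sub subring_1 by blast
      fix x y assume "x \<in> \<Union>\<C>" "y \<in> \<Union>\<C>"
      then obtain R S where R: "R \<in> \<C>" "x \<in> R" and S: "S \<in> \<C>" "y \<in> S" by blast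
      then have "R \<subset> S \<or> R = S \<or> S \<subset> R" using ch unfolding subset.chain_def by blast
      then obtain T where T: "T \<in> \<C>" "x \<in> T" "y \<in> T" using R S by blast
      then show "x - y \<in> \<Union>\<C>" using sub subring_diff by blast
      show "x * y \<in> \<Union>\<C>" using T sub subring_mult by blast
    qed
    moreover obtain S where "S \<in> \<C>" using ne by blast
    then have "R0 \<subseteq> \<Union>\<C>" using sub by auto
    moreover have "\<Union>\<C> \<subseteq> C" using sub by auto
    ultimately show "\<Union>\<C> \<in> ?X" by simp
  qed
  then obtain R where "R \<in> ?X" "\<And>S. S \<in> ?X \<Longrightarrow> R \<subseteq> S \<Longrightarrow> S = R" by meson
  then show ?thesis by (intro exI[of _ R]) auto
qed

end

section \<open>Maximal subrings on which the two valuations agree\<close>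

locale corr_max = corr +
  fixes R :: "'a set"
  assumes R_subring: "subring_of R" and R_C: "R \<subseteq> C"
    and R_max: "\<lbrakk>subring_of S; R \<subseteq> S; S \<subseteq> C\<rbrakk> \<Longrightarrow> S = R"
begin

section \<open>Adjoining elements to a maximal subring\<close>

definition "eq2 x y \<longleftrightarrow> V1.eqv x y \<and> V2.eqv x y"

lemma eq2_D: "eq2 x y \<Longrightarrow> V1.eqv x y" "eq2 x y \<Longrightarrow> V2.eqv x y"
  by (auto simp: eq2_def)

lemma eq2_refl [simp]: "eq2 x x"
  by (simp add: eq2_def)

lemma eq2_sym: "eq2 x y \<Longrightarrow> eq2 y x"
  by (auto simp: eq2_def V1.eqv_sym V2.eqv_sym)

lemma eq2_mult: "eq2 x x' \<Longrightarrow> eq2 y y' \<Longrightarrow> eq2 (x * y) (x' * y')"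
  by (auto simp: eq2_def V1.eqv_mult V2.eqv_mult)

lemma eq2_power: "eq2 x x' \<Longrightarrow> eq2 (x ^ n) (x' ^ n)"
  by (auto simp: eq2_def V1.eqv_power V2.eqv_power)

lemma eq2_sum: "(\<And>i. i \<in> I \<Longrightarrow> eq2 (f i) (g i)) \<Longrightarrow> eq2 (sum f I) (sum g I)"
  by (auto simp: eq2_def V1.eqv_sum V2.eqv_sum)

lemma eq2_poly_coeffs: "(\<And>i. eq2 (coeff p i) (coeff q i)) \<Longrightarrow> eq2 (poly p x) (poly q x)"
  by (auto simp: eq2_def V1.eqv_poly_coeffs V2.eqv_poly_coeffs)

lemma C_eq2: "z \<in> C \<Longrightarrow> eq2 z w \<Longrightarrow> w \<in> C"
  by (auto simp: eq2_def intro: C_eqv)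

lemma RC: "z \<in> R \<Longrightarrow> z \<in> C"
  using R_C by blast

lemma RE: "z \<in> R \<Longrightarrow> z \<in> E"
  using CE RC by blast

lemma RD: "z \<in> R \<Longrightarrow> rD z"
  using CD RC by blast

lemma coeffs_in_R_E: "p \<in> coeffs_in R \<Longrightarrow> p \<in> coeffs_in E"
  using RE by (auto simp: coeffs_in_def)

text \<open>The values at \<open>x\<close> of polynomials over \<open>R\<close> form the subring
  generated by \<open>R\<close> and \<open>x\<close>. If it is contained in \<open>C\<close>, it
  equals \<open>R\<close> by maximality.\<close>

lemma adjoin:
  assumes "\<And>p. p \<in> coeffs_in R \<Longrightarrow> poly p x \<in> C"
  shows "x \<in> R"
proof -
  let ?S = "(\<lambda>p. poly p x) ` coeffs_in R"
  have "subring_of ?S"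
    unfolding subring_of_def
  proof (intro conjI ballI)
    show "1 \<in> ?S"
      using coeffs_in_const[OF R_subring subring_1[OF R_subring]] by (intro image_eqI[of _ _ "[:1:]"]) auto
    fix y z assume "y \<in> ?S" "z \<in> ?S"
    then obtain p q where "p \<in> coeffs_in R" "q \<in> coeffs_in R" "y = poly p x" "z = poly q x" by blast
    then show "y - z \<in> ?S" "y * z \<in> ?S"
      using coeffs_in_diff[OF R_subring, of p q] coeffs_in_mult[OF R_subring, of p q]
        poly_diff[of p q x] poly_mult[of p q x] by (metis image_eqI)+
  qed
  moreover have "R \<subseteq> ?S"
  proof
    fix r assume "r \<in> R"
    then show "r \<in> ?S"
      using coeffs_in_const[OF R_subring, of r] by (intro image_eqI[of _ _ "[:r:]"]) auto
  qed
  moreover have "?S \<subseteq> C" using assms by auto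
  ultimately have "?S = R" by (rule R_max)
  moreover have "monom 1 1 \<in> coeffs_in R" using R_subring by (intro coeffs_in_monom subring_1)
  then have "x \<in> ?S" by (intro image_eqI[of _ _ "monom 1 1"]) (auto simp: poly_monom)
  ultimately show ?thesis by simp
qed

text \<open>With \<open>P\<close> bounding the degree, only remainders modulo a monic polynomial
  vanishing at \<open>x\<close> have to be tested.\<close>

lemma adjoin_mod:
  assumes "\<And>p. p \<in> coeffs_in R \<Longrightarrow> \<exists>r\<in>coeffs_in R. P r \<and> eq2 (poly r x) (poly p x)"
    and "\<And>r. r \<in> coeffs_in R \<Longrightarrow> P r \<Longrightarrow> poly r x \<in> C"
  shows "x \<in> R"
  using assms C_eq2 by (intro adjoin) blast

lemma reduce_mod_monic:
  assumes m: "m \<in> coeffs_in R" "lead_coeff m = 1" and x: "v1 (poly m x) = Inf" "v2 (poly m x) = Inf"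
    and p: "p \<in> coeffs_in R" and "degree m > 0"
  shows "\<exists>r\<in>coeffs_in R. degree r < degree m \<and> eq2 (poly r x) (poly p x)"
proof -
  obtain q r where q: "p = q * m + r" "r \<in> coeffs_in R" "degree r < degree m \<or> r = 0"
    using monic_division[OF R_subring m(2,1) p] by blast
  have "poly r x - poly p x = - (poly q x * poly m x)" by (simp add: q)
  then have "eq2 (poly r x) (poly p x)"
    using x by (simp add: eq2_def V1.eqv_def V2.eqv_def V1.val_mult V2.val_mult)
  moreover have "degree r < degree m" using q(3) \<open>degree m > 0\<close> by auto
  ultimately show ?thesis using q(2) by blast
qed

text \<open>The zero polynomial over the field: coefficients need only lie in the support.
  Accordingly \<open>degree\<close> is just an upper bound for the degree over the field.\<close>

definition "null p \<longleftrightarrow> (\<forall>i. v1 (coeff p i) = Inf)"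

lemma coeff_C: "p \<in> coeffs_in R \<Longrightarrow> coeff p i \<in> C"
  using RC coeffs_inD by blast

lemma null_poly:
  assumes "p \<in> coeffs_in R" "null p"
  shows "v1 (poly p x) = Inf" "v2 (poly p x) = Inf" "poly p x \<in> C"
proof -
  have "eq2 (coeff p i) (coeff 0 i)" for i
    using assms rD_Inf[OF CD[OF coeff_C[OF assms(1)]]]
    by (simp add: null_def eq2_def V1.eqv_0_iff V2.eqv_0_iff)
  from eq2_poly_coeffs[OF this, of x]
  show 1: "v1 (poly p x) = Inf" "v2 (poly p x) = Inf"
    by (auto simp: eq2_def V1.eqv_0_iff V2.eqv_0_iff)
  then show "poly p x \<in> C" by (rule C_InfI)
qed

text \<open>The element inverse to \<open>z\<close> in both fields lies in \<open>C\<close>. A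
  polynomial value at it is, after clearing denominators, one of its powers times an element of
  \<open>R\<close>, so it can be adjoined.\<close>

lemma R_inverse: "z \<in> R \<Longrightarrow> v1 z \<noteq> Inf \<Longrightarrow> \<exists>y\<in>R. eq2 (z * y) 1"
proof -
  assume z: "z \<in> R" "v1 z \<noteq> Inf"
  then have z2: "v2 z \<noteq> Inf" using rD_Inf RD by blast
  obtain y where y: "V1.eqv y (V1.iv z)" "V2.eqv y (V2.iv z)" using combine by blast
  have zy: "eq2 (z * y) 1"
    using V1.eqv_trans[OF V1.eqv_mult[OF V1.eqv_refl y(1)] V1.eqv_iv[OF z(2)]]
      V2.eqv_trans[OF V2.eqv_mult[OF V2.eqv_refl y(2)] V2.eqv_iv[OF z2]]
    by (simp add: eq2_def)
  have yC: "y \<in> C" using C_inverse[OF RC[OF z(1)] z(2)] zy by (simp add: eq2_def)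
  have "y \<in> R"
  proof (rule adjoin)
    fix p assume p: "p \<in> coeffs_in R"
    let ?n = "degree p"
    define s where "s = (\<Sum>i\<le>?n. coeff p i * z ^ (?n - i))"
    have "s \<in> R" unfolding s_def
      using R_subring p z by (intro subring_sum subring_mult subring_power coeffs_inD) auto
    then have "y ^ ?n * s \<in> C" by (intro C_mult C_power yC RC)
    moreover have "eq2 (y ^ ?n * s) (poly p y)"
      unfolding s_def poly_altdef sum_distrib_left
    proof (rule eq2_sum)
      fix i assume "i \<in> {..?n}"
      then have "y ^ ?n = y ^ i * y ^ (?n - i)" by (simp flip: power_add)
      then have "y ^ ?n * (coeff p i * z ^ (?n - i)) = coeff p i * y ^ i * (z * y) ^ (?n - i)"
        by (simp add: power_mult_distrib ac_simps)
      moreover have "eq2 (coeff p i * y ^ i * (z * y) ^ (?n - i)) (coeff p i * y ^ i * 1 ^ (?n - i))"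
        using zy by (intro eq2_mult eq2_power) auto
      ultimately show "eq2 (y ^ ?n * (coeff p i * z ^ (?n - i))) (coeff p i * y ^ i)" by simp
    qed
    ultimately show "poly p y \<in> C" by (rule C_eq2)
  qed
  with zy show ?thesis by blast
qed

text \<open>Divide by a coefficient of least value.\<close>

lemma normalize:
  assumes p: "p \<in> coeffs_in R" "\<not> null p"
  shows "\<exists>b\<in>R. \<exists>q\<in>coeffs_in R. v1 b \<noteq> Inf \<and> degree q \<le> degree p \<and> (\<forall>i. 0 \<le> v1 (coeff q i)) \<and>
    (\<exists>i. v1 (coeff q i) = 0) \<and> (\<forall>i. eq2 (b * coeff q i) (coeff p i))"
proof -
  let ?V = "(\<lambda>i. v1 (coeff p i)) ` {..degree p}"
  have "Min ?V \<in> ?V" by (intro Min_in) auto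
  then obtain k where k: "Min ?V = v1 (coeff p k)" by (rule imageE)
  have min: "v1 (coeff p k) \<le> v1 (coeff p i)" for i
  proof (cases "i \<le> degree p")
    case True
    then show ?thesis unfolding k[symmetric] by (intro Min_le) auto
  qed (simp add: coeff_eq_0)
  define b where "b = coeff p k"
  have b: "b \<in> R" "v1 b \<noteq> Inf"
    using p min coeffs_inD by (auto simp: null_def b_def)
  obtain y where y: "y \<in> R" "eq2 (b * y) 1" using R_inverse b by blast
  have vy: "v1 b + v1 y = 0" using y by (intro V1.val_inv_add) (simp add: eq2_def)
  then have "v1 y + v1 b \<le> v1 y + v1 (coeff p i)" for i
    using min[of i] by (auto simp: b_def intro: add_left_mono)
  then have "\<forall>i. 0 \<le> v1 (coeff (smult y p) i)" using vy by (simp add: V1.val_mult add.commute)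
  moreover have "v1 (coeff (smult y p) k) = 0"
    using vy by (simp add: V1.val_mult b_def[symmetric] add.commute)
  moreover have "eq2 (b * coeff (smult y p) i) (coeff p i)" for i
    using eq2_mult[OF y(2) eq2_refl[of "coeff p i"]] by (simp add: ac_simps)
  moreover have "smult y p \<in> coeffs_in R" using R_subring y p by (intro coeffs_in_smult)
  ultimately show ?thesis using b degree_smult_le[of y p] by blast
qed

lemma unit_coeffs_rA:
  "q \<in> coeffs_in R \<Longrightarrow> (\<And>i. 0 \<le> v1 (coeff q i)) \<Longrightarrow> rA x \<Longrightarrow> rA (poly q x)"
  using coeff_C C_rA by (intro rA_poly) blast

text \<open>Up to a factor from \<open>R\<close> every polynomial that is not null has a nonzero
  reduction. Its value at \<open>x\<close> is a unit with matched residue and hence in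
  \<open>C\<close>. \<open>P\<close> is trivial for a transcendental residue and bounds the degree
  for an algebraic one.\<close>

lemma adjoin_residue:
  assumes x: "rA x"
    and red: "\<And>p. p \<in> coeffs_in R \<Longrightarrow> \<exists>r\<in>coeffs_in R. P (degree r) \<and> eq2 (poly r x) (poly p x)"
    and P: "\<And>m n. P n \<Longrightarrow> m \<le> n \<Longrightarrow> P m"
    and unit: "\<And>q. \<lbrakk>q \<in> coeffs_in R; \<And>i. 0 \<le> v1 (coeff q i); \<exists>i. v1 (coeff q i) = 0; P (degree q)\<rbrakk>
      \<Longrightarrow> v1 (poly q x) = 0"
  shows "x \<in> R"
proof (rule adjoin_mod[where P = "\<lambda>r. P (degree r)"])
  fix r assume r: "r \<in> coeffs_in R" "P (degree r)"
  show "poly r x \<in> C"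
  proof (cases "null r")
    case False
    then obtain b q where b: "b \<in> R" and q: "q \<in> coeffs_in R" "degree q \<le> degree r"
        "\<And>i. 0 \<le> v1 (coeff q i)" "\<exists>i. v1 (coeff q i) = 0"
      and e: "\<And>i. eq2 (b * coeff q i) (coeff r i)"
      using normalize[OF r(1)] by blast
    have "v1 (poly q x) = 0" using unit[OF q(1,3,4)] P r q by blast
    then have "b * poly q x \<in> C"
      using unit_coeffs_rA[OF q(1,3) x] b by (intro C_mult C_unitI RC)
    moreover have "eq2 (b * poly q x) (poly r x)"
      using eq2_poly_coeffs[of "smult b q" r x] e by simp
    ultimately show ?thesis by (rule C_eq2)
  qed (use r null_poly in blast)
qed (use red in blast)

text \<open>If the residue of \<open>c\<close> is transcendental over the residues of
  \<open>R\<close>, any lift to a matched pair can be adjoined. If it is algebraic, its minimal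
  polynomial lifts to a monic \<open>m\<close>, and separability in residue characteristic 0 yields
  roots of \<open>m\<close> in both fields with the prescribed residues.\<close>

lemma residue_step:
  assumes c: "c \<in> E" "0 \<le> v1 c"
  shows "\<exists>z\<in>R. 0 < v1 (z - c)"
proof -
  define U where "U = {p\<in>coeffs_in R. (\<forall>i. 0 \<le> v1 (coeff p i)) \<and> (\<exists>i. v1 (coeff p i) = 0)}"
  obtain a where a: "a \<in> A" "0 < v1 (c - a)" using A_ex c by blast
  \<comment> \<open>\<open>t\<close> is \<open>c\<close> in the first field and has the residue
    prescribed for it in the second.\<close>
  obtain t where t: "V1.eqv t c" "V2.eqv t a" using combine by blast
  have tE: "t \<in> E" using t c E_eqv V1.eqv_sym by blast
  have "0 < v1 (t - a)" "0 < v2 (t - a)"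
    using V1.eqv_val[OF V1.eqv_diff[OF t(1) V1.eqv_refl[of a]]] a t by (auto simp: V2.eqv_def)
  then have rt: "rA t" using tE a by (auto simp: rA_def)
  have pt: "v1 (poly p t) = v1 (poly p c)" for p by (rule V1.eqv_val[OF V1.eqv_poly[OF t(1)]])
  have vt: "0 \<le> v1 t" using rA_int[OF rt] by simp
  show ?thesis
  proof (cases "\<forall>q\<in>U. v1 (poly q c) = 0")
    case True
    have "t \<in> R"
    proof (rule adjoin_residue[OF rt, of "\<lambda>_. True"])
      show "\<exists>r\<in>coeffs_in R. True \<and> eq2 (poly r t) (poly p t)" if "p \<in> coeffs_in R" for p
        using that eq2_refl by blast
    qed (use True pt in \<open>auto simp: U_def\<close>)
    then show ?thesis using t by (intro bexI[of _ t]) (auto simp: V1.eqv_def)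
  next
    case False
    define Q where "Q n \<longleftrightarrow> (\<exists>q\<in>U. degree q = n \<and> v1 (poly q c) \<noteq> 0)" for n
    define n where "n = (LEAST n. Q n)"
    have "Q n" unfolding n_def by (rule LeastI_ex) (use False in \<open>auto simp: Q_def\<close>)
    then obtain q where q: "q \<in> U" "degree q = n" "v1 (poly q c) \<noteq> 0" by (auto simp: Q_def)
    have least: "v1 (poly q' c) = 0" if "q' \<in> U" "degree q' < n" for q'
      using not_less_Least[of "degree q'" Q] that unfolding Q_def n_def by blast
    have qR: "q \<in> coeffs_in R" "\<And>i. 0 \<le> v1 (coeff q i)" and unit: "\<exists>i. v1 (coeff q i) = 0"
      using q by (auto simp: U_def)
    have qc: "0 < v1 (poly q c)" using V1.val_poly_ge_0[of q c] qR q c by (simp add: less_le)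
    \<comment> \<open>If the leading coefficient of \<open>q\<close> were in the maximal ideal,
      \<open>q0\<close> would have the same reduction, still vanish at the residue of
      \<open>c\<close>, and have smaller degree.\<close>
    define q0 where "q0 = q - monom (lead_coeff q) n"
    have cq0: "coeff q0 i = (if i = n then 0 else coeff q i)" for i
      using q(2) by (auto simp: q0_def)
    have q0R: "q0 \<in> coeffs_in R" using qR R_subring subring_0 by (simp add: coeffs_in_def cq0)
    have dq0: "degree q0 < n \<or> n = 0"
    proof (cases "n = 0")
      case False
      have "degree q0 \<le> n - 1"
      proof (rule degree_le, intro allI impI)
        fix i assume "n - 1 < i"
        then show "coeff q0 i = 0" using q(2) False by (auto simp: cq0 intro!: coeff_eq_0)
      qed
      then show ?thesis using False by simp
    qed simp
    have lead: "v1 (lead_coeff q) = 0"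
    proof (rule ccontr)
      assume "v1 (lead_coeff q) \<noteq> 0"
      then have pos: "0 < v1 (lead_coeff q)" using qR by (simp add: less_le)
      obtain i where i: "v1 (coeff q i) = 0" using unit by blast
      then have "i \<noteq> n" using pos q(2) by auto
      moreover have "i \<le> n" using i q(2) coeff_eq_0[of q i] by (metis V1.val_0 not_le zero_neq_Inf(2))
      ultimately have "q0 \<in> U" "degree q0 < n"
        using q0R qR i dq0 by (auto simp: U_def cq0)
      then have z: "v1 (poly q0 c) = 0" by (rule least)
      have "poly q0 c = poly q c - lead_coeff q * c ^ n" by (simp add: q0_def poly_monom)
      moreover have "0 < v1 (lead_coeff q * c ^ n)"
        using pos c V1.val_power_ge_0[of c n] by (simp add: V1.val_mult add_pos_nonneg)
      ultimately show False using V1.less_val_diff[OF qc] z by (metis less_irrefl)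
    qed
    obtain y where y: "y \<in> R" "eq2 (lead_coeff q * y) 1"
      using R_inverse[of "lead_coeff q"] lead qR coeffs_inD by (metis zero_neq_Inf(1))
    have vy: "v1 y = 0" using V1.val_inv_add[of "lead_coeff q" y] y lead by (simp add: eq2_def)
    \<comment> \<open>The leading coefficient has to be exactly 1, not just modulo the supports, for
      division with remainder.\<close>
    define m where "m = smult y q0 + monom 1 n"
    have cm: "coeff m i = (if i = n then 1 else y * coeff q i)" for i
      by (simp add: m_def cq0)
    have mR: "m \<in> coeffs_in R"
      unfolding m_def using R_subring y q0R
      by (intro coeffs_in_add coeffs_in_smult coeffs_in_monom subring_1)
    have m0: "0 \<le> v1 (coeff m i)" for i using qR vy by (simp add: cm V1.val_mult)
    have dm: "degree m = n"
    proof (rule antisym)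
      show "degree m \<le> n" using q(2) by (intro degree_le) (auto simp: cm coeff_eq_0)
      show "n \<le> degree m" by (rule le_degree) (simp add: cm)
    qed
    have lm: "lead_coeff m = 1" by (simp add: dm cm)
    have emq: "eq2 (coeff m i) (coeff (smult y q) i)" for i
      using y(2) q(2) by (auto simp: cm mult.commute intro: eq2_sym)
    have mc: "0 < v1 (poly m c)"
      using V1.eqv_val[OF eq2_D(1)[OF eq2_poly_coeffs[OF emq]], of c] qc vy by (simp add: V1.val_mult)
    have n: "n > 0"
    proof (rule ccontr)
      assume "\<not> n > 0"
      then have "m = 1" using dm lm by (metis degree_0_id gr0I lead_coeff_pCons(2) monom_0 one_pCons poly_eqI coeff_pCons_0 degree_eq_zeroE)
      then show False using mc by simp
    qed
    define h where "h = hasse 1 m"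
    have hR: "h \<in> coeffs_in R" unfolding h_def using R_subring mR by (rule coeffs_in_hasse)
    have h0: "0 \<le> v1 (coeff h i)" for i
      using m0 V1.val_of_nat_ge_0[of "i + 1"] unfolding h_def coeff_hasse
      by (simp add: V1.val_mult add_nonneg_nonneg)
    \<comment> \<open>The leading coefficient of the derivative is \<open>n\<close>, a unit; so its
      reduction is nonzero, and by minimality of \<open>n\<close> it does not vanish at the residue
      of \<open>c\<close>.\<close>
    have "v1 (coeff h (n - 1)) = 0"
      using n V1.residue_char_0[OF n] by (simp add: h_def coeff_hasse cm)
    then have "h \<in> U" using hR h0 by (auto simp: U_def)
    moreover have "degree h < n" using degree_hasse_le[of 1 m] n unfolding h_def dm by linarith
    ultimately have hc: "v1 (poly h c) = 0" by (rule least)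
    have "\<exists>y\<in>E. v1 (poly m y) = Inf \<and> v1 1 < v1 (y - t)"
    proof (rule V1.newton_root[OF E_subring E_inv E_hensel coeffs_in_R_E[OF mR] tE])
      show "1 \<in> E" using E_subring subring_1 by blast
      show "v1 (poly (hasse 1 m) t * 1) \<noteq> Inf" using hc pt[of h] unfolding h_def by simp
      show "v1 (poly (hasse 1 m) t * 1) < v1 (poly m t)" using hc pt mc unfolding h_def by simp
      fix j
      have "0 \<le> v1 (poly (hasse j m) t)"
        using m0 V1.val_of_nat_ge_0 vt
        by (intro V1.val_poly_ge_0) (auto simp: coeff_hasse V1.val_mult intro!: add_nonneg_nonneg)
      then show "v1 (poly (hasse 1 m) t * 1) \<le> v1 (poly (hasse j m) t * 1 ^ j)"
        using hc pt[of h] unfolding h_def by simp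
    qed
    then obtain y1 where y1: "y1 \<in> E" "v1 (poly m y1) = Inf" "0 < v1 (y1 - t)" by auto
    have rm: "rA (coeff m i)" for i using C_rA[OF coeff_C[OF mR] m0] .
    have rh: "rA (coeff h i)" for i using C_rA[OF coeff_C[OF hR] h0] .
    have t2: "0 < v2 (poly m t)" "v2 (poly h t) = 0"
      using rA_pos_iff[OF rA_poly[OF rm rt]] mc pt rA_val_0_iff[OF rA_poly[OF rh rt]] hc by simp_all
    \<comment> \<open>The domain \<open>E\<close> is prescribed in the first field only, so here the
      root may lie anywhere.\<close>
    have "\<exists>y\<in>UNIV. v2 (poly m y) = Inf \<and> v2 1 < v2 (y - t)"
    proof (rule V2.newton_root[OF _ _ V2.hensel])
      show "subring_of (UNIV :: 'a set)" by (simp add: subring_of_def)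
      show "V2.inv_closed UNIV" using V2.eqv_iv by (auto simp: V2.inv_closed_def)
      show "m \<in> coeffs_in UNIV" by (simp add: coeffs_in_def)
      show "v2 (poly (hasse 1 m) t * 1) \<noteq> Inf" using t2 unfolding h_def by simp
      show "v2 (poly (hasse 1 m) t * 1) < v2 (poly m t)" using t2 unfolding h_def by simp
      fix j
      have "0 \<le> v2 (poly (hasse j m) t)"
        using rA_int[OF rm] V2.val_of_nat_ge_0 rA_int[OF rt]
        by (intro V2.val_poly_ge_0) (auto simp: coeff_hasse V2.val_mult intro!: add_nonneg_nonneg)
      then show "v2 (poly (hasse 1 m) t * 1) \<le> v2 (poly (hasse j m) t * 1 ^ j)"
        using t2 unfolding h_def by simp
    qed auto
    then obtain y2 where y2: "v2 (poly m y2) = Inf" "0 < v2 (y2 - t)" by auto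
    obtain x where x: "V1.eqv x y1" "V2.eqv x y2" using combine by blast
    have xE: "x \<in> E" using x y1 E_eqv V1.eqv_sym by blast
    have xt: "0 < v1 (t - x)" "0 < v2 (t - x)"
      using V1.eqv_val[OF V1.eqv_diff[OF x(1) V1.eqv_refl[of t]]]
        V2.eqv_val[OF V2.eqv_diff[OF x(2) V2.eqv_refl[of t]]] y1 y2
      by (simp_all add: V1.val_diff_commute V2.val_diff_commute)
    have rx: "rA x" using rA_res[OF rt xE xt] .
    have mx: "v1 (poly m x) = Inf" "v2 (poly m x) = Inf"
      using V1.eqv_val[OF V1.eqv_poly[OF x(1)]] V2.eqv_val[OF V2.eqv_poly[OF x(2)]] y1 y2 by simp_all
    have "x \<in> R"
    proof (rule adjoin_residue[OF rx, of "\<lambda>k. k < n"])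
      fix p assume p: "p \<in> coeffs_in R"
      show "\<exists>r\<in>coeffs_in R. degree r < n \<and> eq2 (poly r x) (poly p x)"
        using reduce_mod_monic[OF mR lm mx p] n unfolding dm by blast
    next
      fix q' assume q': "q' \<in> coeffs_in R" "\<And>i. 0 \<le> v1 (coeff q' i)" "\<exists>i. v1 (coeff q' i) = 0"
          "degree q' < n"
      then have "v1 (poly q' t) = 0" using least pt by (auto simp: U_def)
      moreover have "0 < v1 (poly q' t - poly q' x)" using V1.res_poly[of q' t x] q' vt xt by blast
      ultimately show "v1 (poly q' x) = 0" by (rule V1.val_eq_0_of_res)
    qed auto
    moreover have "0 < v1 (x - c)"
      using V1.eqv_val[OF V1.eqv_diff[OF V1.eqv_refl[of x] t(1)]] xt V1.val_diff_commute[of t x] by simp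
    ultimately show ?thesis by blast
  qed
qed

text \<open>If no positive power of \<open>x\<close> up to the degree has a value from
  \<open>R\<close>, the finite values of the terms of a polynomial are distinct. The least term
  dominates in both fields, since comparisons of values are matched.\<close>

lemma adjoin_value:
  assumes x: "x \<in> C" "v1 x \<noteq> Inf"
    and red: "\<And>p. p \<in> coeffs_in R \<Longrightarrow> \<exists>r\<in>coeffs_in R. P (degree r) \<and> eq2 (poly r x) (poly p x)"
    and new: "\<And>j k u. \<lbrakk>P k; 0 < j; j \<le> k; u \<in> R\<rbrakk> \<Longrightarrow> v1 (x ^ j) \<noteq> v1 u"
  shows "x \<in> R"
proof (rule adjoin_mod[where P = "\<lambda>r. P (degree r)"])
  fix r assume r: "r \<in> coeffs_in R" "P (degree r)"
  let ?t = "\<lambda>i. coeff r i * x ^ i"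
  have tC: "?t i \<in> C" for i using coeff_C[OF r(1)] x by (intro C_mult C_power)
  have distinct: "v1 (?t i) \<noteq> v1 (?t j)" if ij: "i < j" "j \<le> degree r" "v1 (?t i) \<noteq> Inf" for i j
  proof
    assume eq: "v1 (?t i) = v1 (?t j)"
    define d where "d = j - i"
    have "?t j = x ^ i * (coeff r j * x ^ d)" using ij by (simp add: d_def ac_simps flip: power_add)
    then have "v1 (x ^ i) + v1 (coeff r i) = v1 (x ^ i) + v1 (coeff r j * x ^ d)"
      using eq by (simp add: V1.val_mult add.commute)
    then have c: "v1 (coeff r i) = v1 (coeff r j) + v1 (x ^ d)"
      using x by (simp add: fin_add_eq_cancel V1.val_power_eq_Inf_iff V1.val_mult)
    have cj: "coeff r j \<in> R" "v1 (coeff r j) \<noteq> Inf" "coeff r i \<in> R"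
      using c ij r coeffs_inD by (auto simp: V1.val_mult)
    obtain y where y: "y \<in> R" "eq2 (coeff r j * y) 1" using R_inverse cj by blast
    have "v1 (coeff r j) + v1 y = 0" using y by (intro V1.val_inv_add) (simp add: eq2_def)
    moreover have "v1 (coeff r i * y) = (v1 (coeff r j) + v1 y) + v1 (x ^ d)"
      unfolding V1.val_mult c by (simp add: ac_simps)
    ultimately have "v1 (x ^ d) = v1 (coeff r i * y)" by simp
    moreover have "coeff r i * y \<in> R" using R_subring cj y by (intro subring_mult)
    moreover have "d \<le> degree r" "d > 0" using ij by (simp_all add: d_def)
    ultimately show False using new[of "degree r" d "coeff r i * y"] r by blast
  qed
  show "poly r x \<in> C"
  proof (cases "null r")
    case False
    let ?V = "(\<lambda>i. v1 (?t i)) ` {..degree r}"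
    have "Min ?V \<in> ?V" by (intro Min_in) auto
    then obtain k where k: "Min ?V = v1 (?t k)" "k \<in> {..degree r}" by (rule imageE)
    have min: "v1 (?t k) \<le> v1 (?t i)" if "i \<le> degree r" for i
      unfolding k(1)[symmetric] using that by (intro Min_le) auto
    obtain i where i: "v1 (coeff r i) \<noteq> Inf" using False by (auto simp: null_def)
    then have "i \<le> degree r" using coeff_eq_0[of r i] by (cases "i \<le> degree r") auto
    moreover have "v1 (?t i) \<noteq> Inf" using i x by (simp add: V1.val_mult V1.val_power_eq_Inf_iff)
    ultimately have kf: "v1 (?t k) \<noteq> Inf" using min by (metis Inf_le_iff)
    have less: "v1 (?t k) < v1 (?t i)" if "i \<in> {..degree r} - {k}" for i
    proof -
      have "v1 (?t k) \<noteq> v1 (?t i)"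
        using distinct[of k i] distinct[of i k] that k(2) kf by (cases "k < i") auto
      then show ?thesis using min[of i] that by (simp add: less_le)
    qed
    have "poly r x - ?t k = (\<Sum>i\<in>{..degree r} - {k}. ?t i)"
      unfolding poly_altdef using k(2) by (simp add: sum.remove)
    moreover have "v1 (?t k) < v1 (\<Sum>i\<in>{..degree r} - {k}. ?t i)"
      using less kf by (intro V1.less_val_sum) auto
    moreover have "v2 (?t k) < v2 (\<Sum>i\<in>{..degree r} - {k}. ?t i)"
      using less kf rD_less[OF CD[OF tC] CD[OF tC]] rD_Inf[OF CD[OF tC]]
      by (intro V2.less_val_sum) auto
    moreover have "poly r x \<in> E"
      using coeffs_in_R_E[OF r(1)] CE[OF x(1)] by (rule poly_in_subring[OF E_subring])
    ultimately show ?thesis using C_close[OF tC kf] by metis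
  qed (use r null_poly in blast)
qed (use red in blast)

text \<open>If no positive multiple of the value of \<open>z\<close> is a value of \<open>R\<close>,
  a pair with the matched values and angular component 1 can be adjoined. Otherwise take the least
  multiple \<open>n\<close> and \<open>e'\<close> in \<open>R\<close> with that value and angular
  component 1: roots of \<open>X^n - e'\<close> in both fields form the pair to be adjoined.\<close>

lemma value_step:
  assumes z: "z \<in> E" "v1 z \<noteq> Inf"
  shows "\<exists>u\<in>R. v1 u = v1 z"
proof (rule ccontr)
  assume no: "\<not> (\<exists>u\<in>R. v1 u = v1 z)"
  have U: "subring_of (UNIV :: 'a set)" "V2.inv_closed UNIV"
    using V2.eqv_iv by (auto simp: subring_of_def V2.inv_closed_def)
  obtain x1 where x1: "x1 \<in> E" "v1 x1 = v1 z" "0 < v1 (ac x1 - 1)"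
    using V1.make_ac_1[OF E_subring E_inv z(1) E_ac[OF z] z(2)] by blast
  obtain d where d: "d \<in> D" "v1 d = v1 z" using D_ex z by blast
  have d2: "v2 d \<noteq> Inf" using d z D_Inf by metis
  obtain x2 where x2: "v2 x2 = v2 d" "0 < v2 (ac x2 - 1)"
    using V2.make_ac_1[OF U _ _ d2] by blast
  \<comment> \<open>Angular component 1 in both fields is matched by \<open>rA_1\<close>.\<close>
  have pair: "x \<in> C \<and> v1 x = v1 z \<and> v2 x = v2 d"
    if "V1.eqv x y1" "V2.eqv x y2" "y1 \<in> E" "v1 y1 = v1 z" "0 < v1 (ac y1 - 1)"
      "v2 y2 = v2 d" "0 < v2 (ac y2 - 1)" for x y1 y2
  proof (intro conjI CI)
    show v: "v1 x = v1 z" "v2 x = v2 d" using that V1.eqv_val V2.eqv_val by metis+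
    have xE: "x \<in> E" using that E_eqv V1.eqv_sym by blast
    then show "rD x" using v d unfolding rD_def by metis
    have "0 < v1 (ac x - ac y1)" "0 < v2 (ac x - ac y2)"
      using that V1.ac_eqv[of y1 x] V2.ac_eqv[of y2 x] V1.eqv_sym V2.eqv_sym z d2 by auto
    then have "0 < v1 (ac x - 1)" "0 < v2 (ac x - 1)"
      using that V1.less_val_trans V2.less_val_trans by blast+
    then show "rA (ac x)" using rA_res[OF rA_1, of "ac x"] E_ac[OF xE] v z
      by (simp add: V1.val_diff_commute V2.val_diff_commute)
  qed
  obtain x where x: "V1.eqv x x1" "V2.eqv x x2" using combine by blast
  have xC: "x \<in> C" "v1 x = v1 z" "v2 x = v2 d" using pair x x1 x2 by blast+
  show False
  proof (cases "\<exists>m>0. \<exists>u\<in>R. v1 (x1 ^ m) = v1 u")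
    case False
    have new: "v1 (x ^ j) \<noteq> v1 u" if "0 < j" "u \<in> R" for j u
      using False that V1.val_power_cong[of x x1 j] xC x1 by (metis gr0I)
    have "x \<in> R"
    proof (rule adjoin_value[of x "\<lambda>_. True"])
      show "\<exists>r\<in>coeffs_in R. True \<and> eq2 (poly r x) (poly p x)" if "p \<in> coeffs_in R" for p
        using that eq2_refl by blast
    qed (use xC z new in auto)
    then show False using no xC by blast
  next
    case True
    define Q where "Q m \<longleftrightarrow> m > 0 \<and> (\<exists>u\<in>R. v1 (x1 ^ m) = v1 u)" for m
    define n where "n = (LEAST m. Q m)"
    have "Q n" unfolding n_def by (rule LeastI_ex) (use True in \<open>auto simp: Q_def\<close>)
    then obtain e where e: "e \<in> R" "v1 (x1 ^ n) = v1 e" and n: "n > 0" by (auto simp: Q_def)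
    have least: "v1 (x1 ^ j) \<noteq> v1 u" if "0 < j" "j < n" "u \<in> R" for j u
      using not_less_Least[of j Q] that by (auto simp: Q_def n_def)
    have ef: "v1 e \<noteq> Inf" using e(2) x1 z by (metis V1.val_power_eq_Inf_iff)
    have ace: "ac e \<in> E" "v1 (ac e) = 0" using E_ac[OF RE[OF e(1)] ef] V1.val_ac[OF ef] by auto
    \<comment> \<open>The angular component of \<open>e\<close> need not lie in \<open>R\<close>,
      but its residue is attained there, which is enough to divide it out.\<close>
    obtain u where u: "u \<in> R" "0 < v1 (u - ac e)" using residue_step[OF ace(1)] ace by auto
    have vu: "v1 u = 0" using V1.val_eq_0_of_res[OF ace(2)] u by (simp add: V1.val_diff_commute)
    obtain y where y: "y \<in> R" "eq2 (u * y) 1" using R_inverse u vu by (metis zero_neq_Inf(1))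
    have vy: "v1 y = 0" using V1.val_inv_add[of u y] y vu by (simp add: eq2_def)
    define e' where "e' = e * y"
    have e'R: "e' \<in> R" unfolding e'_def using R_subring e y by (intro subring_mult)
    have ve': "v1 e' = v1 e" using vy by (simp add: e'_def V1.val_mult)
    have ace': "0 < v1 (ac e' - 1)"
    proof -
      have "0 < v1 (ac e' - ac e * ac y)" unfolding e'_def using ef vy by (intro V1.ac_mult) auto
      moreover have "0 < v1 (ac e * ac y - u * y)"
        using V1.res_mult[of "ac e" y u "ac y"] ace vy u V1.ac_unit[OF vy]
        by (simp add: V1.val_diff_commute)
      moreover have "0 < v1 (u * y - 1)" using y by (simp add: eq2_def V1.eqv_def)
      ultimately show ?thesis using V1.less_val_trans by blast
    qed
    have "rA (ac e')" using CA RC e'R ve' ef by simp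
    \<comment> \<open>The residue of \<open>ac e' - 1\<close> is matched, so it vanishes in the
      second field as well.\<close>
    then have ace'2: "0 < v2 (ac e' - 1)" using rA_pos_iff[of "ac e' - 1"] rA_diff rA_1 ace' by simp
    have xe: "v1 (x ^ n) = v1 e'" using V1.val_power_cong[of x x1 n] xC x1 e ve' by simp
    then have "v2 (x ^ n) = v2 e'" using rD_eq[OF CD[OF C_power[OF xC(1)]] RD[OF e'R]] by simp
    then have xe2: "v2 (x2 ^ n) = v2 e'" using V2.val_power_cong[of x x2 n] xC x2 by simp
    have xe1: "v1 (x1 ^ n) = v1 e'" using e ve' by simp
    have f1: "v1 x1 \<noteq> Inf" and f2: "v2 x2 \<noteq> Inf" using x1 x2 z d2 by auto
    obtain y1 where y1: "y1 \<in> E" "V1.eqv (y1 ^ n) e'" "v1 y1 = v1 x1" "0 < v1 (ac y1 - 1)"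
      using V1.adjust_nth_root[OF E_subring E_inv E_hensel x1(1) RE[OF e'R] n f1 x1(3) xe1 ace'] by blast
    obtain y2 where y2: "V2.eqv (y2 ^ n) e'" "v2 y2 = v2 x2" "0 < v2 (ac y2 - 1)"
      using V2.adjust_nth_root[OF U V2.hensel _ _ n f2 x2(2) xe2 ace'2] by blast
    obtain w where w: "V1.eqv w y1" "V2.eqv w y2" using combine by blast
    have wC: "w \<in> C" "v1 w = v1 z" "v2 w = v2 d" using pair[OF w] y1 y2 x1 x2 by auto
    define m where "m = monom 1 n + [:- e':]"
    have mR: "m \<in> coeffs_in R" unfolding m_def using R_subring e'R
      by (intro coeffs_in_add coeffs_in_monom coeffs_in_const subring_1 subring_uminus)
    have dm: "degree m = n"
      unfolding m_def using n by (subst degree_add_eq_left) (auto simp: degree_monom_eq)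
    have lm: "lead_coeff m = 1" unfolding dm using n by (simp add: m_def coeff_pCons split: nat.split)
    have mw: "v1 (poly m w) = Inf" "v2 (poly m w) = Inf"
      using V1.eqv_trans[OF V1.eqv_power[OF w(1)] y1(2)] V2.eqv_trans[OF V2.eqv_power[OF w(2)] y2(1)]
      by (auto simp: m_def poly_monom V1.eqv_def V2.eqv_def)
    have "w \<in> R"
    proof (rule adjoin_value[of w "\<lambda>k. k < n"])
      show "w \<in> C" "v1 w \<noteq> Inf" using wC z by auto
      show "\<exists>r\<in>coeffs_in R. degree r < n \<and> eq2 (poly r w) (poly p w)" if "p \<in> coeffs_in R" for p
        using reduce_mod_monic[OF mR lm mw that] n unfolding dm by blast
      show "v1 (w ^ j) \<noteq> v1 u" if "k < n" "0 < j" "j \<le> k" "u \<in> R" for j k u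
        using least[of j u] that V1.val_power_cong[of w x1 j] wC x1 by auto
    qed
    then show False using no wC by blast
  qed
qed

end

text \<open>By maximality \<open>R\<close> covers all residues and values of \<open>E\<close>, but not \<open>x\<close>. Then \<open>x\<close> is a
  pseudo-limit of \<open>R\<close>, and saturation gives a partner in the second field. If every polynomial is
  eventually dominated by its constant Taylor term near \<open>x\<close>, the pair can be adjoined; otherwise a
  polynomial of least degree without this property has a root near \<open>x\<close>, which can be adjoined.\<close>

locale immediate = corr_max +
  fixes x :: 'a
  assumes x_E: "x \<in> E" and x_new: "z \<in> R \<Longrightarrow> v1 (x - z) \<noteq> Inf"
begin

section \<open>Pseudo-limits of the maximal subring\<close>

lemma value_of_diff: "e \<in> R \<Longrightarrow> \<exists>g\<in>R. v1 g = v1 (x - e)"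
  using value_step[of "x - e"] x_E RE x_new subring_diff[OF E_subring] by blast

text \<open>\<open>R\<close> attains all values and residues of \<open>E\<close>. With
  \<open>g\<close> of the same value as \<open>x - e\<close> and \<open>u\<close> of the same
  residue as the quotient of \<open>x - e\<close> by \<open>g\<close>, the element
  \<open>e + g * u\<close> is closer to \<open>x\<close>.\<close>

lemma no_max: "e \<in> R \<Longrightarrow> \<exists>f\<in>R. v1 (x - e) < v1 (x - f)"
proof -
  assume e: "e \<in> R"
  then obtain g where g: "g \<in> R" "v1 g = v1 (x - e)" using value_of_diff by blast
  have gf: "v1 g \<noteq> Inf" using g x_new e by simp
  obtain y where y: "y \<in> R" "eq2 (g * y) 1" using R_inverse g gf by blast
  have gy: "v1 g + v1 y = 0" using y by (intro V1.val_inv_add) (simp add: eq2_def)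
  have c: "(x - e) * y \<in> E" "v1 ((x - e) * y) = 0"
    using x_E e y g gy RE subring_diff[OF E_subring] subring_mult[OF E_subring]
    by (simp_all add: V1.val_mult)
  obtain u where u: "u \<in> R" "0 < v1 (u - (x - e) * y)" using residue_step[OF c(1)] c(2) by auto
  have "v1 g < v1 (g * (u - (x - e) * y))"
    using u(2) fin_add_less_cancel[OF gf, of 0] by (simp add: V1.val_mult)
  moreover have "V1.eqv (g * (u - (x - e) * y)) (g * u - (x - e))"
  proof -
    have "V1.eqv (g * u - (x - e) * (g * y)) (g * u - (x - e) * 1)"
      using y by (intro V1.eqv_diff V1.eqv_mult) (auto simp: eq2_def)
    then show ?thesis by (simp add: algebra_simps)
  qed
  ultimately have "v1 (x - e) < v1 (g * u - (x - e))" using V1.eqv_val g by metis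
  then have "v1 (x - e) < v1 (x - (e + g * u))"
    using V1.val_minus[of "g * u - (x - e)"] by (simp add: algebra_simps)
  moreover have "e + g * u \<in> R" using R_subring e g u by (intro subring_add subring_mult)
  ultimately show ?thesis by blast
qed

text \<open>The elements of \<open>R\<close>, ordered by closeness to \<open>x\<close>, serve
  themselves as the pseudo-Cauchy family; \<open>near Q\<close> says that \<open>Q\<close> holds
  eventually along it.\<close>

definition near :: "('a \<Rightarrow> bool) \<Rightarrow> bool" where
  "near Q \<longleftrightarrow> (\<exists>e0\<in>R. \<forall>e\<in>R. v1 (x - e0) \<le> v1 (x - e) \<longrightarrow> Q e)"

lemma near_conj: "near P \<Longrightarrow> near Q \<Longrightarrow> near (\<lambda>e. P e \<and> Q e)"
proof -
  assume "near P" "near Q"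
  then obtain d f where d: "d \<in> R" "\<forall>e\<in>R. v1 (x - d) \<le> v1 (x - e) \<longrightarrow> P e"
    and f: "f \<in> R" "\<forall>e\<in>R. v1 (x - f) \<le> v1 (x - e) \<longrightarrow> Q e" by (auto simp: near_def)
  show ?thesis
  proof (cases "v1 (x - d) \<le> v1 (x - f)")
    case True
    then show ?thesis unfolding near_def using d f by (intro bexI[of _ f]) auto
  next
    case False
    then show ?thesis unfolding near_def using d f by (intro bexI[of _ d]) auto
  qed
qed

lemma near_mono: "near P \<Longrightarrow> (\<And>e. e \<in> R \<Longrightarrow> P e \<Longrightarrow> Q e) \<Longrightarrow> near Q"
  unfolding near_def by blast

lemma near_always: "(\<And>e. e \<in> R \<Longrightarrow> Q e) \<Longrightarrow> near Q"
  unfolding near_def using subring_1[OF R_subring] by blast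

lemma near_ex: "near P \<Longrightarrow> \<exists>e\<in>R. P e"
  unfolding near_def by blast

lemma near_finite: "(\<And>j. j < n \<Longrightarrow> near (P j)) \<Longrightarrow> near (\<lambda>e. \<forall>j<n. P j e)" for n :: nat
proof (induction n)
  case 0
  then show ?case by (intro near_always) auto
next
  case (Suc n)
  have "near (\<lambda>e. (\<forall>j<n. P j e) \<and> P n e)" using Suc by (intro near_conj) auto
  then show ?case by (rule near_mono) (auto simp: less_Suc_eq)
qed

lemma near_beyond: "e0 \<in> R \<Longrightarrow> near (\<lambda>e. v1 (x - e0) < v1 (x - e))"
  using no_max unfolding near_def by (meson less_le_trans)

text \<open>A pseudo-limit in both fields: \<open>z\<close> has the distances of \<open>x\<close> in
  the first field, and in the second the corresponding ones, expressed through elements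
  \<open>g\<close> of \<open>R\<close>.\<close>

definition "plim z \<longleftrightarrow> z \<in> E \<and> (\<forall>e\<in>R. v1 (z - e) = v1 (x - e)) \<and>
  (\<forall>e\<in>R. \<forall>g\<in>R. v1 g = v1 (x - e) \<longrightarrow> v2 (z - e) = v2 g)"

lemma plim_less_iff:
  assumes "plim z" "e \<in> R" "f \<in> R"
  shows "v1 (x - e) < v1 (x - f) \<longleftrightarrow> v2 (z - e) < v2 (z - f)"
proof -
  obtain g h where "g \<in> R" "v1 g = v1 (x - e)" "h \<in> R" "v1 h = v1 (x - f)"
    using value_of_diff assms by meson
  then show ?thesis using assms rD_less[of g h] RD unfolding plim_def by metis
qed

lemma plim_fin: "plim z \<Longrightarrow> e \<in> R \<Longrightarrow> v1 (z - e) \<noteq> Inf \<and> v2 (z - e) \<noteq> Inf"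
proof -
  assume a: "plim z" "e \<in> R"
  obtain g where "g \<in> R" "v1 g = v1 (x - e)" using value_of_diff a by meson
  then show ?thesis using a x_new rD_Inf[OF RD] unfolding plim_def by metis
qed

text \<open>The distances from \<open>x\<close> to \<open>R\<close> are values of \<open>E\<close>,
  hence countably many, and saturation is applied to one center per distance. Finitely many
  conditions are met by an element of \<open>R\<close> closer to \<open>x\<close> than the centers
  involved.\<close>

lemma plim_exists: "\<exists>z. plim z \<and> V1.eqv z x"
proof -
  define S where "S = (\<lambda>e. v1 (x - e)) ` R"
  have "S \<subseteq> v1 ` D"
  proof
    fix s assume "s \<in> S"
    then obtain e where "e \<in> R" "s = v1 (x - e)" by (auto simp: S_def)
    then show "s \<in> v1 ` D"
      using D_ex[of "x - e"] x_E RE subring_diff[OF E_subring, of x e] by (metis image_eqI)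
  qed
  then have "countable S" using D_countable by (meson countable_image countable_subset)
  moreover have "S \<noteq> {}" using subring_1[OF R_subring] by (auto simp: S_def)
  ultimately have S: "range (from_nat_into S) = S" by (rule range_from_nat_into[rotated])
  have "\<exists>e g. e \<in> R \<and> g \<in> R \<and> v1 (x - e) = from_nat_into S i \<and> v1 g = v1 (x - e)" for i
  proof -
    have "from_nat_into S i \<in> S" using S by blast
    then obtain e where "e \<in> R" "v1 (x - e) = from_nat_into S i" unfolding S_def by auto
    then show ?thesis using value_of_diff by blast
  qed
  then obtain e g where eg: "\<And>i. e i \<in> R" "\<And>i. g i \<in> R"
      "\<And>i. v1 (x - e i) = from_nat_into S i" "\<And>i. v1 (g i) = v1 (x - e i)" by metis
  have "\<exists>z. \<forall>i. v2 (z - e i) = v2 (g i)"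
  proof (rule saturated2)
    fix m :: nat
    have "near (\<lambda>f. \<forall>i<Suc m. v1 (x - e i) < v1 (x - f))"
      using eg by (intro near_finite near_beyond)
    then obtain f where f: "f \<in> R" "\<forall>i<Suc m. v1 (x - e i) < v1 (x - f)" using near_ex by blast
    have "v2 (f - e i) = v2 (g i)" if "i \<le> m" for i
    proof -
      have "v1 (x - e i) < v1 ((x - e i) - (f - e i))" using f that by simp
      then have "v1 (f - e i) = v1 (g i)"
        using V1.val_eq_of_close'[of "x - e i" "f - e i"] eg(4)[of i] by simp
      then show ?thesis
        using rD_eq[OF RD[OF subring_diff[OF R_subring f(1) eg(1)]] RD[OF eg(2)]] by blast
    qed
    then show "\<exists>z. \<forall>i\<le>m. v2 (z - e i) = v2 (g i)" by blast
  qed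
  then obtain x2 where x2: "\<And>i. v2 (x2 - e i) = v2 (g i)" by blast
  obtain z where z: "V1.eqv z x" "V2.eqv z x2" using combine by blast
  have "plim z"
    unfolding plim_def
  proof (intro conjI ballI impI)
    show "z \<in> E" using z E_eqv x_E V1.eqv_sym by blast
    show v1z: "v1 (z - f) = v1 (x - f)" for f
      using V1.eqv_val[OF V1.eqv_diff[OF z(1) V1.eqv_refl]] .
    fix f h assume f: "f \<in> R" "h \<in> R" "v1 h = v1 (x - f)"
    \<comment> \<open>Through a chosen center that is closer to \<open>x\<close> than
      \<open>f\<close>, the distance to \<open>f\<close> becomes the value of an element of
      \<open>R\<close>.\<close>
    obtain k where k: "k \<in> R" "v1 (x - f) < v1 (x - k)" using no_max f by blast
    then obtain i where i: "v1 (x - e i) = v1 (x - k)" using eg S unfolding S_def by (metis imageE image_eqI)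
    then have "v1 (x - f) < v1 ((x - f) - (e i - f))" using k by simp
    then have "v1 (e i - f) = v1 h" using V1.val_eq_of_close'[of "x - f" "e i - f"] f(3) by simp
    then have a: "v2 (e i - f) = v2 h"
      using rD_eq[OF RD[OF subring_diff[OF R_subring eg(1) f(1)]] RD[OF f(2)]] by blast
    have "v1 h < v1 (g i)" using f k i eg by simp
    then have "v2 h < v2 (x2 - e i)" using rD_less[OF RD[OF f(2)] RD[OF eg(2)]] x2 by simp
    then have "v2 (e i - f) < v2 ((x2 - f) - (e i - f))" using a by simp
    then have "v2 (x2 - f) = v2 h" using V2.val_eq_of_close[of "e i - f" "x2 - f"] a by simp
    then show "v2 (z - f) = v2 h" using V2.eqv_val[OF V2.eqv_diff[OF z(2) V2.eqv_refl]] by metis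
  qed
  with z show ?thesis by blast
qed

text \<open>The constant Taylor term eventually dominates, so that \<open>p\<close> has the same
  value at a pseudo-limit as at \<open>e\<close>. The strict inequality also makes this value
  finite.\<close>

definition "settled p \<longleftrightarrow>
  near (\<lambda>e. \<forall>j\<ge>1. v1 (poly p e) < v1 (poly (hasse j p) e * (x - e) ^ j))"

text \<open>The Taylor terms at \<open>e\<close> have the values of elements of \<open>R\<close>,
  obtained by replacing \<open>x - e\<close> with \<open>g\<close>. Their comparison therefore holds
  in both fields and for every \<open>z\<close> with matching distances.\<close>

lemma settled_plim:
  assumes p: "p \<in> coeffs_in R" "settled p" and z: "plim z"
  shows "near (\<lambda>e. v1 (poly p e) \<noteq> Inf \<and> v1 (poly p e) < v1 (poly p z - poly p e) \<and>
    v2 (poly p e) < v2 (poly p z - poly p e))"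
  using p(2) unfolding settled_def
proof (rule near_mono)
  fix e assume e: "e \<in> R" and s: "\<forall>j\<ge>1. v1 (poly p e) < v1 (poly (hasse j p) e * (x - e) ^ j)"
  obtain g where g: "g \<in> R" "v1 g = v1 (x - e)" using value_of_diff e by blast
  have zg: "v1 (z - e) = v1 g" "v2 (z - e) = v2 g" using z g e by (auto simp: plim_def)
  have pR: "poly p e \<in> R" "poly (hasse j p) e * g ^ j \<in> R" for j
    using R_subring p e g by (auto intro!: poly_in_subring subring_mult subring_power coeffs_in_hasse)
  have fin: "v1 (poly p e) \<noteq> Inf" using s[rule_format, of 1] by auto
  have 1: "v1 (poly p e) < v1 (poly (hasse j p) e * g ^ j)" if "j \<ge> 1" for j
    using s that V1.val_power_cong[OF g(2), of j] by (simp add: V1.val_mult)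
  then have 2: "v2 (poly p e) < v2 (poly (hasse j p) e * g ^ j)" if "j \<ge> 1" for j
    using rD_less[OF RD RD] pR that by blast
  have "v1 (poly p e) < v1 (poly p z - poly p e)"
    unfolding poly_taylor_diff using 1 fin V1.val_power_cong[OF zg(1)]
    by (intro V1.less_val_sum) (auto simp: V1.val_mult)
  moreover have "v2 (poly p e) < v2 (poly p z - poly p e)"
    unfolding poly_taylor_diff using 2 fin V2.val_power_cong[OF zg(2)] rD_Inf[OF RD[OF pR(1)]]
    by (intro V2.less_val_sum) (auto simp: V2.val_mult)
  ultimately show "v1 (poly p e) \<noteq> Inf \<and> v1 (poly p e) < v1 (poly p z - poly p e) \<and>
    v2 (poly p e) < v2 (poly p z - poly p e)" using fin by blast
qed

lemma settled_C:
  assumes p: "p \<in> coeffs_in R" "settled p" and z: "plim z"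
  shows "poly p z \<in> C"
proof -
  obtain e where e: "e \<in> R" "v1 (poly p e) \<noteq> Inf" "v1 (poly p e) < v1 (poly p z - poly p e)"
      "v2 (poly p e) < v2 (poly p z - poly p e)"
    using near_ex[OF settled_plim[OF assms]] by blast
  have "poly p z \<in> E" using coeffs_in_R_E[OF p(1)] z
    by (intro poly_in_subring[OF E_subring]) (auto simp: plim_def)
  moreover have "poly p e \<in> C" using RC poly_in_subring[OF R_subring p(1) e(1)] by blast
  ultimately show ?thesis using C_close e by blast
qed

lemma settled_scale:
  assumes c: "\<And>i. V1.eqv (b * coeff q i) (coeff p i)" and b: "v1 b \<noteq> Inf" and q: "settled q"
  shows "settled p"
  using q unfolding settled_def
proof (rule near_mono, intro allI impI)
  fix e j assume a: "\<forall>j\<ge>1. v1 (poly q e) < v1 (poly (hasse j q) e * (x - e) ^ j)" and j: "1 \<le> (j::nat)"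
  have h: "v1 (poly (hasse j p) e) = v1 b + v1 (poly (hasse j q) e)" for j
  proof -
    have "V1.eqv (coeff (smult b (hasse j q)) i) (coeff (hasse j p) i)" for i
      using V1.eqv_mult[OF V1.eqv_refl[of "of_nat ((i + j) choose j)"] c[of "i + j"]]
      by (simp add: coeff_hasse ac_simps)
    from V1.eqv_val[OF V1.eqv_poly_coeffs[OF this]] show ?thesis by (simp add: V1.val_mult)
  qed
  have "v1 b + v1 (poly q e) < v1 b + v1 (poly (hasse j q) e * (x - e) ^ j)"
    using a j b by (simp add: fin_add_less_cancel)
  then show "v1 (poly p e) < v1 (poly (hasse j p) e * (x - e) ^ j)"
    using h[of 0] h[of j] by (simp add: hasse_0 V1.val_mult ac_simps)
qed

text \<open>Divide by the last coefficient outside the support and drop those after it, which vanish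
  in the field.\<close>

lemma monicize:
  assumes p: "p \<in> coeffs_in R" "\<not> null p"
  shows "\<exists>m\<in>coeffs_in R. \<exists>b\<in>R. lead_coeff m = 1 \<and> degree m \<le> degree p \<and> v1 b \<noteq> Inf \<and>
    (\<forall>i. V1.eqv (b * coeff m i) (coeff p i))"
proof -
  let ?K = "{i. v1 (coeff p i) \<noteq> Inf}"
  have "?K \<subseteq> {..degree p}" using coeff_eq_0[of p] by (metis (mono_tags) V1.val_0 atMost_iff mem_Collect_eq not_le subsetI)
  then have K: "finite ?K" using finite_subset by blast
  moreover have "?K \<noteq> {}" using p by (auto simp: null_def)
  ultimately have "Max ?K \<in> ?K" by (rule Max_in)
  define k where "k = Max ?K"
  have k: "v1 (coeff p k) \<noteq> Inf" "k \<le> degree p"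
    using \<open>Max ?K \<in> ?K\<close> \<open>?K \<subseteq> {..degree p}\<close> unfolding k_def by auto
  have big: "v1 (coeff p i) = Inf" if "k < i" for i
    using Max_ge[OF K, of i] that unfolding k_def by force
  have "coeff p k \<in> R" using p coeffs_inD by blast
  then obtain y where y: "y \<in> R" "eq2 (coeff p k * y) 1" using R_inverse k by blast
  define m where "m = (\<Sum>i<k. monom (y * coeff p i) i) + monom 1 k"
  have cm: "coeff m i = (if i < k then y * coeff p i else if i = k then 1 else 0)" for i
    by (auto simp: m_def coeff_sum)
  have dm: "degree m = k"
  proof (rule antisym)
    show "degree m \<le> k" by (intro degree_le) (auto simp: cm)
    show "k \<le> degree m" by (rule le_degree) (simp add: cm)
  qed
  have "m \<in> coeffs_in R"
    using R_subring y p unfolding coeffs_in_def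
    by (auto simp: cm intro: subring_0 subring_1 subring_mult)
  moreover have "V1.eqv (coeff p k * coeff m i) (coeff p i)" for i
  proof -
    consider "i < k" | "i = k" | "k < i" by linarith
    then show ?thesis
    proof cases
      case 1
      then show ?thesis using V1.eqv_mult[OF eq2_D(1)[OF y(2)] V1.eqv_refl[of "coeff p i"]]
        by (simp add: cm mult.assoc)
    next
      case 3
      then show ?thesis using big by (simp add: cm V1.eqv_def)
    qed (simp add: cm)
  qed
  moreover have "lead_coeff m = 1" by (simp add: dm cm)
  ultimately show ?thesis using dm k \<open>coeff p k \<in> R\<close> by blast
qed

lemma near_not_near: "near P \<Longrightarrow> \<not> near Q \<Longrightarrow> \<exists>e\<in>R. P e \<and> \<not> Q e"
  using near_mono by blast

text \<open>Let \<open>m\<close> be a monic polynomial of least degree that is not settled. Its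
  derivative is settled, so the linear Taylor term dominates the higher ones near \<open>x\<close>,
  while the constant term does not dominate it. Newton's method yields roots closer to
  \<open>z\<close> than all of \<open>R\<close>; their pair \<open>w\<close> is again a pseudo-limit
  and can be adjoined, but a pseudo-limit in \<open>R\<close> would equal \<open>x\<close> in the
  first field.\<close>

lemma immediate_False: False
proof (cases "\<forall>p\<in>coeffs_in R. \<not> null p \<longrightarrow> settled p")
  case True
  obtain z where z: "plim z" "V1.eqv z x" using plim_exists by blast
  have "z \<in> R" using True settled_C null_poly(3) z by (intro adjoin) blast
  then show False using x_new[of z] V1.eqv_sym[OF z(2)] by (simp add: V1.eqv_def)
next
  case False
  define Q where "Q n \<longleftrightarrow> (\<exists>m\<in>coeffs_in R. lead_coeff m = 1 \<and> degree m = n \<and> \<not> settled m)" for n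
  define n where "n = (LEAST n. Q n)"
  obtain p where p: "p \<in> coeffs_in R" "\<not> null p" "\<not> settled p" using False by blast
  have "\<exists>n. Q n" using monicize[OF p(1,2)] settled_scale p(3) unfolding Q_def by metis
  then have "Q n" unfolding n_def by (rule LeastI_ex)
  then obtain m where mR: "m \<in> coeffs_in R" and lm: "lead_coeff m = 1" and dm: "degree m = n"
    and ns: "\<not> settled m" by (auto simp: Q_def)
  have least: "settled q" if q: "q \<in> coeffs_in R" "\<not> null q" "degree q < n" for q
  proof (rule ccontr)
    assume "\<not> settled q"
    then obtain m' where "m' \<in> coeffs_in R" "lead_coeff m' = 1" "degree m' \<le> degree q" "\<not> settled m'"
      using monicize[OF q(1,2)] settled_scale by metis
    then show False using not_less_Least[of "degree m'" Q] q(3) unfolding Q_def n_def by force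
  qed
  have n: "n > 0"
  proof (rule ccontr)
    assume "\<not> n > 0"
    then obtain c where "m = [:c:]" using dm degree_eq_zeroE[of m] by auto
    then have "m = [:1:]" using lm by simp
    moreover have "hasse j [:1 :: 'a:] = 0" if "j \<ge> 1" for j
      using that hasse_const by (metis Suc_le_D One_nat_def)
    ultimately have "settled m" unfolding settled_def by (intro near_always) simp
    then show False using ns by blast
  qed
  define h where "h = hasse 1 m"
  have hjR: "hasse j m \<in> coeffs_in R" for j using R_subring mR by (rule coeffs_in_hasse)
  have hR: "h \<in> coeffs_in R" unfolding h_def by (rule hjR)
  have "coeff h (n - 1) = of_nat n" using n lm dm by (simp add: h_def coeff_hasse)
  then have "\<not> null h" using V1.residue_char_0[OF n] unfolding null_def by (metis zero_neq_Inf(1))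
  moreover have "degree h < n" using degree_hasse_le[of 1 m] n unfolding h_def dm by linarith
  ultimately have sh: "settled h" using least hR by blast
  have hz: "hasse j m = 0" if "j > n" for j
    using that by (intro poly_eqI) (simp add: coeff_hasse coeff_eq_0 dm)
  \<comment> \<open>Multiply the inequalities for the derivative by \<open>x - e\<close>; by
    \<open>hasse_hasse_1\<close> they become inequalities for \<open>m\<close>, one degree
    higher.\<close>
  have beta: "near (\<lambda>e. \<forall>j\<ge>2. v1 (poly h e * (x - e)) < v1 (poly (hasse j m) e * (x - e) ^ j))"
    using sh unfolding settled_def
  proof (rule near_mono, intro allI impI)
    fix e j assume e: "e \<in> R" and a: "\<forall>i\<ge>1. v1 (poly h e) < v1 (poly (hasse i h) e * (x - e) ^ i)"
      and "2 \<le> (j::nat)"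
    then obtain i where j: "j = Suc i" "i \<ge> 1" by (cases j) auto
    have "v1 (poly (hasse i h) e * (x - e) ^ i) = v1 (poly (hasse j m) e * (x - e) ^ i)"
      using V1.residue_char_0[of "Suc i"] unfolding h_def hasse_hasse_1 j(1)
      by (simp add: V1.val_mult del: of_nat_Suc)
    then have "v1 (x - e) + v1 (poly h e) < v1 (x - e) + v1 (poly (hasse j m) e * (x - e) ^ i)"
      using a[rule_format, OF j(2)] x_new[OF e] by (simp add: fin_add_less_cancel)
    then show "v1 (poly h e * (x - e)) < v1 (poly (hasse j m) e * (x - e) ^ j)"
      by (simp add: V1.val_mult j(1) ac_simps)
  qed
  obtain z where z: "plim z" using plim_exists by blast
  have zE: "z \<in> E" using z by (simp add: plim_def)
  \<comment> \<open>The derivatives of \<open>m\<close> have smaller degree, so each is null or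
    settled and eventually has equal values at \<open>e\<close> and at \<open>z\<close>.\<close>
  define S where "S j e \<longleftrightarrow> v1 (poly (hasse j m) z) = v1 (poly (hasse j m) e) \<and>
    v2 (poly (hasse j m) z) = v2 (poly (hasse j m) e)" for j e
  have S_near: "near (\<lambda>e. j \<ge> 1 \<longrightarrow> S j e)" for j
  proof (cases "j \<ge> 1")
    case True
    show ?thesis
    proof (cases "null (hasse j m)")
      case True
      then show ?thesis using null_poly[OF hjR True] by (intro near_always) (simp add: S_def)
    next
      case False
      have "degree (hasse j m) < n" using degree_hasse_le[of j m] n \<open>j \<ge> 1\<close> unfolding dm by linarith
      then have "settled (hasse j m)" using least hjR False by blast
      from settled_plim[OF hjR this z] show ?thesis
        by (rule near_mono) (auto simp: S_def intro!: V1.val_eq_of_close V2.val_eq_of_close)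
    qed
  qed (auto intro: near_always)
  have S_all: "near (\<lambda>e. \<forall>j\<ge>1. S j e)"
    using near_finite[OF S_near, of "Suc n"]
  proof (rule near_mono, intro allI impI)
    fix e j assume "\<forall>j<Suc n. 1 \<le> j \<longrightarrow> S j e" "1 \<le> (j::nat)"
    then show "S j e" using hz[of j] by (cases "j \<le> n") (auto simp: S_def)
  qed
  have hfin: "v1 (poly h z) \<noteq> Inf" "v2 (poly h z) \<noteq> Inf"
  proof -
    obtain e where "e \<in> R" "v1 (poly h e) \<noteq> Inf" "v1 (poly h e) < v1 (poly h z - poly h e)"
      using near_ex[OF settled_plim[OF hR sh z]] by blast
    then show "v1 (poly h z) \<noteq> Inf" using V1.val_eq_of_close by metis
    then show "v2 (poly h z) \<noteq> Inf" using rD_Inf CD settled_C[OF hR sh z] by blast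
  qed
  \<comment> \<open>The inequality of \<open>beta\<close>, moved to the center \<open>z\<close> of
    Newton's method and stated in both fields.\<close>
  define B where "B e \<longleftrightarrow> (\<forall>j\<ge>2. v1 (poly h z * (z - e)) < v1 (poly (hasse j m) z * (z - e) ^ j)) \<and>
    (\<forall>j\<ge>2. v2 (poly h z * (z - e)) < v2 (poly (hasse j m) z * (z - e) ^ j))" for e
  have val_e: "v1 (poly (hasse j m) z * (z - e) ^ i) = v1 (poly (hasse j m) e * g ^ i)"
      "v2 (poly (hasse j m) z * (z - e) ^ i) = v2 (poly (hasse j m) e * g ^ i)"
      "v1 (poly (hasse j m) e * (x - e) ^ i) = v1 (poly (hasse j m) e * g ^ i)"
      "rD (poly (hasse j m) e * g ^ i)"
    if "e \<in> R" "g \<in> R" "v1 g = v1 (x - e)" "\<forall>j\<ge>1. S j e" "j \<ge> 1" for e g i j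
  proof -
    have "v1 (z - e) = v1 g" "v2 (z - e) = v2 g" using z that by (auto simp: plim_def)
    then show "v1 (poly (hasse j m) z * (z - e) ^ i) = v1 (poly (hasse j m) e * g ^ i)"
      "v2 (poly (hasse j m) z * (z - e) ^ i) = v2 (poly (hasse j m) e * g ^ i)"
      using that(4,5) V1.val_power_cong[of "z - e" g i] V2.val_power_cong[of "z - e" g i]
      by (simp_all add: S_def V1.val_mult V2.val_mult)
    show "v1 (poly (hasse j m) e * (x - e) ^ i) = v1 (poly (hasse j m) e * g ^ i)"
      using V1.val_power_cong[of "x - e" g i] that by (simp add: V1.val_mult)
    show "rD (poly (hasse j m) e * g ^ i)"
      using R_subring hjR that by (intro RD subring_mult subring_power poly_in_subring)
  qed
  have B_near: "near (\<lambda>e. (\<forall>j\<ge>1. S j e) \<and> B e)"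
    using near_conj[OF beta S_all]
  proof (rule near_mono)
    fix e assume e: "e \<in> R" and a: "(\<forall>j\<ge>2. v1 (poly h e * (x - e)) < v1 (poly (hasse j m) e * (x - e) ^ j)) \<and>
      (\<forall>j\<ge>1. S j e)"
    obtain g where g: "g \<in> R" "v1 g = v1 (x - e)" using value_of_diff e by blast
    note ve = val_e[OF e g conjunct2[OF a]]
    have 1: "v1 (poly (hasse 1 m) e * g ^ 1) < v1 (poly (hasse j m) e * g ^ j)" if "j \<ge> 2" for j
      using a[THEN conjunct1, rule_format, OF that] that ve(3)[of 1 1] ve(3)[of j j] by (simp add: h_def)
    have 2: "v2 (poly (hasse 1 m) e * g ^ 1) < v2 (poly (hasse j m) e * g ^ j)" if "j \<ge> 2" for j
      using 1[OF that] rD_less[OF ve(4)[of 1 1] ve(4)[of j j]] that by simp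
    have "B e"
      unfolding B_def h_def
    proof (intro conjI allI impI)
      fix j :: nat assume j: "2 \<le> j"
      show "v1 (poly (hasse 1 m) z * (z - e)) < v1 (poly (hasse j m) z * (z - e) ^ j)"
        using 1[OF j] ve(1)[of 1 1] ve(1)[of j j] j by simp
      show "v2 (poly (hasse 1 m) z * (z - e)) < v2 (poly (hasse j m) z * (z - e) ^ j)"
        using 2[OF j] ve(2)[of 1 1] ve(2)[of j j] j by simp
    qed
    then show "(\<forall>j\<ge>1. S j e) \<and> B e" using a by blast
  qed
  \<comment> \<open>As \<open>m\<close> is not settled, arbitrarily close to \<open>x\<close> the
    value of some Taylor term is at most that of the constant one. The linear term has the least
    value among the nonconstant ones, so its value bounds that of \<open>poly m z\<close> from
    below.\<close>
  have cofinal: "\<exists>e\<in>R. v1 (x - e0) \<le> v1 (x - e) \<and> v1 (poly h z * (z - e)) \<le> v1 (poly m z) \<and>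
    v2 (poly h z * (z - e)) \<le> v2 (poly m z)" if e0: "e0 \<in> R" for e0
  proof -
    have "near (\<lambda>e. ((\<forall>j\<ge>1. S j e) \<and> B e) \<and> v1 (x - e0) < v1 (x - e))"
      by (intro near_conj B_near near_beyond e0)
    from near_not_near[OF this ns[unfolded settled_def]]
    obtain e k where e: "e \<in> R" "\<forall>j\<ge>1. S j e" "B e" "v1 (x - e0) < v1 (x - e)"
      and k: "k \<ge> 1" "v1 (poly (hasse k m) e * (x - e) ^ k) \<le> v1 (poly m e)"
      unfolding not_all not_imp not_less by blast
    obtain g where g: "g \<in> R" "v1 g = v1 (x - e)" using value_of_diff e by blast
    note ve = val_e[OF e(1) g e(2)]
    let ?t = "poly (hasse 1 m) e * g ^ 1"
    have le1: "v1 ?t \<le> v1 (poly (hasse j m) e * g ^ j)" "v2 ?t \<le> v2 (poly (hasse j m) e * g ^ j)" if "j \<ge> 1" for j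
    proof -
      have "v1 (poly h z * (z - e)) \<le> v1 (poly (hasse j m) z * (z - e) ^ j) \<and>
          v2 (poly h z * (z - e)) \<le> v2 (poly (hasse j m) z * (z - e) ^ j)"
      proof (cases "j = 1")
        case False
        then have "j \<ge> 2" using that by simp
        then show ?thesis using e(3) unfolding B_def by (blast intro: less_imp_le)
      qed (simp add: h_def)
      then show "v1 ?t \<le> v1 (poly (hasse j m) e * g ^ j)" "v2 ?t \<le> v2 (poly (hasse j m) e * g ^ j)"
        using ve(1,2)[of 1 1] ve(1,2)[of j j] that by (simp_all add: h_def)
    qed
    have tm: "v1 ?t \<le> v1 (poly m e)" using le1(1)[of k] k ve(3)[of k k] by simp
    then have tm2: "v2 ?t \<le> v2 (poly m e)"
      using rD_le[OF ve(4)[of 1 1] RD[OF poly_in_subring[OF R_subring mR e(1)]]] by simp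
    have "v1 ?t \<le> v1 (poly m z - poly m e)"
      unfolding poly_taylor_diff
    proof (rule V1.le_val_sum)
      fix j assume "j \<in> {1..degree m}"
      then show "v1 ?t \<le> v1 (poly (hasse j m) e * (z - e) ^ j)"
        using le1(1)[of j] ve(1)[of j j] e(2) by (simp add: V1.val_mult S_def)
    qed
    then have "v1 ?t \<le> v1 (poly m z)" using V1.le_val_add[OF _ tm] by fastforce
    moreover have "v2 ?t \<le> v2 (poly m z - poly m e)"
      unfolding poly_taylor_diff
    proof (rule V2.le_val_sum)
      fix j assume "j \<in> {1..degree m}"
      then show "v2 ?t \<le> v2 (poly (hasse j m) e * (z - e) ^ j)"
        using le1(2)[of j] ve(2)[of j j] e(2) by (simp add: V2.val_mult S_def)
    qed
    then have "v2 ?t \<le> v2 (poly m z)" using V2.le_val_add[OF _ tm2] by fastforce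
    ultimately show ?thesis
      using e ve(1)[of 1 1] ve(2)[of 1 1] unfolding h_def by (intro bexI[of _ e]) auto
  qed
  \<comment> \<open>Passing to a closer center makes the inequality strict, and does so for every
    \<open>e\<close>.\<close>
  have far: "v1 (poly h z * (z - e)) < v1 (poly m z)" "v2 (poly h z * (z - e)) < v2 (poly m z)"
    if e: "e \<in> R" for e
  proof -
    obtain f where f: "f \<in> R" "v1 (x - e) < v1 (x - f)" using no_max e by blast
    obtain k where k: "k \<in> R" "v1 (x - f) \<le> v1 (x - k)" "v1 (poly h z * (z - k)) \<le> v1 (poly m z)"
      "v2 (poly h z * (z - k)) \<le> v2 (poly m z)" using cofinal f by blast
    have ek: "v1 (x - e) < v1 (x - k)" using f k by simp
    then have "v1 (z - e) < v1 (z - k)" "v2 (z - e) < v2 (z - k)"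
      using z e k plim_less_iff[OF z e k(1)] by (auto simp: plim_def)
    then have "v1 (poly h z * (z - e)) < v1 (poly h z * (z - k))"
      "v2 (poly h z * (z - e)) < v2 (poly h z * (z - k))"
      using hfin by (simp_all add: V1.val_mult V2.val_mult fin_add_less_cancel)
    then show "v1 (poly h z * (z - e)) < v1 (poly m z)" "v2 (poly h z * (z - e)) < v2 (poly m z)"
      using k by auto
  qed
  obtain e0 where e0: "e0 \<in> R" "\<And>e. e \<in> R \<Longrightarrow> v1 (x - e0) \<le> v1 (x - e) \<Longrightarrow> B e"
    using B_near unfolding near_def by blast
  have later: "\<exists>f\<in>R. v1 (x - e0) < v1 (x - f) \<and> v1 (x - e) < v1 (x - f)" if "e \<in> R" for e
    using near_ex[OF near_conj[OF near_beyond[OF e0(1)] near_beyond[OF that]]] .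
  have hfin_e: "v1 (poly h z * (z - e)) \<noteq> Inf" "v2 (poly h z * (z - e)) \<noteq> Inf" if "e \<in> R" for e
    using hfin plim_fin[OF z that] by (auto simp: V1.val_mult V2.val_mult)
  have B_le: "v1 (poly (hasse 1 m) z * (z - e)) \<le> v1 (poly (hasse j m) z * (z - e) ^ j)"
    "v2 (poly (hasse 1 m) z * (z - e)) \<le> v2 (poly (hasse j m) z * (z - e) ^ j)"
    if "e \<in> R" "v1 (x - e0) \<le> v1 (x - e)" "j \<ge> 2" for e j
    using e0(2)[OF that(1,2)] that(3) unfolding B_def h_def by (auto intro: less_imp_le)
  have root1: "\<exists>y\<in>E. v1 (poly m y) = Inf \<and> v1 (z - e) < v1 (y - z)"
    if "e \<in> R" "v1 (x - e0) \<le> v1 (x - e)" for e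
    using V1.newton_root[OF E_subring E_inv E_hensel coeffs_in_R_E[OF mR] zE
        subring_diff[OF E_subring zE RE[OF that(1)]]] hfin_e(1)[OF that(1)] far(1)[OF that(1)] B_le(1)[OF that]
    unfolding h_def by blast
  have root2: "\<exists>y. v2 (poly m y) = Inf \<and> v2 (z - e) < v2 (y - z)"
    if "e \<in> R" "v1 (x - e0) \<le> v1 (x - e)" for e
  proof -
    have "subring_of (UNIV :: 'a set)" by (simp add: subring_of_def)
    moreover have "V2.inv_closed UNIV" using V2.eqv_iv by (auto simp: V2.inv_closed_def)
    moreover have "m \<in> coeffs_in UNIV" by (simp add: coeffs_in_def)
    ultimately show ?thesis
      using V2.newton_root[OF _ _ V2.hensel, of m z "z - e"] hfin_e(2)[OF that(1)] far(2)[OF that(1)] B_le(2)[OF that]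
      unfolding h_def by blast
  qed
  obtain y1 where y1: "y1 \<in> E" "v1 (poly m y1) = Inf" "v1 (z - e0) < v1 (y1 - z)"
    using root1[OF e0(1)] by auto
  obtain y2 where y2: "v2 (poly m y2) = Inf" "v2 (z - e0) < v2 (y2 - z)"
    using root2[OF e0(1)] by auto
  \<comment> \<open>Roots found for different centers coincide by \<open>newton_unique\<close>, so
    one root is closer to \<open>z\<close> than every element of \<open>R\<close>.\<close>
  have close1: "v1 (z - e) < v1 (y1 - z)" if e: "e \<in> R" for e
  proof -
    obtain f where f: "f \<in> R" "v1 (x - e0) < v1 (x - f)" "v1 (x - e) < v1 (x - f)" using later e by blast
    then obtain y where y: "v1 (poly m y) = Inf" "v1 (z - f) < v1 (y - z)" using root1[OF f(1) less_imp_le[OF f(2)]] by blast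
    have zf: "v1 (z - e0) < v1 (z - f)" "v1 (z - e) < v1 (z - f)" using z e e0 f by (auto simp: plim_def)
    have "V1.eqv y1 y"
      using y zf y1 hfin_e(1)[OF e0(1)] B_le(1)[OF e0(1) order.refl] unfolding h_def
      by (intro V1.newton_unique[of m z "z - e0"]) auto
    then have "v1 (y1 - z) = v1 (y - z)" using V1.eqv_val V1.eqv_diff V1.eqv_refl by metis
    then show ?thesis using y zf by simp
  qed
  have close2: "v2 (z - e) < v2 (y2 - z)" if e: "e \<in> R" for e
  proof -
    obtain f where f: "f \<in> R" "v1 (x - e0) < v1 (x - f)" "v1 (x - e) < v1 (x - f)" using later e by blast
    then obtain y where y: "v2 (poly m y) = Inf" "v2 (z - f) < v2 (y - z)" using root2[OF f(1) less_imp_le[OF f(2)]] by blast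
    have zf: "v2 (z - e0) < v2 (z - f)" "v2 (z - e) < v2 (z - f)"
      using plim_less_iff[OF z] e e0 f by blast+
    have "V2.eqv y2 y"
      using y zf y2 hfin_e(2)[OF e0(1)] B_le(2)[OF e0(1) order.refl] unfolding h_def
      by (intro V2.newton_unique[of m z "z - e0"]) auto
    then have "v2 (y2 - z) = v2 (y - z)" using V2.eqv_val V2.eqv_diff V2.eqv_refl by metis
    then show ?thesis using y zf by simp
  qed
  obtain w where w: "V1.eqv w y1" "V2.eqv w y2" using combine by blast
  have wz: "v1 (w - z) = v1 (y1 - z)" "v2 (w - z) = v2 (y2 - z)"
    using V1.eqv_val[OF V1.eqv_diff[OF w(1) V1.eqv_refl]] V2.eqv_val[OF V2.eqv_diff[OF w(2) V2.eqv_refl]] by auto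
  have wze: "v1 (w - e) = v1 (z - e)" "v2 (w - e) = v2 (z - e)" if "e \<in> R" for e
    using close1[OF that] close2[OF that] wz
    by (auto intro!: V1.val_eq_of_close V2.val_eq_of_close)
  have pw: "plim w"
    unfolding plim_def
  proof (intro conjI ballI impI)
    show "w \<in> E" using w y1 E_eqv V1.eqv_sym by blast
    fix e assume e: "e \<in> R"
    show "v1 (w - e) = v1 (x - e)" using wze e z by (simp add: plim_def)
    fix g assume "g \<in> R" "v1 g = v1 (x - e)"
    then show "v2 (w - e) = v2 g" using wze e z by (simp add: plim_def)
  qed
  have mw: "v1 (poly m w) = Inf" "v2 (poly m w) = Inf"
    using V1.eqv_val[OF V1.eqv_poly[OF w(1)]] V2.eqv_val[OF V2.eqv_poly[OF w(2)]] y1 y2 by auto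
  have "w \<in> R"
  proof (rule adjoin_mod[where P = "\<lambda>r. degree r < n"])
    show "\<exists>r\<in>coeffs_in R. degree r < n \<and> eq2 (poly r w) (poly p w)" if "p \<in> coeffs_in R" for p
      using reduce_mod_monic[OF mR lm mw that] n unfolding dm by blast
    show "poly r w \<in> C" if "r \<in> coeffs_in R" "degree r < n" for r
      using that least[of r] null_poly(3)[of r] settled_C[OF _ _ pw] by blast
  qed
  \<comment> \<open>Being in \<open>R\<close>, \<open>w\<close> is itself one of the
    centers.\<close>
  then have "v1 (w - w) = v1 (x - w)" using pw unfolding plim_def by blast
  then have "v1 (x - w) = Inf" by (metis V1.val_0 diff_self)
  then show False using x_new[OF \<open>w \<in> R\<close>] by simp
qed

end

context corr begin

text \<open>An element of \<open>E\<close> missed by a maximal subring would satisfy the assumptions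
  of \<open>immediate\<close>, which are contradictory.\<close>

theorem extend_correspondence:
  assumes "subring_of R0" "R0 \<subseteq> C"
  shows "\<exists>R. subring_of R \<and> R0 \<subseteq> R \<and> R \<subseteq> C \<and> (\<forall>x\<in>E. \<exists>z\<in>R. V1.eqv x z) \<and>
    (\<forall>z\<in>R. v1 z \<noteq> Inf \<longrightarrow> (\<exists>y\<in>R. V1.eqv (z * y) 1 \<and> V2.eqv (z * y) 1))"
proof -
  obtain R where R: "subring_of R" "R0 \<subseteq> R" "R \<subseteq> C"
    and max: "\<And>S. subring_of S \<Longrightarrow> R \<subseteq> S \<Longrightarrow> S \<subseteq> C \<Longrightarrow> S = R"
    using maximal_subring[OF assms] by blast
  interpret M: corr_max v1 v2 ac E A D R
    by unfold_locales (use R max in blast)+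
  have "\<exists>z\<in>R. V1.eqv x z" if "x \<in> E" for x
  proof (rule ccontr)
    assume no: "\<not> (\<exists>z\<in>R. V1.eqv x z)"
    interpret immediate v1 v2 ac E A D R x
      by unfold_locales (use that no in \<open>auto simp: V1.eqv_def\<close>)
    show False by (rule immediate_False)
  qed
  then show ?thesis using R M.R_inverse by (intro exI[of _ R]) (auto simp: M.eq2_def)
qed

end

section \<open>Ultrapowers along a free ultrafilter on the natural numbers\<close>

text \<open>A maximal family with infinite finite intersections is a free ultrafilter;
  \<open>alm P\<close> says that \<open>P\<close> holds almost everywhere with respect to it.\<close>

definition inf_fip :: "nat set set \<Rightarrow> bool" where
  "inf_fip F \<longleftrightarrow> (\<forall>G\<subseteq>F. finite G \<longrightarrow> infinite (\<Inter>G))"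

lemma maximal_inf_fip: "\<exists>M. inf_fip M \<and> (\<forall>F. inf_fip F \<longrightarrow> M \<subseteq> F \<longrightarrow> F = M)"
proof -
  have "\<exists>M\<in>Collect inf_fip. \<forall>F\<in>Collect inf_fip. M \<subseteq> F \<longrightarrow> F = M"
  proof (rule subset_Zorn_nonempty)
    have "inf_fip {}" by (auto simp: inf_fip_def)
    then show "Collect inf_fip \<noteq> {}" by blast
    fix \<C> assume ne: "\<C> \<noteq> {}" and ch: "subset.chain (Collect inf_fip) \<C>"
    have "infinite (\<Inter>G)" if G: "G \<subseteq> \<Union>\<C>" "finite G" for G
    proof -
      obtain F where "F \<in> \<C>" "G \<subseteq> F"
        using finite_subset_Union_chain[OF G(2,1) ne ch] by blast
      then show ?thesis using ch G(2) by (auto simp: subset.chain_def inf_fip_def)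
    qed
    then show "\<Union>\<C> \<in> Collect inf_fip" by (simp add: inf_fip_def)
  qed
  then show ?thesis by blast
qed

definition ultra :: "nat set set" where
  "ultra = (SOME M. inf_fip M \<and> (\<forall>F. inf_fip F \<longrightarrow> M \<subseteq> F \<longrightarrow> F = M))"

lemma ultra_fip: "inf_fip ultra" and ultra_max: "inf_fip F \<Longrightarrow> ultra \<subseteq> F \<Longrightarrow> F = ultra"
  using someI_ex[OF maximal_inf_fip] unfolding ultra_def by blast+

lemma ultra_Inter: "G \<subseteq> ultra \<Longrightarrow> finite G \<Longrightarrow> infinite (\<Inter>G)"
  using ultra_fip unfolding inf_fip_def by blast

text \<open>A set with infinite intersection with every finite intersection of members can be added
  to the family, so by maximality it is already in it.\<close>

lemma ultraI:
  assumes "\<And>G. \<lbrakk>G \<subseteq> ultra; finite G\<rbrakk> \<Longrightarrow> infinite (\<Inter>G \<inter> S)"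
  shows "S \<in> ultra"
proof -
  have "inf_fip (insert S ultra)"
    unfolding inf_fip_def
  proof (intro allI impI)
    fix G assume G: "G \<subseteq> insert S ultra" "finite G"
    then have "infinite (\<Inter>(G - {S}) \<inter> S)" by (intro assms) auto
    moreover have "\<Inter>(G - {S}) \<inter> S \<subseteq> \<Inter>G" by auto
    ultimately show "infinite (\<Inter>G)" using finite_subset by blast
  qed
  from ultra_max[OF this] show ?thesis by blast
qed

definition alm :: "(nat \<Rightarrow> bool) \<Rightarrow> bool" where
  "alm P \<longleftrightarrow> {n. P n} \<in> ultra"

lemma alm_not: "alm (\<lambda>n. \<not> P n) \<longleftrightarrow> \<not> alm P"
proof
  assume n: "alm (\<lambda>n. \<not> P n)"
  show "\<not> alm P"
  proof
    assume "alm P"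
    then have "infinite (\<Inter>{{n. P n}, {n. \<not> P n}})"
      using n by (intro ultra_Inter) (auto simp: alm_def)
    moreover have "\<Inter>{{n. P n}, {n. \<not> P n}} = {}" by auto
    ultimately show False by simp
  qed
next
  assume "\<not> alm P"
  \<comment> \<open>Finitely many members meet \<open>P\<close> in a finite set only, so every
    larger finite intersection is infinite outside \<open>P\<close>.\<close>
  then obtain G where G: "G \<subseteq> ultra" "finite G" "finite (\<Inter>G \<inter> {n. P n})"
    using ultraI unfolding alm_def by metis
  show "alm (\<lambda>n. \<not> P n)"
    unfolding alm_def
  proof (rule ultraI)
    fix G' assume G': "G' \<subseteq> ultra" "finite G'"
    then have "infinite (\<Inter>(G \<union> G'))" using G by (intro ultra_Inter) auto
    moreover have "\<Inter>(G \<union> G') \<subseteq> (\<Inter>G \<inter> {n. P n}) \<union> (\<Inter>G' \<inter> {n. \<not> P n})" by auto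
    ultimately show "infinite (\<Inter>G' \<inter> {n. \<not> P n})" using G(3) finite_subset by blast
  qed
qed

lemma alm_mono: "alm P \<Longrightarrow> (\<And>n. P n \<Longrightarrow> Q n) \<Longrightarrow> alm Q"
  unfolding alm_def
proof (rule ultraI)
  fix G assume P: "{n. P n} \<in> ultra" "\<And>n. P n \<Longrightarrow> Q n" and G: "G \<subseteq> ultra" "finite G"
  have "infinite (\<Inter>(insert {n. P n} G))" by (rule ultra_Inter) (use P G in auto)
  moreover have "\<Inter>(insert {n. P n} G) \<subseteq> \<Inter>G \<inter> {n. Q n}" using P by auto
  ultimately show "infinite (\<Inter>G \<inter> {n. Q n})" using finite_subset by blast
qed

lemma alm_conj: "alm (\<lambda>n. P n \<and> Q n) \<longleftrightarrow> alm P \<and> alm Q"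
proof
  assume a: "alm P \<and> alm Q"
  show "alm (\<lambda>n. P n \<and> Q n)"
    unfolding alm_def
  proof (rule ultraI)
    fix G assume G: "G \<subseteq> ultra" "finite G"
    have "infinite (\<Inter>(insert {n. P n} (insert {n. Q n} G)))"
      by (rule ultra_Inter) (use G a in \<open>auto simp: alm_def\<close>)
    moreover have "\<Inter>(insert {n. P n} (insert {n. Q n} G)) = \<Inter>G \<inter> {n. P n \<and> Q n}" by auto
    ultimately show "infinite (\<Inter>G \<inter> {n. P n \<and> Q n})" by metis
  qed
qed (auto elim: alm_mono)

text \<open>Final segments belong to the ultrafilter because intersections are required to be
  infinite, not just nonempty. Saturation rests on this.\<close>

lemma alm_ge: "alm (\<lambda>n. m \<le> n)"
  unfolding alm_def
proof (rule ultraI)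
  fix G assume "G \<subseteq> ultra" "finite G"
  then have "infinite (\<Inter>G)" by (rule ultra_Inter)
  then have "infinite (\<Inter>G - {..<m})" by simp
  moreover have "\<Inter>G - {..<m} = \<Inter>G \<inter> {n. m \<le> n}" by auto
  ultimately show "infinite (\<Inter>G \<inter> {n. m \<le> n})" by simp
qed

lemma alm_always: "(\<And>n. P n) \<Longrightarrow> alm P"
  using alm_ge[of 0] by (rule alm_mono)

lemma alm_const [simp]: "alm (\<lambda>_. P) \<longleftrightarrow> P"
proof (cases P)
  case False
  then show ?thesis using alm_not[of "\<lambda>_. P"] alm_always[of "\<lambda>_. True"] by simp
qed (simp add: alm_always)

lemma alm_imp: "alm (\<lambda>n. P n \<longrightarrow> Q n) \<longleftrightarrow> (alm P \<longrightarrow> alm Q)"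
  using alm_not[of "\<lambda>n. P n \<and> \<not> Q n"] alm_conj[of P "\<lambda>n. \<not> Q n"] alm_not[of Q] by simp

lemma alm_disj: "alm (\<lambda>n. P n \<or> Q n) \<longleftrightarrow> alm P \<or> alm Q"
  using alm_imp[of "\<lambda>n. \<not> P n" Q] alm_not[of P] by (simp add: imp_conv_disj)

lemma alm_iff: "alm (\<lambda>n. P n \<longleftrightarrow> Q n) \<longleftrightarrow> (alm P \<longleftrightarrow> alm Q)"
  unfolding iff_conv_conj_imp alm_conj alm_imp by blast

lemma alm_all_le: "alm (\<lambda>n. \<forall>i\<le>m. P i n) \<longleftrightarrow> (\<forall>i\<le>m. alm (P i))" for m :: nat
proof (induction m)
  case (Suc m)
  have "(\<lambda>n. \<forall>i\<le>Suc m. P i n) = (\<lambda>n. (\<forall>i\<le>m. P i n) \<and> P (Suc m) n)"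
    by (auto simp: le_Suc_eq)
  then show ?case using Suc by (auto simp: alm_conj le_Suc_eq)
qed simp

lemma alm_ex: "alm (\<lambda>n. \<exists>x. P x n) \<longleftrightarrow> (\<exists>f. alm (\<lambda>n. P (f n) n))"
proof
  assume "alm (\<lambda>n. \<exists>x. P x n)"
  then have "alm (\<lambda>n. P (SOME x. P x n) n)" by (rule alm_mono) (rule someI_ex)
  then show "\<exists>f. alm (\<lambda>n. P (f n) n)" by (rule exI[of _ "\<lambda>n. SOME x. P x n"])
qed (auto elim: alm_mono)

text \<open>A diagonal argument: at index \<open>n\<close>, satisfy as long an initial segment of
  the conditions as possible, up to number \<open>n\<close>. The unknown is a family indexed by
  \<open>'i\<close>, so that infinitely many elements can be found together.\<close>

lemma countably_saturated:
  fixes Q :: "nat \<Rightarrow> nat \<Rightarrow> ('i \<Rightarrow> 'z) \<Rightarrow> bool"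
  assumes "\<And>m. \<exists>e. \<forall>j\<le>m. alm (\<lambda>n. Q j n (\<lambda>i. e i n))"
  shows "\<exists>e. \<forall>j. alm (\<lambda>n. Q j n (\<lambda>i. e i n))"
proof -
  define G where "G m n x \<longleftrightarrow> (\<forall>j\<le>m. Q j n x)" for m n x
  \<comment> \<open>The bound \<open>m \<le> n\<close> makes \<open>M n\<close> finite; no condition
    is lost, since almost every \<open>n\<close> is at least a given \<open>j\<close>.\<close>
  define M where "M n = {m. m \<le> n \<and> (\<exists>x. G m n x)}" for n
  define f where "f n = (SOME x. G (Max (M n)) n x)" for n
  have fin: "finite (M n)" for n unfolding M_def by auto
  have "alm (\<lambda>n. Q j n (\<lambda>i. f n i))" for j
  proof -
    obtain e where "\<forall>k\<le>j. alm (\<lambda>n. Q k n (\<lambda>i. e i n))" using assms by blast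
    then have "alm (\<lambda>n. G j n (\<lambda>i. e i n))" unfolding G_def alm_all_le .
    then have "alm (\<lambda>n. G j n (\<lambda>i. e i n) \<and> j \<le> n)" using alm_ge by (simp add: alm_conj)
    then show ?thesis
    proof (rule alm_mono)
      fix n assume "G j n (\<lambda>i. e i n) \<and> j \<le> n"
      then have j: "j \<in> M n" by (auto simp: M_def)
      then have "Max (M n) \<in> M n" using fin by (intro Max_in) auto
      then have "\<exists>x. G (Max (M n)) n x" by (auto simp: M_def)
      then have "G (Max (M n)) n (f n)" unfolding f_def by (rule someI_ex)
      moreover have "j \<le> Max (M n)" using j fin by (intro Max_ge)
      ultimately show "Q j n (\<lambda>i. f n i)" by (simp add: G_def)
    qed
  qed
  then show ?thesis by (intro exI[of _ "\<lambda>i n. f n i"]) simp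
qed

definition star_rel :: "(nat \<Rightarrow> 'a) \<Rightarrow> (nat \<Rightarrow> 'a) \<Rightarrow> bool" where
  "star_rel x y \<longleftrightarrow> alm (\<lambda>n. x n = y n)"

lemma equivp_star_rel: "equivp star_rel"
proof (rule equivpI)
  show "reflp star_rel" by (auto simp: reflp_def star_rel_def)
  show "symp star_rel" by (auto simp: symp_def star_rel_def eq_commute)
  show "transp star_rel"
    unfolding transp_def star_rel_def
  proof (intro allI impI)
    fix x y z
    assume "alm (\<lambda>n. x n = y n)" "alm (\<lambda>n. y n = z n)"
    then have "alm (\<lambda>n. x n = y n \<and> y n = z n)" by (simp add: alm_conj)
    then show "alm (\<lambda>n. x n = z n)" by (rule alm_mono) simp
  qed
qed

\<comment> \<open>Only the value group becomes a quotient type, since values must be linearly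
  ordered. Elements of the field remain sequences.\<close>
quotient_type 'a star = "nat \<Rightarrow> 'a" / star_rel
  by (rule equivp_star_rel)

lemma star_rel_cong2:
  assumes "star_rel x x'" "star_rel y y'"
  shows "star_rel (\<lambda>n. f (x n) (y n)) (\<lambda>n. f (x' n) (y' n))"
    and "alm (\<lambda>n. P (x n) (y n)) = alm (\<lambda>n. P (x' n) (y' n))"
proof -
  have a: "alm (\<lambda>n. x n = x' n \<and> y n = y' n)"
    using assms by (simp add: star_rel_def alm_conj)
  then show "star_rel (\<lambda>n. f (x n) (y n)) (\<lambda>n. f (x' n) (y' n))"
    unfolding star_rel_def by (rule alm_mono) simp
  have "alm (\<lambda>n. P (x n) (y n) \<longleftrightarrow> P (x' n) (y' n))" using a by (rule alm_mono) simp
  then show "alm (\<lambda>n. P (x n) (y n)) = alm (\<lambda>n. P (x' n) (y' n))" by (simp add: alm_iff)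
qed

instantiation star :: (linordered_ab_group_add) linordered_ab_group_add
begin

lift_definition zero_star :: "'a star" is "\<lambda>_. 0" .
lift_definition plus_star :: "'a star \<Rightarrow> 'a star \<Rightarrow> 'a star" is "\<lambda>x y n. x n + y n"
  by (rule star_rel_cong2)
lift_definition minus_star :: "'a star \<Rightarrow> 'a star \<Rightarrow> 'a star" is "\<lambda>x y n. x n - y n"
  by (rule star_rel_cong2)
lift_definition uminus_star :: "'a star \<Rightarrow> 'a star" is "\<lambda>x n. - x n"
  using star_rel_cong2(1)[where f = "\<lambda>x _. - x"] by blast
lift_definition less_eq_star :: "'a star \<Rightarrow> 'a star \<Rightarrow> bool" is "\<lambda>x y. alm (\<lambda>n. x n \<le> y n)"
  by (rule star_rel_cong2)
lift_definition less_star :: "'a star \<Rightarrow> 'a star \<Rightarrow> bool" is "\<lambda>x y. alm (\<lambda>n. x n < y n)"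
  by (rule star_rel_cong2)

instance
proof
  fix a b c :: "'a star"
  show "a + b + c = a + (b + c)" by transfer (simp add: star_rel_def add.assoc)
  show "a + b = b + a" by transfer (simp add: star_rel_def add.commute)
  show "0 + a = a" by transfer (simp add: star_rel_def)
  show "- a + a = 0" by transfer (simp add: star_rel_def)
  show "a - b = a + - b" by transfer (simp add: star_rel_def)
  show "a < b \<longleftrightarrow> a \<le> b \<and> \<not> b \<le> a"
    by transfer (auto simp: alm_not[symmetric] alm_conj[symmetric] not_le order.strict_implies_order elim: alm_mono)
  show "a \<le> a" by transfer simp
  show "a \<le> b \<Longrightarrow> b \<le> c \<Longrightarrow> a \<le> c"
  proof transfer
    fix a b c :: "nat \<Rightarrow> 'a"
    assume "alm (\<lambda>n. a n \<le> b n)" "alm (\<lambda>n. b n \<le> c n)"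
    then have "alm (\<lambda>n. a n \<le> b n \<and> b n \<le> c n)" by (simp add: alm_conj)
    then show "alm (\<lambda>n. a n \<le> c n)" by (rule alm_mono) (blast intro: order_trans)
  qed
  show "a \<le> b \<Longrightarrow> b \<le> a \<Longrightarrow> a = b"
    by transfer (simp add: star_rel_def order.eq_iff alm_conj)
  show "a \<le> b \<or> b \<le> a"
    by transfer (simp add: alm_disj[symmetric] linear)
  show "a \<le> b \<Longrightarrow> c + a \<le> c + b" by transfer simp
qed

end

section \<open>The valuation on sequences\<close>

lemma sum_fun_apply: "(\<Sum>i\<in>I. f i) n = (\<Sum>i\<in>I. f i n)" for f :: "'i \<Rightarrow> nat \<Rightarrow> 'z::comm_ring_1"
  by (induction I rule: infinite_finite_induct) auto

lemma power_fun_apply: "(x ^ k) n = x n ^ k" for x :: "nat \<Rightarrow> 'z::comm_ring_1"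
  by (induction k) auto

definition seq_poly :: "(nat \<Rightarrow> 'z::comm_ring_1) poly \<Rightarrow> nat \<Rightarrow> 'z poly" where
  "seq_poly p n = map_poly (\<lambda>c. c n) p"

lemma coeff_seq_poly: "coeff (seq_poly p n) i = coeff p i n"
  by (simp add: seq_poly_def coeff_map_poly)

lemma poly_seq_apply: "poly p x n = poly (seq_poly p n) (x n)"
proof -
  have "degree (seq_poly p n) \<le> degree p"
    by (rule degree_le) (simp add: coeff_seq_poly coeff_eq_0)
  then have "poly (seq_poly p n) (x n) = (\<Sum>i\<le>degree p. coeff p i n * x n ^ i)"
    unfolding poly_altdef coeff_seq_poly[symmetric]
    by (intro sum.mono_neutral_left) (auto simp: coeff_eq_0)
  then show ?thesis by (simp add: poly_altdef sum_fun_apply power_fun_apply)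
qed

text \<open>The value at \<open>Inf\<close> is a default. In the finite case of
  \<open>star_val\<close> it occurs only on a negligible set of indices, where it does not change
  the class.\<close>

primrec fin_part :: "'g::zero with_inf \<Rightarrow> 'g" where
  "fin_part (Fin g) = g"
| "fin_part Inf = 0"

definition star_val :: "('z \<Rightarrow> 'g::linordered_ab_group_add with_inf) \<Rightarrow> (nat \<Rightarrow> 'z) \<Rightarrow> 'g star with_inf" where
  "star_val v z = (if alm (\<lambda>n. v (z n) = Inf) then Inf else Fin (abs_star (\<lambda>n. fin_part (v (z n)))))"

lemma star_val_Inf: "star_val v z = Inf \<longleftrightarrow> alm (\<lambda>n. v (z n) = Inf)"
  by (simp add: star_val_def)

lemma star_val_le: "star_val v z \<le> star_val v w \<longleftrightarrow> alm (\<lambda>n. v (z n) \<le> v (w n))"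
proof (cases "alm (\<lambda>n. v (z n) = Inf) \<or> alm (\<lambda>n. v (w n) = Inf)")
  case True
  then show ?thesis
  proof
    assume z: "alm (\<lambda>n. v (z n) = Inf)"
    have "alm (\<lambda>n. v (z n) \<le> v (w n) \<longleftrightarrow> v (w n) = Inf)" using z by (rule alm_mono) simp
    then show ?thesis using z by (simp add: alm_iff star_val_def)
  next
    assume "alm (\<lambda>n. v (w n) = Inf)"
    moreover have "alm (\<lambda>n. v (z n) \<le> v (w n))" using calculation by (rule alm_mono) simp
    ultimately show ?thesis by (simp add: star_val_def)
  qed
next
  case False
  then have "alm (\<lambda>n. v (z n) \<noteq> Inf \<and> v (w n) \<noteq> Inf)" by (simp add: alm_conj alm_not)
  then have "alm (\<lambda>n. fin_part (v (z n)) \<le> fin_part (v (w n)) \<longleftrightarrow> v (z n) \<le> v (w n))"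
  proof (rule alm_mono)
    fix n assume "v (z n) \<noteq> Inf \<and> v (w n) \<noteq> Inf"
    then show "fin_part (v (z n)) \<le> fin_part (v (w n)) \<longleftrightarrow> v (z n) \<le> v (w n)"
      by (cases "v (z n)"; cases "v (w n)") auto
  qed
  then show ?thesis using False by (simp add: star_val_def less_eq_star.abs_eq alm_iff)
qed

lemma star_val_less: "star_val v z < star_val v w \<longleftrightarrow> alm (\<lambda>n. v (z n) < v (w n))"
  using star_val_le[of v w z] by (simp add: not_le[symmetric] alm_not)

lemma star_val_eq: "star_val v z = star_val v w \<longleftrightarrow> alm (\<lambda>n. v (z n) = v (w n))"
  by (simp add: order.eq_iff star_val_le alm_conj)

lemma star_val_0: "alm (\<lambda>n. v (z n) = 0) \<Longrightarrow> star_val v z = 0"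
proof -
  assume z: "alm (\<lambda>n. v (z n) = 0)"
  have "alm (\<lambda>n. v (z n) \<noteq> Inf)" using z by (rule alm_mono) simp
  moreover have "alm (\<lambda>n. fin_part (v (z n)) = 0)"
    using z by (rule alm_mono) (simp add: zero_with_inf_def)
  then have "abs_star (\<lambda>n. fin_part (v (z n))) = 0"
    by (simp add: zero_star.abs_eq star.abs_eq_iff star_rel_def)
  ultimately show ?thesis by (simp add: star_val_def alm_not zero_with_inf_def)
qed

context hens_val begin

abbreviation "sv \<equiv> star_val v"

lemma star_val_one: "sv 1 = 0"
  by (rule star_val_0) simp

lemma sv_ge_0: "0 \<le> sv z \<longleftrightarrow> alm (\<lambda>n. 0 \<le> v (z n))"
  using star_val_le[of v 1 z] star_val_one by simp

lemma sv_gr_0: "0 < sv z \<longleftrightarrow> alm (\<lambda>n. 0 < v (z n))"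
  using star_val_less[of v 1 z] star_val_one by simp

lemma sv_eq_0: "sv z = 0 \<longleftrightarrow> alm (\<lambda>n. v (z n) = 0)"
  using star_val_eq[of v z 1] star_val_one by simp

lemma star_supp_val: "supp_val sv"
proof
  fix x y :: "nat \<Rightarrow> 'a"
  show "sv 0 = Inf" by (simp add: star_val_Inf)
  show "sv 1 = 0" by (rule star_val_one)
  show "sv (x * y) = sv x + sv y"
  proof (cases "alm (\<lambda>n. v (x n) = Inf) \<or> alm (\<lambda>n. v (y n) = Inf)")
    case True
    then have "alm (\<lambda>n. v ((x * y) n) = Inf)" by (auto simp: val_mult elim: alm_mono)
    then show ?thesis using True by (auto simp: star_val_def)
  next
    case False
    then have "alm (\<lambda>n. v (x n) \<noteq> Inf \<and> v (y n) \<noteq> Inf)" by (simp add: alm_conj alm_not)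
    then have "alm (\<lambda>n. v ((x * y) n) \<noteq> Inf \<and>
        fin_part (v ((x * y) n)) = fin_part (v (x n)) + fin_part (v (y n)))"
    proof (rule alm_mono)
      fix n assume "v (x n) \<noteq> Inf \<and> v (y n) \<noteq> Inf"
      then show "v ((x * y) n) \<noteq> Inf \<and> fin_part (v ((x * y) n)) = fin_part (v (x n)) + fin_part (v (y n))"
        by (cases "v (x n)"; cases "v (y n)") (auto simp: val_mult)
    qed
    then show ?thesis using False
      by (simp add: star_val_def plus_star.abs_eq star.abs_eq_iff star_rel_def alm_conj alm_not)
  qed
  show "min (sv x) (sv y) \<le> sv (x + y)"
  proof -
    have "alm (\<lambda>n. v (x n) \<le> v ((x + y) n) \<or> v (y n) \<le> v ((x + y) n))"
    proof (rule alm_always)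
      fix n show "v (x n) \<le> v ((x + y) n) \<or> v (y n) \<le> v ((x + y) n)"
        using val_add[of "x n" "y n"] by (auto simp: min_def split: if_splits)
    qed
    then show ?thesis unfolding alm_disj star_val_le[symmetric] min_le_iff_disj .
  qed
  show "\<exists>y. sv (x * y - 1) = Inf" if "sv x \<noteq> Inf"
  proof -
    have "alm (\<lambda>n. \<exists>y. v (x n * y - 1) = Inf)"
      using that unfolding star_val_Inf alm_not[symmetric] by (rule alm_mono) (rule val_inverse)
    then obtain f where "alm (\<lambda>n. v (x n * f n - 1) = Inf)" unfolding alm_ex by blast
    then show ?thesis by (intro exI[of _ f]) (simp add: star_val_Inf minus_apply)
  qed
qed

text \<open>The Hensel conditions concern finitely many coefficients, so they hold together at
  almost every index, and roots chosen index by index form a root.\<close>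

lemma star_hens_val: "hens_val sv"
proof (intro hens_val.intro hens_val_axioms.intro star_supp_val)
  show "sv (of_nat n) = 0" if "n > 0" for n
    using that by (simp add: sv_eq_0 of_nat_fun_apply residue_char_0)
  interpret S: supp_val sv by (rule star_supp_val)
  show "S.hensel_on UNIV"
    unfolding S.hensel_on_def
  proof (intro ballI impI)
    fix p :: "(nat \<Rightarrow> 'a) poly"
    assume a: "(\<forall>i. 0 \<le> sv (coeff p i)) \<and> 0 < sv (coeff p 0) \<and> sv (coeff p 1) = 0"
    have "alm (\<lambda>n. \<forall>i\<le>degree p. 0 \<le> v (coeff p i n))"
      using a by (simp add: alm_all_le sv_ge_0)
    then have "alm (\<lambda>n. (\<forall>i\<le>degree p. 0 \<le> v (coeff p i n)) \<and> 0 < v (coeff p 0 n) \<and> v (coeff p 1 n) = 0)"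
      using a by (simp add: alm_conj sv_gr_0 sv_eq_0)
    then have "alm (\<lambda>n. \<exists>b. 0 < v b \<and> v (poly (seq_poly p n) b) = Inf)"
    proof (rule alm_mono)
      fix n assume n: "(\<forall>i\<le>degree p. 0 \<le> v (coeff p i n)) \<and> 0 < v (coeff p 0 n) \<and> v (coeff p 1 n) = 0"
      have "0 \<le> v (coeff (seq_poly p n) i)" for i
        using n by (cases "i \<le> degree p") (simp_all add: coeff_seq_poly coeff_eq_0)
      moreover have "seq_poly p n \<in> coeffs_in UNIV" by (simp add: coeffs_in_def)
      ultimately have "\<exists>b\<in>UNIV. 0 < v b \<and> v (poly (seq_poly p n) b) = Inf"
        using hensel n unfolding hensel_on_def by (simp add: coeff_seq_poly)
      then show "\<exists>b. 0 < v b \<and> v (poly (seq_poly p n) b) = Inf" by blast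
    qed
    then obtain b where "alm (\<lambda>n. 0 < v (b n) \<and> v (poly (seq_poly p n) (b n)) = Inf)"
      unfolding alm_ex by blast
    then show "\<exists>b\<in>UNIV. 0 < sv b \<and> sv (poly p b) = Inf"
      by (intro bexI[of _ b]) (simp_all add: sv_gr_0 star_val_Inf poly_seq_apply alm_conj)
  qed
qed

lemma star_saturated:
  assumes "\<And>m::nat. \<exists>z. \<forall>i\<le>m. sv (z - e i) = sv (g i)"
  shows "\<exists>z. \<forall>i. sv (z - e i) = sv (g i)"
proof -
  have "\<exists>z. \<forall>i. alm (\<lambda>n. v (z () n - e i n) = v (g i n))"
  proof (rule countably_saturated)
    fix m
    obtain z where "\<forall>i\<le>m. sv (z - e i) = sv (g i)" using assms by blast
    then show "\<exists>z. \<forall>i\<le>m. alm (\<lambda>n. v (z () n - e i n) = v (g i n))"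
      by (intro exI[of _ "\<lambda>_. z"]) (simp add: star_val_eq minus_apply)
  qed
  then obtain z where "\<forall>i. alm (\<lambda>n. v (z () n - e i n) = v (g i n))" by blast
  then show ?thesis by (intro exI[of _ "z ()"]) (simp add: star_val_eq minus_apply)
qed

text \<open>Here the unknown is a whole sequence \<open>X\<close>, each equation linking two
  successive members. Such systems describe the compatible roots from which a section of the
  valuation is built.\<close>

lemma star_saturated_chain:
  assumes "\<And>m::nat. \<exists>X. \<forall>i\<le>m. sv (X i) = sv (z i) \<and>
    sv (X i * X (Suc i) ^ b i - X (Suc i) ^ a i * h i) = Inf"
  shows "\<exists>X. \<forall>i. sv (X i) = sv (z i) \<and> sv (X i * X (Suc i) ^ b i - X (Suc i) ^ a i * h i) = Inf"
proof -
  have e: "sv (X i) = sv (z i) \<and> sv (X i * X (Suc i) ^ b i - X (Suc i) ^ a i * h i) = Inf \<longleftrightarrow>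
    alm (\<lambda>n. v (X i n) = v (z i n) \<and> v (X i n * X (Suc i) n ^ b i - X (Suc i) n ^ a i * h i n) = Inf)"
    for X i
    by (simp add: star_val_eq star_val_Inf minus_apply power_fun_apply alm_conj)
  show ?thesis unfolding e by (rule countably_saturated) (use assms in \<open>simp only: e\<close>)
qed

end

section \<open>Existence of an angular component\<close>

context supp_val begin

definition zp :: "'a \<Rightarrow> int \<Rightarrow> 'a" where
  "zp x m = (if m \<ge> 0 then x ^ nat m else iv x ^ nat (- m))"

lemma zp_of_nat: "zp x (int n) = x ^ n"
  by (simp add: zp_def)

text \<open>An integer power is determined by an equation between natural powers, uniquely by
  \<open>zp_unique\<close>. The laws for sums of exponents and for products follow from it without
  distinguishing signs.\<close>

lemma zp_char:
  assumes x: "v x \<noteq> Inf"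
  shows "eqv (zp x (int a - int b) * x ^ b) (x ^ a)"
proof (cases "b \<le> a")
  case True
  then have "zp x (int a - int b) = x ^ (a - b)" by (simp add: zp_def nat_diff_distrib')
  then show ?thesis using True by (simp flip: power_add)
next
  case False
  then have z: "zp x (int a - int b) = iv x ^ (b - a)" by (simp add: zp_def nat_diff_distrib')
  have "x ^ b = x ^ (b - a) * x ^ a" using False by (simp flip: power_add)
  then have "zp x (int a - int b) * x ^ b = (x * iv x) ^ (b - a) * x ^ a"
    by (simp add: z power_mult_distrib ac_simps)
  moreover have "eqv ((x * iv x) ^ (b - a) * x ^ a) (1 ^ (b - a) * x ^ a)"
    using eqv_iv[OF x] by (intro eqv_mult eqv_power) auto
  ultimately show ?thesis by simp
qed

lemma zp_unique:
  assumes x: "v x \<noteq> Inf" and y: "eqv (y * x ^ b) (x ^ a)"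
  shows "eqv y (zp x (int a - int b))"
proof -
  have "eqv (x ^ b * y) (x ^ b * zp x (int a - int b))"
    using eqv_trans[OF y eqv_sym[OF zp_char[OF x]]] by (simp add: mult.commute)
  then show ?thesis using x by (simp add: eqv_mult_cancel val_power_eq_Inf_iff)
qed

lemma zp_fin: "v x \<noteq> Inf \<Longrightarrow> v (zp x m) \<noteq> Inf"
  using val_iv_fin by (simp add: zp_def val_power_eq_Inf_iff)

lemma int_as_diff: obtains a b where "m = int a - int b"
  by (metis int_diff_cases)

lemma zp_add: "v x \<noteq> Inf \<Longrightarrow> eqv (zp x (m + n)) (zp x m * zp x n)"
proof -
  assume x: "v x \<noteq> Inf"
  obtain a b c d where m: "m = int a - int b" and n: "n = int c - int d" using int_as_diff by metis
  have "eqv (zp x m * x ^ b * (zp x n * x ^ d)) (x ^ a * x ^ c)"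
    unfolding m n by (intro eqv_mult zp_char x)
  then have "eqv (zp x m * zp x n * x ^ (b + d)) (x ^ (a + c))" by (simp add: power_add ac_simps)
  from zp_unique[OF x this] have "eqv (zp x m * zp x n) (zp x (m + n))"
    by (simp add: m n algebra_simps)
  then show ?thesis by (rule eqv_sym)
qed

lemma zp_0 [simp]: "zp x 0 = 1" and zp_1 [simp]: "zp x 1 = x"
  by (simp_all add: zp_def)

lemma zp_mult: "v x \<noteq> Inf \<Longrightarrow> v y \<noteq> Inf \<Longrightarrow> eqv (zp (x * y) m) (zp x m * zp y m)"
proof -
  assume x: "v x \<noteq> Inf" and y: "v y \<noteq> Inf"
  obtain a b where m: "m = int a - int b" using int_as_diff by metis
  have "eqv (zp x m * x ^ b * (zp y m * y ^ b)) (x ^ a * y ^ a)"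
    unfolding m by (intro eqv_mult zp_char x y)
  then have "eqv (zp x m * zp y m * (x * y) ^ b) ((x * y) ^ a)" by (simp add: power_mult_distrib ac_simps)
  from zp_unique[OF _ this] show ?thesis using x y by (simp add: m val_mult eqv_sym)
qed

lemma zp_cong: "v x \<noteq> Inf \<Longrightarrow> eqv x y \<Longrightarrow> eqv (zp x m) (zp y m)"
proof -
  assume x: "v x \<noteq> Inf" and e: "eqv x y"
  then have y: "v y \<noteq> Inf" using eqv_val by simp
  obtain a b where m: "m = int a - int b" using int_as_diff by metis
  have "eqv (zp x m * y ^ b) (zp x m * x ^ b)" using e by (intro eqv_mult eqv_power) (auto intro: eqv_sym)
  also have "eqv \<dots> (x ^ a)" unfolding m by (rule zp_char[OF x])
  also have "eqv \<dots> (y ^ a)" using e by (rule eqv_power)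
  finally show ?thesis using zp_unique[OF y] m by simp
qed

lemma zp_val_cong: "v x \<noteq> Inf \<Longrightarrow> v x = v y \<Longrightarrow> v (zp x m) = v (zp y m)"
  using val_power_cong[of x y] val_power_cong[of "iv x" "iv y"] val_iv[of x] val_iv[of y]
  by (simp add: zp_def)

lemma zp_zp: "v x \<noteq> Inf \<Longrightarrow> eqv (zp (zp x m) n) (zp x (m * n))"
proof (induction n rule: int_induct[of _ 0])
  case base
  then show ?case by simp
next
  case (step1 i)
  have "eqv (zp (zp x m) (i + 1)) (zp (zp x m) i * zp x m)" using zp_add[OF zp_fin[OF step1(3)], of m i 1] by simp
  also have "eqv \<dots> (zp x (m * i) * zp x m)" using step1 by (intro eqv_mult) auto
  also have "eqv \<dots> (zp x (m * i + m))" using zp_add[OF step1(3)] eqv_sym by blast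
  finally show ?case by (simp add: algebra_simps)
next
  case (step2 i)
  have "eqv (zp (zp x m) i) (zp (zp x m) (i - 1) * zp x m)"
    using zp_add[OF zp_fin[OF step2(3)], of m "i - 1" 1] by simp
  then have "eqv (zp x m * zp (zp x m) (i - 1)) (zp (zp x m) i)" by (simp add: mult.commute eqv_sym)
  also have "eqv \<dots> (zp x (m * i))" using step2 by blast
  also have "eqv \<dots> (zp x m * zp x (m * (i - 1)))"
    using zp_add[OF step2(3), of m "m * (i - 1)"] by (simp add: algebra_simps)
  finally show ?case using zp_fin[OF step2(3)] by (simp add: eqv_mult_cancel)
qed

lemma val_power_torsion_free: "v (x ^ n) = 0 \<Longrightarrow> n > 0 \<Longrightarrow> v x = 0"
proof -
  assume x: "v (x ^ n) = 0" and n: "n > 0"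
  have pos: "0 < v (y ^ Suc k)" if "0 < v y" for y k
    using that by (induction k) (auto simp: val_mult add_pos_pos)
  have f: "v x \<noteq> Inf" using x n by (metis val_power_eq_Inf_iff zero_neq_Inf(1))
  have "eqv ((x * iv x) ^ n) (1 ^ n)" by (intro eqv_power eqv_iv f)
  then have "v (x ^ n) + v (iv x ^ n) = 0" using eqv_val by (fastforce simp: power_mult_distrib val_mult)
  then have i: "v (iv x ^ n) = 0" using x by simp
  obtain k where k: "n = Suc k" using n gr0_implies_Suc by blast
  consider "0 < v x" | "v x = 0" | "v x < 0" by fastforce
  then show ?thesis
  proof cases
    case 3
    then have "0 < v (iv x)" using val_iv[OF f] by (cases "v x") (auto simp: zero_with_inf_def)
    then show ?thesis using pos[of "iv x" k] i k by simp
  qed (use pos[of x k] x k in auto)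
qed

text \<open>A partial section of the valuation, given as a set of representatives that is a subgroup of
  the multiplicative group modulo \<^term>\<open>eqv\<close>, with pure image in the value group.\<close>

definition pure_section :: "'a set \<Rightarrow> bool" where
  "pure_section H \<longleftrightarrow> 1 \<in> H \<and> (\<forall>h\<in>H. v h \<noteq> Inf) \<and> (\<forall>h\<in>H. \<forall>k\<in>H. h * k \<in> H) \<and>
    (\<forall>h\<in>H. \<forall>y. eqv (h * y) 1 \<longrightarrow> y \<in> H) \<and> (\<forall>h\<in>H. v h = 0 \<longrightarrow> eqv h 1) \<and>
    (\<forall>h\<in>H. \<forall>w n. 0 < n \<and> v (w ^ n) = v h \<longrightarrow> (\<exists>k\<in>H. v k = v w))"

context
  fixes H assumes H: "pure_section H"
begin

lemma sec_1: "1 \<in> H" and sec_fin: "h \<in> H \<Longrightarrow> v h \<noteq> Inf" and sec_mult: "h \<in> H \<Longrightarrow> k \<in> H \<Longrightarrow> h * k \<in> H"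
  and sec_inv: "h \<in> H \<Longrightarrow> eqv (h * y) 1 \<Longrightarrow> y \<in> H"
  and sec_unit: "h \<in> H \<Longrightarrow> v h = 0 \<Longrightarrow> eqv h 1"
  and sec_pure: "h \<in> H \<Longrightarrow> 0 < n \<Longrightarrow> v (w ^ n) = v h \<Longrightarrow> \<exists>k\<in>H. v k = v w"
  using H unfolding pure_section_def by blast+

lemma sec_iv: "h \<in> H \<Longrightarrow> iv h \<in> H"
  using sec_inv eqv_iv sec_fin by blast

lemma sec_power: "h \<in> H \<Longrightarrow> h ^ n \<in> H"
  by (induction n) (auto intro: sec_1 sec_mult)

lemma sec_zp: "h \<in> H \<Longrightarrow> zp h m \<in> H"
  by (auto simp: zp_def intro: sec_power sec_iv)

lemma sec_val_inj: "h \<in> H \<Longrightarrow> k \<in> H \<Longrightarrow> v h = v k \<Longrightarrow> eqv h k"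
proof -
  assume a: "h \<in> H" "k \<in> H" "v h = v k"
  have i: "eqv (k * iv k) 1" using a sec_fin eqv_iv by blast
  have "v (h * iv k) = 0" using val_inv_add[OF i] a by (simp add: val_mult)
  then have u: "eqv (h * iv k) 1" using a by (intro sec_unit sec_mult sec_iv)
  have "eqv (h * 1) (h * (k * iv k))" using i by (intro eqv_mult) (auto intro: eqv_sym)
  also have "eqv (h * (k * iv k)) (k * 1)" using eqv_mult[OF eqv_refl[of k] u] by (simp add: ac_simps)
  finally show "eqv h k" by simp
qed

end

end

text \<open>Saturation for systems \<open>X i = X (Suc i) ^ q i * h i\<close> with integer exponents
  \<open>q i = a i - b i\<close>, written without inverses.\<close>

locale chain_val = supp_val +
  assumes root_chain: "(\<And>m::nat. \<exists>X. \<forall>i\<le>m. v (X i) = v (z i) \<and>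
      v (X i * X (Suc i) ^ b i - X (Suc i) ^ a i * h i) = Inf) \<Longrightarrow>
    \<exists>X. \<forall>i. v (X i) = v (z i) \<and> v (X i * X (Suc i) ^ b i - X (Suc i) ^ a i * h i) = Inf"
begin

text \<open>Modulo the values of \<open>H\<close>, the pure hull generated by \<open>v z0\<close> is
  torsion-free of rank 1, hence an increasing union of cyclic groups. Saturation gives generators
  that are compatible as field elements and not only in value; they extend the section.\<close>

lemma extend_pure_section:
  assumes H: "pure_section H" and z0: "v z0 \<noteq> Inf" "\<And>h. h \<in> H \<Longrightarrow> v h \<noteq> v z0"
  shows "\<exists>H'. pure_section H' \<and> H \<subset> H'"
proof -
  note sec = sec_1[OF H] sec_fin[OF H] sec_mult[OF H] sec_iv[OF H] sec_zp[OF H]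
  \<comment> \<open>Additively, \<open>n * v w = m * v z0 + v h\<close>, so \<open>m / n\<close> is
    the coordinate of \<open>w\<close> along \<open>z0\<close>.\<close>
  define rel where "rel n w m \<longleftrightarrow> (\<exists>h\<in>H. v (w ^ n) = v (zp z0 m * h))" for n :: nat and w m
  have in_H: "\<exists>k\<in>H. v k = v w" if w: "v (w ^ n * h) = v h'" and h: "h \<in> H" "h' \<in> H" "n > 0" for w n h h'
  proof -
    have i: "v h + v (iv h) = 0" using val_inv_add[OF eqv_iv[OF sec(2)[OF h(1)]]] .
    have "v (w ^ n) = (v (w ^ n) + v h) + v (iv h)" using i by (simp add: add.assoc)
    also have "\<dots> = v (h' * iv h)" using w by (simp add: val_mult)
    finally have "v (w ^ n) = v (h' * iv h)" .
    then show ?thesis using sec_pure[OF H sec(3)[OF h(2) sec(4)[OF h(1)]] h(3)] by blast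
  qed
  \<comment> \<open>By purity, \<open>v z0\<close> has infinite order modulo the values of
    \<open>H\<close>.\<close>
  have zp_H: "m = 0" if m: "v (zp z0 m * h) = v h'" and h: "h \<in> H" "h' \<in> H" for m h h'
  proof (rule ccontr)
    assume "m \<noteq> 0"
    show False
    proof (cases "m > 0")
      case True
      then have "zp z0 m = z0 ^ nat m" by (simp add: zp_def)
      then show False using in_H[of z0 "nat m" h h'] m h True z0(2) by auto
    next
      case False
      then have "zp z0 m = iv z0 ^ nat (- m)" using \<open>m \<noteq> 0\<close> by (simp add: zp_def)
      then obtain k where k: "k \<in> H" "v k = v (iv z0)"
        using in_H[of "iv z0" "nat (- m)" h h'] m h False \<open>m \<noteq> 0\<close> by auto
      have "v (iv z0) + v z0 = 0" "v k + v (iv k) = 0"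
        using val_inv_add[OF eqv_iv[OF z0(1)]] val_inv_add[OF eqv_iv[OF sec(2)[OF k(1)]]]
        by (simp_all add: add.commute)
      then have "v (iv k) = v z0" using k(2) add_eq_0_imp_neg by metis
      then show False using z0(2) sec k by blast
    qed
  qed
  have rel_fun: "m = m'" if r: "rel n w m" "rel n w m'" for n w m m'
  proof -
    obtain h h' where h: "h \<in> H" "v (w ^ n) = v (zp z0 m * h)" "h' \<in> H" "v (w ^ n) = v (zp z0 m' * h')"
      using r by (auto simp: rel_def)
    have "v (zp z0 m) = v (zp z0 (m - m')) + v (zp z0 m')"
      using eqv_val[OF zp_add[OF z0(1), of "m - m'" m']] by (simp add: val_mult)
    then have "v (zp z0 m') + v (zp z0 (m - m') * h) = v (zp z0 m') + v h'"
      using h by (simp add: val_mult ac_simps)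
    then have "v (zp z0 (m - m') * h) = v h'" using zp_fin[OF z0(1)] by (simp add: fin_add_eq_cancel)
    then show ?thesis using zp_H h by fastforce
  qed
  have rel_fin: "v w \<noteq> Inf" if r: "rel n w m" "n > 0" for n w m
  proof -
    obtain h where "h \<in> H" "v (w ^ n) = v (zp z0 m * h)" using r(1) by (auto simp: rel_def)
    then have "v (w ^ n) \<noteq> Inf" using zp_fin[OF z0(1)] sec(2) by (simp add: val_mult)
    then show ?thesis using r(2) by (simp add: val_power_eq_Inf_iff)
  qed
  have rel_mult: "rel n (w * w') (m + m')" if r: "rel n w m" "rel n w' m'" for n w w' m m'
  proof -
    obtain h h' where h: "h \<in> H" "v (w ^ n) = v (zp z0 m * h)" "h' \<in> H" "v (w' ^ n) = v (zp z0 m' * h')"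
      using r by (auto simp: rel_def)
    have "v ((w * w') ^ n) = v (zp z0 (m + m') * (h * h'))"
      using h eqv_val[OF zp_add[OF z0(1), of m m']] by (simp add: power_mult_distrib val_mult ac_simps)
    then show ?thesis using h sec unfolding rel_def by blast
  qed
  have rel_zp: "rel n (zp w q) (m * q)" if r: "rel n w m" "n > 0" for n w m q
  proof -
    obtain h where h: "h \<in> H" "v (w ^ n) = v (zp z0 m * h)" using r by (auto simp: rel_def)
    have wf: "v w \<noteq> Inf" using rel_fin r by blast
    have "v (zp w q ^ n) = v (zp (zp w q) (int n))" by (simp add: zp_of_nat)
    also have "\<dots> = v (zp w (q * int n))" using zp_zp[OF wf] eqv_val by blast
    also have "\<dots> = v (zp (zp w (int n)) q)" using zp_zp[OF wf, of "int n" q] eqv_val by (simp add: mult.commute)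
    also have "\<dots> = v (zp (w ^ n) q)" by (simp add: zp_of_nat)
    also have "\<dots> = v (zp (zp z0 m * h) q)"
      by (rule zp_val_cong[OF _ h(2)]) (simp add: val_power_eq_Inf_iff wf)
    also have "\<dots> = v (zp (zp z0 m) q * zp h q)"
      using zp_mult[OF zp_fin[OF z0(1)] sec(2)[OF h(1)]] eqv_val by blast
    also have "\<dots> = v (zp z0 (m * q) * zp h q)"
      using eqv_val[OF zp_zp[OF z0(1)]] by (simp add: val_mult)
    finally show ?thesis using sec h unfolding rel_def by blast
  qed
  have rel_0: "\<exists>h\<in>H. v h = v w" if r: "rel n w 0" "n > 0" for n w
    using r in_H[of w n 1] sec unfolding rel_def by auto
  have rel_up: "rel (n * k) w (m * int k)" if r: "rel n w m" "n > 0" for n k w m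
  proof -
    have "rel n (zp w (int k)) (m * int k)" using rel_zp r by blast
    then show ?thesis by (simp add: rel_def zp_of_nat mult.commute flip: power_mult)
  qed
  \<comment> \<open>The least positive numerator for the denominator \<open>n\<close> generates all
    the others, by division with remainder.\<close>
  define good where "good n g \<longleftrightarrow> g > 0 \<and> (\<exists>w. rel n w (int g))" for n g :: nat
  define gg where "gg n = (LEAST g. good n g)" for n
  have "rel n z0 (int n)" for n
    unfolding rel_def using sec by (intro bexI[of _ 1]) (simp_all add: zp_of_nat)
  then have "good n n" if "n > 0" for n using that by (auto simp: good_def)
  then have "good n (gg n)" if "n > 0" for n unfolding gg_def by (rule LeastI) (rule that)
  then have "\<exists>w. n > 0 \<longrightarrow> rel n w (int (gg n))" for n by (auto simp: good_def)
  then obtain Z where Z: "\<And>n. n > 0 \<Longrightarrow> rel n (Z n) (int (gg n))" by metis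
  have gpos: "gg n > 0" if "n > 0" for n
    using \<open>\<And>n. n > 0 \<Longrightarrow> good n (gg n)\<close> that by (auto simp: good_def)
  have gen: "\<exists>q. \<exists>h\<in>H. v w = v (zp (Z n) q * h)" if r: "rel n w m" "n > 0" for n w m
  proof -
    let ?g = "int (gg n)"
    define q where "q = m div ?g"
    have "rel n (w * zp (Z n) (- q)) (m + ?g * (- q))"
      using rel_mult rel_zp Z r by blast
    then have r2: "rel n (w * zp (Z n) (- q)) (m mod ?g)"
      by (simp add: q_def minus_mult_div_eq_mod)
    have "m mod ?g = 0"
    proof (rule ccontr)
      assume "m mod ?g \<noteq> 0"
      moreover have "0 \<le> m mod ?g" "m mod ?g < ?g" using gpos[OF r(2)] by auto
      ultimately have "good n (nat (m mod ?g))" "nat (m mod ?g) < gg n"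
        using r2 by (auto simp: good_def)
      then show False using not_less_Least unfolding gg_def by blast
    qed
    then obtain h where h: "h \<in> H" "v h = v (w * zp (Z n) (- q))" using rel_0 r2 r(2) by metis
    have Zf: "v (Z n) \<noteq> Inf" using rel_fin Z r(2) by blast
    have "v (zp (Z n) q) + v (zp (Z n) (- q)) = 0"
      using eqv_val[OF zp_add[OF Zf, of q "- q"]] by (simp add: val_mult)
    then have "v (zp (Z n) q * h) = v w" using h by (simp add: val_mult ac_simps)
    then show ?thesis using h by metis
  qed
  \<comment> \<open>Each factorial divides the next, so the cyclic groups increase, and every
    denominator divides some factorial.\<close>
  define z where "z i = Z (fact i)" for i :: nat
  have zrel: "rel (fact i) (z i) (int (gg (fact i)))" for i unfolding z_def by (rule Z) simp
  have "\<exists>q. \<exists>h\<in>H. v (z i) = v (zp (z (Suc i)) q * h)" for i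
    using gen[of "fact (Suc i)" "z i" "int (gg (fact i)) * int (Suc i)"]
      rel_up[OF zrel[of i], of "Suc i"] unfolding z_def by (simp add: mult.commute)
  then obtain q h where qh: "\<And>i. h i \<in> H" "\<And>i. v (z i) = v (zp (z (Suc i)) (q i) * h i)" by metis
  have zf: "v (z i) \<noteq> Inf" for i using rel_fin[OF zrel] by simp
  have "\<exists>a b. q i = int a - int b" for i using int_as_diff by metis
  then obtain a b where ab: "\<And>i. q i = int (a i) - int (b i)" by metis
  have link: "eqv (X * Y ^ b i) (Y ^ a i * h i) \<longleftrightarrow> eqv X (zp Y (q i) * h i)" if Y: "v Y \<noteq> Inf" for X Y i
  proof -
    have e: "eqv (zp Y (q i) * Y ^ b i * h i) (Y ^ a i * h i)"
      unfolding ab by (intro eqv_mult zp_char Y) auto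
    have "eqv (X * Y ^ b i) (Y ^ a i * h i) \<longleftrightarrow> eqv (X * Y ^ b i) (zp Y (q i) * Y ^ b i * h i)"
      using e eqv_sym eqv_trans by blast
    also have "\<dots> \<longleftrightarrow> eqv (Y ^ b i * X) (Y ^ b i * (zp Y (q i) * h i))" by (simp add: ac_simps)
    finally show ?thesis using Y by (simp add: eqv_mult_cancel val_power_eq_Inf_iff)
  qed
  have "\<exists>X. \<forall>i. v (X i) = v (z i) \<and> v (X i * X (Suc i) ^ b i - X (Suc i) ^ a i * h i) = Inf"
  proof (rule root_chain)
    fix m
    \<comment> \<open>Finitely many links are solved backwards from the last generator, each earlier
      element being defined by its equation.\<close>
    define W where "W = rec_nat (z (Suc m)) (\<lambda>j w. zp w (q (m - j)) * h (m - j))"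
    have W: "W 0 = z (Suc m)" "\<And>j. W (Suc j) = zp (W j) (q (m - j)) * h (m - j)"
      by (simp_all add: W_def)
    have vW: "v (W j) = v (z (Suc m - j))" if "j \<le> Suc m" for j
      using that
    proof (induction j)
      case (Suc j)
      then have "v (zp (W j) (q (m - j))) = v (zp (z (Suc m - j)) (q (m - j)))"
        using zf by (intro zp_val_cong) auto
      moreover have "Suc m - j = Suc (m - j)" using Suc by simp
      ultimately show ?case using qh(2)[of "m - j"] by (simp add: W val_mult)
    qed (simp add: W)
    define X where "X i = W (Suc m - i)" for i
    have "v (X i) = v (z i) \<and> eqv (X i * X (Suc i) ^ b i) (X (Suc i) ^ a i * h i)" if i: "i \<le> m" for i
    proof -
      have vX: "v (X k) = v (z k)" if "k \<le> Suc m" for k unfolding X_def using vW[of "Suc m - k"] that by simp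
      have "X i = zp (X (Suc i)) (q i) * h i"
        using W(2)[of "m - i"] i by (simp add: X_def Suc_diff_le)
      moreover have "v (X (Suc i)) \<noteq> Inf" using vX[of "Suc i"] i zf by simp
      ultimately show ?thesis using link vX[of i] i by simp
    qed
    then show "\<exists>X. \<forall>i\<le>m. v (X i) = v (z i) \<and> v (X i * X (Suc i) ^ b i - X (Suc i) ^ a i * h i) = Inf"
      unfolding eqv_def by blast
  qed
  then obtain X where vX: "\<And>i. v (X i) = v (z i)"
    and X: "\<And>i. eqv (X i * X (Suc i) ^ b i) (X (Suc i) ^ a i * h i)"
    unfolding eqv_def by blast
  have Xf: "v (X i) \<noteq> Inf" for i using vX zf by simp
  have Xl: "eqv (X i) (zp (X (Suc i)) (q i) * h i)" for i using X link Xf by blast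
  define rep where "rep i w \<longleftrightarrow> (\<exists>p. \<exists>k\<in>H. eqv w (zp (X i) p * k))" for i w
  define H' where "H' = {w. \<exists>i. rep i w}"
  have rep_Suc: "rep (Suc i) w" if "rep i w" for i w
  proof -
    obtain p k where k: "k \<in> H" and w: "eqv w (zp (X i) p * k)" using \<open>rep i w\<close> unfolding rep_def by blast
    have "eqv (zp (X i) p) (zp (zp (X (Suc i)) (q i) * h i) p)" by (intro zp_cong Xf Xl)
    also have "eqv \<dots> (zp (zp (X (Suc i)) (q i)) p * zp (h i) p)"
      by (intro zp_mult zp_fin Xf sec(2) qh)
    also have "eqv \<dots> (zp (X (Suc i)) (q i * p) * zp (h i) p)"
      by (intro eqv_mult zp_zp Xf eqv_refl)
    finally have "eqv (zp (X i) p * k) (zp (X (Suc i)) (q i * p) * zp (h i) p * k)"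
      by (intro eqv_mult eqv_refl)
    then have "eqv w (zp (X (Suc i)) (q i * p) * (zp (h i) p * k))"
      using eqv_trans[OF w] by (simp add: mult.assoc)
    moreover have "zp (h i) p * k \<in> H" by (intro sec qh k)
    ultimately show ?thesis unfolding rep_def by blast
  qed
  have rep_le: "rep j w" if "rep i w" "i \<le> j" for i j w
    using that(2,1) by (induction j rule: dec_induct) (auto intro: rep_Suc)
  have H'_fin: "v w \<noteq> Inf" if "w \<in> H'" for w
    using that eqv_val zp_fin[OF Xf] sec(2) unfolding H'_def rep_def by (fastforce simp: val_mult)
  have repI: "rep i (zp (X i) p * k)" if "k \<in> H" for i p k using that unfolding rep_def by blast
  have rel_X: "rel n (zp (z i) p) (int (gg (fact i)) * p)" if "n = fact i" for n i p
    using rel_zp[OF zrel[of i]] that by simp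
  have vzX: "v (zp (X i) p) = v (zp (z i) p)" for i p by (intro zp_val_cong Xf vX)
  have gz: "\<exists>w\<in>H'. v w = v y" if r: "rel n y m" "n > 0" for n y m
  proof -
    obtain k where k: "fact n = n * k" using dvd_fact[of n n] r(2) by (auto elim: dvdE)
    have "rel (fact n) y (m * int k)" using rel_up[OF r, of k] k by simp
    from gen[OF this] obtain p h' where "h' \<in> H" "v y = v (zp (Z (fact n)) p * h')" by auto
    then have "v y = v (zp (X n) p * h')" "zp (X n) p * h' \<in> H'"
      using vzX[of n p] repI[of h' n p] by (auto simp: val_mult z_def H'_def)
    then show ?thesis by metis
  qed
  have "pure_section H'"
    unfolding pure_section_def
  proof (intro conjI ballI allI impI)
    show "1 \<in> H'" using repI[OF sec(1), of 0 0] by (auto simp: H'_def)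
    show "v w \<noteq> Inf" if "w \<in> H'" for w using H'_fin that .
  next
    fix w w' assume "w \<in> H'" "w' \<in> H'"
    then obtain i j where "rep i w" "rep j w'" by (auto simp: H'_def)
    then have "rep (max i j) w" "rep (max i j) w'" using rep_le by auto
    then obtain p k p' k' where k: "k \<in> H" "eqv w (zp (X (max i j)) p * k)"
        "k' \<in> H" "eqv w' (zp (X (max i j)) p' * k')" unfolding rep_def by blast
    let ?X = "X (max i j)"
    have "eqv (w * w') (zp ?X p * k * (zp ?X p' * k'))" using k by (intro eqv_mult)
    also have "zp ?X p * k * (zp ?X p' * k') = zp ?X p * zp ?X p' * (k * k')" by (simp add: ac_simps)
    also have "eqv \<dots> (zp ?X (p + p') * (k * k'))"
      using zp_add[OF Xf] by (intro eqv_mult) (auto intro: eqv_sym)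
    finally show "w * w' \<in> H'" using k sec(3) unfolding H'_def rep_def by blast
  next
    fix w y assume w: "w \<in> H'" and wy: "eqv (w * y) 1"
    then obtain i p k where k: "k \<in> H" "eqv w (zp (X i) p * k)" unfolding H'_def rep_def by blast
    have "eqv (w * (zp (X i) (- p) * iv k)) (zp (X i) p * k * (zp (X i) (- p) * iv k))"
      using k by (intro eqv_mult eqv_refl)
    also have "zp (X i) p * k * (zp (X i) (- p) * iv k) = (zp (X i) p * zp (X i) (- p)) * (k * iv k)"
      by (simp add: ac_simps)
    also have "eqv \<dots> (1 * 1)"
      using zp_add[OF Xf, of i p "- p"] eqv_iv[OF sec(2)[OF k(1)]]
      by (intro eqv_mult) (auto intro: eqv_sym)
    finally have "eqv (w * (zp (X i) (- p) * iv k)) (w * y)" using eqv_trans[OF _ eqv_sym[OF wy]] by simp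
    then have "eqv y (zp (X i) (- p) * iv k)" using H'_fin[OF w] eqv_sym by (simp add: eqv_mult_cancel)
    then show "y \<in> H'" using sec(4)[OF k(1)] unfolding H'_def rep_def by blast
  next
    fix w assume w: "w \<in> H'" "v w = 0"
    then obtain i p k where k: "k \<in> H" "eqv w (zp (X i) p * k)" unfolding H'_def rep_def by blast
    \<comment> \<open>An element of value 0 has coordinate 0 along \<open>z0\<close>; this forces
      \<open>p = 0\<close> and leaves an element of \<open>H\<close>.\<close>
    have "v k + v (zp (z i) p) = 0" using eqv_val[OF k(2)] w(2) vzX by (simp add: val_mult add.commute)
    then have "v (zp (z i) p) = - v k" by (rule add_eq_0_imp_neg)
    also have "- v k = v (iv k)" by (rule val_iv[OF sec(2)[OF k(1)], symmetric])
    finally have "v (zp (z i) p ^ fact i) = v (iv k ^ fact i)" by (rule val_power_cong)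
    then have "v (zp (z i) p ^ fact i) = v (zp z0 0 * iv k ^ fact i)" by (simp only: zp_0 mult_1)
    then have "rel (fact i) (zp (z i) p) 0"
      unfolding rel_def by (rule bexI) (rule sec_power[OF H sec(4)[OF k(1)]])
    then have "int (gg (fact i)) * p = 0" by (rule rel_fun[OF rel_X[OF refl]])
    then have "p = 0" using gpos[of "fact i"] by simp
    then have "eqv w k" using k by simp
    moreover have "eqv k 1" using sec_unit[OF H k(1)] eqv_val[OF \<open>eqv w k\<close>] w by simp
    ultimately show "eqv w 1" by (rule eqv_trans)
  next
    fix w y n assume w: "w \<in> H'" and yn: "0 < n \<and> v (y ^ n) = v w"
    then obtain i p k where k: "k \<in> H" "eqv w (zp (X i) p * k)" unfolding H'_def rep_def by blast
    let ?N = "fact i :: nat"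
    obtain h' where h': "h' \<in> H" "v (zp (z i) p ^ ?N) = v (zp z0 (int (gg ?N) * p) * h')"
      using rel_X[of ?N i p] unfolding rel_def by blast
    have "v (y ^ n) = v (zp (z i) p * k)" using yn eqv_val[OF k(2)] vzX by (simp add: val_mult)
    then have "v ((y ^ n) ^ ?N) = v ((zp (z i) p * k) ^ ?N)" by (rule val_power_cong)
    then have "v (y ^ (n * ?N)) = v (zp z0 (int (gg ?N) * p) * (h' * k ^ ?N))"
      using h'(2) by (simp add: power_mult power_mult_distrib val_mult ac_simps)
    then have "rel (n * ?N) y (int (gg ?N) * p)"
      unfolding rel_def using sec(3)[OF h'(1) sec_power[OF H k(1)]] by blast
    then show "\<exists>k\<in>H'. v k = v y" by (rule gz) (use yn in simp)
  qed
  moreover have "H \<subseteq> H'" using repI[of _ 0 0] by (auto simp: H'_def)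
  moreover have "rel 1 z0 1" unfolding rel_def using sec(1) by (intro bexI[of _ 1]) simp_all
  then have "\<exists>w\<in>H'. v w = v z0" by (rule gz) simp
  then have "H \<noteq> H'" using z0(2) by blast
  ultimately show ?thesis by blast
qed

text \<open>Zorn's lemma, starting from the representatives of 1; the trivial group of values is
  pure because an ordered group is torsion-free.\<close>

lemma full_section: "\<exists>H. pure_section H \<and> (\<forall>z. v z \<noteq> Inf \<longrightarrow> (\<exists>h\<in>H. v h = v z))"
proof -
  have "\<exists>M\<in>Collect pure_section. \<forall>X\<in>Collect pure_section. M \<subseteq> X \<longrightarrow> X = M"
  proof (rule subset_Zorn_nonempty)
    have "pure_section {w. eqv w 1}"
      unfolding pure_section_def
    proof (intro conjI ballI allI impI)
      fix h k :: 'a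
      show "1 \<in> {w. eqv w 1}" by simp
      assume h: "h \<in> {w. eqv w 1}"
      then have vh: "v h = 0" using eqv_val by fastforce
      then show "v h \<noteq> Inf" by simp
      show "eqv h 1" using h by simp
      show "h * k \<in> {w. eqv w 1}" if "k \<in> {w. eqv w 1}" using eqv_mult[of h 1 k 1] h that by simp
      show "y \<in> {w. eqv w 1}" if y: "eqv (h * y) 1" for y
      proof -
        have "eqv (h * y) (1 * y)" using h by (intro eqv_mult) auto
        then have "eqv y (h * y)" using eqv_sym by simp
        then show ?thesis using y eqv_trans by simp
      qed
      show "\<exists>k\<in>{w. eqv w 1}. v k = v w" if "0 < n \<and> v (w ^ n) = v h" for w n
        using that val_power_torsion_free[of w n] vh by (intro bexI[of _ 1]) auto
    qed
    then show "Collect pure_section \<noteq> {}" by blast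
    fix \<C> assume ne: "\<C> \<noteq> {}" and ch: "subset.chain (Collect pure_section) \<C>"
    have sub: "pure_section S" if "S \<in> \<C>" for S using ch that by (auto simp: subset.chain_def)
    have "pure_section (\<Union>\<C>)"
      unfolding pure_section_def
    proof (intro conjI ballI allI impI)
      show "1 \<in> \<Union>\<C>" using ne sub sec_1 by blast
    next
      fix h assume "h \<in> \<Union>\<C>"
      then obtain S where S: "S \<in> \<C>" "h \<in> S" by blast
      show "v h \<noteq> Inf" using sec_fin[OF sub] S by blast
      show "y \<in> \<Union>\<C>" if "eqv (h * y) 1" for y using sec_inv[OF sub S(2) that] S by blast
      show "eqv h 1" if "v h = 0" using sec_unit[OF sub S(2) that] S by blast
      show "\<exists>k\<in>\<Union>\<C>. v k = v w" if "0 < n \<and> v (w ^ n) = v h" for w n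
        using sec_pure[OF sub S(2)] S that by blast
      fix k assume "k \<in> \<Union>\<C>"
      then obtain T where T: "T \<in> \<C>" "k \<in> T" by blast
      have "S \<subset> T \<or> S = T \<or> T \<subset> S" using ch S T unfolding subset.chain_def by blast
      then obtain U where "U \<in> \<C>" "h \<in> U" "k \<in> U" using S T by blast
      then show "h * k \<in> \<Union>\<C>" using sec_mult[OF sub] by blast
    qed
    then show "\<Union>\<C> \<in> Collect pure_section" by simp
  qed
  then obtain M where M: "pure_section M" "\<And>X. pure_section X \<Longrightarrow> M \<subseteq> X \<Longrightarrow> X = M" by auto
  have "\<exists>h\<in>M. v h = v z" if "v z \<noteq> Inf" for z
  proof (rule ccontr)
    assume "\<not> (\<exists>h\<in>M. v h = v z)"
    then have "\<exists>H'. pure_section H' \<and> M \<subset> H'" using extend_pure_section[OF M(1) that] by blast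
    then show False using M(2) by blast
  qed
  then show ?thesis using M(1) by blast
qed

text \<open>Divide \<open>x\<close> by the element \<open>s x\<close> of the section with the same
  value. The choice of \<open>s x\<close> depends on the representative, but only up to
  \<open>eqv\<close>, as the last clause records.\<close>

lemma angular_component:
  "\<exists>ac. (\<forall>x. v x \<noteq> Inf \<longrightarrow> v (ac x) = 0) \<and>
    (\<forall>x y. v x \<noteq> Inf \<longrightarrow> v y \<noteq> Inf \<longrightarrow> 0 < v (ac (x * y) - ac x * ac y)) \<and>
    (\<forall>x. v x = 0 \<longrightarrow> 0 < v (ac x - x)) \<and>
    (\<forall>x y. v x \<noteq> Inf \<longrightarrow> v x < v (y - x) \<longrightarrow> 0 < v (ac y - ac x)) \<and>
    (\<forall>x y. v x \<noteq> Inf \<longrightarrow> eqv x y \<longrightarrow> eqv (ac x) (ac y))"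
proof -
  obtain H where H: "pure_section H" "\<And>z. v z \<noteq> Inf \<Longrightarrow> \<exists>h\<in>H. v h = v z" using full_section by blast
  then obtain s where s: "\<And>z. v z \<noteq> Inf \<Longrightarrow> s z \<in> H" "\<And>z. v z \<noteq> Inf \<Longrightarrow> v (s z) = v z" by metis
  define t where "t x = iv (s x)" for x
  have st: "eqv (s x * t x) 1" if "v x \<noteq> Inf" for x
    unfolding t_def using eqv_iv sec_fin[OF H(1)] s that by blast
  have tH: "t x \<in> H" if "v x \<noteq> Inf" for x unfolding t_def using sec_iv[OF H(1)] s that by blast
  have vt: "v x + v (t x) = 0" if "v x \<noteq> Inf" for x using val_inv_add[OF st[OF that]] s that by simp
  have tf: "v (t x) \<noteq> Inf" if "v x \<noteq> Inf" for x using vt[OF that] by auto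
  have t_eq: "eqv (t x) k" if "v x \<noteq> Inf" "k \<in> H" "v x + v k = 0" for x k
    using that vt[OF that(1)] tH sec_val_inj[OF H(1)] by (metis add_eq_0_imp_neg)
  show ?thesis
  proof (intro exI[of _ "\<lambda>x. x * t x"] conjI allI impI)
    fix x assume x: "v x \<noteq> Inf"
    then show "v (x * t x) = 0" using vt by (simp add: val_mult)
    fix y
    show "0 < v (x * y * t (x * y) - x * t x * (y * t y))" if y: "v y \<noteq> Inf"
    proof -
      have "eqv (t (x * y)) (t x * t y)"
      proof (rule t_eq)
        show "v (x * y) \<noteq> Inf" using x y by (simp add: val_mult)
        show "t x * t y \<in> H" by (intro sec_mult[OF H(1)] tH x y)
        have "v (x * y) + v (t x * t y) = (v x + v (t x)) + (v y + v (t y))"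
          by (simp add: val_mult ac_simps)
        then show "v (x * y) + v (t x * t y) = 0" using vt x y by simp
      qed
      then have "eqv (x * y * t (x * y)) (x * y * (t x * t y))" by (intro eqv_mult) auto
      then show ?thesis by (simp add: eqv_def ac_simps)
    qed
    show "0 < v (y * t y - x * t x)" if c: "v x < v (y - x)"
    proof -
      have vy: "v y = v x" by (rule val_eq_of_close[OF c])
      have "eqv (t y) (t x)" using x vy vt[OF x] by (intro t_eq[OF _ tH[OF x]]) simp_all
      then have "eqv (y * t y - x * t x) (y * t x - x * t x)" by (intro eqv_diff eqv_mult) auto
      then have "v (y * t y - x * t x) = v (y * t x - x * t x)" by (rule eqv_val)
      also have "y * t x - x * t x = t x * (y - x)" by (simp add: algebra_simps)
      finally have "v (y * t y - x * t x) = v (t x) + v (y - x)" by (simp add: val_mult)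
      moreover have "v (t x) + v x < v (t x) + v (y - x)" using c tf[OF x] by (simp add: fin_add_less_cancel)
      ultimately show ?thesis using vt[OF x] by (simp add: add.commute)
    qed
    show "eqv (x * t x) (y * t y)" if e: "eqv x y"
    proof -
      have vy: "v y = v x" using eqv_val[OF e] by simp
      have "eqv (t y) (t x)" using x vy vt[OF x] by (intro t_eq[OF _ tH[OF x]]) simp_all
      then show ?thesis using e by (intro eqv_mult) (auto intro: eqv_sym)
    qed
  next
    fix x assume x: "v x = 0"
    then have "eqv (t x) 1" using sec_1[OF H(1)] by (intro t_eq) auto
    then have "eqv (x * t x) (x * 1)" by (intro eqv_mult) auto
    then show "0 < v (x * t x - x)" by (simp add: eqv_def)
  qed
qed

end

section \<open>Representing a valued field by a commutative ring type class\<close>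

text \<open>The product of all commutative rings on a type. It maps onto each of them, so that computations in
  such a ring can be pulled back to a type of class \<^class>\<open>comm_ring_1\<close>; the factor
  \<^typ>\<open>int\<close> only ensures \<open>0 \<noteq> 1\<close>.\<close>

typedef ('a, 'm) all_crings =
  "{f :: int \<times> (('a, 'm) ring_scheme \<Rightarrow> 'a).
     (\<forall>K. cring K \<longrightarrow> snd f K \<in> carrier K) \<and> (\<forall>K. \<not> cring K \<longrightarrow> snd f K = undefined)}"
  by (intro exI[of _ "(0, \<lambda>K. if cring K then \<zero>\<^bsub>K\<^esub> else undefined)"])
    (auto simp: cring.cring_simprules)

setup_lifting type_definition_all_crings

instantiation all_crings :: (type, type) comm_ring_1
begin

lift_definition zero_all_crings :: "('a, 'b) all_crings" is
  "(0, \<lambda>K. if cring K then \<zero>\<^bsub>K\<^esub> else undefined)"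
  by (auto simp: cring.cring_simprules)

lift_definition one_all_crings :: "('a, 'b) all_crings" is
  "(1, \<lambda>K. if cring K then \<one>\<^bsub>K\<^esub> else undefined)"
  by (auto simp: cring.cring_simprules)

lift_definition plus_all_crings :: "('a, 'b) all_crings \<Rightarrow> ('a, 'b) all_crings \<Rightarrow> ('a, 'b) all_crings" is
  "\<lambda>f g. (fst f + fst g, \<lambda>K. if cring K then snd f K \<oplus>\<^bsub>K\<^esub> snd g K else undefined)"
  by (auto simp: cring.cring_simprules)

lift_definition times_all_crings :: "('a, 'b) all_crings \<Rightarrow> ('a, 'b) all_crings \<Rightarrow> ('a, 'b) all_crings" is
  "\<lambda>f g. (fst f * fst g, \<lambda>K. if cring K then snd f K \<otimes>\<^bsub>K\<^esub> snd g K else undefined)"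
  by (auto simp: cring.cring_simprules)

lift_definition uminus_all_crings :: "('a, 'b) all_crings \<Rightarrow> ('a, 'b) all_crings" is
  "\<lambda>f. (- fst f, \<lambda>K. if cring K then \<ominus>\<^bsub>K\<^esub> snd f K else undefined)"
  by (auto simp: cring.cring_simprules)

definition minus_all_crings :: "('a, 'b) all_crings \<Rightarrow> ('a, 'b) all_crings \<Rightarrow> ('a, 'b) all_crings" where
  "minus_all_crings x y = x + - y"

instance
proof
  fix a b c :: "('a, 'b) all_crings"
  show "a * b * c = a * (b * c)"
    by transfer (auto simp: fun_eq_iff cring.cring_simprules mult.assoc)
  show "a * b = b * a"
    by transfer (auto simp: fun_eq_iff cring.cring_simprules mult.commute)
  show "1 * a = a"
    by transfer (auto simp: fun_eq_iff cring.cring_simprules prod_eq_iff)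
  show "a + b + c = a + (b + c)"
    by transfer (auto simp: fun_eq_iff cring.cring_simprules add.assoc)
  show "a + b = b + a"
    by transfer (auto simp: fun_eq_iff cring.cring_simprules add.commute)
  show "0 + a = a"
    by transfer (auto simp: fun_eq_iff cring.cring_simprules prod_eq_iff)
  show "- a + a = 0"
    by transfer (auto simp: fun_eq_iff cring.cring_simprules)
  show "a - b = a + - b"
    by (simp add: minus_all_crings_def)
  show "(a + b) * c = a * c + b * c"
    by transfer (auto simp: fun_eq_iff cring.cring_simprules distrib_right)
  show "(0 :: ('a, 'b) all_crings) \<noteq> 1"
    by transfer simp
qed

end

lift_definition proj :: "('a, 'm) ring_scheme \<Rightarrow> ('a, 'm) all_crings \<Rightarrow> 'a" is "\<lambda>K f. snd f K" .

lemma
  assumes "cring K"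
  shows proj_closed: "proj K z \<in> carrier K"
    and proj_1: "proj K 1 = \<one>\<^bsub>K\<^esub>"
    and proj_add: "proj K (z + w) = proj K z \<oplus>\<^bsub>K\<^esub> proj K w"
    and proj_mult: "proj K (z * w) = proj K z \<otimes>\<^bsub>K\<^esub> proj K w"
  using assms by (transfer; auto)+

lemma proj_surj: "cring K \<Longrightarrow> a \<in> carrier K \<Longrightarrow> \<exists>z. proj K z = a"
proof -
  assume K: "cring K" "a \<in> carrier K"
  let ?f = "(0 :: int, \<lambda>L. if L = K then a else if cring L then \<zero>\<^bsub>L\<^esub> else undefined)"
  have "proj K (Abs_all_crings ?f) = a"
    using K by (simp add: proj.rep_eq Abs_all_crings_inverse cring.cring_simprules)
  then show ?thesis ..
qed

text \<open>The common ring of the two fields will be a product, one component for each field, so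
  that any two elements can be glued to a pair.\<close>

instantiation prod :: (comm_ring_1, comm_ring_1) comm_ring_1
begin

definition one_prod :: "'a \<times> 'b" where "one_prod = (1, 1)"
definition times_prod :: "'a \<times> 'b \<Rightarrow> 'a \<times> 'b \<Rightarrow> 'a \<times> 'b" where
  "times_prod x y = (fst x * fst y, snd x * snd y)"

instance
  by standard (auto simp: one_prod_def times_prod_def prod_eq_iff algebra_simps)

end

text \<open>A subring \<open>D\<close> is part of the data because the residue map respects the
  operations only on integral elements.\<close>

locale ring_rep = R: cring R for R (structure) +
  fixes D :: "'z::comm_ring_1 set" and h :: "'z \<Rightarrow> 'a"
  assumes D: "subring_of D" and h_closed: "z \<in> D \<Longrightarrow> h z \<in> carrier R" and h_1: "h 1 = \<one>"
    and h_add: "z \<in> D \<Longrightarrow> w \<in> D \<Longrightarrow> h (z + w) = h z \<oplus> h w"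
    and h_mult: "z \<in> D \<Longrightarrow> w \<in> D \<Longrightarrow> h (z * w) = h z \<otimes> h w"
begin

lemma h_0: "h 0 = \<zero>"
proof -
  have "h 0 \<in> carrier R" using h_closed subring_0[OF D] by blast
  moreover have "h 0 \<oplus> h 0 = h 0" using h_add[of 0 0] subring_0[OF D] by simp
  ultimately show ?thesis using R.add.r_cancel_one' by metis
qed

lemma h_uminus: "z \<in> D \<Longrightarrow> h (- z) = \<ominus> h z"
proof -
  assume z: "z \<in> D"
  have "h (- z) \<oplus> h z = \<zero>" using h_add[of "- z" z] h_0 z subring_uminus[OF D] by simp
  then show ?thesis using R.minus_equality h_closed z subring_uminus[OF D] by metis
qed

lemma h_diff: "z \<in> D \<Longrightarrow> w \<in> D \<Longrightarrow> h (z - w) = h z \<ominus> h w"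
  using h_add[of z "- w"] h_uminus[of w] subring_uminus[OF D] by (simp add: a_minus_def)

lemma h_power: "z \<in> D \<Longrightarrow> h (z ^ n) = h z [^] n"
proof (induction n)
  case (Suc n)
  then have "h (z ^ Suc n) = h (z ^ n * z)" by (simp add: mult.commute)
  also have "\<dots> = h (z ^ n) \<otimes> h z" using Suc.prems subring_power[OF D] by (intro h_mult)
  finally show ?case using Suc by simp
qed (simp add: h_1)

lemma h_of_nat: "h (of_nat n) = [n] \<cdot> \<one>"
proof (induction n)
  case (Suc n)
  have "h (of_nat (Suc n)) = h (of_nat n + 1)" by (simp add: add.commute)
  also have "\<dots> = h (of_nat n) \<oplus> h 1" by (intro h_add subring_of_nat subring_1 D)
  finally show ?case using Suc h_1 by (simp add: R.add.nat_pow_Suc)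
qed (simp add: h_0)

lemma h_of_nat_mult: "z \<in> D \<Longrightarrow> h (of_nat n * z) = [n] \<cdot> h z"
proof (induction n)
  case (Suc n)
  have "h (of_nat (Suc n) * z) = h (of_nat n * z + z)" by (simp add: algebra_simps)
  also have "\<dots> = h (of_nat n * z) \<oplus> h z"
    using Suc.prems by (intro h_add subring_mult subring_of_nat D) auto
  finally show ?case using Suc by (simp add: R.add.nat_pow_Suc)
qed (simp add: h_0)

lemma h_sum: "(\<And>i. i \<le> n \<Longrightarrow> f i \<in> D) \<Longrightarrow> h (\<Sum>i\<le>n. f i) = (\<Oplus>i\<in>{..n}. h (f i))" for n :: nat
proof (induction n)
  case 0
  then show ?case using h_closed by simp
next
  case (Suc n)
  have "h (\<Sum>i\<le>Suc n. f i) = h (f (Suc n) + (\<Sum>i\<le>n. f i))" by (simp add: add.commute)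
  also have "\<dots> = h (f (Suc n)) \<oplus> h (\<Sum>i\<le>n. f i)"
    using Suc.prems by (intro h_add subring_sum D) auto
  also have "\<dots> = (\<Oplus>i\<in>{..Suc n}. h (f i))"
    using Suc h_closed by (subst R.finsum_Suc) auto
  finally show ?case .
qed

text \<open>\<open>h\<close> may annihilate leading coefficients, so \<open>deg R\<close> can be
  smaller than \<open>degree p\<close>; the surplus terms are 0.\<close>

lemma UP_eval_poly:
  assumes p: "p \<in> coeffs_in D" and b: "b \<in> D"
  shows "h \<circ> coeff p \<in> carrier (UP R)" "UP_eval R (h \<circ> coeff p) (h b) = h (poly p b)"
proof -
  have cl: "h (coeff p i) \<in> carrier R" for i using p h_closed coeffs_inD by blast
  have bd: "bound \<zero> (degree p) (h \<circ> coeff p)"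
    by (rule bound.intro) (simp add: coeff_eq_0 h_0)
  then show up: "h \<circ> coeff p \<in> carrier (UP R)" using cl by (auto simp: UP_def up_def)
  let ?d = "deg R (h \<circ> coeff p)"
  have co: "up_ring.coeff (UP R) (h \<circ> coeff p) = h \<circ> coeff p" using up by (auto simp: UP_def)
  have dle: "?d \<le> degree p" unfolding deg_def co using bd by (rule Least_le)
  have "bound \<zero> ?d (h \<circ> coeff p)" unfolding deg_def co using bd by (rule LeastI)
  then have z: "h (coeff p i) = \<zero>" if "?d < i" for i using bound.bound[of \<zero> ?d "h \<circ> coeff p" i] that by simp
  have hb: "h b \<in> carrier R" using b h_closed by blast
  have "UP_eval R (h \<circ> coeff p) (h b) = (\<Oplus>i\<in>{..?d}. h (coeff p i) \<otimes> h b [^] i)"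
    using up by (simp add: UP_eval_def eval_def co)
  also have "\<dots> = (\<Oplus>i\<in>{..degree p}. h (coeff p i) \<otimes> h b [^] i)"
    using dle z hb cl by (intro R.add.finprod_mono_neutral_cong_left) auto
  also have "\<dots> = (\<Oplus>i\<in>{..degree p}. h (coeff p i * b ^ i))"
    using p b hb cl D h_closed
    by (intro R.finsum_cong') (auto simp: h_mult h_power coeffs_inD subring_power)
  also have "\<dots> = h (poly p b)"
    unfolding poly_altdef using p b D
    by (intro h_sum[symmetric]) (auto intro: subring_mult subring_power coeffs_inD)
  finally show "UP_eval R (h \<circ> coeff p) (h b) = h (poly p b)" .
qed

end

section \<open>Pulling a Henselian valued field back to a ring\<close>

locale vf_rep = valued_field K v for K (structure) and v :: "'a \<Rightarrow> 'g::linordered_ab_group_add with_inf" +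
  fixes \<pi> :: "'z::comm_ring_1 \<Rightarrow> 'a"
  assumes hens: "henselian K v" and equi: "equichar_zero K v"
    and pi_closed: "\<pi> z \<in> carrier K" and pi_1: "\<pi> 1 = \<one>"
    and pi_add: "\<pi> (z + w) = \<pi> z \<oplus> \<pi> w" and pi_mult: "\<pi> (z * w) = \<pi> z \<otimes> \<pi> w"
    and pi_surj: "a \<in> carrier K \<Longrightarrow> \<exists>z. \<pi> z = a"
begin

sublocale P: ring_rep K UNIV \<pi>
  by unfold_locales (auto simp: pi_closed pi_1 pi_add pi_mult subring_of_def)

definition "v0 z = v (\<pi> z)"

lemma v0_Inf: "v0 z = Inf \<longleftrightarrow> \<pi> z = \<zero>"
  by (simp add: v0_def val_eq_Inf_iff pi_closed)

lemma v0_supp_val: "supp_val v0"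
proof
  show "v0 0 = Inf" by (simp add: v0_Inf P.h_0)
  have m: "v0 (x * y) = v0 x + v0 y" for x y
  proof (cases "\<pi> x = \<zero> \<or> \<pi> y = \<zero>")
    case True
    then have "\<pi> (x * y) = \<zero>" using pi_closed by (auto simp: pi_mult)
    then show ?thesis using True by (metis add_eq_Inf_iff v0_Inf)
  next
    case False
    then show ?thesis using val_mult[of "\<pi> x" "\<pi> y"] pi_closed by (simp add: v0_def pi_mult)
  qed
  then show "v0 (x * y) = v0 x + v0 y" for x y .
  have "v0 1 \<noteq> Inf" using one_not_zero by (simp add: v0_Inf pi_1)
  then show "v0 1 = 0" using m[of 1 1] fin_add_cancel_0[of "v0 1" "v0 1"] by simp
  show "min (v0 x) (v0 y) \<le> v0 (x + y)" for x y
    using val_add pi_closed by (simp add: v0_def pi_add)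
  show "\<exists>y. v0 (x * y - 1) = Inf" if "v0 x \<noteq> Inf" for x
  proof -
    have "\<pi> x \<in> Units K" using that pi_closed field_Units by (simp add: v0_Inf)
    then obtain b where "b \<in> carrier K" "\<pi> x \<otimes> b = \<one>" by (auto simp: Units_def)
    then obtain y where "\<pi> x \<otimes> \<pi> y = \<one>" using pi_surj by blast
    then have "\<pi> (x * y - 1) = \<zero>" by (simp add: P.h_diff pi_mult pi_1 r_neg a_minus_def)
    then show ?thesis using v0_Inf by blast
  qed
qed

sublocale S: supp_val v0
  by (rule v0_supp_val)

abbreviation "\<O> \<equiv> valuation_ring K v"
abbreviation "k \<equiv> residue_field K v"
abbreviation "\<MM> \<equiv> valuation_ideal K v"

definition "ints = {z. 0 \<le> v0 z}"

lemma ints_subring: "subring_of ints"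
  unfolding subring_of_def ints_def by (auto simp: S.le_val_diff S.val_mult add_nonneg_nonneg)

lemma O_carrier: "carrier \<O> = {a \<in> carrier K. 0 \<le> v a}" and
  O_simps: "a \<oplus>\<^bsub>\<O>\<^esub> b = a \<oplus> b" "a \<otimes>\<^bsub>\<O>\<^esub> b = a \<otimes> b" "\<one>\<^bsub>\<O>\<^esub> = \<one>" "\<zero>\<^bsub>\<O>\<^esub> = \<zero>"
  by (auto simp: valuation_ring_def)

lemma O_carrier_iff: "\<pi> z \<in> carrier \<O> \<longleftrightarrow> z \<in> ints"
  by (simp add: O_carrier pi_closed ints_def v0_def)

lemma O_ex: "a \<in> carrier \<O> \<Longrightarrow> \<exists>z\<in>ints. a = \<pi> z"
  using pi_surj[of a] O_carrier_iff by (auto simp: O_carrier)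

lemma O_closed:
  assumes "a \<in> carrier \<O>" "b \<in> carrier \<O>"
  shows "a \<oplus> b \<in> carrier \<O>" "a \<otimes> b \<in> carrier \<O>" "\<ominus> a \<in> carrier \<O>"
proof -
  obtain z w where z: "z \<in> ints" "a = \<pi> z" and w: "w \<in> ints" "b = \<pi> w" using O_ex assms by meson
  show "\<ominus> a \<in> carrier \<O>"
    using z O_carrier_iff[of "- z"] subring_uminus[OF ints_subring] P.h_uminus[of z] by simp
  show "a \<oplus> b \<in> carrier \<O>" "a \<otimes> b \<in> carrier \<O>"
    using z w subring_add[OF ints_subring] subring_mult[OF ints_subring]
    by (auto simp: O_carrier_iff pi_add[symmetric] pi_mult[symmetric])
qed

lemma O_cring: "cring \<O>"
proof (rule cringI)
  have K: "a \<in> carrier K" if "a \<in> carrier \<O>" for a using that by (simp add: O_carrier)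
  have 0: "\<zero> \<in> carrier \<O>" and 1: "\<one> \<in> carrier \<O>"
    using O_carrier_iff[of 0] O_carrier_iff[of 1] subring_0[OF ints_subring] subring_1[OF ints_subring]
    by (simp_all add: P.h_0 pi_1)
  show "abelian_group \<O>"
  proof (rule abelian_groupI)
    fix x assume x: "x \<in> carrier \<O>"
    show "\<exists>y\<in>carrier \<O>. y \<oplus>\<^bsub>\<O>\<^esub> x = \<zero>\<^bsub>\<O>\<^esub>"
      using O_closed[OF x x] l_neg[OF K[OF x]] by (auto simp: O_simps)
  qed (use O_closed K 0 in \<open>auto simp: O_simps a_ac\<close>)
  show "comm_monoid \<O>"
    by (rule comm_monoidI) (use O_closed K 1 in \<open>auto simp: O_simps m_ac\<close>)
  show "(x \<oplus>\<^bsub>\<O>\<^esub> y) \<otimes>\<^bsub>\<O>\<^esub> z = x \<otimes>\<^bsub>\<O>\<^esub> z \<oplus>\<^bsub>\<O>\<^esub> y \<otimes>\<^bsub>\<O>\<^esub> z"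
    if "x \<in> carrier \<O>" "y \<in> carrier \<O>" "z \<in> carrier \<O>" for x y z
    using that K by (simp add: O_simps l_distr)
qed

sublocale V: ring_rep \<O> ints \<pi>
  using O_cring O_carrier_iff
  by (intro ring_rep.intro ring_rep_axioms.intro ints_subring) (auto simp: O_simps pi_1 pi_add pi_mult)

lemma M_iff: "\<pi> z \<in> \<MM> \<longleftrightarrow> 0 < v0 z"
  by (simp add: valuation_ideal_def pi_closed v0_def)

lemma M_ex: "a \<in> \<MM> \<Longrightarrow> \<exists>z\<in>ints. a = \<pi> z \<and> 0 < v0 z"
proof -
  assume a: "a \<in> \<MM>"
  then obtain z where z: "\<pi> z = a" using pi_surj[of a] by (auto simp: valuation_ideal_def)
  then have "0 < v0 z" using a M_iff by blast
  then show ?thesis using z by (intro bexI[of _ z]) (auto simp: ints_def)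
qed

lemma M_ideal: "ideal \<MM> \<O>"
proof (rule idealI)
  show "ring \<O>" using O_cring by (rule cring.axioms(1))
  show mm: "a \<otimes>\<^bsub>\<O>\<^esub> x \<in> \<MM>" if a: "a \<in> \<MM>" and x: "x \<in> carrier \<O>" for a x
  proof -
    obtain z where z: "a = \<pi> z" "0 < v0 z" using M_ex[OF a] by blast
    obtain w where w: "w \<in> ints" "x = \<pi> w" using O_ex[OF x] by blast
    have "0 < v0 (z * w)" using z(2) w(1) by (simp add: S.val_mult ints_def add_pos_nonneg)
    then show ?thesis using M_iff[of "z * w"] by (simp add: z w O_simps pi_mult)
  qed
  show "x \<otimes>\<^bsub>\<O>\<^esub> a \<in> \<MM>" if a: "a \<in> \<MM>" and x: "x \<in> carrier \<O>" for a x
  proof -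
    have "a \<in> carrier \<O>" using a by (auto simp: valuation_ideal_def O_carrier)
    then have "x \<otimes>\<^bsub>\<O>\<^esub> a = a \<otimes>\<^bsub>\<O>\<^esub> x" using x cring.cring_simprules(14)[OF O_cring] by blast
    then show ?thesis using mm[OF a x] by simp
  qed
  show "subgroup \<MM> (add_monoid \<O>)"
  proof (rule group.subgroupI)
    show "Group.group (add_monoid \<O>)" using O_cring
      by (simp add: abelian_group.a_group cring.axioms(1) ring.is_abelian_group)
    show "\<MM> \<subseteq> carrier (add_monoid \<O>)" by (auto simp: valuation_ideal_def O_carrier)
    have "\<pi> 0 \<in> \<MM>" by (simp add: M_iff)
    then show "\<MM> \<noteq> {}" by blast
    fix a assume "a \<in> \<MM>"
    then obtain z where z: "z \<in> ints" "a = \<pi> z" "0 < v0 z" using M_ex by blast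
    have "inv\<^bsub>add_monoid \<O>\<^esub> a = \<pi> (- z)" using V.h_uminus[OF z(1)] z(2) by (simp add: a_inv_def)
    then show "inv\<^bsub>add_monoid \<O>\<^esub> a \<in> \<MM>" using z(3) by (simp add: M_iff)
    fix b assume "b \<in> \<MM>"
    then obtain w where w: "b = \<pi> w" "0 < v0 w" using M_ex by blast
    have "a \<otimes>\<^bsub>add_monoid \<O>\<^esub> b = \<pi> (z + w)" by (simp add: z w O_simps pi_add)
    then show "a \<otimes>\<^bsub>add_monoid \<O>\<^esub> b \<in> \<MM>" using S.less_val_add[OF z(3) w(2)] by (simp add: M_iff)
  qed
qed

definition "rs z = residue_map K v (\<pi> z)"

lemma k_cring: "cring k"
  unfolding residue_field_def using M_ideal O_cring by (rule ideal.quotient_is_cring)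

lemma rs_int: "z \<in> ints \<Longrightarrow> rs z = \<MM> +>\<^bsub>\<O>\<^esub> \<pi> z"
  by (simp add: rs_def residue_map_def O_carrier_iff)

sublocale Q: ring_rep k ints rs
proof (intro ring_rep.intro ring_rep_axioms.intro k_cring ints_subring)
  note h = ideal.rcos_ring_hom[OF M_ideal, folded residue_field_def]
  show "rs z \<in> carrier k" if "z \<in> ints" for z
    using ring_hom_closed[OF h] that by (simp add: rs_int O_carrier_iff)
  show "rs 1 = \<one>\<^bsub>k\<^esub>"
    using ring_hom_one[OF h] by (simp add: rs_int subring_1[OF ints_subring] pi_1 O_simps)
  show "rs (z + w) = rs z \<oplus>\<^bsub>k\<^esub> rs w" if "z \<in> ints" "w \<in> ints" for z w
    using ring_hom_add[OF h, of "\<pi> z" "\<pi> w"] that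
    by (simp add: rs_int O_carrier_iff subring_add[OF ints_subring] pi_add O_simps)
  show "rs (z * w) = rs z \<otimes>\<^bsub>k\<^esub> rs w" if "z \<in> ints" "w \<in> ints" for z w
    using ring_hom_mult[OF h, of "\<pi> z" "\<pi> w"] that
    by (simp add: rs_int O_carrier_iff subring_mult[OF ints_subring] pi_mult O_simps)
qed

lemma rs_eq: "z \<in> ints \<Longrightarrow> w \<in> ints \<Longrightarrow> rs z = rs w \<longleftrightarrow> 0 < v0 (z - w)"
  using ring.quotient_eq_iff_same_a_r_cos[OF cring.axioms(1)[OF O_cring] M_ideal, of "\<pi> z" "\<pi> w"]
    M_iff[of "z - w"] V.h_diff[of z w]
  by (simp add: rs_int O_carrier_iff)

lemma rs_non_int: "z \<notin> ints \<Longrightarrow> rs z = \<zero>\<^bsub>k\<^esub>"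
  by (simp add: rs_def residue_map_def O_carrier_iff)

lemma k_carrier: "carrier k = range rs"
proof
  show "carrier k \<subseteq> range rs"
  proof
    fix x assume "x \<in> carrier k"
    then obtain a where a: "a \<in> carrier \<O>" "x = \<MM> +>\<^bsub>\<O>\<^esub> a"
      unfolding residue_field_def FactRing_simps by auto
    obtain z where "z \<in> ints" "a = \<pi> z" using O_ex[OF a(1)] by blast
    then have "x = rs z" using a(2) rs_int by simp
    then show "x \<in> range rs" by (rule range_eqI)
  qed
  have "rs z \<in> carrier k" for z
    using Q.h_closed[of z] Q.h_closed[of 0] rs_non_int[of z] Q.h_0 subring_0[OF ints_subring]
    by (cases "z \<in> ints") auto
  then show "range rs \<subseteq> carrier k" by blast
qed

text \<open>Positive integers have nonzero residues, hence are units. The Hensel property is used at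
  the residue 0, with evaluation and formal derivative translated to \<open>poly\<close> and
  \<open>hasse 1\<close>.\<close>

lemma v0_hens_val: "hens_val v0"
proof (intro hens_val.intro hens_val_axioms.intro v0_supp_val)
  fix n :: nat assume n: "n > 0"
  have "rs (of_nat n) \<noteq> rs 0"
    using equi n unfolding equichar_zero_def char_zero_def by (simp add: Q.h_of_nat Q.h_0)
  then have "\<not> 0 < v0 (of_nat n)"
    using rs_eq[of "of_nat n" 0] subring_of_nat[OF ints_subring, of n] subring_0[OF ints_subring] by simp
  then show "v0 (of_nat n) = 0" using S.val_of_nat_ge_0[of n] by (simp add: less_le)
next
  show "S.hensel_on UNIV"
    unfolding S.hensel_on_def
  proof (intro ballI impI)
    fix p assume a: "(\<forall>i. 0 \<le> v0 (coeff p i)) \<and> 0 < v0 (coeff p 0) \<and> v0 (coeff p 1) = 0"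
    have p: "p \<in> coeffs_in ints" using a by (simp add: coeffs_in_def ints_def)
    have p': "hasse 1 p \<in> coeffs_in ints" by (rule coeffs_in_hasse[OF ints_subring p])
    have 0: "0 \<in> ints" by (rule subring_0[OF ints_subring])
    have c: "coeff p i \<in> ints" for i using p coeffs_inD by blast
    have r1: "residue_map K v \<circ> (\<pi> \<circ> coeff p) = rs \<circ> coeff p" by (auto simp: rs_def)
    have r2: "residue_map K v \<circ> UP_deriv \<O> (\<pi> \<circ> coeff p) = rs \<circ> coeff (hasse 1 p)"
    proof
      fix i
      have "UP_deriv \<O> (\<pi> \<circ> coeff p) i = \<pi> (of_nat (Suc i) * coeff p (Suc i))"
        unfolding UP_deriv_def o_apply by (rule V.h_of_nat_mult[OF c, symmetric])
      then show "(residue_map K v \<circ> UP_deriv \<O> (\<pi> \<circ> coeff p)) i = (rs \<circ> coeff (hasse 1 p)) i"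
        by (simp add: rs_def coeff_hasse)
    qed
    have "UP_eval k (rs \<circ> coeff p) (rs 0) = \<zero>\<^bsub>k\<^esub>"
      unfolding Q.UP_eval_poly(2)[OF p 0] using rs_eq[OF c[of 0] 0] a by (simp add: poly_0_coeff_0 Q.h_0)
    moreover have "UP_eval k (rs \<circ> coeff (hasse 1 p)) (rs 0) \<noteq> \<zero>\<^bsub>k\<^esub>"
      unfolding Q.UP_eval_poly(2)[OF p' 0] using rs_eq[OF c[of 1] 0] a
      by (simp add: poly_0_coeff_0 Q.h_0 coeff_hasse)
    ultimately obtain b where b: "b \<in> carrier \<O>" "UP_eval \<O> (\<pi> \<circ> coeff p) b = \<zero>\<^bsub>\<O>\<^esub>" "residue_map K v b = rs 0"
      using hens[unfolded henselian_def, rule_format, OF V.UP_eval_poly(1)[OF p 0] Q.h_closed[OF 0]]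
      unfolding r1 r2 by blast
    then obtain y where y: "y \<in> ints" "b = \<pi> y" using O_ex by blast
    have "v0 (poly p y) = Inf" using b(2) unfolding y(2) V.UP_eval_poly(2)[OF p y(1)] by (simp add: v0_Inf O_simps)
    moreover have "0 < v0 y" using b(3) rs_eq[OF y(1) 0] by (simp add: y(2) rs_def)
    ultimately show "\<exists>b\<in>UNIV. 0 < v0 b \<and> v0 (poly p b) = Inf" by blast
  qed
qed

lemma group_universe: "insert Inf (value_group K v) = range v0"
proof -
  have "v ` carrier K = range v0" using pi_surj pi_closed by (fastforce simp: v0_def)
  moreover have "v \<zero> = Inf" by (simp add: val_eq_Inf_iff)
  then have "insert Inf (value_group K v) = v ` carrier K" by (force simp: value_group_def)
  ultimately show ?thesis by simp
qed

end

section \<open>Satisfaction in ultrapowers and elementary maps\<close>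

instance ring_sym :: countable by countable_datatype
instance gp_sym :: countable by countable_datatype
instance gp_rel :: countable by countable_datatype
instance fo_term :: (countable, countable) countable by countable_datatype
instance fo_formula :: (countable, countable, countable) countable by countable_datatype

lemma finite_term_vars: "finite (term_vars t)"
  by (induction t) auto

lemma finite_free_vars: "finite (free_vars \<phi>)"
  by (induction \<phi>) (auto simp: finite_term_vars)

lemma term_val_cong: "(\<And>x. x \<in> term_vars t \<Longrightarrow> e x = e' x) \<Longrightarrow> term_val M e t = term_val M e' t"
proof (induction t)
  case (App f ts)
  then have "map (term_val M e) ts = map (term_val M e') ts" by (intro map_cong) auto
  then show ?case by (simp only: term_val.simps)
qed simp

lemma satisfies_cong:
  "(\<And>x. x \<in> free_vars \<phi> \<Longrightarrow> e x = e' x) \<Longrightarrow> satisfies M e \<phi> \<longleftrightarrow> satisfies M e' \<phi>"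
proof (induction \<phi> arbitrary: e e')
  case (Eq t u)
  then show ?case using term_val_cong[of t e e' M] term_val_cong[of u e e' M] by simp
next
  case (Rel r ts)
  then have "map (term_val M e) ts = map (term_val M e') ts"
    by (intro map_cong term_val_cong) auto
  then show ?case by (simp only: satisfies.simps)
next
  case (Neg \<phi>)
  from Neg.IH[of e e'] Neg.prems show ?case by simp
next
  case (Conj \<phi> \<psi>)
  from Conj.IH(1)[of e e'] Conj.IH(2)[of e e'] Conj.prems show ?case by auto
next
  case (Exists s n \<phi>)
  have "satisfies M (e((s, n) := x)) \<phi> \<longleftrightarrow> satisfies M (e'((s, n) := x)) \<phi>" for x
    using Exists.prems by (intro Exists.IH) auto
  then show ?case by simp
qed

text \<open>Truth in the ultrapower of \<open>M\<close>, where elements of \<open>M\<close> are represented by elements of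
  \<open>'z\<close> through \<open>\<rho>\<close>, and elements of the ultrapower by sequences; the ultrapower itself is
  not formed. The clauses for the connectives are the theorem of Los.\<close>

definition usat where
  "usat M \<rho> p \<phi> \<longleftrightarrow> alm (\<lambda>n. satisfies M (\<lambda>x. \<rho> (fst x) (p x n)) \<phi>)"

lemma usat_Neg: "usat M \<rho> p (Neg \<phi>) \<longleftrightarrow> \<not> usat M \<rho> p \<phi>"
  by (simp add: usat_def alm_not)

lemma usat_Conj: "usat M \<rho> p (Conj \<phi> \<psi>) \<longleftrightarrow> usat M \<rho> p \<phi> \<and> usat M \<rho> p \<psi>"
  by (simp add: usat_def alm_conj)

text \<open>A formula has finitely many free variables, so the exceptional sets of indices have a
  negligible union.\<close>

lemma usat_cong_alm:
  assumes a: "\<And>x. x \<in> free_vars \<phi> \<Longrightarrow> alm (\<lambda>n. \<rho> (fst x) (p x n) = \<rho> (fst x) (q x n))"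
  shows "usat M \<rho> p \<phi> \<longleftrightarrow> usat M \<rho> q \<phi>"
proof -
  have "alm (\<lambda>n. \<forall>x\<in>F. \<rho> (fst x) (p x n) = \<rho> (fst x) (q x n))" if "finite F" "F \<subseteq> free_vars \<phi>" for F
    using that by (induction F rule: finite_induct) (auto simp: alm_conj a)
  then have "alm (\<lambda>n. \<forall>x\<in>free_vars \<phi>. \<rho> (fst x) (p x n) = \<rho> (fst x) (q x n))"
    using finite_free_vars by blast
  then have "alm (\<lambda>n. satisfies M (\<lambda>x. \<rho> (fst x) (p x n)) \<phi> \<longleftrightarrow> satisfies M (\<lambda>x. \<rho> (fst x) (q x n)) \<phi>)"
    by (rule alm_mono) (rule satisfies_cong, blast)
  then show ?thesis by (simp add: usat_def alm_iff)
qed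

lemma usat_cong: "(\<And>x. x \<in> free_vars \<phi> \<Longrightarrow> p x = q x) \<Longrightarrow> usat M \<rho> p \<phi> \<longleftrightarrow> usat M \<rho> q \<phi>"
  by (rule usat_cong_alm) simp

primrec exs :: "('s \<times> nat) list \<Rightarrow> ('s, 'f, 'r) fo_formula \<Rightarrow> ('s, 'f, 'r) fo_formula" where
  "exs [] \<phi> = \<phi>"
| "exs (w # ws) \<phi> = Exists (fst w) (snd w) (exs ws \<phi>)"

lemma is_formula_exs: "is_formula L (exs ws \<phi>) \<longleftrightarrow> is_formula L \<phi>"
  by (induction ws) auto

lemma free_vars_exs: "free_vars (exs ws \<phi>) = free_vars \<phi> - set ws"
  by (induction ws) auto

text \<open>Elements of every sort are represented in the one type \<open>'z\<close>, so quantifiers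
  over any sort become quantifiers over \<open>'z\<close>.\<close>

locale urep =
  fixes M :: "('s, 'f, 'r, 'u) fo_structure" and \<rho> :: "'s \<Rightarrow> 'z \<Rightarrow> 'u"
  assumes rep_surj: "range (\<rho> s) = universe M s"
begin

lemma usat_Exists: "usat M \<rho> p (Exists s k \<phi>) \<longleftrightarrow> (\<exists>z. usat M \<rho> (p((s, k) := z)) \<phi>)"
proof -
  have e: "(\<lambda>x. \<rho> (fst x) ((p((s, k) := z)) x n)) = (\<lambda>x. \<rho> (fst x) (p x n))((s, k) := \<rho> s (z n))" for z n
    by auto
  have "usat M \<rho> p (Exists s k \<phi>) \<longleftrightarrow>
      alm (\<lambda>n. \<exists>c. satisfies M ((\<lambda>x. \<rho> (fst x) (p x n))((s, k) := \<rho> s c)) \<phi>)"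
    by (simp add: usat_def rep_surj[symmetric])
  also have "\<dots> \<longleftrightarrow> (\<exists>z. alm (\<lambda>n. satisfies M ((\<lambda>x. \<rho> (fst x) (p x n))((s, k) := \<rho> s (z n))) \<phi>))"
    by (rule alm_ex)
  finally show ?thesis unfolding usat_def e .
qed

lemma usat_exs: "usat M \<rho> p (exs ws \<phi>) \<longleftrightarrow> (\<exists>q. (\<forall>x. x \<notin> set ws \<longrightarrow> q x = p x) \<and> usat M \<rho> q \<phi>)"
proof (induction ws arbitrary: p)
  case Nil
  have "(\<forall>x. q x = p x) \<longleftrightarrow> q = p" for q by auto
  then show ?case by simp
next
  case (Cons w ws)
  have "(\<exists>z q. (\<forall>x. x \<notin> set ws \<longrightarrow> q x = (p(w := z)) x) \<and> usat M \<rho> q \<phi>) \<longleftrightarrow>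
      (\<exists>q. (\<forall>x. x \<notin> set (w # ws) \<longrightarrow> q x = p x) \<and> usat M \<rho> q \<phi>)"
  proof (intro iffI; elim exE conjE)
    fix z q assume "\<forall>x. x \<notin> set ws \<longrightarrow> q x = (p(w := z)) x" "usat M \<rho> q \<phi>"
    then show "\<exists>q. (\<forall>x. x \<notin> set (w # ws) \<longrightarrow> q x = p x) \<and> usat M \<rho> q \<phi>"
      by (intro exI[of _ q]) auto
  next
    fix q assume "\<forall>x. x \<notin> set (w # ws) \<longrightarrow> q x = p x" "usat M \<rho> q \<phi>"
    then show "\<exists>z q. (\<forall>x. x \<notin> set ws \<longrightarrow> q x = (p(w := z)) x) \<and> usat M \<rho> q \<phi>"
      by (intro exI[of _ "q w"] exI[of _ q]) auto
  qed
  then show ?case by (simp add: usat_Exists Cons.IH)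
qed

lemma models_iff_usat:
  assumes "free_vars \<phi> = {}"
  shows "models M \<phi> \<longleftrightarrow> usat M \<rho> p \<phi>"
proof -
  define e where "e x = \<rho> (fst x) undefined" for x :: "'s \<times> nat"
  have s: "satisfies M e' \<phi> \<longleftrightarrow> satisfies M e \<phi>" for e' using assms by (intro satisfies_cong) simp
  have "\<forall>s n. e (s, n) \<in> universe M s" unfolding e_def rep_surj[symmetric] by simp
  then have "models M \<phi> \<longleftrightarrow> satisfies M e \<phi>" unfolding models_def using s by blast
  moreover have "(\<lambda>n. satisfies M (\<lambda>x. \<rho> (fst x) (p x n)) \<phi>) = (\<lambda>_. satisfies M e \<phi>)"
    by (rule ext) (rule s)
  ultimately show ?thesis by (simp add: usat_def)
qed

end

text \<open>The syntax has no formula for truth, so conjunctions are formed of non-empty lists,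
  starting from the head.\<close>

definition conj_list :: "('s, 'f, 'r) fo_formula list \<Rightarrow> ('s, 'f, 'r) fo_formula" where
  "conj_list \<phi>s = foldr Conj (tl \<phi>s) (hd \<phi>s)"

lemma
  assumes "\<phi>s \<noteq> []"
  shows usat_conj_list: "usat M \<rho> p (conj_list \<phi>s) \<longleftrightarrow> (\<forall>\<phi>\<in>set \<phi>s. usat M \<rho> p \<phi>)"
    and is_formula_conj_list: "is_formula L (conj_list \<phi>s) \<longleftrightarrow> (\<forall>\<phi>\<in>set \<phi>s. is_formula L \<phi>)"
    and free_vars_conj_list: "free_vars (conj_list \<phi>s) = (\<Union>\<phi>\<in>set \<phi>s. free_vars \<phi>)"
proof -
  obtain \<psi> \<psi>s where e: "\<phi>s = \<psi> # \<psi>s" using assms by (cases \<phi>s) auto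
  show "usat M \<rho> p (conj_list \<phi>s) \<longleftrightarrow> (\<forall>\<phi>\<in>set \<phi>s. usat M \<rho> p \<phi>)"
    unfolding e conj_list_def by (induction \<psi>s) (auto simp: usat_Conj)
  show "is_formula L (conj_list \<phi>s) \<longleftrightarrow> (\<forall>\<phi>\<in>set \<phi>s. is_formula L \<phi>)"
    unfolding e conj_list_def by (induction \<psi>s) auto
  show "free_vars (conj_list \<phi>s) = (\<Union>\<phi>\<in>set \<phi>s. free_vars \<phi>)"
    unfolding e conj_list_def by (induction \<psi>s) auto
qed

text \<open>The sequences \<open>P i\<close> with \<open>i \<in> X\<close> represent a partial elementary map between the ultrapowers.\<close>

definition elementary where
  "elementary L M1 \<rho>1 M2 \<rho>2 X P \<longleftrightarrow> (\<forall>\<phi>. is_formula L \<phi> \<and> snd ` free_vars \<phi> \<subseteq> X \<longrightarrow>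
     (usat M1 \<rho>1 (\<lambda>x. P (snd x)) \<phi> \<longleftrightarrow> usat M2 \<rho>2 (\<lambda>x. P (snd x)) \<phi>))"

text \<open>Countably many symbols give countably many formulas, as countable saturation requires.
  \<open>glue\<close> lets one element of \<open>'z\<close> represent an arbitrary pair.\<close>

locale elem_pair =
  M1: urep M1 \<rho>1 + M2: urep M2 \<rho>2
  for M1 :: "(unit, 'f::countable, 'r::countable, 'u) fo_structure" and \<rho>1 :: "unit \<Rightarrow> 'z \<Rightarrow> 'u"
    and M2 :: "(unit, 'f, 'r, 'w) fo_structure" and \<rho>2 :: "unit \<Rightarrow> 'z \<Rightarrow> 'w" +
  fixes L :: "(unit, 'f, 'r) language" and glue :: "'z \<Rightarrow> 'z \<Rightarrow> 'z"
  assumes glue1: "\<rho>1 s (glue a b) = \<rho>1 s a" and glue2: "\<rho>2 s (glue a b) = \<rho>2 s b"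
begin

abbreviation "elem_map X P \<equiv> elementary L M1 \<rho>1 M2 \<rho>2 X P"

lemma elem_extend:
  fixes b :: "nat \<Rightarrow> nat \<Rightarrow> 'z"
  assumes el: "elem_map X P" and X: "infinite (- X)"
  shows "\<exists>X' P'. X \<subseteq> X' \<and> infinite (- X') \<and> (\<forall>i\<in>X. P' i = P i) \<and> elem_map X' P' \<and>
    (\<forall>j. \<exists>i\<in>X'. \<exists>y. \<forall>n. P' i n = glue (b j n) (y n)) \<and>
    (\<forall>i\<in>X' - X. \<exists>j y. \<forall>n. P' i n = glue (b j n) (y n))"
proof -
  obtain f :: "nat \<Rightarrow> nat" where f: "inj f" "range f \<subseteq> - X"
    using infinite_countable_subset[OF X] by blast
  define Y where "Y = range (\<lambda>j. f (2 * j))"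
  define g where "g i = inv_into UNIV f i div 2" for i
  have gf: "g (f (2 * j)) = j" for j using f(1) by (simp add: g_def)
  have YX: "Y \<inter> X = {}" using f(2) by (auto simp: Y_def)
  have inf: "infinite (- (X \<union> Y))"
  proof -
    have "f (2 * j + 1) \<notin> Y" for j
    proof
      assume "f (2 * j + 1) \<in> Y"
      then obtain i where "f (2 * j + 1) = f (2 * i)" by (auto simp: Y_def)
      then have "2 * j + 1 = 2 * i" using f(1) by (simp add: inj_eq)
      then show False by presburger
    qed
    then have "range (\<lambda>j. f (2 * j + 1)) \<subseteq> - (X \<union> Y)" using f(2) by auto
    moreover have "inj (\<lambda>j. f (2 * j + 1))" by (rule injI) (simp add: inj_eq[OF f(1)])
    then have "infinite (range (\<lambda>j. f (2 * j + 1)))" by (rule range_inj_infinite)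
    ultimately show ?thesis using finite_subset by blast
  qed
  define P1 where "P1 i = (if i \<in> Y then b (g i) else P i)" for i
  define S where "S = {\<phi>. is_formula L \<phi> \<and> snd ` free_vars \<phi> \<subseteq> X \<union> Y \<and> usat M1 \<rho>1 (\<lambda>x. P1 (snd x)) \<phi>}"
  define Q where "Q k n x \<longleftrightarrow> ((from_nat k :: (unit, 'f, 'r) fo_formula) \<in> S \<longrightarrow>
    satisfies M2 (\<lambda>z. \<rho>2 (fst z) (if snd z \<in> Y then x (g (snd z)) else P (snd z) n)) (from_nat k))"
    for k n x
  have "\<exists>y. \<forall>k. alm (\<lambda>n. Q k n (\<lambda>j. y j n))"
  proof (rule countably_saturated)
    fix m
    define \<phi>s where "\<phi>s = filter (\<lambda>\<phi>. \<phi> \<in> S) (map from_nat [0..<Suc m])"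
    show "\<exists>y. \<forall>k\<le>m. alm (\<lambda>n. Q k n (\<lambda>j. y j n))"
    proof (cases "\<phi>s = []")
      case True
      have "(from_nat k :: (unit, 'f, 'r) fo_formula) \<notin> S" if "k \<le> m" for k
        using True that by (auto simp: \<phi>s_def filter_empty_conv simp del: upt_Suc)
      then show ?thesis by (auto simp: Q_def)
    next
      case False
      define \<psi> where "\<psi> = conj_list \<phi>s"
      have sub: "\<phi> \<in> S" if "\<phi> \<in> set \<phi>s" for \<phi> using that by (auto simp: \<phi>s_def simp del: upt_Suc)
      have form: "is_formula L \<psi>" and fv: "snd ` free_vars \<psi> \<subseteq> X \<union> Y"
        and sat1: "usat M1 \<rho>1 (\<lambda>x. P1 (snd x)) \<psi>"
        using sub unfolding \<psi>_def is_formula_conj_list[OF False] free_vars_conj_list[OF False] usat_conj_list[OF False]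
        by (auto simp: S_def)
      obtain ws where ws: "set ws = {w \<in> free_vars \<psi>. snd w \<in> Y}"
        using finite_list[of "{w \<in> free_vars \<psi>. snd w \<in> Y}"] finite_free_vars[of \<psi>] by auto
      have "usat M1 \<rho>1 (\<lambda>x. P (snd x)) (exs ws \<psi>)"
        unfolding M1.usat_exs
      proof (intro exI conjI allI impI)
        let ?q = "\<lambda>x. if x \<in> set ws then P1 (snd x) else P (snd x)"
        show "?q x = P (snd x)" if "x \<notin> set ws" for x using that by simp
        have "usat M1 \<rho>1 (\<lambda>x. P1 (snd x)) \<psi> \<longleftrightarrow> usat M1 \<rho>1 ?q \<psi>"
          by (rule usat_cong) (auto simp: ws P1_def)
        then show "usat M1 \<rho>1 ?q \<psi>" using sat1 by simp
      qed
      moreover have "snd ` free_vars (exs ws \<psi>) \<subseteq> X" using fv by (auto simp: free_vars_exs ws)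
      moreover have "is_formula L (exs ws \<psi>)" using form by (simp add: is_formula_exs)
      ultimately have "usat M2 \<rho>2 (\<lambda>x. P (snd x)) (exs ws \<psi>)"
        using el unfolding elementary_def by blast
      then obtain q where q: "\<And>x. x \<notin> set ws \<Longrightarrow> q x = P (snd x)" "usat M2 \<rho>2 q \<psi>"
        unfolding M2.usat_exs by blast
      define y where "y j = q ((), f (2 * j))" for j
      have "usat M2 \<rho>2 (\<lambda>z. if snd z \<in> Y then y (g (snd z)) else P (snd z)) \<psi>"
      proof -
        have "usat M2 \<rho>2 q \<psi> \<longleftrightarrow> usat M2 \<rho>2 (\<lambda>z. if snd z \<in> Y then y (g (snd z)) else P (snd z)) \<psi>"
        proof (rule usat_cong)
          fix w :: "unit \<times> nat" assume "w \<in> free_vars \<psi>"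
          show "q w = (if snd w \<in> Y then y (g (snd w)) else P (snd w))"
          proof (cases "snd w \<in> Y")
            case True
            then obtain j where "w = ((), f (2 * j))" by (cases w) (auto simp: Y_def)
            then show ?thesis using True by (simp add: gf y_def)
          qed (use q(1)[of w] in \<open>simp add: ws\<close>)
        qed
        then show ?thesis using q(2) by simp
      qed
      then have all: "usat M2 \<rho>2 (\<lambda>z. if snd z \<in> Y then y (g (snd z)) else P (snd z)) \<phi>"
        if "\<phi> \<in> set \<phi>s" for \<phi>
        using that unfolding \<psi>_def usat_conj_list[OF False] by blast
      have "alm (\<lambda>n. Q k n (\<lambda>j. y j n))" if k: "k \<le> m" for k
      proof (cases "(from_nat k :: (unit, 'f, 'r) fo_formula) \<in> S")
        case True
        then have "from_nat k \<in> set \<phi>s" using k by (auto simp: \<phi>s_def simp del: upt_Suc)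
        from all[OF this] show ?thesis unfolding usat_def
          by (rule alm_mono) (simp add: Q_def if_distrib[of "\<lambda>f. f _"])
      qed (simp add: Q_def)
      then show ?thesis by blast
    qed
  qed
  then obtain y where y: "\<And>k. alm (\<lambda>n. Q k n (\<lambda>j. y j n))" by blast
  \<comment> \<open>Truth on the first side sees only the first argument of \<open>glue\<close>,
    truth on the second side only the second.\<close>
  define P' where "P' i = (if i \<in> Y then (\<lambda>n. glue (b (g i) n) (y (g i) n)) else P i)" for i
  have sat1: "usat M1 \<rho>1 (\<lambda>x. P' (snd x)) \<phi> \<longleftrightarrow> usat M1 \<rho>1 (\<lambda>x. P1 (snd x)) \<phi>" for \<phi>
    by (rule usat_cong_alm) (simp add: P'_def P1_def glue1)
  have sat2: "usat M2 \<rho>2 (\<lambda>x. P' (snd x)) \<phi>" if \<phi>: "\<phi> \<in> S" for \<phi>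
    using y[of "to_nat \<phi>"] unfolding usat_def
  proof (rule alm_mono)
    fix n assume "Q (to_nat \<phi>) n (\<lambda>j. y j n)"
    then have "satisfies M2 (\<lambda>z. \<rho>2 (fst z) (if snd z \<in> Y then y (g (snd z)) n else P (snd z) n)) \<phi>"
      using \<phi> by (simp add: Q_def)
    moreover have "(\<lambda>z. \<rho>2 (fst z) (if snd z \<in> Y then y (g (snd z)) n else P (snd z) n)) =
        (\<lambda>z. \<rho>2 (fst z) (P' (snd z) n))"
      by (auto simp: P'_def glue2)
    ultimately show "satisfies M2 (\<lambda>x. \<rho>2 (fst x) (P' (snd x) n)) \<phi>" by simp
  qed
  have "elem_map (X \<union> Y) P'"
    unfolding elementary_def
  proof (intro allI impI)
    fix \<phi> assume \<phi>: "is_formula L \<phi> \<and> snd ` free_vars \<phi> \<subseteq> X \<union> Y"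
    show "usat M1 \<rho>1 (\<lambda>x. P' (snd x)) \<phi> \<longleftrightarrow> usat M2 \<rho>2 (\<lambda>x. P' (snd x)) \<phi>"
    proof (cases "usat M1 \<rho>1 (\<lambda>x. P' (snd x)) \<phi>")
      case True
      then have "\<phi> \<in> S" using \<phi> sat1 by (simp add: S_def)
      then show ?thesis using True sat2 by blast
    next
      case False
      \<comment> \<open>\<open>S\<close> is a complete type, so transferring its members to the
        second side gives the equivalence.\<close>
      then have "Neg \<phi> \<in> S" using \<phi> sat1 by (simp add: S_def usat_Neg)
      then show ?thesis using False sat2[of "Neg \<phi>"] by (simp add: usat_Neg)
    qed
  qed
  moreover have "\<exists>i\<in>X \<union> Y. \<exists>z. \<forall>n. P' i n = glue (b j n) (z n)" for j
  proof -
    have "f (2 * j) \<in> Y" by (auto simp: Y_def)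
    then show ?thesis by (intro bexI[of _ "f (2 * j)"] exI[of _ "y j"]) (auto simp: P'_def gf)
  qed
  moreover have "\<exists>j z. \<forall>n. P' i n = glue (b j n) (z n)" if "i \<in> X \<union> Y - X" for i
    using that by (intro exI[of _ "g i"] exI[of _ "y (g i)"]) (auto simp: P'_def)
  moreover have "\<forall>i\<in>X. P' i = P i" using YX by (auto simp: P'_def)
  ultimately show ?thesis using inf by (intro exI[of _ "X \<union> Y"] exI[of _ P']) auto
qed

lemma elem_empty:
  assumes "elementarily_equivalent L M1 M2"
  shows "elem_map {} P"
  unfolding elementary_def
proof (intro allI impI)
  fix \<phi> assume "is_formula L \<phi> \<and> snd ` free_vars \<phi> \<subseteq> {}"
  then have "is_sentence L \<phi>" "free_vars \<phi> = {}" by (auto simp: is_sentence_def)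
  then show "usat M1 \<rho>1 (\<lambda>x. P (snd x)) \<phi> \<longleftrightarrow> usat M2 \<rho>2 (\<lambda>x. P (snd x)) \<phi>"
    using assms M1.models_iff_usat M2.models_iff_usat unfolding elementarily_equivalent_def by blast
qed

end

section \<open>The residue field and the value group of an ultrapower\<close>

text \<open>Operations act on lists, so that one family covers all arities, including a chosen root
  of the polynomial with a given list of coefficients.\<close>

lemma countable_closure:
  fixes F :: "nat \<Rightarrow> 'a list \<Rightarrow> 'a"
  assumes "countable B"
  shows "\<exists>E. countable E \<and> B \<subseteq> E \<and> (\<forall>n xs. set xs \<subseteq> E \<longrightarrow> F n xs \<in> E)"
proof -
  define step where "step S = S \<union> (\<Union>n. F n ` lists S)" for S
  define E where "E i = (step ^^ i) B" for i
  have E_Suc: "E (Suc i) = step (E i)" for i by (simp add: E_def)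
  have "countable (E i)" for i
  proof (induction i)
    case (Suc i)
    then show ?case unfolding E_Suc step_def
      by (intro countable_Un countable_UN countable_image countable_lists) auto
  qed (simp add: E_def assms)
  then have "countable (\<Union>i. E i)" by (intro countable_UN) auto
  moreover have "B \<subseteq> (\<Union>i. E i)" by (rule order.trans[OF _ UN_upper[of 0]]) (simp_all add: E_def)
  moreover have "F n xs \<in> (\<Union>i. E i)" if "set xs \<subseteq> (\<Union>i. E i)" for n xs
  proof -
    have mono: "E i \<subseteq> E j" if "i \<le> j" for i j
      using that by (induction j rule: dec_induct) (auto simp: E_Suc step_def)
    have "\<exists>i. set xs \<subseteq> E i" using that
    proof (induction xs)
      case (Cons x xs)
      then obtain i j where "set xs \<subseteq> E i" "x \<in> E j" by auto
      then have "set (x # xs) \<subseteq> E (max i j)" using mono[of i "max i j"] mono[of j "max i j"] by auto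
      then show ?case by blast
    qed auto
    then obtain i where "xs \<in> lists (E i)" by auto
    then have "F n xs \<in> E (Suc i)" unfolding E_Suc step_def by blast
    then show ?thesis by blast
  qed
  ultimately have "countable (\<Union>i. E i) \<and> B \<subseteq> (\<Union>i. E i) \<and> (\<forall>n xs. set xs \<subseteq> (\<Union>i. E i) \<longrightarrow> F n xs \<in> (\<Union>i. E i))"
    by (intro conjI allI impI)
  then show ?thesis by (rule exI)
qed

text \<open>The atomic formulas whose preservation supplies the conditions on \<open>A\<close> and
  \<open>D\<close> in \<open>corr\<close>.\<close>

definition "f_radd i j l = Eq (App RPlus [Var () i, Var () j]) (Var () l)"
definition "f_rmult i j l = Eq (App RTimes [Var () i, Var () j]) (Var () l)"
definition "f_rzero i = Eq (Var () i) (App RZero [])"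
definition "f_rone i = Eq (Var () i) (App ROne [])"
definition "f_gadd i j l = Eq (App GPlus [Var () i, Var () j]) (Var () l)"
definition "f_gless i j = Rel GLess [Var () i, Var () j]"
definition "f_ginf i = Eq (Var () i) (App GInf [])"
definition "f_gzero i = Eq (Var () i) (App GZero [])"

lemmas f_defs = f_radd_def f_rmult_def f_rzero_def f_rone_def f_gadd_def f_gless_def f_ginf_def f_gzero_def

lemma is_formula_f:
  "is_formula L_ring (f_radd i j l)" "is_formula L_ring (f_rmult i j l)"
  "is_formula L_ring (f_rzero i)" "is_formula L_ring (f_rone i)"
  "is_formula L_gp (f_gadd i j l)" "is_formula L_gp (f_gless i j)"
  "is_formula L_gp (f_ginf i)" "is_formula L_gp (f_gzero i)"
proof -
  have r: "has_sort L_ring (App f ts) ()" if "length ts = ring_sym_arity f" "\<forall>t\<in>set ts. has_sort L_ring t ()" for f ts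
    using that by (intro has_sort_App[of _ _ "replicate (ring_sym_arity f) ()"])
      (auto simp: L_ring_def list_all2_conv_all_nth)
  have g: "has_sort L_gp (App f ts) ()" if "length ts = gp_sym_arity f" "\<forall>t\<in>set ts. has_sort L_gp t ()" for f ts
    using that by (intro has_sort_App[of _ _ "replicate (gp_sym_arity f) ()"])
      (auto simp: L_gp_def list_all2_conv_all_nth)
  show "is_formula L_ring (f_radd i j l)" "is_formula L_ring (f_rmult i j l)"
    "is_formula L_ring (f_rzero i)" "is_formula L_ring (f_rone i)"
    using r by (auto simp: f_defs has_sort_Var)
  show "is_formula L_gp (f_gadd i j l)" "is_formula L_gp (f_ginf i)" "is_formula L_gp (f_gzero i)"
    using g by (auto simp: f_defs has_sort_Var)
  show "is_formula L_gp (f_gless i j)" by (simp add: f_defs L_gp_def has_sort_Var)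
qed

context vf_rep begin

text \<open>One ring element stands for an element of each sort: its image, its residue and its
  value. A single back-and-forth on the ring therefore serves the quantifiers of all three
  sorts.\<close>

definition rho :: "sort3 \<Rightarrow> 'z \<Rightarrow> ('a, 'a set, 'g) elem3" where
  "rho s z = (case s of SField \<Rightarrow> KElem (\<pi> z) | SResidue \<Rightarrow> RElem (rs z) | SGroup \<Rightarrow> GElem (v0 z))"

lemma pi_range: "range \<pi> = carrier K"
proof
  show "carrier K \<subseteq> range \<pi>" using pi_surj by (metis rangeI subsetI)
qed (use pi_closed in auto)

lemma urep_vf: "urep (vf_structure K v) rho"
proof
  fix s show "range (rho s) = universe (vf_structure K v) s"
    by (cases s) (simp_all add: rho_def vf_structure_def k_carrier group_universe pi_range[symmetric]
        image_comp o_def)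
qed

lemma urep_residue: "urep (ring_structure k) (\<lambda>_. rs)"
  by unfold_locales (simp add: ring_structure_def k_carrier)

lemma urep_group: "urep (gp_structure (value_group K v)) (\<lambda>_. v0)"
  by unfold_locales (simp add: gp_structure_def group_universe)

abbreviation "vs \<equiv> star_val v0"

sublocale H0: hens_val v0 by (rule v0_hens_val)
sublocale H: hens_val vs by (rule H0.star_hens_val)

lemma alm_ints: "0 \<le> vs z \<longleftrightarrow> alm (\<lambda>n. z n \<in> ints)"
  by (simp add: H0.sv_ge_0 ints_def)

lemma alm_rs_eq: "0 \<le> vs z \<Longrightarrow> 0 \<le> vs w \<Longrightarrow> alm (\<lambda>n. rs (z n) = rs (w n)) \<longleftrightarrow> 0 < vs (z - w)"
proof -
  assume "0 \<le> vs z" "0 \<le> vs w"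
  then have "alm (\<lambda>n. z n \<in> ints \<and> w n \<in> ints)" by (simp add: alm_ints alm_conj)
  then have "alm (\<lambda>n. rs (z n) = rs (w n) \<longleftrightarrow> 0 < v0 ((z - w) n))"
    by (rule alm_mono) (simp add: rs_eq minus_apply)
  then show ?thesis by (simp add: alm_iff H0.sv_gr_0)
qed

lemma usat_residue:
  fixes P :: "nat \<Rightarrow> nat \<Rightarrow> 'z"
  assumes "0 \<le> vs (P i)"
  shows "usat (ring_structure k) (\<lambda>_. rs) (\<lambda>x. P (snd x)) (f_rzero i) \<longleftrightarrow> 0 < vs (P i)"
    and "usat (ring_structure k) (\<lambda>_. rs) (\<lambda>x. P (snd x)) (f_rone i) \<longleftrightarrow> 0 < vs (P i - 1)"
    and "\<lbrakk>0 \<le> vs (P j); 0 \<le> vs (P l)\<rbrakk> \<Longrightarrow>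
      usat (ring_structure k) (\<lambda>_. rs) (\<lambda>x. P (snd x)) (f_radd i j l) \<longleftrightarrow> 0 < vs (P i + P j - P l)"
    and "\<lbrakk>0 \<le> vs (P j); 0 \<le> vs (P l)\<rbrakk> \<Longrightarrow>
      usat (ring_structure k) (\<lambda>_. rs) (\<lambda>x. P (snd x)) (f_rmult i j l) \<longleftrightarrow> 0 < vs (P i * P j - P l)"
proof -
  show "usat (ring_structure k) (\<lambda>_. rs) (\<lambda>x. P (snd x)) (f_rzero i) \<longleftrightarrow> 0 < vs (P i)"
    using alm_rs_eq[of "P i" 0] assms by (simp add: usat_def f_defs ring_structure_def Q.h_0)
  show "usat (ring_structure k) (\<lambda>_. rs) (\<lambda>x. P (snd x)) (f_rone i) \<longleftrightarrow> 0 < vs (P i - 1)"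
    using alm_rs_eq[of "P i" 1] assms by (simp add: usat_def f_defs ring_structure_def Q.h_1)
  assume j: "0 \<le> vs (P j)" and l: "0 \<le> vs (P l)"
  have i: "alm (\<lambda>n. P i n \<in> ints \<and> P j n \<in> ints)" using assms j by (simp add: alm_ints alm_conj)
  have "alm (\<lambda>n. rs (P i n) \<oplus>\<^bsub>k\<^esub> rs (P j n) = rs (P l n) \<longleftrightarrow> rs ((P i + P j) n) = rs (P l n))"
    using i by (rule alm_mono) (simp add: Q.h_add)
  moreover have "0 \<le> vs (P i + P j)" using assms j by (rule H.le_val_add)
  ultimately show "usat (ring_structure k) (\<lambda>_. rs) (\<lambda>x. P (snd x)) (f_radd i j l) \<longleftrightarrow> 0 < vs (P i + P j - P l)"
    using alm_rs_eq[of "P i + P j" "P l"] l by (simp add: usat_def f_defs ring_structure_def alm_iff)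
  have "alm (\<lambda>n. rs (P i n) \<otimes>\<^bsub>k\<^esub> rs (P j n) = rs (P l n) \<longleftrightarrow> rs ((P i * P j) n) = rs (P l n))"
    using i by (rule alm_mono) (simp add: Q.h_mult)
  moreover have "0 \<le> vs (P i * P j)" using assms j by (simp add: H.val_mult add_nonneg_nonneg)
  ultimately show "usat (ring_structure k) (\<lambda>_. rs) (\<lambda>x. P (snd x)) (f_rmult i j l) \<longleftrightarrow> 0 < vs (P i * P j - P l)"
    using alm_rs_eq[of "P i * P j" "P l"] l by (simp add: usat_def f_defs ring_structure_def alm_iff)
qed

lemma usat_group:
  fixes P :: "nat \<Rightarrow> nat \<Rightarrow> 'z"
  shows "usat (gp_structure (value_group K v)) (\<lambda>_. v0) (\<lambda>x. P (snd x)) (f_gadd i j l) \<longleftrightarrow> vs (P i * P j) = vs (P l)"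
    and "usat (gp_structure (value_group K v)) (\<lambda>_. v0) (\<lambda>x. P (snd x)) (f_gless i j) \<longleftrightarrow> vs (P i) < vs (P j)"
    and "usat (gp_structure (value_group K v)) (\<lambda>_. v0) (\<lambda>x. P (snd x)) (f_ginf i) \<longleftrightarrow> vs (P i) = Inf"
    and "usat (gp_structure (value_group K v)) (\<lambda>_. v0) (\<lambda>x. P (snd x)) (f_gzero i) \<longleftrightarrow> vs (P i) = 0"
  by (simp_all add: usat_def f_defs gp_structure_def star_val_eq star_val_less star_val_Inf H0.sv_eq_0
      S.val_mult)

end

locale vf_glue =
  K1: vf_rep K v \<pi>1 + L1: vf_rep L w \<pi>2
  for K :: "('a, 'm) ring_scheme" and v :: "'a \<Rightarrow> 'g::linordered_ab_group_add with_inf"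
    and L :: "('b, 'n) ring_scheme" and w :: "'b \<Rightarrow> 'h::linordered_ab_group_add with_inf"
    and \<pi>1 :: "'z::comm_ring_1 \<Rightarrow> 'a" and \<pi>2 :: "'z \<Rightarrow> 'b" +
  fixes glue :: "'z \<Rightarrow> 'z \<Rightarrow> 'z"
  assumes glue1: "\<pi>1 (glue a b) = \<pi>1 a" and glue2: "\<pi>2 (glue a b) = \<pi>2 b"
begin

abbreviation "v1 \<equiv> star_val K1.v0"
abbreviation "v2 \<equiv> star_val L1.v0"

lemma v0_glue1: "K1.v0 (glue a b) = K1.v0 a" and v0_glue2: "L1.v0 (glue a b) = L1.v0 b"
  and rs_glue1: "K1.rs (glue a b) = K1.rs a" and rs_glue2: "L1.rs (glue a b) = L1.rs b"
  by (simp_all add: K1.v0_def L1.v0_def K1.rs_def L1.rs_def glue1 glue2)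

lemma eqv_glue1: "(\<And>n. x n = glue (a n) (b n)) \<Longrightarrow> K1.H.eqv x a"
  and eqv_glue2: "(\<And>n. x n = glue (a n) (b n)) \<Longrightarrow> L1.H.eqv x b"
  by (simp_all add: K1.H.eqv_def L1.H.eqv_def star_val_Inf minus_apply K1.v0_Inf L1.v0_Inf
      K1.P.h_diff L1.P.h_diff glue1 glue2 a_minus_def K1.r_neg L1.r_neg K1.pi_closed L1.pi_closed)

end

text \<open>A single function represents the angular components of both fields. Its compatibility
  with \<open>eqv\<close> allows the hull of a countable set to be closed under it.\<close>

locale vf_pair = vf_glue K v L w \<pi>1 \<pi>2 glue
  for K :: "('a, 'm) ring_scheme" and v :: "'a \<Rightarrow> 'g::linordered_ab_group_add with_inf"
    and L :: "('b, 'n) ring_scheme" and w :: "'b \<Rightarrow> 'h::linordered_ab_group_add with_inf"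
    and \<pi>1 :: "'z::comm_ring_1 \<Rightarrow> 'a" and \<pi>2 :: "'z \<Rightarrow> 'b" and glue +
  fixes ac :: "(nat \<Rightarrow> 'z) \<Rightarrow> (nat \<Rightarrow> 'z)"
  assumes ac1: "ac_val (star_val K1.v0) ac" and ac2: "ac_val (star_val L1.v0) ac"
    and ac_cong1: "star_val K1.v0 x \<noteq> Inf \<Longrightarrow> K1.H.eqv x y \<Longrightarrow> K1.H.eqv (ac x) (ac y)"
    and ac_cong2: "star_val L1.v0 x \<noteq> Inf \<Longrightarrow> L1.H.eqv x y \<Longrightarrow> L1.H.eqv (ac x) (ac y)"
begin

sublocale T: two_val v1 v2 ac
proof (intro two_val.intro two_val_axioms.intro ac1 ac2)
  show "\<exists>z. K1.H.eqv z a \<and> L1.H.eqv z b" for a b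
    using eqv_glue1[of "\<lambda>n. glue (a n) (b n)"] eqv_glue2[of "\<lambda>n. glue (a n) (b n)"] by blast
qed (rule L1.H0.star_saturated; assumption)

text \<open>Integrality is demanded separately: a non-integral representative has residue 0 by
  convention, and \<open>elementary\<close> does not see the difference.\<close>

definition "rmap X P \<longleftrightarrow> elementary L_ring (ring_structure (residue_field K v)) (\<lambda>_. K1.rs)
    (ring_structure (residue_field L w)) (\<lambda>_. L1.rs) X P \<and> infinite (- X) \<and>
  (\<forall>i\<in>X. 0 \<le> v1 (P i) \<and> 0 \<le> v2 (P i))"

definition "gmap Y Q \<longleftrightarrow> elementary L_gp (gp_structure (value_group K v)) (\<lambda>_. K1.v0)
    (gp_structure (value_group L w)) (\<lambda>_. L1.v0) Y Q \<and> infinite (- Y)"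

lemma rmap_extend:
  fixes b :: "nat \<Rightarrow> nat \<Rightarrow> 'z"
  assumes P: "rmap X P" and b: "\<And>j. 0 \<le> v1 (b j)"
  shows "\<exists>X' P'. rmap X' P' \<and> P ` X \<subseteq> P' ` X' \<and> (\<forall>j. \<exists>i\<in>X'. K1.H.eqv (P' i) (b j))"
proof -
  interpret elem_pair "ring_structure (residue_field K v)" "\<lambda>_. K1.rs"
    "ring_structure (residue_field L w)" "\<lambda>_. L1.rs" L_ring glue
    by (intro elem_pair.intro elem_pair_axioms.intro K1.urep_residue L1.urep_residue rs_glue1 rs_glue2)
  obtain X' P0 where X': "X \<subseteq> X'" "infinite (- X')" "\<forall>i\<in>X. P0 i = P i" "elem_map X' P0"
    "\<forall>j. \<exists>i\<in>X'. \<exists>y. \<forall>n. P0 i n = glue (b j n) (y n)"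
    "\<forall>i\<in>X' - X. \<exists>j y. \<forall>n. P0 i n = glue (b j n) (y n)"
    using elem_extend[of X P b] P unfolding rmap_def by blast
  \<comment> \<open>Saturation may return a representative that is not integral in the second field.
    Its residue is 0 there, so its second component can be replaced by 0.\<close>
  define P' where "P' i = (if 0 \<le> v2 (P0 i) then P0 i else (\<lambda>n. glue (P0 i n) 0))" for i
  have e1: "K1.H.eqv (P' i) (P0 i)" for i unfolding P'_def using eqv_glue1 by auto
  have s1: "K1.rs (P' i n) = K1.rs (P0 i n)" for i n by (simp add: P'_def rs_glue1)
  have s2: "alm (\<lambda>n. L1.rs (P' i n) = L1.rs (P0 i n))" for i
  proof (cases "0 \<le> v2 (P0 i)")
    case False
    then have "alm (\<lambda>n. P0 i n \<notin> L1.ints)" by (simp add: L1.alm_ints alm_not)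
    then show ?thesis
    proof (rule alm_mono)
      fix n assume "P0 i n \<notin> L1.ints"
      then show "L1.rs (P' i n) = L1.rs (P0 i n)"
        using False by (simp add: P'_def rs_glue2 L1.rs_non_int L1.Q.h_0)
    qed
  qed (simp add: P'_def)
  have "usat (ring_structure (residue_field K v)) (\<lambda>_. K1.rs) (\<lambda>x. P' (snd x)) \<phi> \<longleftrightarrow>
      usat (ring_structure (residue_field K v)) (\<lambda>_. K1.rs) (\<lambda>x. P0 (snd x)) \<phi>" for \<phi>
    by (rule usat_cong_alm) (simp add: s1)
  moreover have "usat (ring_structure (residue_field L w)) (\<lambda>_. L1.rs) (\<lambda>x. P' (snd x)) \<phi> \<longleftrightarrow>
      usat (ring_structure (residue_field L w)) (\<lambda>_. L1.rs) (\<lambda>x. P0 (snd x)) \<phi>" for \<phi>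
    by (rule usat_cong_alm) (simp add: s2)
  ultimately have "elem_map X' P'" using X'(4) unfolding elementary_def by simp
  moreover have "0 \<le> v1 (P' i) \<and> 0 \<le> v2 (P' i)" if i: "i \<in> X'" for i
  proof
    show "0 \<le> v1 (P' i)"
    proof (cases "i \<in> X")
      case True
      then show ?thesis using P X'(3) K1.H.eqv_val[OF e1] by (simp add: rmap_def)
    next
      case False
      then obtain j y where "\<forall>n. P0 i n = glue (b j n) (y n)" using X'(6) i by blast
      then have "K1.H.eqv (P0 i) (b j)" using eqv_glue1 by blast
      then show ?thesis using b K1.H.eqv_val e1 by metis
    qed
    have "v2 (\<lambda>n. glue (P0 i n) 0) = v2 (\<lambda>n. 0)"
      by (simp add: star_val_eq v0_glue2)
    then show "0 \<le> v2 (P' i)" by (simp add: P'_def L1.H0.sv_ge_0 v0_glue2)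
  qed
  moreover have "P' i = P i" if "i \<in> X" for i using P X'(3) that by (simp add: rmap_def P'_def)
  then have "P ` X \<subseteq> P' ` X'" using X'(1) by force
  moreover have "\<exists>i\<in>X'. K1.H.eqv (P' i) (b j)" for j
    using X'(5) eqv_glue1 e1 K1.H.eqv_trans by metis
  ultimately show ?thesis using X'(2) unfolding rmap_def by blast
qed

lemma gmap_extend:
  fixes b :: "nat \<Rightarrow> nat \<Rightarrow> 'z"
  assumes Q: "gmap Y Q"
  shows "\<exists>Y' Q'. gmap Y' Q' \<and> Q ` Y \<subseteq> Q' ` Y' \<and> (\<forall>j. \<exists>i\<in>Y'. K1.H.eqv (Q' i) (b j))"
proof -
  interpret elem_pair "gp_structure (value_group K v)" "\<lambda>_. K1.v0"
    "gp_structure (value_group L w)" "\<lambda>_. L1.v0" L_gp glue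
    by (intro elem_pair.intro elem_pair_axioms.intro K1.urep_group L1.urep_group v0_glue1 v0_glue2)
  obtain Y' Q' where Y': "Y \<subseteq> Y'" "infinite (- Y')" "\<forall>i\<in>Y. Q' i = Q i" "elem_map Y' Q'"
    "\<forall>j. \<exists>i\<in>Y'. \<exists>y. \<forall>n. Q' i n = glue (b j n) (y n)"
    using elem_extend[of Y Q b] Q unfolding gmap_def by blast
  have "\<exists>i\<in>Y'. K1.H.eqv (Q' i) (b j)" for j using Y'(5) eqv_glue1 by blast
  moreover have "Q ` Y \<subseteq> Q' ` Y'" using Y'(1,3) by force
  ultimately show ?thesis using Y'(2,4) unfolding gmap_def by blast
qed

lemma rmap_facts:
  assumes P: "rmap X P" and i: "i \<in> X" "j \<in> X" "l \<in> X"
  shows "0 < v1 (P i) \<longleftrightarrow> 0 < v2 (P i)" and "0 < v1 (P i - 1) \<longleftrightarrow> 0 < v2 (P i - 1)"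
    and "0 < v1 (P i + P j - P l) \<longleftrightarrow> 0 < v2 (P i + P j - P l)"
    and "0 < v1 (P i * P j - P l) \<longleftrightarrow> 0 < v2 (P i * P j - P l)"
proof -
  have f: "usat (ring_structure (residue_field K v)) (\<lambda>_. K1.rs) (\<lambda>x. P (snd x)) \<phi> \<longleftrightarrow>
      usat (ring_structure (residue_field L w)) (\<lambda>_. L1.rs) (\<lambda>x. P (snd x)) \<phi>"
    if "is_formula L_ring \<phi>" "snd ` free_vars \<phi> \<subseteq> X" for \<phi>
    using P that unfolding rmap_def elementary_def by blast
  have p: "0 \<le> v1 (P i)" "0 \<le> v1 (P j)" "0 \<le> v1 (P l)" "0 \<le> v2 (P i)" "0 \<le> v2 (P j)" "0 \<le> v2 (P l)"
    using P i unfolding rmap_def by auto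
  show "0 < v1 (P i) \<longleftrightarrow> 0 < v2 (P i)"
    using f[OF is_formula_f(3)[of i]] i K1.usat_residue(1)[of P i, OF p(1)] L1.usat_residue(1)[of P i, OF p(4)]
    by (simp add: f_rzero_def)
  show "0 < v1 (P i - 1) \<longleftrightarrow> 0 < v2 (P i - 1)"
    using f[OF is_formula_f(4)[of i]] i K1.usat_residue(2)[of P i, OF p(1)] L1.usat_residue(2)[of P i, OF p(4)]
    by (simp add: f_rone_def)
  show "0 < v1 (P i + P j - P l) \<longleftrightarrow> 0 < v2 (P i + P j - P l)"
    using f[OF is_formula_f(1)[of i j l]] i K1.usat_residue(3)[of P i, OF p(1-3)] L1.usat_residue(3)[of P i, OF p(4-6)]
    by (simp add: f_radd_def)
  show "0 < v1 (P i * P j - P l) \<longleftrightarrow> 0 < v2 (P i * P j - P l)"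
    using f[OF is_formula_f(2)[of i j l]] i K1.usat_residue(4)[of P i, OF p(1-3)] L1.usat_residue(4)[of P i, OF p(4-6)]
    by (simp add: f_rmult_def)
qed

lemma gmap_facts:
  assumes Q: "gmap Y Q" and i: "i \<in> Y" "j \<in> Y" "l \<in> Y"
  shows "v1 (Q i) < v1 (Q j) \<longleftrightarrow> v2 (Q i) < v2 (Q j)" and "v1 (Q i) = Inf \<longleftrightarrow> v2 (Q i) = Inf"
    and "v1 (Q i) = 0 \<longleftrightarrow> v2 (Q i) = 0" and "v1 (Q i * Q j) = v1 (Q l) \<longleftrightarrow> v2 (Q i * Q j) = v2 (Q l)"
proof -
  have f: "usat (gp_structure (value_group K v)) (\<lambda>_. K1.v0) (\<lambda>x. Q (snd x)) \<phi> \<longleftrightarrow>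
      usat (gp_structure (value_group L w)) (\<lambda>_. L1.v0) (\<lambda>x. Q (snd x)) \<phi>"
    if "is_formula L_gp \<phi>" "snd ` free_vars \<phi> \<subseteq> Y" for \<phi>
    using Q that unfolding gmap_def elementary_def by blast
  show "v1 (Q i) < v1 (Q j) \<longleftrightarrow> v2 (Q i) < v2 (Q j)"
    using f[OF is_formula_f(6)[of i j]] i unfolding K1.usat_group L1.usat_group by (simp add: f_gless_def)
  show "v1 (Q i) = Inf \<longleftrightarrow> v2 (Q i) = Inf"
    using f[OF is_formula_f(7)[of i]] i unfolding K1.usat_group L1.usat_group by (simp add: f_ginf_def)
  show "v1 (Q i) = 0 \<longleftrightarrow> v2 (Q i) = 0"
    using f[OF is_formula_f(8)[of i]] i unfolding K1.usat_group L1.usat_group by (simp add: f_gzero_def)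
  show "v1 (Q i * Q j) = v1 (Q l) \<longleftrightarrow> v2 (Q i * Q j) = v2 (Q l)"
    using f[OF is_formula_f(5)[of i j l]] i unfolding K1.usat_group L1.usat_group by (simp add: f_gadd_def)
qed

end

section \<open>Back and forth\<close>

context vf_glue begin

lemma ex_ac: "\<exists>ac. vf_pair K v L w \<pi>1 \<pi>2 glue ac"
proof -
  interpret A1: chain_val v1
    by (intro chain_val.intro chain_val_axioms.intro K1.H.supp_val_axioms)
      (rule K1.H0.star_saturated_chain; assumption)
  interpret A2: chain_val v2
    by (intro chain_val.intro chain_val_axioms.intro L1.H.supp_val_axioms)
      (rule L1.H0.star_saturated_chain; assumption)
  obtain a1 where "(\<forall>x. v1 x \<noteq> Inf \<longrightarrow> v1 (a1 x) = 0) \<and>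
    (\<forall>x y. v1 x \<noteq> Inf \<longrightarrow> v1 y \<noteq> Inf \<longrightarrow> 0 < v1 (a1 (x * y) - a1 x * a1 y)) \<and>
    (\<forall>x. v1 x = 0 \<longrightarrow> 0 < v1 (a1 x - x)) \<and>
    (\<forall>x y. v1 x \<noteq> Inf \<longrightarrow> v1 x < v1 (y - x) \<longrightarrow> 0 < v1 (a1 y - a1 x)) \<and>
    (\<forall>x y. v1 x \<noteq> Inf \<longrightarrow> K1.H.eqv x y \<longrightarrow> K1.H.eqv (a1 x) (a1 y))"
    by (rule exE[OF A1.angular_component])
  note a1 = this[THEN conjunct1, rule_format] this[THEN conjunct2, THEN conjunct1, rule_format]
    this[THEN conjunct2, THEN conjunct2, THEN conjunct1, rule_format]
    this[THEN conjunct2, THEN conjunct2, THEN conjunct2, THEN conjunct1, rule_format]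
    this[THEN conjunct2, THEN conjunct2, THEN conjunct2, THEN conjunct2, rule_format]
  obtain a2 where "(\<forall>x. v2 x \<noteq> Inf \<longrightarrow> v2 (a2 x) = 0) \<and>
    (\<forall>x y. v2 x \<noteq> Inf \<longrightarrow> v2 y \<noteq> Inf \<longrightarrow> 0 < v2 (a2 (x * y) - a2 x * a2 y)) \<and>
    (\<forall>x. v2 x = 0 \<longrightarrow> 0 < v2 (a2 x - x)) \<and>
    (\<forall>x y. v2 x \<noteq> Inf \<longrightarrow> v2 x < v2 (y - x) \<longrightarrow> 0 < v2 (a2 y - a2 x)) \<and>
    (\<forall>x y. v2 x \<noteq> Inf \<longrightarrow> L1.H.eqv x y \<longrightarrow> L1.H.eqv (a2 x) (a2 y))"
    by (rule exE[OF A2.angular_component])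
  note a2 = this[THEN conjunct1, rule_format] this[THEN conjunct2, THEN conjunct1, rule_format]
    this[THEN conjunct2, THEN conjunct2, THEN conjunct1, rule_format]
    this[THEN conjunct2, THEN conjunct2, THEN conjunct2, THEN conjunct1, rule_format]
    this[THEN conjunct2, THEN conjunct2, THEN conjunct2, THEN conjunct2, rule_format]
  define ac where "ac z n = glue (a1 z n) (a2 z n)" for z n
  have e1: "K1.H.eqv (ac z) (a1 z)" and e2: "L1.H.eqv (ac z) (a2 z)" for z
    by (rule eqv_glue1[OF ac_def] eqv_glue2[OF ac_def])+
  note d1 = K1.H.eqv_val[OF K1.H.eqv_diff] and d2 = L1.H.eqv_val[OF L1.H.eqv_diff]
  have "ac_val v1 ac"
  proof (intro ac_val.intro ac_val_axioms.intro K1.H.hens_val_axioms)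
    show "v1 (ac x) = 0" if "v1 x \<noteq> Inf" for x using a1(1)[OF that] K1.H.eqv_val[OF e1] by simp
    show "0 < v1 (ac (x * y) - ac x * ac y)" if "v1 x \<noteq> Inf" "v1 y \<noteq> Inf" for x y
      using a1(2)[OF that] d1[OF e1 K1.H.eqv_mult[OF e1 e1], of "x * y" x y] by simp
    show "0 < v1 (ac x - x)" if "v1 x = 0" for x
      using a1(3)[OF that] d1[OF e1 K1.H.eqv_refl, of x x] by simp
    show "0 < v1 (ac y - ac x)" if "v1 x \<noteq> Inf" "v1 x < v1 (y - x)" for x y
      using a1(4)[OF that] d1[OF e1 e1, of y x] by simp
  qed
  moreover have "ac_val v2 ac"
  proof (intro ac_val.intro ac_val_axioms.intro L1.H.hens_val_axioms)
    show "v2 (ac x) = 0" if "v2 x \<noteq> Inf" for x using a2(1)[OF that] L1.H.eqv_val[OF e2] by simp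
    show "0 < v2 (ac (x * y) - ac x * ac y)" if "v2 x \<noteq> Inf" "v2 y \<noteq> Inf" for x y
      using a2(2)[OF that] d2[OF e2 L1.H.eqv_mult[OF e2 e2], of "x * y" x y] by simp
    show "0 < v2 (ac x - x)" if "v2 x = 0" for x
      using a2(3)[OF that] d2[OF e2 L1.H.eqv_refl, of x x] by simp
    show "0 < v2 (ac y - ac x)" if "v2 x \<noteq> Inf" "v2 x < v2 (y - x)" for x y
      using a2(4)[OF that] d2[OF e2 e2, of y x] by simp
  qed
  moreover have "K1.H.eqv (ac x) (ac y)" if "v1 x \<noteq> Inf" "K1.H.eqv x y" for x y
    by (rule K1.H.eqv_trans[OF e1 K1.H.eqv_trans[OF a1(5)[OF that] K1.H.eqv_sym[OF e1]]])
  moreover have "L1.H.eqv (ac x) (ac y)" if "v2 x \<noteq> Inf" "L1.H.eqv x y" for x y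
    by (rule L1.H.eqv_trans[OF e2 L1.H.eqv_trans[OF a2(5)[OF that] L1.H.eqv_sym[OF e2]]])
  ultimately have "vf_pair K v L w \<pi>1 \<pi>2 glue ac"
    by (intro vf_pair.intro vf_pair_axioms.intro vf_glue_axioms)
  then show ?thesis by (rule exI[of _ ac])
qed

end

lemma elementary_swap: "elementary L M1 \<rho>1 M2 \<rho>2 X P \<longleftrightarrow> elementary L M2 \<rho>2 M1 \<rho>1 X P"
  unfolding elementary_def by blast

context vf_pair begin

text \<open>Pairs whose value and angular component are matched by the partial elementary maps
  \<open>P\<close> of residues and \<open>Q\<close> of values.\<close>

definition "agree X P Y Q = {z. (\<exists>i\<in>Y. v1 z = v1 (Q i) \<and> v2 z = v2 (Q i)) \<and>
  (v1 z \<noteq> Inf \<and> v2 z \<noteq> Inf \<longrightarrow> (\<exists>i\<in>X. 0 < v1 (ac z - P i) \<and> 0 < v2 (ac z - P i)))}"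

definition "small R \<longleftrightarrow> (\<exists>B\<subseteq>R. countable B \<and> (\<forall>z\<in>R. \<exists>b\<in>B. K1.H.eqv z b \<and> L1.H.eqv z b))"

text \<open>The integers are admitted separately, so that the prime ring corresponds to itself before
  the maps \<open>P\<close> and \<open>Q\<close> have any elements.\<close>

definition "corresponding R \<longleftrightarrow> subring_of R \<and> small R \<and>
  (\<exists>X P Y Q. rmap X P \<and> gmap Y Q \<and> R \<subseteq> agree X P Y Q \<union> range of_int)"

text \<open>The positions of the game. Inverses are included for the unary minus of the value group,
  which is computed by inverting representatives.\<close>

definition "elementary_on R \<longleftrightarrow> subring_of R \<and> small R \<and>
  (\<exists>X P Y Q. rmap X P \<and> gmap Y Q \<and> R \<subseteq> agree X P Y Q) \<and>
  (\<forall>z\<in>R. v1 z \<noteq> Inf \<and> v2 z \<noteq> Inf \<longrightarrow> (\<exists>y\<in>R. K1.H.eqv (z * y) 1 \<and> L1.H.eqv (z * y) 1))"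

lemma elementary_on_corresponding: "elementary_on R \<Longrightarrow> corresponding R"
  unfolding elementary_on_def corresponding_def by blast

lemma agree_mono: "P ` X \<subseteq> P' ` X' \<Longrightarrow> Q ` Y \<subseteq> Q' ` Y' \<Longrightarrow> agree X P Y Q \<subseteq> agree X' P' Y' Q'"
proof
  fix z assume a: "P ` X \<subseteq> P' ` X'" "Q ` Y \<subseteq> Q' ` Y'" "z \<in> agree X P Y Q"
  have "\<exists>i\<in>Y'. v1 z = v1 (Q' i) \<and> v2 z = v2 (Q' i)"
  proof -
    obtain i where i: "i \<in> Y" "v1 z = v1 (Q i) \<and> v2 z = v2 (Q i)" using a(3) unfolding agree_def by blast
    then obtain j where "j \<in> Y'" "Q i = Q' j" using a(2) by blast
    then show ?thesis using i(2) by (intro bexI[of _ j]) auto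
  qed
  moreover have "\<exists>i\<in>X'. 0 < v1 (ac z - P' i) \<and> 0 < v2 (ac z - P' i)" if z: "v1 z \<noteq> Inf \<and> v2 z \<noteq> Inf"
  proof -
    obtain i where i: "i \<in> X" "0 < v1 (ac z - P i) \<and> 0 < v2 (ac z - P i)"
      using a(3) z unfolding agree_def by blast
    then obtain j where "j \<in> X'" "P i = P' j" using a(1) by blast
    then show ?thesis using i(2) by (intro bexI[of _ j]) auto
  qed
  ultimately show "z \<in> agree X' P' Y' Q'" unfolding agree_def by blast
qed

text \<open>Close under the field operations, \<open>ac\<close> and a chosen Hensel root for each
  list of coefficients. A polynomial over the hull may be replaced by one with coefficients in the
  countable set, as the two agree in the field.\<close>

lemma countable_hull:
  assumes "countable B"
  shows "\<exists>E0. countable E0 \<and> B \<subseteq> E0 \<and>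
    (let E = {z. \<exists>e\<in>E0. K1.H.eqv z e} in subring_of E \<and> K1.H.inv_closed E \<and> K1.H.hensel_on E \<and>
      (\<forall>x\<in>E. v1 x \<noteq> Inf \<longrightarrow> ac x \<in> E))"
proof -
  define root where "root p = (SOME b. 0 < v1 b \<and> v1 (poly p b) = Inf)" for p
  \<comment> \<open>The index modulo 6 selects the operation; closure is used only for lists of the
    length that it needs.\<close>
  define F where "F n xs = ([1, xs ! 0 - xs ! 1, xs ! 0 * xs ! 1, K1.H.iv (xs ! 0), ac (xs ! 0), root (Poly xs)] ! (n mod 6))"
    for n :: nat and xs
  obtain E0 where E0: "countable E0" "B \<subseteq> E0" "\<And>n xs. set xs \<subseteq> E0 \<Longrightarrow> F n xs \<in> E0"
    using countable_closure[OF assms, of F] by auto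
  have c: "1 \<in> E0" "\<And>x y. x \<in> E0 \<Longrightarrow> y \<in> E0 \<Longrightarrow> x - y \<in> E0" "\<And>x y. x \<in> E0 \<Longrightarrow> y \<in> E0 \<Longrightarrow> x * y \<in> E0"
    "\<And>x. x \<in> E0 \<Longrightarrow> K1.H.iv x \<in> E0" "\<And>x. x \<in> E0 \<Longrightarrow> ac x \<in> E0"
    "\<And>xs. set xs \<subseteq> E0 \<Longrightarrow> root (Poly xs) \<in> E0"
    using E0(3)[of "[]" 0] E0(3)[of "[_, _]" 1] E0(3)[of "[_, _]" 2] E0(3)[of "[_]" 3] E0(3)[of "[_]" 4]
      E0(3)[of _ 5] by (simp_all add: F_def)
  define E where "E = {z. \<exists>e\<in>E0. K1.H.eqv z e}"
  have E: "E0 \<subseteq> E" by (auto simp: E_def)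
  have "subring_of E"
    unfolding subring_of_def
  proof (intro conjI ballI)
    show "1 \<in> E" using c(1) E by blast
    fix x y assume "x \<in> E" "y \<in> E"
    then obtain e f where e: "e \<in> E0" "K1.H.eqv x e" and f: "f \<in> E0" "K1.H.eqv y f" by (auto simp: E_def)
    show "x - y \<in> E" using c(2)[OF e(1) f(1)] K1.H.eqv_diff[OF e(2) f(2)] by (auto simp: E_def)
    show "x * y \<in> E" using c(3)[OF e(1) f(1)] K1.H.eqv_mult[OF e(2) f(2)] by (auto simp: E_def)
  qed
  moreover have "K1.H.inv_closed E"
    unfolding K1.H.inv_closed_def
  proof (intro ballI impI)
    fix x assume "x \<in> E" and x: "v1 x \<noteq> Inf"
    then obtain e where e: "e \<in> E0" "K1.H.eqv x e" by (auto simp: E_def)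
    then have "K1.H.eqv (e * K1.H.iv e) 1" using K1.H.eqv_iv[of e] K1.H.eqv_val[OF e(2)] x by simp
    then have "K1.H.eqv (x * K1.H.iv e) 1" by (rule K1.H.eqv_trans[OF K1.H.eqv_mult[OF e(2) K1.H.eqv_refl]])
    then show "\<exists>y\<in>E. K1.H.eqv (x * y) 1" using c(4)[OF e(1)] E by blast
  qed
  moreover have "K1.H.hensel_on E"
    unfolding K1.H.hensel_on_def
  proof (intro ballI impI)
    fix p assume p: "p \<in> coeffs_in E"
      and a: "(\<forall>i. 0 \<le> v1 (coeff p i)) \<and> 0 < v1 (coeff p 0) \<and> v1 (coeff p 1) = 0"
    have "\<exists>e. e \<in> E0 \<and> K1.H.eqv (coeff p i) e" for i using coeffs_inD[OF p, of i] by (auto simp: E_def)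
    then obtain g where g: "\<And>i. g i \<in> E0" "\<And>i. K1.H.eqv (coeff p i) (g i)" by metis
    define xs where "xs = map g [0..<Suc (degree p)]"
    have xs: "set xs \<subseteq> E0" using g(1) by (auto simp: xs_def)
    have q: "K1.H.eqv (coeff p i) (coeff (Poly xs) i)" for i
    proof (cases "i \<le> degree p")
      case True
      then show ?thesis using g(2)[of i] by (simp add: xs_def coeff_Poly_eq nth_default_def del: upt_Suc)
    next
      case False
      then show ?thesis by (simp add: xs_def coeff_Poly_eq nth_default_def coeff_eq_0 del: upt_Suc)
    qed
    have "(\<forall>i. 0 \<le> v1 (coeff (Poly xs) i)) \<and> 0 < v1 (coeff (Poly xs) 0) \<and> v1 (coeff (Poly xs) 1) = 0"
      using a unfolding K1.H.eqv_val[OF q] .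
    then have "\<exists>b. 0 < v1 b \<and> v1 (poly (Poly xs) b) = Inf"
      using K1.H.hensel unfolding K1.H.hensel_on_def coeffs_in_def by blast
    then have "0 < v1 (root (Poly xs)) \<and> v1 (poly (Poly xs) (root (Poly xs))) = Inf"
      unfolding root_def by (rule someI_ex)
    moreover have "v1 (poly p b) = v1 (poly (Poly xs) b)" for b
      by (rule K1.H.eqv_val[OF K1.H.eqv_poly_coeffs[OF q]])
    ultimately show "\<exists>b\<in>E. 0 < v1 b \<and> v1 (poly p b) = Inf" using c(6)[OF xs] E by auto
  qed
  moreover have "\<forall>x\<in>E. v1 x \<noteq> Inf \<longrightarrow> ac x \<in> E"
  proof (intro ballI impI)
    fix x assume "x \<in> E" and x: "v1 x \<noteq> Inf"
    then obtain e where e: "e \<in> E0" "K1.H.eqv x e" by (auto simp: E_def)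
    then show "ac x \<in> E" using c(5)[OF e(1)] ac_cong1[OF x e(2)] by (auto simp: E_def)
  qed
  ultimately show ?thesis using E0(1,2) unfolding Let_def E_def by blast
qed

text \<open>The order matters: first a domain \<open>E\<close> with \<open>x\<close> in it, then
  residue and value maps covering all of \<open>E\<close>, and last the isomorphism, which
  \<open>extend_correspondence\<close> finds within the resulting set \<open>C\<close>.\<close>

lemma forth_step:
  assumes "corresponding R"
  shows "\<exists>R'. elementary_on R' \<and> R \<subseteq> R' \<and> (\<exists>z\<in>R'. K1.H.eqv x z)"
proof -
  obtain X P Y Q where PQ: "rmap X P" "gmap Y Q" "R \<subseteq> agree X P Y Q \<union> range of_int" and R: "subring_of R"
    using assms unfolding corresponding_def by blast
  have "small R" using assms unfolding corresponding_def by blast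
  then obtain B where B: "B \<subseteq> R" "countable B" "\<forall>z\<in>R. \<exists>b\<in>B. K1.H.eqv z b \<and> L1.H.eqv z b"
    unfolding small_def by (elim exE conjE)
  obtain E0 where E0: "countable E0" "insert x B \<subseteq> E0"
    and "let E = {z. \<exists>e\<in>E0. K1.H.eqv z e} in subring_of E \<and> K1.H.inv_closed E \<and> K1.H.hensel_on E \<and>
      (\<forall>x\<in>E. v1 x \<noteq> Inf \<longrightarrow> ac x \<in> E)"
    using countable_hull[of "insert x B"] B(2) by auto
  then obtain E where E: "E = {z. \<exists>e\<in>E0. K1.H.eqv z e}" "subring_of E" "K1.H.inv_closed E"
    "K1.H.hensel_on E" "\<And>x. x \<in> E \<Longrightarrow> v1 x \<noteq> Inf \<Longrightarrow> ac x \<in> E"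
    unfolding Let_def by blast
  define e where "e = from_nat_into E0"
  have e: "range e = E0" unfolding e_def by (rule range_from_nat_into) (use E0 in auto)
  \<comment> \<open>Only integral elements may enter a residue map, so the others are replaced by
    0.\<close>
  define b where "b j = (if 0 \<le> v1 (e j) then e j else 0)" for j
  have b0: "0 \<le> v1 (b j)" for j by (simp add: b_def)
  obtain X' P' where P': "rmap X' P'" "P ` X \<subseteq> P' ` X'" "\<And>j. \<exists>i\<in>X'. K1.H.eqv (P' i) (b j)"
    using rmap_extend[OF PQ(1), of b] b0 by blast
  obtain Y' Q' where Q': "gmap Y' Q'" "Q ` Y \<subseteq> Q' ` Y'" "\<And>j. \<exists>i\<in>Y'. K1.H.eqv (Q' i) (e j)"
    using gmap_extend[OF PQ(2), of e] by blast
  have Ee: "\<exists>j. K1.H.eqv z (e j)" if "z \<in> E" for z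
  proof -
    obtain f where "f \<in> E0" "K1.H.eqv z f" using \<open>z \<in> E\<close> unfolding E(1) by blast
    then show ?thesis unfolding e[symmetric] by blast
  qed
  interpret C: corr v1 v2 ac E "P' ` X'" "Q' ` Y'"
  proof (intro corr.intro corr_axioms.intro T.two_val_axioms E(2-5))
    show "z \<in> E" if "y \<in> E" "K1.H.eqv y z" for y z
      using that K1.H.eqv_trans[OF K1.H.eqv_sym[OF that(2)]] unfolding E(1) by blast
    show "\<exists>a\<in>P' ` X'. 0 < v1 (z - a)" if z: "z \<in> E" "0 \<le> v1 z" for z
    proof -
      obtain j where j: "K1.H.eqv z (e j)" using Ee z by blast
      obtain i where i: "i \<in> X'" "K1.H.eqv (P' i) (b j)" using P'(3) by blast
      have "b j = e j" using z K1.H.eqv_val[OF j] by (simp add: b_def)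
      then have "K1.H.eqv z (P' i)" using K1.H.eqv_trans[OF j] K1.H.eqv_sym[OF i(2)] by simp
      then have "0 < v1 (z - P' i)" by (simp add: K1.H.eqv_def)
      then show ?thesis using i(1) by blast
    qed
    show "\<exists>d\<in>Q' ` Y'. v1 d = v1 z" if z: "z \<in> E" for z
    proof -
      obtain j where j: "K1.H.eqv z (e j)" using Ee z by blast
      obtain i where i: "i \<in> Y'" "K1.H.eqv (Q' i) (e j)" using Q'(3) by blast
      have "v1 (Q' i) = v1 z" using K1.H.eqv_val[OF j] K1.H.eqv_val[OF i(2)] by simp
      then show ?thesis using i(1) by blast
    qed
    show "0 \<le> v1 a" "0 \<le> v2 a" if "a \<in> P' ` X'" for a using that P'(1) unfolding rmap_def by auto
    show "0 < v1 a \<longleftrightarrow> 0 < v2 a" "0 < v1 (a - 1) \<longleftrightarrow> 0 < v2 (a - 1)" if "a \<in> P' ` X'" for a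
      using that rmap_facts(1,2)[OF P'(1)] by blast+
    show "0 < v1 (a + f - g) \<longleftrightarrow> 0 < v2 (a + f - g)" "0 < v1 (a * f - g) \<longleftrightarrow> 0 < v2 (a * f - g)"
      if "a \<in> P' ` X'" "f \<in> P' ` X'" "g \<in> P' ` X'" for a f g
      using that rmap_facts(3,4)[OF P'(1)] by blast+
    show "v1 a < v1 f \<longleftrightarrow> v2 a < v2 f" if "a \<in> Q' ` Y'" "f \<in> Q' ` Y'" for a f
      using that gmap_facts(1)[OF Q'(1)] by blast
    show "v1 a = Inf \<longleftrightarrow> v2 a = Inf" "v1 a = 0 \<longleftrightarrow> v2 a = 0" if "a \<in> Q' ` Y'" for a
      using that gmap_facts(2,3)[OF Q'(1)] by blast+
    show "v1 (a * f) = v1 g \<longleftrightarrow> v2 (a * f) = v2 g" if "a \<in> Q' ` Y'" "f \<in> Q' ` Y'" "g \<in> Q' ` Y'" for a f g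
      using that gmap_facts(4)[OF Q'(1)] by blast
    show "countable (Q' ` Y')" by simp
  qed
  have CE: "C.C \<subseteq> agree X' P' Y' Q'"
    unfolding C.C_def C.rA_def C.rD_def agree_def by blast
  have RC: "R \<subseteq> C.C"
  proof
    fix z assume z: "z \<in> R"
    show "z \<in> C.C"
    proof (cases "z \<in> agree X P Y Q")
      case True
      then have a: "z \<in> agree X' P' Y' Q'" using agree_mono[OF P'(2) Q'(2)] by blast
      have "z \<in> E" using B(3)[rule_format, OF z] E0(2) unfolding E(1) by blast
      moreover have "C.rD z" using a \<open>z \<in> E\<close> unfolding agree_def C.rD_def by blast
      moreover have "C.rA (ac z)" if f: "v1 z \<noteq> Inf"
      proof -
        have "v2 z \<noteq> Inf" using C.rD_Inf[OF \<open>C.rD z\<close>] f by simp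
        then show ?thesis using a E(5)[OF \<open>z \<in> E\<close> f] f unfolding agree_def C.rA_def by blast
      qed
      ultimately show ?thesis by (auto intro: C.CI)
    next
      case False
      then obtain m where m: "z = of_int m" using PQ(3) z by blast
      \<comment> \<open>Positive integers are sums of ones, so their residues are matched, and they
        are units in residue characteristic 0. Hence the prime ring lies in \<open>C\<close>
        whatever the maps are.\<close>
      have nat: "C.rA (of_nat n)" for n
      proof (induction n)
        case (Suc n)
        then show ?case unfolding of_nat_Suc by (rule C.rA_add[OF C.rA_1])
      qed (unfold of_nat_0, rule C.rA_0)
      have fin: "of_nat n \<in> C.C \<and> - of_nat n \<in> C.C" if "n > 0" for n
        using C.C_unitI[OF nat[of n]] C.C_unitI[OF C.rA_uminus[OF nat[of n]]] K1.H.residue_char_0[OF that]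
        by (simp only: K1.H.val_minus)
      show ?thesis
      proof (cases m rule: int_cases3)
        case zero
        then have "z = 0" using m by (simp only: of_int_0)
        then show ?thesis using C.C_InfI[of 0] by (simp only: K1.H.val_0 L1.H.val_0)
      next
        case (pos n)
        then have "z = of_nat n" using m by (simp only: of_int_of_nat_eq)
        then show ?thesis using fin[OF pos(2)] by (simp only: )
      next
        case (neg n)
        then have "z = - of_nat n" using m by (simp only: of_int_minus of_int_of_nat_eq)
        then show ?thesis using fin[OF neg(2)] by (simp only: )
      qed
    qed
  qed
  obtain R' where R': "subring_of R'" "R \<subseteq> R'" "R' \<subseteq> C.C" "\<And>x. x \<in> E \<Longrightarrow> \<exists>z\<in>R'. K1.H.eqv x z"
    "\<And>z. z \<in> R' \<Longrightarrow> v1 z \<noteq> Inf \<Longrightarrow> \<exists>y\<in>R'. K1.H.eqv (z * y) 1 \<and> L1.H.eqv (z * y) 1"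
    using C.extend_correspondence[OF R RC] by blast
  have "small R'"
  proof -
    \<comment> \<open>One representative in \<open>R'\<close> per element of \<open>E0\<close>
      suffices: elements of \<open>R'\<close> equal in the first field are equal in the second,
      since their difference lies in \<open>C\<close>.\<close>
    define t where "t f = (SOME z. z \<in> R' \<and> K1.H.eqv f z)" for f
    have t: "t f \<in> R' \<and> K1.H.eqv f (t f)" if "f \<in> E" for f
    proof -
      have "\<exists>z. z \<in> R' \<and> K1.H.eqv f z" using R'(4)[OF that] by blast
      then show ?thesis unfolding t_def by (rule someI_ex)
    qed
    have EE: "E0 \<subseteq> E" unfolding E(1) by auto
    have "\<exists>c\<in>t ` E0. K1.H.eqv z c \<and> L1.H.eqv z c" if z: "z \<in> R'" for z
    proof -
      have "z \<in> E" using z R'(3) C.CE by blast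
      then obtain f where f: "f \<in> E0" "K1.H.eqv z f" unfolding E(1) by blast
      have tf: "t f \<in> R'" "K1.H.eqv f (t f)" using t[of f] EE f(1) by auto
      have k: "K1.H.eqv z (t f)" by (rule K1.H.eqv_trans[OF f(2) tf(2)])
      have "z - t f \<in> C.C" using subring_diff[OF R'(1) z tf(1)] R'(3) by blast
      then have "L1.H.eqv z (t f)"
        using C.rD_Inf[OF C.CD[of "z - t f"]] k by (simp add: K1.H.eqv_def L1.H.eqv_def)
      then show ?thesis using k f(1) by blast
    qed
    moreover have "t ` E0 \<subseteq> R'" using t EE by blast
    ultimately show ?thesis unfolding small_def
      by (intro exI[of _ "t ` E0"]) (auto simp: E0(1))
  qed
  moreover have "R' \<subseteq> agree X' P' Y' Q'" using R'(3) CE by blast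
  ultimately have "elementary_on R'" unfolding elementary_on_def using R'(1,5) P'(1) Q'(1) by blast
  moreover have "x \<in> E" using E0(2) unfolding E(1) by auto
  ultimately show ?thesis using R'(2,4) by blast
qed

lemma swap: "vf_pair L w K v \<pi>2 \<pi>1 (\<lambda>a b. glue b a) ac"
  by (intro vf_pair.intro vf_pair_axioms.intro vf_glue.intro vf_glue_axioms.intro
      K1.vf_rep_axioms L1.vf_rep_axioms glue1 glue2 ac1 ac2 ac_cong1 ac_cong2)

text \<open>The invariants treat both fields alike; only the proof of the forth step starts from a
  domain in the first. Exchanging the fields turns it into the back step.\<close>

lemma back_step:
  assumes "corresponding R"
  shows "\<exists>R'. elementary_on R' \<and> R \<subseteq> R' \<and> (\<exists>z\<in>R'. L1.H.eqv x z)"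
proof -
  interpret S: vf_pair L w K v \<pi>2 \<pi>1 "\<lambda>a b. glue b a" ac by (rule swap)
  have r: "S.rmap X P \<longleftrightarrow> rmap X P" for X P
    unfolding rmap_def S.rmap_def elementary_swap[of L_ring "ring_structure L1.k"] by blast
  have g: "S.gmap Y Q \<longleftrightarrow> gmap Y Q" for Y Q
    unfolding gmap_def S.gmap_def elementary_swap[of L_gp "gp_structure (value_group L w)"] by blast
  have a: "S.agree X P Y Q = agree X P Y Q" for X P Y Q
    unfolding agree_def S.agree_def by (auto simp: conj_commute)
  have s: "S.small R \<longleftrightarrow> small R" for R
    unfolding small_def S.small_def by (simp add: conj_commute)
  have "S.corresponding R"
    using assms unfolding corresponding_def S.corresponding_def r g a s .
  moreover have "S.elementary_on R' \<longleftrightarrow> elementary_on R'" for R'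
    unfolding elementary_on_def S.elementary_on_def r g a s by (simp add: conj_commute)
  ultimately show ?thesis using S.forth_step[of R x] by simp
qed

end

section \<open>Formulas in the three-sorted language\<close>

context vf_rep begin

definition "represents s X z \<longleftrightarrow> alm (\<lambda>n. X n = rho s (z n))"

lemma represents_KSym:
  "represents SField (\<lambda>n. fun_interp3 K v (KSym RZero) []) 0"
  "represents SField (\<lambda>n. fun_interp3 K v (KSym ROne) []) 1"
  "represents SField X x \<Longrightarrow> represents SField (\<lambda>n. fun_interp3 K v (KSym RMinus) [X n]) (- x)"
  "\<lbrakk>represents SField X x; represents SField Y y\<rbrakk> \<Longrightarrow>
    represents SField (\<lambda>n. fun_interp3 K v (KSym RPlus) [X n, Y n]) (x + y)"
  "\<lbrakk>represents SField X x; represents SField Y y\<rbrakk> \<Longrightarrow>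
    represents SField (\<lambda>n. fun_interp3 K v (KSym RTimes) [X n, Y n]) (x * y)"
proof -
  show "represents SField (\<lambda>n. fun_interp3 K v (KSym RZero) []) 0"
    "represents SField (\<lambda>n. fun_interp3 K v (KSym ROne) []) 1"
    by (simp_all add: represents_def rho_def P.h_0 pi_1)
  show "represents SField (\<lambda>n. fun_interp3 K v (KSym RMinus) [X n]) (- x)" if "represents SField X x"
    using that unfolding represents_def by (rule alm_mono) (simp add: rho_def P.h_uminus)
  assume "represents SField X x" "represents SField Y y"
  then have a: "alm (\<lambda>n. X n = rho SField (x n) \<and> Y n = rho SField (y n))"
    by (simp add: represents_def alm_conj)
  show "represents SField (\<lambda>n. fun_interp3 K v (KSym RPlus) [X n, Y n]) (x + y)"
    using a unfolding represents_def by (rule alm_mono) (simp add: rho_def pi_add)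
  show "represents SField (\<lambda>n. fun_interp3 K v (KSym RTimes) [X n, Y n]) (x * y)"
    using a unfolding represents_def by (rule alm_mono) (simp add: rho_def pi_mult)
qed

lemma represents_RSym:
  "represents SResidue (\<lambda>n. fun_interp3 K v (RSym RZero) []) 0"
  "represents SResidue (\<lambda>n. fun_interp3 K v (RSym ROne) []) 1"
  "\<lbrakk>represents SResidue X x; 0 \<le> vs x\<rbrakk> \<Longrightarrow>
    represents SResidue (\<lambda>n. fun_interp3 K v (RSym RMinus) [X n]) (- x)"
  "\<lbrakk>represents SResidue X x; represents SResidue Y y; 0 \<le> vs x; 0 \<le> vs y\<rbrakk> \<Longrightarrow>
    represents SResidue (\<lambda>n. fun_interp3 K v (RSym RPlus) [X n, Y n]) (x + y)"
  "\<lbrakk>represents SResidue X x; represents SResidue Y y; 0 \<le> vs x; 0 \<le> vs y\<rbrakk> \<Longrightarrow>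
    represents SResidue (\<lambda>n. fun_interp3 K v (RSym RTimes) [X n, Y n]) (x * y)"
proof -
  show "represents SResidue (\<lambda>n. fun_interp3 K v (RSym RZero) []) 0"
    "represents SResidue (\<lambda>n. fun_interp3 K v (RSym ROne) []) 1"
    by (simp_all add: represents_def rho_def Q.h_0 Q.h_1)
  show "represents SResidue (\<lambda>n. fun_interp3 K v (RSym RMinus) [X n]) (- x)"
    if "represents SResidue X x" "0 \<le> vs x"
  proof -
    have "alm (\<lambda>n. X n = rho SResidue (x n) \<and> x n \<in> ints)"
      using that by (simp add: represents_def alm_conj alm_ints)
    then show ?thesis unfolding represents_def by (rule alm_mono) (simp add: rho_def Q.h_uminus)
  qed
  assume "represents SResidue X x" "represents SResidue Y y" "0 \<le> vs x" "0 \<le> vs y"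
  then have a: "alm (\<lambda>n. (X n = rho SResidue (x n) \<and> Y n = rho SResidue (y n)) \<and> x n \<in> ints \<and> y n \<in> ints)"
    by (simp add: represents_def alm_conj alm_ints)
  show "represents SResidue (\<lambda>n. fun_interp3 K v (RSym RPlus) [X n, Y n]) (x + y)"
    using a unfolding represents_def by (rule alm_mono) (simp add: rho_def Q.h_add)
  show "represents SResidue (\<lambda>n. fun_interp3 K v (RSym RTimes) [X n, Y n]) (x * y)"
    using a unfolding represents_def by (rule alm_mono) (simp add: rho_def Q.h_mult)
qed

text \<open>On representatives, addition of values is multiplication, the value 0 is that of 1, and
  infinity is that of 0. Negation is inversion, except that infinity is its own negative.\<close>

lemma represents_GSym:
  "represents SGroup (\<lambda>n. fun_interp3 K v (GSym GZero) []) 1"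
  "represents SGroup (\<lambda>n. fun_interp3 K v (GSym GInf) []) 0"
  "\<lbrakk>represents SGroup X x; represents SGroup Y y\<rbrakk> \<Longrightarrow>
    represents SGroup (\<lambda>n. fun_interp3 K v (GSym GPlus) [X n, Y n]) (x * y)"
  "\<lbrakk>represents SGroup X x; vs x = Inf \<Longrightarrow> y = x; vs x \<noteq> Inf \<Longrightarrow> H.eqv (x * y) 1\<rbrakk> \<Longrightarrow>
    represents SGroup (\<lambda>n. fun_interp3 K v (GSym GMinus) [X n]) y"
proof -
  show "represents SGroup (\<lambda>n. fun_interp3 K v (GSym GZero) []) 1"
    "represents SGroup (\<lambda>n. fun_interp3 K v (GSym GInf) []) 0"
    by (simp_all add: represents_def rho_def)
  show "represents SGroup (\<lambda>n. fun_interp3 K v (GSym GPlus) [X n, Y n]) (x * y)"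
    if "represents SGroup X x" "represents SGroup Y y"
  proof -
    have "alm (\<lambda>n. X n = rho SGroup (x n) \<and> Y n = rho SGroup (y n))"
      using that by (simp add: represents_def alm_conj)
    then show ?thesis unfolding represents_def by (rule alm_mono) (simp add: rho_def S.val_mult)
  qed
  assume x: "represents SGroup X x" and y: "vs x = Inf \<Longrightarrow> y = x" "vs x \<noteq> Inf \<Longrightarrow> H.eqv (x * y) 1"
  have "alm (\<lambda>n. v0 (y n) = - v0 (x n))"
  proof (cases "vs x = Inf")
    case True
    then have "alm (\<lambda>n. v0 (x n) = Inf)" by (simp add: star_val_Inf)
    then show ?thesis by (rule alm_mono) (simp add: y(1)[OF True])
  next
    case False
    then have "alm (\<lambda>n. v0 ((x * y - 1) n) = Inf)" using y(2) by (simp add: H.eqv_def star_val_Inf)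
    then show ?thesis
    proof (rule alm_mono)
      fix n assume "v0 ((x * y - 1) n) = Inf"
      then have "S.eqv (x n * y n) 1" by (simp add: S.eqv_def minus_apply)
      then show "v0 (y n) = - v0 (x n)" by (rule add_eq_0_imp_neg[OF S.val_inv_add])
    qed
  qed
  then have "alm (\<lambda>n. X n = rho SGroup (x n) \<and> v0 (y n) = - v0 (x n))"
    using x by (simp add: represents_def alm_conj)
  then show "represents SGroup (\<lambda>n. fun_interp3 K v (GSym GMinus) [X n]) y"
    unfolding represents_def by (rule alm_mono) (simp add: rho_def)
qed

lemma represents_ValSym: "represents SField X x \<Longrightarrow> represents SGroup (\<lambda>n. fun_interp3 K v ValSym [X n]) x"
  and represents_ResSym: "represents SField X x \<Longrightarrow> represents SResidue (\<lambda>n. fun_interp3 K v ResSym [X n]) x"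
  unfolding represents_def by (erule alm_mono, simp add: rho_def v0_def rs_def)+

text \<open>A non-integral element has residue 0 by convention, so 0 can represent that residue and
  the ring operations apply.\<close>

lemma represents_residue_int:
  "represents SResidue X x \<Longrightarrow> represents SResidue X (if 0 \<le> vs x then x else 0)"
proof (cases "0 \<le> vs x")
  case False
  assume "represents SResidue X x"
  then have "alm (\<lambda>n. X n = rho SResidue (x n) \<and> x n \<notin> ints)"
    using False by (simp add: represents_def alm_conj alm_ints alm_not)
  then have "represents SResidue X 0"
    unfolding represents_def by (rule alm_mono) (simp add: rho_def rs_non_int Q.h_0)
  then show ?thesis using False by simp
qed simp

lemma represents_eq:
  assumes "represents s X x" "represents s Y y"
  shows "alm (\<lambda>n. X n = Y n) \<longleftrightarrow> alm (\<lambda>n. rho s (x n) = rho s (y n))"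
proof -
  have "alm (\<lambda>n. X n = rho s (x n) \<and> Y n = rho s (y n))"
    using assms by (simp add: represents_def alm_conj)
  then have "alm (\<lambda>n. X n = Y n \<longleftrightarrow> rho s (x n) = rho s (y n))" by (rule alm_mono) simp
  then show ?thesis by (simp add: alm_iff)
qed

lemma alm_rho_eq:
  "alm (\<lambda>n. rho SField (x n) = rho SField (y n)) \<longleftrightarrow> H.eqv x y"
  "\<lbrakk>0 \<le> vs x; 0 \<le> vs y\<rbrakk> \<Longrightarrow> alm (\<lambda>n. rho SResidue (x n) = rho SResidue (y n)) \<longleftrightarrow> 0 < vs (x - y)"
  "alm (\<lambda>n. rho SGroup (x n) = rho SGroup (y n)) \<longleftrightarrow> vs x = vs y"
proof -
  have "\<pi> a = \<pi> b \<longleftrightarrow> v0 (a - b) = Inf" for a b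
    using pi_add[of "a - b" b] P.h_diff[of a b] pi_closed r_neg[of "\<pi> b"]
    by (auto simp: v0_Inf a_minus_def)
  then show "alm (\<lambda>n. rho SField (x n) = rho SField (y n)) \<longleftrightarrow> H.eqv x y"
    by (simp add: rho_def H.eqv_def star_val_Inf minus_apply)
qed (simp_all add: rho_def alm_rs_eq star_val_eq)

lemma eqv_alm_rho: "H.eqv x y \<Longrightarrow> alm (\<lambda>n. rho s (x n) = rho s (y n))"
proof -
  assume "H.eqv x y"
  then have "alm (\<lambda>n. rho SField (x n) = rho SField (y n))" by (simp add: alm_rho_eq)
  then show ?thesis by (rule alm_mono) (cases s; simp add: rho_def v0_def rs_def)
qed

lemma represents_GLess:
  assumes "represents SGroup X x" "represents SGroup Y y"
  shows "alm (\<lambda>n. gp_less GLess (map the_G [X n, Y n])) \<longleftrightarrow> vs x < vs y"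
proof -
  have "alm (\<lambda>n. X n = rho SGroup (x n) \<and> Y n = rho SGroup (y n))"
    using assms by (simp add: represents_def alm_conj)
  then have "alm (\<lambda>n. gp_less GLess (map the_G [X n, Y n]) \<longleftrightarrow> v0 (x n) < v0 (y n))"
    by (rule alm_mono) (simp add: rho_def)
  then show ?thesis by (simp add: alm_iff star_val_less)
qed

end

context vf_pair begin

lemma
  assumes R: "elementary_on R" and z: "z \<in> R" "u \<in> R"
  shows elementary_on_less: "v1 z < v1 u \<longleftrightarrow> v2 z < v2 u"
    and elementary_on_Inf: "v1 z = Inf \<longleftrightarrow> v2 z = Inf"
proof -
  obtain X P Y Q where Q: "gmap Y Q" "R \<subseteq> agree X P Y Q" "rmap X P"
    using R unfolding elementary_on_def by blast
  obtain i where i: "i \<in> Y" "v1 z = v1 (Q i)" "v2 z = v2 (Q i)" using Q(2) z unfolding agree_def by blast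
  obtain j where j: "j \<in> Y" "v1 u = v1 (Q j)" "v2 u = v2 (Q j)" using Q(2) z unfolding agree_def by blast
  show "v1 z < v1 u \<longleftrightarrow> v2 z < v2 u" using gmap_facts(1)[OF Q(1) i(1) j(1) i(1)] i j by simp
  show "v1 z = Inf \<longleftrightarrow> v2 z = Inf" using gmap_facts(2)[OF Q(1) i(1) i(1) i(1)] i by simp
qed

lemma elementary_on_sub: "elementary_on R \<Longrightarrow> subring_of R"
  by (simp add: elementary_on_def)

lemma
  assumes R: "elementary_on R" and z: "z \<in> R"
  shows elementary_on_pos: "0 < v1 z \<longleftrightarrow> 0 < v2 z" and elementary_on_ge_0: "0 \<le> v1 z \<longleftrightarrow> 0 \<le> v2 z"
  using elementary_on_less[OF R subring_1[OF elementary_on_sub[OF R]] z]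
    elementary_on_less[OF R z subring_1[OF elementary_on_sub[OF R]]] by (simp_all add: not_less[symmetric])

lemma elementary_on_inverse:
  assumes R: "elementary_on R" and z: "z \<in> R"
  shows "\<exists>y\<in>R. (v1 z = Inf \<longrightarrow> y = z) \<and> (v1 z \<noteq> Inf \<longrightarrow> K1.H.eqv (z * y) 1) \<and>
    (v2 z = Inf \<longrightarrow> y = z) \<and> (v2 z \<noteq> Inf \<longrightarrow> L1.H.eqv (z * y) 1)"
proof (cases "v1 z = Inf")
  case True
  then show ?thesis using elementary_on_Inf[OF R z z] by (intro bexI[OF _ z]) simp
next
  case False
  moreover have f: "v2 z \<noteq> Inf" using elementary_on_Inf[OF R z z] False by blast
  ultimately obtain y where "y \<in> R" "K1.H.eqv (z * y) 1 \<and> L1.H.eqv (z * y) 1"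
    using R z unfolding elementary_on_def by blast
  then show ?thesis using False f by (intro bexI[of _ y]) simp_all
qed

definition "represented R s X1 X2 \<longleftrightarrow> (\<exists>z\<in>R. K1.represents s X1 z \<and> L1.represents s X2 z)"

lemma represented_residue:
  assumes R: "elementary_on R" and "represented R SResidue X1 X2"
  shows "\<exists>z\<in>R. K1.represents SResidue X1 z \<and> L1.represents SResidue X2 z \<and> 0 \<le> v1 z \<and> 0 \<le> v2 z"
proof -
  obtain z where z: "z \<in> R" "K1.represents SResidue X1 z" "L1.represents SResidue X2 z"
    using assms(2) unfolding represented_def by blast
  let ?u = "if 0 \<le> v1 z then z else 0"
  have u: "?u = (if 0 \<le> v2 z then z else 0)" using elementary_on_ge_0[OF R z(1)] by simp
  have "K1.represents SResidue X1 ?u" by (rule K1.represents_residue_int[OF z(2)])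
  moreover have "L1.represents SResidue X2 ?u" unfolding u by (rule L1.represents_residue_int[OF z(3)])
  moreover have "?u \<in> R" using z(1) subring_0[OF elementary_on_sub[OF R]] by simp
  moreover have "0 \<le> v1 ?u" by simp
  moreover have "0 \<le> v2 ?u" unfolding u by simp
  ultimately show ?thesis by blast
qed

lemma represented_op1:
  assumes R: "elementary_on R" and X: "represented R s X1 X2" and f: "sym3_arity f = ([s], s')"
  shows "represented R s' (\<lambda>n. fun_interp3 K v f [X1 n]) (\<lambda>n. fun_interp3 L w f [X2 n])"
proof -
  note sub = elementary_on_sub[OF R]
  obtain z where z: "z \<in> R" "K1.represents s X1 z" "L1.represents s X2 z"
    using X unfolding represented_def by blast
  show ?thesis
  proof (cases f)
    case (KSym r)
    then have r: "r = RMinus" "s = SField" "s' = SField" using f by (cases r; simp add: numeral_2_eq_2)+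
    show ?thesis using z K1.represents_KSym(3)[of X1 z] L1.represents_KSym(3)[of X2 z] subring_uminus[OF sub z(1)]
      unfolding represented_def KSym r by blast
  next
    case (RSym r)
    then have r: "r = RMinus" "s = SResidue" "s' = SResidue" using f by (cases r; simp add: numeral_2_eq_2)+
    obtain u where u: "u \<in> R" "K1.represents SResidue X1 u" "L1.represents SResidue X2 u" "0 \<le> v1 u" "0 \<le> v2 u"
      using represented_residue[OF R] X r by blast
    show ?thesis using K1.represents_RSym(3)[OF u(2,4)] L1.represents_RSym(3)[OF u(3,5)] subring_uminus[OF sub u(1)]
      unfolding represented_def RSym r by blast
  next
    case (GSym r)
    then have r: "r = GMinus" "s = SGroup" "s' = SGroup" using f by (cases r; simp add: numeral_2_eq_2)+
    obtain y where y: "y \<in> R" "(v1 z = Inf \<longrightarrow> y = z) \<and> (v1 z \<noteq> Inf \<longrightarrow> K1.H.eqv (z * y) 1) \<and>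
        (v2 z = Inf \<longrightarrow> y = z) \<and> (v2 z \<noteq> Inf \<longrightarrow> L1.H.eqv (z * y) 1)"
      by (rule bexE[OF elementary_on_inverse[OF R z(1)]])
    have "K1.represents SGroup (\<lambda>n. fun_interp3 K v (GSym GMinus) [X1 n]) y"
      using z(2) y(2) unfolding r by (intro K1.represents_GSym(4)) blast+
    moreover have "L1.represents SGroup (\<lambda>n. fun_interp3 L w (GSym GMinus) [X2 n]) y"
      using z(3) y(2) unfolding r by (intro L1.represents_GSym(4)) blast+
    ultimately show ?thesis using y(1) unfolding represented_def GSym r by blast
  next
    case ValSym
    then have s: "s = SField" "s' = SGroup" using f by simp_all
    show ?thesis using z K1.represents_ValSym[of X1 z] L1.represents_ValSym[of X2 z]
      unfolding represented_def ValSym s by blast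
  next
    case ResSym
    then have s: "s = SField" "s' = SResidue" using f by simp_all
    show ?thesis using z K1.represents_ResSym[of X1 z] L1.represents_ResSym[of X2 z]
      unfolding represented_def ResSym s by blast
  qed
qed

lemma represented_op2:
  assumes R: "elementary_on R" and X: "represented R s X1 X2" and Y: "represented R t Y1 Y2"
    and f: "sym3_arity f = ([s, t], s')"
  shows "represented R s' (\<lambda>n. fun_interp3 K v f [X1 n, Y1 n]) (\<lambda>n. fun_interp3 L w f [X2 n, Y2 n])"
proof -
  note sub = elementary_on_sub[OF R]
  obtain z where z: "z \<in> R" "K1.represents s X1 z" "L1.represents s X2 z"
    using X unfolding represented_def by blast
  obtain u where u: "u \<in> R" "K1.represents t Y1 u" "L1.represents t Y2 u"
    using Y unfolding represented_def by blast
  show ?thesis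
  proof (cases f)
    case (KSym r)
    then have s: "s = SField" "t = SField" "s' = SField" and r: "r = RPlus \<or> r = RTimes"
      using f by (cases r; simp add: numeral_2_eq_2)+
    note zu = z[unfolded s] u[unfolded s]
    show ?thesis using r
    proof
      assume r: "r = RPlus"
      show ?thesis using K1.represents_KSym(4)[OF zu(2,5)] L1.represents_KSym(4)[OF zu(3,6)]
          subring_add[OF sub z(1) u(1)] unfolding represented_def KSym r s by blast
    next
      assume r: "r = RTimes"
      show ?thesis using K1.represents_KSym(5)[OF zu(2,5)] L1.represents_KSym(5)[OF zu(3,6)]
          subring_mult[OF sub z(1) u(1)] unfolding represented_def KSym r s by blast
    qed
  next
    case (RSym r)
    then have s: "s = SResidue" "t = SResidue" "s' = SResidue" and r: "r = RPlus \<or> r = RTimes"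
      using f by (cases r; simp add: numeral_2_eq_2)+
    obtain z where z: "z \<in> R" "K1.represents SResidue X1 z" "L1.represents SResidue X2 z" "0 \<le> v1 z" "0 \<le> v2 z"
      using represented_residue[OF R X[unfolded s]] by blast
    obtain u where u: "u \<in> R" "K1.represents SResidue Y1 u" "L1.represents SResidue Y2 u" "0 \<le> v1 u" "0 \<le> v2 u"
      using represented_residue[OF R Y[unfolded s]] by blast
    show ?thesis using r
    proof
      assume r: "r = RPlus"
      show ?thesis
        using K1.represents_RSym(4)[OF z(2) u(2) z(4) u(4)] L1.represents_RSym(4)[OF z(3) u(3) z(5) u(5)]
          subring_add[OF sub z(1) u(1)] unfolding represented_def RSym r s by blast
    next
      assume r: "r = RTimes"
      show ?thesis
        using K1.represents_RSym(5)[OF z(2) u(2) z(4) u(4)] L1.represents_RSym(5)[OF z(3) u(3) z(5) u(5)]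
          subring_mult[OF sub z(1) u(1)] unfolding represented_def RSym r s by blast
    qed
  next
    case (GSym r)
    then have r: "r = GPlus" "s = SGroup" "t = SGroup" "s' = SGroup" using f by (cases r; simp add: numeral_2_eq_2)+
    note zu = z[unfolded r] u[unfolded r]
    show ?thesis using K1.represents_GSym(3)[OF zu(2,5)] L1.represents_GSym(3)[OF zu(3,6)]
        subring_mult[OF sub z(1) u(1)] unfolding represented_def GSym r by blast
  qed (use f in simp_all)
qed

lemma represented_op0:
  assumes R: "elementary_on R" and f: "sym3_arity f = ([], s')"
  shows "represented R s' (\<lambda>n. fun_interp3 K v f []) (\<lambda>n. fun_interp3 L w f [])"
proof -
  note c = subring_0[OF elementary_on_sub[OF R]] subring_1[OF elementary_on_sub[OF R]]
  show ?thesis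
  proof (cases f)
    case (KSym r)
    then have s: "s' = SField" and r: "r = RZero \<or> r = ROne" using f by (cases r; simp add: numeral_2_eq_2)+
    show ?thesis using r c K1.represents_KSym(1,2) L1.represents_KSym(1,2)
      unfolding represented_def KSym s by blast
  next
    case (RSym r)
    then have s: "s' = SResidue" and r: "r = RZero \<or> r = ROne" using f by (cases r; simp add: numeral_2_eq_2)+
    show ?thesis using r c K1.represents_RSym(1,2) L1.represents_RSym(1,2)
      unfolding represented_def RSym s by blast
  next
    case (GSym r)
    then have s: "s' = SGroup" and r: "r = GZero \<or> r = GInf" using f by (cases r; simp add: numeral_2_eq_2)+
    show ?thesis using r c K1.represents_GSym(1,2) L1.represents_GSym(1,2)
      unfolding represented_def GSym s by blast
  qed (use f in simp_all)
qed

lemma sym3_arity_le_2: "length (fst (sym3_arity f)) \<le> 2"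
proof (cases f)
  case (KSym r) then show ?thesis by (cases r) simp_all
next
  case (RSym r) then show ?thesis by (cases r) simp_all
next
  case (GSym r) then show ?thesis by (cases r) simp_all
qed simp_all

lemma represented_term:
  assumes R: "elementary_on R" and p: "\<And>x. p x \<in> R" and t: "has_sort L_3s t s"
  shows "represented R s (\<lambda>n. term_val (vf_structure K v) (\<lambda>x. K1.rho (fst x) (p x n)) t)
    (\<lambda>n. term_val (vf_structure L w) (\<lambda>x. L1.rho (fst x) (p x n)) t)"
  using t
proof (induction rule: has_sort.induct)
  case (has_sort_Var s i)
  have "alm (\<lambda>n. True)" by (rule alm_always) simp
  then show ?case using p[of "(s, i)"]
    unfolding represented_def K1.represents_def L1.represents_def by (intro bexI[of _ "p (s, i)"]) simp_all
next
  case (has_sort_App f ss s ts)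
  then have f: "sym3_arity f = (ss, s)" by (simp add: L_3s_def)
  have "length ss \<le> 2" using sym3_arity_le_2[of f] f by simp
  then consider "ss = []" | s1 where "ss = [s1]" | s1 s2 where "ss = [s1, s2]"
    by (cases ss; cases "tl ss"; cases "tl (tl ss)") auto
  then show ?case
  proof cases
    case 1
    then have "ts = []" using has_sort_App.IH by simp
    then show ?thesis using represented_op0[OF R f[unfolded 1]] by (simp add: vf_structure_def)
  next
    case (2 s1)
    then obtain t1 where "ts = [t1]" using has_sort_App.IH by (auto simp: list_all2_Cons2)
    then show ?thesis using represented_op1[OF R _ f[unfolded 2]] has_sort_App.IH 2
      by (simp add: vf_structure_def)
  next
    case (3 s1 s2)
    then obtain t1 t2 where "ts = [t1, t2]" using has_sort_App.IH by (auto simp: list_all2_Cons2)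
    then show ?thesis using represented_op2[OF R _ _ f[unfolded 3]] has_sort_App.IH 3
      by (simp add: vf_structure_def)
  qed
qed

text \<open>The position \<open>R\<close> varies in the induction. At a quantifier it is extended by
  a witness from either side, and the witness is replaced by an equal element of the larger subring,
  which then represents a witness on the other side too.\<close>

theorem elementary_on_usat:
  assumes "elementary_on R" "\<And>x. p x \<in> R" "is_formula L_3s \<phi>"
  shows "usat (vf_structure K v) K1.rho p \<phi> \<longleftrightarrow> usat (vf_structure L w) L1.rho p \<phi>"
  using assms
proof (induction \<phi> arbitrary: R p)
  case (Eq t u)
  note R = Eq.prems(1)
  obtain s where s: "has_sort L_3s t s" "has_sort L_3s u s" using Eq.prems by auto
  note t = represented_term[OF Eq.prems(1,2) s(1)] and u = represented_term[OF Eq.prems(1,2) s(2)]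
  \<comment> \<open>Residues are compared through \<open>0 < v1 (z - y)\<close>, which requires
    integral representatives.\<close>
  obtain z y where z: "z \<in> R" "K1.represents s (\<lambda>n. term_val (vf_structure K v) (\<lambda>x. K1.rho (fst x) (p x n)) t) z"
      "L1.represents s (\<lambda>n. term_val (vf_structure L w) (\<lambda>x. L1.rho (fst x) (p x n)) t) z"
    and y: "y \<in> R" "K1.represents s (\<lambda>n. term_val (vf_structure K v) (\<lambda>x. K1.rho (fst x) (p x n)) u) y"
      "L1.represents s (\<lambda>n. term_val (vf_structure L w) (\<lambda>x. L1.rho (fst x) (p x n)) u) y"
    and int: "s = SResidue \<Longrightarrow> 0 \<le> v1 z \<and> 0 \<le> v2 z \<and> 0 \<le> v1 y \<and> 0 \<le> v2 y"
  proof (cases "s = SResidue")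
    case True
    note tu = represented_residue[OF R t[unfolded True]] represented_residue[OF R u[unfolded True]]
    show ?thesis by (rule bexE[OF tu(1)], rule bexE[OF tu(2)]) (elim conjE, rule that; simp add: True)
  next
    case False
    note tu = t[unfolded represented_def] u[unfolded represented_def]
    show ?thesis by (rule bexE[OF tu(1)], rule bexE[OF tu(2)]) (elim conjE, rule that; simp add: False)
  qed
  have zy: "z - y \<in> R" using subring_diff[OF elementary_on_sub[OF R] z(1) y(1)] .
  have "alm (\<lambda>n. K1.rho s (z n) = K1.rho s (y n)) \<longleftrightarrow> alm (\<lambda>n. L1.rho s (z n) = L1.rho s (y n))"
  proof (cases s)
    case SField
    show ?thesis unfolding SField K1.alm_rho_eq(1) L1.alm_rho_eq(1)
      using elementary_on_Inf[OF R zy zy] by (simp add: K1.H.eqv_def L1.H.eqv_def)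
  next
    case SResidue
    show ?thesis using int[OF SResidue] elementary_on_pos[OF R zy]
      unfolding SResidue by (simp add: K1.alm_rho_eq(2) L1.alm_rho_eq(2))
  next
    case SGroup
    show ?thesis unfolding SGroup K1.alm_rho_eq(3) L1.alm_rho_eq(3)
      using elementary_on_less[OF R z(1) y(1)] elementary_on_less[OF R y(1) z(1)] by (metis linorder_neq_iff)
  qed
  then show ?case
    unfolding usat_def satisfies.simps K1.represents_eq[OF z(2) y(2)] L1.represents_eq[OF z(3) y(3)] .
next
  case (Rel r ts)
  then have "list_all2 (has_sort L_3s) ts [SGroup, SGroup]" by (simp add: L_3s_def)
  then obtain t u where ts: "ts = [t, u]" "has_sort L_3s t SGroup" "has_sort L_3s u SGroup"
    by (auto simp: list_all2_Cons2)
  note tu = represented_term[OF Rel.prems(1,2) ts(2), unfolded represented_def]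
    represented_term[OF Rel.prems(1,2) ts(3), unfolded represented_def]
  obtain z where z: "z \<in> R" "K1.represents SGroup (\<lambda>n. term_val (vf_structure K v) (\<lambda>x. K1.rho (fst x) (p x n)) t) z \<and>
      L1.represents SGroup (\<lambda>n. term_val (vf_structure L w) (\<lambda>x. L1.rho (fst x) (p x n)) t) z"
    by (rule bexE[OF tu(1)])
  obtain y where y: "y \<in> R" "K1.represents SGroup (\<lambda>n. term_val (vf_structure K v) (\<lambda>x. K1.rho (fst x) (p x n)) u) y \<and>
      L1.represents SGroup (\<lambda>n. term_val (vf_structure L w) (\<lambda>x. L1.rho (fst x) (p x n)) u) y"
    by (rule bexE[OF tu(2)])
  have r: "r = GLess" by (cases r)
  have e: "usat (vf_structure K v) K1.rho p (Rel r ts) \<longleftrightarrow> alm (\<lambda>n. gp_less GLess (map the_G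
      [term_val (vf_structure K v) (\<lambda>x. K1.rho (fst x) (p x n)) t, term_val (vf_structure K v) (\<lambda>x. K1.rho (fst x) (p x n)) u]))"
    "usat (vf_structure L w) L1.rho p (Rel r ts) \<longleftrightarrow> alm (\<lambda>n. gp_less GLess (map the_G
      [term_val (vf_structure L w) (\<lambda>x. L1.rho (fst x) (p x n)) t, term_val (vf_structure L w) (\<lambda>x. L1.rho (fst x) (p x n)) u]))"
    by (simp_all add: usat_def ts r vf_structure_def)
  show ?case
    unfolding e K1.represents_GLess[OF conjunct1[OF z(2)] conjunct1[OF y(2)]]
      L1.represents_GLess[OF conjunct2[OF z(2)] conjunct2[OF y(2)]]
    by (rule elementary_on_less[OF Rel.prems(1) z(1) y(1)])
next
  case (Neg \<phi>)
  then show ?case using Neg.IH[OF Neg.prems(1,2)] by (simp add: usat_Neg)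
next
  case (Conj \<phi> \<psi>)
  then show ?case using Conj.IH(1)[OF Conj.prems(1,2)] Conj.IH(2)[OF Conj.prems(1,2)] by (simp add: usat_Conj)
next
  case (Exists s i \<phi>)
  note c = elementary_on_corresponding[OF Exists.prems(1)]
  have IH: "usat (vf_structure K v) K1.rho (p((s, i) := z)) \<phi> \<longleftrightarrow> usat (vf_structure L w) L1.rho (p((s, i) := z)) \<phi>"
    if "elementary_on R'" "R \<subseteq> R'" "z \<in> R'" for R' z
    using that Exists.prems by (intro Exists.IH) auto
  show ?case
    unfolding urep.usat_Exists[OF K1.urep_vf] urep.usat_Exists[OF L1.urep_vf]
  proof
    assume "\<exists>x. usat (vf_structure K v) K1.rho (p((s, i) := x)) \<phi>"
    then obtain x where x: "usat (vf_structure K v) K1.rho (p((s, i) := x)) \<phi>" ..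
    obtain R' z where R': "elementary_on R'" "R \<subseteq> R'" "z \<in> R'" "K1.H.eqv x z"
      using forth_step[OF c, of x] by blast
    have "usat (vf_structure K v) K1.rho (p((s, i) := x)) \<phi> \<longleftrightarrow> usat (vf_structure K v) K1.rho (p((s, i) := z)) \<phi>"
      by (rule usat_cong_alm) (simp add: K1.eqv_alm_rho[OF R'(4)] alm_always)
    then show "\<exists>x. usat (vf_structure L w) L1.rho (p((s, i) := x)) \<phi>" using IH[OF R'(1-3)] x by blast
  next
    assume "\<exists>x. usat (vf_structure L w) L1.rho (p((s, i) := x)) \<phi>"
    then obtain x where x: "usat (vf_structure L w) L1.rho (p((s, i) := x)) \<phi>" ..
    obtain R' z where R': "elementary_on R'" "R \<subseteq> R'" "z \<in> R'" "L1.H.eqv x z"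
      using back_step[OF c, of x] by blast
    have "usat (vf_structure L w) L1.rho (p((s, i) := x)) \<phi> \<longleftrightarrow> usat (vf_structure L w) L1.rho (p((s, i) := z)) \<phi>"
      by (rule usat_cong_alm) (simp add: L1.eqv_alm_rho[OF R'(4)] alm_always)
    then show "\<exists>x. usat (vf_structure K v) K1.rho (p((s, i) := x)) \<phi>" using IH[OF R'(1-3)] x by blast
  qed
qed

end

section \<open>Reducts\<close>

context vf_pair begin

theorem residue_group_equivalence:
  assumes k: "elementarily_equivalent L_ring (ring_structure (residue_field K v)) (ring_structure (residue_field L w))"
    and g: "elementarily_equivalent L_gp (gp_structure (value_group K v)) (gp_structure (value_group L w))"
  shows "elementarily_equivalent L_3s (vf_structure K v) (vf_structure L w)"
proof -
  interpret kp: elem_pair "ring_structure (residue_field K v)" "\<lambda>_. K1.rs"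
    "ring_structure (residue_field L w)" "\<lambda>_. L1.rs" L_ring glue
    by (intro elem_pair.intro elem_pair_axioms.intro K1.urep_residue L1.urep_residue rs_glue1 rs_glue2)
  interpret gp: elem_pair "gp_structure (value_group K v)" "\<lambda>_. K1.v0"
    "gp_structure (value_group L w)" "\<lambda>_. L1.v0" L_gp glue
    by (intro elem_pair.intro elem_pair_axioms.intro K1.urep_group L1.urep_group v0_glue1 v0_glue2)
  \<comment> \<open>The game starts from the prime ring with empty maps, for which elementarity is
    just agreement on sentences. One forth step, with any element, then produces a full
    position.\<close>
  let ?Z = "range of_int :: (nat \<Rightarrow> 'z) set"
  let ?P = "\<lambda>i::nat. (0 :: nat \<Rightarrow> 'z)"
  have "rmap {} ?P" unfolding rmap_def using kp.elem_empty[OF k] by simp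
  moreover have "gmap {} ?P" unfolding gmap_def using gp.elem_empty[OF g] by simp
  moreover have "subring_of ?Z"
    unfolding subring_of_def
  proof (intro conjI ballI)
    show "1 \<in> ?Z" by (rule range_eqI[of _ _ 1]) (simp only: of_int_1)
    fix x y assume "x \<in> ?Z" "y \<in> ?Z"
    then obtain i j where "x = of_int i" "y = of_int j" by blast
    then have "x - y = of_int (i - j)" "x * y = of_int (i * j)" by (simp_all only: of_int_diff of_int_mult)
    then show "x - y \<in> ?Z" "x * y \<in> ?Z" by blast+
  qed
  moreover have "small ?Z"
    unfolding small_def using K1.H.eqv_refl L1.H.eqv_refl countable_image[of UNIV of_int] by blast
  ultimately have "corresponding ?Z" unfolding corresponding_def by blast
  then obtain R where R: "elementary_on R" using forth_step by blast
  have "models (vf_structure K v) \<phi> \<longleftrightarrow> models (vf_structure L w) \<phi>" if "is_sentence L_3s \<phi>" for \<phi>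
  proof -
    have \<phi>: "is_formula L_3s \<phi>" "free_vars \<phi> = {}" using that by (simp_all add: is_sentence_def)
    have "usat (vf_structure K v) K1.rho (\<lambda>_. 0) \<phi> \<longleftrightarrow> usat (vf_structure L w) L1.rho (\<lambda>_. 0) \<phi>"
      using R subring_0[OF elementary_on_sub[OF R]] \<phi>(1) by (rule elementary_on_usat)
    then show ?thesis
      unfolding urep.models_iff_usat[OF K1.urep_vf \<phi>(2), of "\<lambda>_. 0"]
        urep.models_iff_usat[OF L1.urep_vf \<phi>(2), of "\<lambda>_. 0"] .
  qed
  then show ?thesis by (simp add: elementarily_equivalent_def)
qed

end

section \<open>Translating formulas along a map of languages\<close>

primrec map_term :: "('s \<Rightarrow> 't) \<Rightarrow> ('f \<Rightarrow> 'h) \<Rightarrow> ('s, 'f) fo_term \<Rightarrow> ('t, 'h) fo_term" where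
  "map_term \<sigma> F (Var s n) = Var (\<sigma> s) n"
| "map_term \<sigma> F (App f ts) = App (F f) (map (map_term \<sigma> F) ts)"

primrec map_formula ::
  "('s \<Rightarrow> 't) \<Rightarrow> ('f \<Rightarrow> 'h) \<Rightarrow> ('r \<Rightarrow> 'q) \<Rightarrow> ('s, 'f, 'r) fo_formula \<Rightarrow> ('t, 'h, 'q) fo_formula" where
  "map_formula \<sigma> F G (Eq t u) = Eq (map_term \<sigma> F t) (map_term \<sigma> F u)"
| "map_formula \<sigma> F G (Rel r ts) = Rel (G r) (map (map_term \<sigma> F) ts)"
| "map_formula \<sigma> F G (Neg \<phi>) = Neg (map_formula \<sigma> F G \<phi>)"
| "map_formula \<sigma> F G (Conj \<phi> \<psi>) = Conj (map_formula \<sigma> F G \<phi>) (map_formula \<sigma> F G \<psi>)"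
| "map_formula \<sigma> F G (Exists s n \<phi>) = Exists (\<sigma> s) n (map_formula \<sigma> F G \<phi>)"

lemma term_vars_map_term: "term_vars (map_term \<sigma> F t) = map_prod \<sigma> id ` term_vars t"
  by (induction t) auto

lemma free_vars_map_formula:
  "inj \<sigma> \<Longrightarrow> free_vars (map_formula \<sigma> F G \<phi>) = map_prod \<sigma> id ` free_vars \<phi>"
proof (induction \<phi>)
  case (Exists s n \<phi>)
  have "inj (map_prod \<sigma> (id :: nat \<Rightarrow> nat))" using Exists.prems by (simp add: prod.inj_map)
  then show ?case using Exists image_set_diff[of "map_prod \<sigma> id" "free_vars \<phi>" "{(s, n)}"] by (simp add: id_def)
qed (auto simp: term_vars_map_term)

locale language_map =
  fixes L :: "('s, 'f, 'r) language" and L' :: "('t, 'h, 'q) language" and \<sigma> F G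
  assumes inj_sort: "inj \<sigma>"
    and fun_map: "fun_arity L f = Some (ss, s) \<Longrightarrow> fun_arity L' (F f) = Some (map \<sigma> ss, \<sigma> s)"
    and rel_map: "rel_arity L r = Some ss \<Longrightarrow> rel_arity L' (G r) = Some (map \<sigma> ss)"
begin

lemma has_sort_map_term: "has_sort L t s \<Longrightarrow> has_sort L' (map_term \<sigma> F t) (\<sigma> s)"
proof (induction rule: has_sort.induct)
  case (has_sort_App f ss s ts)
  have "list_all2 (has_sort L') (map (map_term \<sigma> F) ts) (map \<sigma> ss)"
    using has_sort_App.IH by (simp add: list.rel_map) (erule list.rel_mono_strong, simp)
  then show ?case using fun_map[OF has_sort_App.hyps] by (simp add: has_sort.has_sort_App)
qed (simp add: has_sort.has_sort_Var)

lemma is_formula_map_formula: "is_formula L \<phi> \<Longrightarrow> is_formula L' (map_formula \<sigma> F G \<phi>)"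
proof (induction \<phi>)
  case (Rel r ts)
  then obtain ss where ss: "rel_arity L r = Some ss" "list_all2 (has_sort L) ts ss" by auto
  have "list_all2 (has_sort L') (map (map_term \<sigma> F) ts) (map \<sigma> ss)"
    using ss(2) by (simp add: list.rel_map) (erule list.rel_mono_strong, simp add: has_sort_map_term)
  then show ?case using rel_map[OF ss(1)] by simp
qed (auto intro: has_sort_map_term)

end

text \<open>Up to the embedding \<open>\<iota>\<close>, \<open>M\<close> consists of some sorts and
  symbols of \<open>N\<close>. The other sorts must be inhabited as well, because
  \<open>models\<close> quantifies over assignments to all sorts.\<close>

locale reduct = language_map L L' \<sigma> F G
  for L :: "('s, 'f, 'r) language" and L' :: "('t, 'h, 'q) language" and \<sigma> F G +
  fixes M :: "('s, 'f, 'r, 'u) fo_structure" and N :: "('t, 'h, 'q, 'w) fo_structure" and \<iota> :: "'u \<Rightarrow> 'w"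
  assumes inj_emb: "inj \<iota>" and universe_map: "universe N (\<sigma> s) = \<iota> ` universe M s"
    and nonempty: "universe N t \<noteq> {}"
    and fun_interp_map: "fun_interp N (F f) (map \<iota> xs) = \<iota> (fun_interp M f xs)"
    and rel_interp_map: "rel_arity L r \<noteq> None \<Longrightarrow> rel_interp N (G r) (map \<iota> xs) = rel_interp M r xs"
begin

lemma term_val_map_term:
  "(\<And>s n. e' (\<sigma> s, n) = \<iota> (e (s, n))) \<Longrightarrow> term_val N e' (map_term \<sigma> F t) = \<iota> (term_val M e t)"
proof (induction t)
  case (App f ts)
  then have "map (term_val N e') (map (map_term \<sigma> F) ts) = map \<iota> (map (term_val M e) ts)" by simp
  then show ?case by (simp only: map_term.simps term_val.simps fun_interp_map)
qed simp

lemma satisfies_map_formula: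
  "is_formula L \<phi> \<Longrightarrow> (\<And>s n. e' (\<sigma> s, n) = \<iota> (e (s, n))) \<Longrightarrow>
    satisfies N e' (map_formula \<sigma> F G \<phi>) \<longleftrightarrow> satisfies M e \<phi>"
proof (induction \<phi> arbitrary: e e')
  case (Eq t u)
  then show ?case using inj_emb by (simp add: term_val_map_term[of e' e] inj_eq)
next
  case (Rel r ts)
  then have "map (term_val N e') (map (map_term \<sigma> F) ts) = map \<iota> (map (term_val M e) ts)"
    by (simp add: term_val_map_term[of e' e])
  moreover have "rel_arity L r \<noteq> None" using Rel.prems(1) by auto
  note rel_interp_map[OF this]
  ultimately show ?case by (simp only: map_formula.simps satisfies.simps)
next
  case (Exists s n \<phi>)
  have "satisfies N (e'((\<sigma> s, n) := \<iota> x)) (map_formula \<sigma> F G \<phi>) \<longleftrightarrow> satisfies M (e((s, n) := x)) \<phi>" for x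
    using Exists.prems inj_sort by (intro Exists.IH) (auto simp: inj_eq)
  then show ?case by (simp add: universe_map)
next
  case (Neg \<phi>)
  from Neg.IH[of e' e] Neg.prems show ?case by simp
next
  case (Conj \<phi> \<psi>)
  from Conj.IH(1)[of e' e] Conj.IH(2)[of e' e] Conj.prems show ?case by simp
qed

lemma models_map_formula:
  assumes "is_sentence L \<phi>"
  shows "models N (map_formula \<sigma> F G \<phi>) \<longleftrightarrow> models M \<phi>"
proof -
  have \<phi>: "is_formula L \<phi>" "free_vars \<phi> = {}" using assms by (simp_all add: is_sentence_def)
  then have fv: "free_vars (map_formula \<sigma> F G \<phi>) = {}" by (simp add: free_vars_map_formula[OF inj_sort])
  have ne: "universe M s \<noteq> {}" for s using nonempty[of "\<sigma> s"] by (simp add: universe_map)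
  define e where "e x = (SOME a. a \<in> universe M (fst x))" for x :: "'s \<times> nat"
  have e: "\<forall>s n. e (s, n) \<in> universe M s" using ne by (simp add: e_def some_in_eq)
  \<comment> \<open>Variables of sorts outside the range of \<open>\<sigma>\<close> receive
    arbitrary elements.\<close>
  define e' where "e' x = (if fst x \<in> range \<sigma> then \<iota> (e (inv_into UNIV \<sigma> (fst x), snd x))
      else SOME a. a \<in> universe N (fst x))" for x :: "'t \<times> nat"
  have e'e: "e' (\<sigma> s, n) = \<iota> (e (s, n))" for s n using inj_sort by (simp add: e'_def)
  have e': "\<forall>s n. e' (s, n) \<in> universe N s"
  proof (intro allI)
    fix s n show "e' (s, n) \<in> universe N s"
    proof (cases "s \<in> range \<sigma>")
      case True
      then obtain t where "s = \<sigma> t" ..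
      then show ?thesis using e e'e by (simp add: universe_map)
    qed (use nonempty in \<open>simp add: e'_def some_in_eq\<close>)
  qed
  have "models N (map_formula \<sigma> F G \<phi>) \<longleftrightarrow> satisfies N e' (map_formula \<sigma> F G \<phi>)"
    unfolding models_def using e' satisfies_cong[of "map_formula \<sigma> F G \<phi>" _ e' N] fv by auto
  moreover have "models M \<phi> \<longleftrightarrow> satisfies M e \<phi>"
    unfolding models_def using e satisfies_cong[of \<phi> _ e M] \<phi>(2) by auto
  ultimately show ?thesis using satisfies_map_formula[of \<phi> e' e, OF \<phi>(1) e'e] by simp
qed

end

lemma elementarily_equivalent_reduct:
  assumes M: "reduct L L' \<sigma> F G M N \<iota>" and M': "reduct L L' \<sigma> F G M' N' \<kappa>"
    and N: "elementarily_equivalent L' N N'"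
  shows "elementarily_equivalent L M M'"
  unfolding elementarily_equivalent_def
proof (intro allI impI)
  interpret M: reduct L L' \<sigma> F G M N \<iota> by fact
  interpret M': reduct L L' \<sigma> F G M' N' \<kappa> by fact
  fix \<phi> assume \<phi>: "is_sentence L \<phi>"
  then have "is_sentence L' (map_formula \<sigma> F G \<phi>)"
    using M.is_formula_map_formula[of \<phi>] free_vars_map_formula[OF M.inj_sort, of F G \<phi>]
    by (simp add: is_sentence_def)
  then show "models M \<phi> \<longleftrightarrow> models M' \<phi>"
    using N M.models_map_formula[OF \<phi>] M'.models_map_formula[OF \<phi>]
    unfolding elementarily_equivalent_def by blast
qed

context valued_field begin

lemma vf_universe_nonempty: "universe (vf_structure K v) s \<noteq> {}"
proof (cases s)
  case SResidue
  have "\<zero> \<in> carrier (valuation_ring K v)" using val_eq_Inf_iff[of \<zero>] by (simp add: valuation_ring_def)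
  then have "carrier (residue_field K v) \<noteq> {}" unfolding residue_field_def FactRing_simps by auto
  then show ?thesis unfolding SResidue by (auto simp: vf_structure_def)
qed (use zero_closed in \<open>auto simp: vf_structure_def\<close>)

lemma residue_reduct:
  "reduct L_ring L_3s (\<lambda>_. SResidue) RSym (\<lambda>_. GLess) (ring_structure (residue_field K v)) (vf_structure K v) RElem"
  by unfold_locales
    (auto simp: L_ring_def L_3s_def ring_structure_def vf_structure_def o_def inj_def
      vf_universe_nonempty[unfolded vf_structure_def, simplified])

lemma group_reduct:
  "reduct L_gp L_3s (\<lambda>_. SGroup) GSym (\<lambda>r. r) (gp_structure (value_group K v)) (vf_structure K v) GElem"
  by unfold_locales
    (auto simp: L_gp_def L_3s_def gp_structure_def vf_structure_def o_def inj_def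
      vf_universe_nonempty[unfolded vf_structure_def, simplified])

end

lemma vf_rep_proj:
  fixes K :: "('a, 'm) ring_scheme" and v :: "'a \<Rightarrow> 'g::linordered_ab_group_add with_inf"
    and h :: "'z::comm_ring_1 \<Rightarrow> ('a, 'm) all_crings"
  assumes "valued_field K v" "henselian K v" "equichar_zero K v"
    and h: "h 1 = 1" "\<And>x y. h (x + y) = h x + h y" "\<And>x y. h (x * y) = h x * h y" "surj h"
  shows "vf_rep K v (\<lambda>z. proj K (h z))"
proof -
  interpret valued_field K v by fact
  note c = is_cring
  show ?thesis
  proof (intro vf_rep.intro vf_rep_axioms.intro assms(1-3))
    show "\<exists>z. proj K (h z) = a" if "a \<in> carrier K" for a
      using proj_surj[OF c that] surjD[OF h(4)] by metis
  qed (simp_all add: h proj_closed[OF c] proj_1[OF c] proj_add[OF c] proj_mult[OF c])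
qed

theorem theorem1p15:
  fixes K :: "('a, 'm) ring_scheme" and v :: "'a \<Rightarrow> 'g::linordered_ab_group_add with_inf"
    and L :: "('b, 'n) ring_scheme" and w :: "'b \<Rightarrow> 'h::linordered_ab_group_add with_inf"
  assumes "valued_field K v" and "valued_field L w"
    and "henselian K v" and "henselian L w"
    and "equichar_zero K v" and "equichar_zero L w"
  shows "elementarily_equivalent L_3s (vf_structure K v) (vf_structure L w) \<longleftrightarrow>
    elementarily_equivalent L_ring
      (ring_structure (residue_field K v)) (ring_structure (residue_field L w)) \<and>
    elementarily_equivalent L_gp
      (gp_structure (value_group K v)) (gp_structure (value_group L w))"
proof
  assume "elementarily_equivalent L_3s (vf_structure K v) (vf_structure L w)"
  then show "elementarily_equivalent L_ring
      (ring_structure (residue_field K v)) (ring_structure (residue_field L w)) \<and>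
    elementarily_equivalent L_gp
      (gp_structure (value_group K v)) (gp_structure (value_group L w))"
    using elementarily_equivalent_reduct
      [OF valued_field.residue_reduct[OF assms(1)] valued_field.residue_reduct[OF assms(2)]]
      elementarily_equivalent_reduct
      [OF valued_field.group_reduct[OF assms(1)] valued_field.group_reduct[OF assms(2)]] by blast
next
  \<comment> \<open>Both fields become images of one product ring; gluing takes the first component
    of \<open>a\<close> and the second of \<open>b\<close>.\<close>
  let ?p = "\<lambda>z :: ('a, 'm) all_crings \<times> ('b, 'n) all_crings. proj K (fst z)"
  let ?q = "\<lambda>z :: ('a, 'm) all_crings \<times> ('b, 'n) all_crings. proj L (snd z)"
  have "vf_rep K v ?p"
    using assms by (intro vf_rep_proj) (simp_all add: one_prod_def times_prod_def)
  moreover have "vf_rep L w ?q"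
    using assms by (intro vf_rep_proj) (simp_all add: one_prod_def times_prod_def)
  ultimately have "vf_glue K v L w ?p ?q (\<lambda>a b. (fst a, snd b))"
    by (intro vf_glue.intro vf_glue_axioms.intro) simp_all
  then obtain ac where "vf_pair K v L w ?p ?q (\<lambda>a b. (fst a, snd b)) ac"
    using vf_glue.ex_ac by blast
  moreover assume "elementarily_equivalent L_ring
      (ring_structure (residue_field K v)) (ring_structure (residue_field L w)) \<and>
    elementarily_equivalent L_gp
      (gp_structure (value_group K v)) (gp_structure (value_group L w))"
  ultimately show "elementarily_equivalent L_3s (vf_structure K v) (vf_structure L w)"
    by (elim conjE) (rule vf_pair.residue_group_equivalence)
qed

end
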